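(* Let $k$ be a field of characteristic $0$, let $G$ be an arbitrary group, $H:=kG$, and let $M$ be a modular crossed module over $kG$. Let $M=\bigoplus_{x\in G}M_x$ with $M_x=\{m\in M\mid\rho(m)=m\otimes x\}$. Then for every $n\ge0$ $$\mathrm{HC}_n(kG,M)\simeq\Big(\bigoplus_{x\in t_f(G)}\bigoplus_{i\ge0}\mathrm H_{n-2i}(\overline G_x,M_x)\Big)\oplus\Big(\bigoplus_{x\in t(G)\setminus t_f(G)}\mathrm H_n(\overline G_x,M_x)\Big),$$ where $t(G)$ is a set of representatives for the conjugacy classes of $G$, $t_f(G)=\{x\in t(G)\mid\mathrm{ord}(x)<\infty\}$, $G_x$ is the centralizer of $x$ in $G$, $\overline G_x=G_x/\langle x\rangle$, and $\mathrm H_*(-,-)$ denotes group homology.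
   Context: $\otimes=\otimes_k$. A crossed module over a Hopf algebra $H$ is a left $H$-module $M$ which is also a right $H$-comodule via $\rho(m)=\sum m_{\langle0\rangle}\otimes m_{\langle1\rangle}\in M\otimes H$ such that $\rho(hm)=\sum h_{(2)}m_{\langle0\rangle}\otimes h_{(3)}m_{\langle1\rangle}S(h_{(1)})$; it is modular if $\sum m_{\langle1\rangle}m_{\langle0\rangle}=m$ for all $m$. For $H=kG$ this means: $M$ is a $kG$-module with a decomposition $M=\bigoplus_{x\in G}M_x$ such that $gM_x\subseteq M_{gxg^{-1}}$, and (modularity) $xm=m$ for $m\in M_x$. Hence $M_x$ is a module over $\overline G_x=G_x/\langle x\rangle$. For a modular crossed module $M$ over $H$, $Z_*(H,M)$ is the cyclic object with $Z_n(H,M)=H^{\otimes(n+1)}\otimes_HM$, where $H^{\otimes(n+1)}$ is a right $H$-module by the diagonal action, faces $\delta_i((h^0,\ldots,h^n)\otimes_Hm)=\varepsilon(h^i)(h^0,\ldots,\widehat{h^i},\ldots,h^n)\otimes_Hm$, degeneracies $\sigma_i((h^0,\ldots,h^n)\otimes_Hm)=(h^0,\ldots,\Delta(h^i),\ldots,h^n)\otimes_Hm$, and cyclic operator $\tau_n((h^0,\ldots,h^n)\otimes_Hm)=\sum(h^nm_{\langle1\rangle},h^0,\ldots,h^{n-1})\otimes_Hm_{\langle0\rangle}$. $\mathrm{HC}_*(H,M)$ is its cyclic homology (homology of the total complex of the Tsygan double complex). Homology in negative degrees is $0$. *)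

theory Defs
  imports
    Complex_Main
    "HOL-Algebra.Module"
    "HOL-Algebra.Generated_Groups"
    "HOL-Algebra.Multiplicative_Group"
    "HOL-Library.Poly_Mapping"
begin

section \<open>Quotients, direct sums and isomorphisms of \<open>k\<close>-vector spaces\<close>

text \<open>
  The field \<open>k\<close> is a type of class \<^class>\<open>field_char_0\<close>. Vector spaces that arise as quotients and
  direct sums are \<^typ>\<open>('k, 'c) module\<close> records over it; as usual for modules in HOL-Algebra, the
  multiplicative part of such a record plays no role.
\<close>

definition vs_quot :: "('k, 'c) module \<Rightarrow> 'c set \<Rightarrow> ('k, 'c set) module" where
  "vs_quot A B =
     \<lparr>carrier = a_rcosets\<^bsub>A\<^esub> B, monoid.mult = undefined, one = undefined,
      zero = B, add = set_add A,
      smult = (\<lambda>c U. \<Union>x\<in>U. B +>\<^bsub>A\<^esub> (c \<odot>\<^bsub>A\<^esub> x))\<rparr>"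

text \<open>The map between quotients induced by a linear map \<open>f\<close>; \<open>A\<close> and \<open>B\<close> belong to the target \<open>A/B\<close>.\<close>

definition induced_map :: "('k, 'c) module \<Rightarrow> 'c set \<Rightarrow> ('b \<Rightarrow> 'c) \<Rightarrow> 'b set \<Rightarrow> 'c set" where
  "induced_map A B f U = (\<Union>x\<in>U. B +>\<^bsub>A\<^esub> f x)"

definition vs_dsum :: "'i set \<Rightarrow> ('i \<Rightarrow> ('k, 'c) module) \<Rightarrow> ('k, 'i \<Rightarrow> 'c) module" where
  "vs_dsum I A =
     \<lparr>carrier = {f \<in> \<Pi>\<^sub>E i\<in>I. carrier (A i). finite {i \<in> I. f i \<noteq> \<zero>\<^bsub>A i\<^esub>}},
      monoid.mult = undefined, one = undefined,
      zero = (\<lambda>i\<in>I. \<zero>\<^bsub>A i\<^esub>), add = (\<lambda>f g. \<lambda>i\<in>I. f i \<oplus>\<^bsub>A i\<^esub> g i),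
      smult = (\<lambda>c f. \<lambda>i\<in>I. c \<odot>\<^bsub>A i\<^esub> f i)\<rparr>"

definition vs_dsum2 :: "('k, 'b) module \<Rightarrow> ('k, 'c) module \<Rightarrow> ('k, 'b \<times> 'c) module" where
  "vs_dsum2 A B =
     \<lparr>carrier = carrier A \<times> carrier B, monoid.mult = undefined, one = undefined,
      zero = (\<zero>\<^bsub>A\<^esub>, \<zero>\<^bsub>B\<^esub>), add = (\<lambda>(a, b) (a', b'). (a \<oplus>\<^bsub>A\<^esub> a', b \<oplus>\<^bsub>B\<^esub> b')),
      smult = (\<lambda>c (a, b). (c \<odot>\<^bsub>A\<^esub> a, c \<odot>\<^bsub>B\<^esub> b))\<rparr>"

definition vs_zero :: "('k, 'c) module" where
  "vs_zero =
     \<lparr>carrier = {undefined}, monoid.mult = undefined, one = undefined,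
      zero = undefined, add = (\<lambda>_ _. undefined), smult = (\<lambda>_ _. undefined)\<rparr>"

definition vs_isomorphic :: "('k, 'b) module \<Rightarrow> ('k, 'c) module \<Rightarrow> bool" where
  "vs_isomorphic A B \<longleftrightarrow>
     (\<exists>f \<in> iso (add_monoid A) (add_monoid B). \<forall>c. \<forall>x\<in>carrier A. f (c \<odot>\<^bsub>A\<^esub> x) = c \<odot>\<^bsub>B\<^esub> f x)"


section \<open>Homology and cyclic homology\<close>

text \<open>
  A complex \<open>\<dots> \<rightarrow> C 1 \<rightarrow> C 0 \<rightarrow> 0\<close> with differentials \<open>d n : C n \<rightarrow> C (n - 1)\<close>; the values \<open>d 0\<close> are
  not used.
\<close>

definition homology :: "(nat \<Rightarrow> ('k, 'c) module) \<Rightarrow> (nat \<Rightarrow> 'c \<Rightarrow> 'c) \<Rightarrow> int \<Rightarrow> ('k, 'c set) module" where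
  "homology C d j =
     (if j < 0 then vs_zero
      else let n = nat j;
               Z = {x \<in> carrier (C n). n > 0 \<longrightarrow> d n x = \<zero>\<^bsub>C (n - 1)\<^esub>}
           in vs_quot (C n \<lparr>carrier := Z\<rparr>) (d (Suc n) ` carrier (C (Suc n))))"

text \<open>\<open>\<Sum>i<m. (-1)\<^sup>i f\<^sub>i x\<close>, computed in \<open>A\<close>.\<close>

definition alt_sum :: "('k::field, 'c) module \<Rightarrow> nat \<Rightarrow> (nat \<Rightarrow> 'c \<Rightarrow> 'c) \<Rightarrow> 'c \<Rightarrow> 'c" where
  "alt_sum A m f x = (\<Oplus>\<^bsub>A\<^esub>i\<in>{..<m}. ((-1) ^ i) \<odot>\<^bsub>A\<^esub> f i x)"

text \<open>
  The data of a cyclic \<open>k\<close>-vector space: \<open>face n i : C\<^sub>n \<rightarrow> C\<^sub>n\<^sub>-\<^sub>1\<close>, \<open>degen n i : C\<^sub>n \<rightarrow> C\<^sub>n\<^sub>+\<^sub>1\<close> for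
  \<open>i \<le> n\<close>, and \<open>cyc n : C\<^sub>n \<rightarrow> C\<^sub>n\<close>.
\<close>

record ('k, 'c) cyclic_object =
  space :: "nat \<Rightarrow> ('k, 'c) module"
  face :: "nat \<Rightarrow> nat \<Rightarrow> 'c \<Rightarrow> 'c"
  degen :: "nat \<Rightarrow> nat \<Rightarrow> 'c \<Rightarrow> 'c"
  cyc :: "nat \<Rightarrow> 'c \<Rightarrow> 'c"

definition tsygan_b :: "('k::field, 'c) cyclic_object \<Rightarrow> nat \<Rightarrow> 'c \<Rightarrow> 'c" where
  "tsygan_b Z n = alt_sum (space Z (n - 1)) (Suc n) (face Z n)"

definition tsygan_b' :: "('k::field, 'c) cyclic_object \<Rightarrow> nat \<Rightarrow> 'c \<Rightarrow> 'c" where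
  "tsygan_b' Z n = alt_sum (space Z (n - 1)) n (face Z n)"

definition signed_cyc :: "('k::field, 'c) cyclic_object \<Rightarrow> nat \<Rightarrow> 'c \<Rightarrow> 'c" where
  "signed_cyc Z n x = ((-1) ^ n) \<odot>\<^bsub>space Z n\<^esub> cyc Z n x"

definition tsygan_norm :: "('k::field, 'c) cyclic_object \<Rightarrow> nat \<Rightarrow> 'c \<Rightarrow> 'c" where
  "tsygan_norm Z n x = (\<Oplus>\<^bsub>space Z n\<^esub>i\<in>{..n}. (signed_cyc Z n ^^ i) x)"

text \<open>
  The Tsygan double complex has \<open>CC\<^sub>p\<^sub>,\<^sub>q = C\<^sub>q\<close> for \<open>p, q \<ge> 0\<close>, vertical differentials \<open>b\<close> in even and
  \<open>-b'\<close> in odd columns, and horizontal differentials from column \<open>p\<close> to column \<open>p - 1\<close> equal to \<open>1 - t\<close>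
  for odd \<open>p\<close> and to the norm \<open>N\<close> for even \<open>p > 0\<close>, where \<open>t = (-1)\<^sup>n \<tau>\<^sub>n\<close>. In total degree \<open>n\<close>, the
  component with index \<open>q\<close> lies in bidegree \<open>(n - q, q)\<close>.
\<close>

definition tsygan_tot :: "('k, 'c) cyclic_object \<Rightarrow> nat \<Rightarrow> ('k, nat \<Rightarrow> 'c) module" where
  "tsygan_tot Z n = vs_dsum {..n} (space Z)"

definition tsygan_diff :: "('k::field, 'c) cyclic_object \<Rightarrow> nat \<Rightarrow> (nat \<Rightarrow> 'c) \<Rightarrow> nat \<Rightarrow> 'c" where
  "tsygan_diff Z n x =
     (\<lambda>q\<in>{..n - 1}.
        let p = n - 1 - q; C = space Z q in
        (if even p then tsygan_b Z (Suc q) (x (Suc q)) else \<ominus>\<^bsub>C\<^esub> tsygan_b' Z (Suc q) (x (Suc q)))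
        \<oplus>\<^bsub>C\<^esub>
        (if even p then x q \<ominus>\<^bsub>C\<^esub> signed_cyc Z q (x q) else tsygan_norm Z q (x q)))"

definition cyclic_homology :: "('k::field, 'c) cyclic_object \<Rightarrow> nat \<Rightarrow> ('k, (nat \<Rightarrow> 'c) set) module" where
  "cyclic_homology Z n = homology (tsygan_tot Z) (tsygan_diff Z) (int n)"


section \<open>Tensor products with free modules\<close>

text \<open>
  For a vector space \<open>V\<close> and a set \<open>U\<close>, the tensor product of \<open>V\<close> with the free module \<open>k[U]\<close> (in
  either order) is the space of finitely supported functions from \<open>U\<close> to \<open>V\<close>: the function
  \<^term>\<open>Poly_Mapping.single x v\<close> is the tensor of \<open>v\<close> with the basis element \<open>x\<close>, and \<open>tens\<close> is the
  universal bilinear map. This covers all tensor products over \<open>k\<close> needed here, as the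
  tensor power \<open>(kG)\<^sup>\<otimes>\<^sup>n\<close> is free on \<open>G\<^sup>n\<close>, whose elements are represented by lists of length \<open>n\<close>.
\<close>

definition fin_supp :: "'x set \<Rightarrow> 'v set \<Rightarrow> ('x \<Rightarrow>\<^sub>0 'v::zero) set" where
  "fin_supp U V = {f. Poly_Mapping.keys f \<subseteq> U \<and> (\<forall>x. Poly_Mapping.lookup f x \<in> V)}"

definition tens :: "('k::field \<Rightarrow> 'v \<Rightarrow> 'v::ab_group_add) \<Rightarrow> ('x \<Rightarrow>\<^sub>0 'k) \<Rightarrow> 'v \<Rightarrow> ('x \<Rightarrow>\<^sub>0 'v)" where
  "tens scale f v = Poly_Mapping.map (\<lambda>c. scale c v) f"

definition fs_scale :: "('k \<Rightarrow> 'v \<Rightarrow> 'v::ab_group_add) \<Rightarrow> 'k \<Rightarrow> ('x \<Rightarrow>\<^sub>0 'v) \<Rightarrow> ('x \<Rightarrow>\<^sub>0 'v)" where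
  "fs_scale scale c f = Poly_Mapping.map (scale c) f"

text \<open>The linear map which sends the tensor of \<open>x\<close> and \<open>v\<close> to \<open>\<phi> x v\<close>.\<close>

definition lin_ext :: "('x \<Rightarrow> 'v \<Rightarrow> 'w::comm_monoid_add) \<Rightarrow> ('x \<Rightarrow>\<^sub>0 'v::zero) \<Rightarrow> 'w" where
  "lin_ext \<phi> f = (\<Sum>x\<in>Poly_Mapping.keys f. \<phi> x (Poly_Mapping.lookup f x))"

definition tuples :: "'x set \<Rightarrow> nat \<Rightarrow> 'x list set" where
  "tuples U n = {xs. length xs = n \<and> set xs \<subseteq> U}"

definition fs_space ::
  "('k \<Rightarrow> 'v \<Rightarrow> 'v) \<Rightarrow> 'x set \<Rightarrow> 'v set \<Rightarrow> ('k, 'x \<Rightarrow>\<^sub>0 'v::ab_group_add) module" where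
  "fs_space scale U V =
     \<lparr>carrier = fin_supp U V, monoid.mult = undefined, one = undefined,
      zero = 0, add = (+), smult = fs_scale scale\<rparr>"

definition delete_nth :: "nat \<Rightarrow> 'x list \<Rightarrow> 'x list" where
  "delete_nth i xs = take i xs @ drop (Suc i) xs"


section \<open>The Hopf algebra \<open>kG\<close>\<close>

definition group_alg :: "('g, 'z) monoid_scheme \<Rightarrow> ('g \<Rightarrow>\<^sub>0 'k::field) set" where
  "group_alg G = fin_supp (carrier G) UNIV"

abbreviation ga_basis :: "'g \<Rightarrow> ('g \<Rightarrow>\<^sub>0 'k::field)" where
  "ga_basis g \<equiv> Poly_Mapping.single g 1"

definition ga_mult ::
  "('g, 'z) monoid_scheme \<Rightarrow> ('g \<Rightarrow>\<^sub>0 'k::field) \<Rightarrow> ('g \<Rightarrow>\<^sub>0 'k) \<Rightarrow> ('g \<Rightarrow>\<^sub>0 'k)" where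
  "ga_mult G a b = lin_ext (\<lambda>g c. lin_ext (\<lambda>h d. Poly_Mapping.single (g \<otimes>\<^bsub>G\<^esub> h) (c * d)) b) a"

definition ga_counit :: "('g \<Rightarrow>\<^sub>0 'k::field) \<Rightarrow> 'k" where
  "ga_counit = lin_ext (\<lambda>g c. c)"

definition ga_comult :: "('g \<Rightarrow>\<^sub>0 'k::field) \<Rightarrow> ('g \<times> 'g \<Rightarrow>\<^sub>0 'k)" where
  "ga_comult = lin_ext (\<lambda>g c. Poly_Mapping.single (g, g) c)"

definition ga_antipode :: "('g, 'z) monoid_scheme \<Rightarrow> ('g \<Rightarrow>\<^sub>0 'k::field) \<Rightarrow> ('g \<Rightarrow>\<^sub>0 'k)" where
  "ga_antipode G = lin_ext (\<lambda>g c. Poly_Mapping.single (inv\<^bsub>G\<^esub> g) c)"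

text \<open>The iterated comultiplication \<open>h \<mapsto> \<Sum> h\<^sub>(\<^sub>1\<^sub>) \<otimes> \<dots> \<otimes> h\<^sub>(\<^sub>n\<^sub>)\<close> with values in \<open>(kG)\<^sup>\<otimes>\<^sup>n\<close>.\<close>

primrec ga_comult_iter :: "nat \<Rightarrow> ('g \<Rightarrow>\<^sub>0 'k::field) \<Rightarrow> ('g list \<Rightarrow>\<^sub>0 'k)" where
  "ga_comult_iter 0 h = Poly_Mapping.single [] (ga_counit h)"
| "ga_comult_iter (Suc n) h =
     lin_ext (\<lambda>(a, b) c.
       lin_ext (\<lambda>gs d. Poly_Mapping.single (a # gs) (c * d)) (ga_comult_iter n (ga_basis b)))
     (ga_comult h)"

text \<open>The algebra \<open>(kG)\<^sup>\<otimes>\<^sup>n\<close>, and its diagonal right \<open>kG\<close>-module structure.\<close>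

definition tpow :: "('g, 'z) monoid_scheme \<Rightarrow> nat \<Rightarrow> ('g list \<Rightarrow>\<^sub>0 'k::field) set" where
  "tpow G n = fin_supp (tuples (carrier G) n) UNIV"

definition tpow_mult ::
  "('g, 'z) monoid_scheme \<Rightarrow> ('g list \<Rightarrow>\<^sub>0 'k::field) \<Rightarrow> ('g list \<Rightarrow>\<^sub>0 'k) \<Rightarrow> ('g list \<Rightarrow>\<^sub>0 'k)" where
  "tpow_mult G u v =
     lin_ext (\<lambda>gs c. lin_ext (\<lambda>hs d. Poly_Mapping.single (map2 (\<otimes>\<^bsub>G\<^esub>) gs hs) (c * d)) v) u"

definition tpow_diag ::
  "('g, 'z) monoid_scheme \<Rightarrow> nat \<Rightarrow> ('g list \<Rightarrow>\<^sub>0 'k::field) \<Rightarrow> ('g \<Rightarrow>\<^sub>0 'k) \<Rightarrow> ('g list \<Rightarrow>\<^sub>0 'k)" where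
  "tpow_diag G n v h = tpow_mult G v (ga_comult_iter n h)"


section \<open>Modular crossed modules over \<open>kG\<close>\<close>

text \<open>
  \<open>M\<close> is the whole type \<open>'m\<close>. Elements of the field act on it by \<open>scale\<close>, elements \<open>a\<close> of \<open>kG\<close> by
  \<open>act a\<close>.
\<close>

locale group_alg_module = group G + vector_space scale
  for G :: "('g, 'z) monoid_scheme" (structure)
    and scale :: "'k::field \<Rightarrow> 'm::ab_group_add \<Rightarrow> 'm" +
  fixes act :: "('g \<Rightarrow>\<^sub>0 'k) \<Rightarrow> 'm \<Rightarrow> 'm"
  assumes act_scalar: "act (Poly_Mapping.single \<one> c) m = scale c m"
    and act_add_right: "a \<in> group_alg G \<Longrightarrow> act a (m + m') = act a m + act a m'"
    and act_add_left:
      "a \<in> group_alg G \<Longrightarrow> b \<in> group_alg G \<Longrightarrow> act (a + b) m = act a m + act b m"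
    and act_mult:
      "a \<in> group_alg G \<Longrightarrow> b \<in> group_alg G \<Longrightarrow> act (ga_mult G a b) m = act a (act b m)"

text \<open>
  In \<open>crossed\<close>, the right-hand side is \<open>\<Sum> h\<^sub>(\<^sub>2\<^sub>) m\<^sub>\<langle>\<^sub>0\<^sub>\<rangle> \<otimes> h\<^sub>(\<^sub>3\<^sub>) m\<^sub>\<langle>\<^sub>1\<^sub>\<rangle> S (h\<^sub>(\<^sub>1\<^sub>))\<close>: the list \<open>hs\<close> is a basis element
  of \<open>(kG)\<^sup>\<otimes>\<^sup>3\<close> with coefficient \<open>c\<close>, whose components are \<open>h\<^sub>(\<^sub>1\<^sub>), h\<^sub>(\<^sub>2\<^sub>), h\<^sub>(\<^sub>3\<^sub>)\<close>.
\<close>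

locale crossed_module = group_alg_module G scale act
  for G :: "('g, 'z) monoid_scheme" (structure)
    and scale :: "'k::field \<Rightarrow> 'm::ab_group_add \<Rightarrow> 'm"
    and act :: "('g \<Rightarrow>\<^sub>0 'k) \<Rightarrow> 'm \<Rightarrow> 'm" +
  fixes \<rho> :: "'m \<Rightarrow> ('g \<Rightarrow>\<^sub>0 'm)"
  assumes coact_closed: "\<rho> m \<in> fin_supp (carrier G) UNIV"
    and coact_linear: "Vector_Spaces.linear scale (fs_scale scale) \<rho>"
    and coact_counit: "lin_ext (\<lambda>x m0. scale (ga_counit (ga_basis x)) m0) (\<rho> m) = m"
    and coact_coassoc:
      "lin_ext (\<lambda>x m0. lin_ext (\<lambda>y m00. Poly_Mapping.single (y, x) m00) (\<rho> m0)) (\<rho> m) =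
       lin_ext (\<lambda>x m0. tens scale (ga_comult (ga_basis x)) m0) (\<rho> m)"
    and crossed:
      "h \<in> group_alg G \<Longrightarrow>
       \<rho> (act h m) =
         lin_ext (\<lambda>hs c. lin_ext (\<lambda>x m0.
             tens scale
               (ga_mult G (ga_mult G (ga_basis (hs ! 2)) (ga_basis x)) (ga_antipode G (ga_basis (hs ! 0))))
               (scale c (act (ga_basis (hs ! 1)) m0)))
           (\<rho> m)) (ga_comult_iter 3 h)"

locale modular_crossed_module = crossed_module +
  assumes modular: "lin_ext (\<lambda>x m0. act (ga_basis x) m0) (\<rho> m) = m"

definition homogeneous_part :: "('k::field \<Rightarrow> 'm \<Rightarrow> 'm) \<Rightarrow> ('m \<Rightarrow> ('g \<Rightarrow>\<^sub>0 'm)) \<Rightarrow> 'g \<Rightarrow> 'm::ab_group_add set" where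
  "homogeneous_part scale \<rho> x = {m. \<rho> m = tens scale (ga_basis x) m}"


section \<open>The cyclic object \<open>Z\<^sub>*(kG, M)\<close>\<close>

text \<open>
  The tensor product of \<open>(kG)\<^sup>\<otimes>\<^sup>n\<^sup>+\<^sup>1\<close> and \<open>M\<close> over \<open>kG\<close> is the quotient of the tensor product over \<open>k\<close>
  by the span of all differences of \<open>v h \<otimes> m\<close> and \<open>v \<otimes> h m\<close>.
\<close>

definition Z_pre ::
  "('g, 'z) monoid_scheme \<Rightarrow> ('k::field \<Rightarrow> 'm \<Rightarrow> 'm) \<Rightarrow> nat \<Rightarrow> ('k, 'g list \<Rightarrow>\<^sub>0 'm::ab_group_add) module" where
  "Z_pre G scale n = fs_space scale (tuples (carrier G) (Suc n)) UNIV"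

definition Z_rel ::
  "('g, 'z) monoid_scheme \<Rightarrow> ('k::field \<Rightarrow> 'm \<Rightarrow> 'm) \<Rightarrow> (('g \<Rightarrow>\<^sub>0 'k) \<Rightarrow> 'm \<Rightarrow> 'm) \<Rightarrow> nat \<Rightarrow>
   ('g list \<Rightarrow>\<^sub>0 'm::ab_group_add) set" where
  "Z_rel G scale act n =
     Modules.module.span (fs_scale scale)
       {tens scale (tpow_diag G (Suc n) v h) m - tens scale v (act h m) |v h m.
          v \<in> tpow G (Suc n) \<and> h \<in> group_alg G}"

text \<open>On representatives, the structure maps are the linear extensions of their formulas on basis tuples.\<close>

definition pre_face :: "('k::field \<Rightarrow> 'm \<Rightarrow> 'm) \<Rightarrow> nat \<Rightarrow> ('g list \<Rightarrow>\<^sub>0 'm::ab_group_add) \<Rightarrow> ('g list \<Rightarrow>\<^sub>0 'm)" where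
  "pre_face scale i =
     lin_ext (\<lambda>hs m. Poly_Mapping.single (delete_nth i hs) (scale (ga_counit (ga_basis (hs ! i))) m))"

definition pre_degen :: "('k::field \<Rightarrow> 'm \<Rightarrow> 'm) \<Rightarrow> nat \<Rightarrow> ('g list \<Rightarrow>\<^sub>0 'm::ab_group_add) \<Rightarrow> ('g list \<Rightarrow>\<^sub>0 'm)" where
  "pre_degen scale i =
     lin_ext (\<lambda>hs m.
       lin_ext (\<lambda>(a, b) c. Poly_Mapping.single (take i hs @ [a, b] @ drop (Suc i) hs) (scale c m))
         (ga_comult (ga_basis (hs ! i))))"

definition pre_cyc ::
  "('g, 'z) monoid_scheme \<Rightarrow> ('m \<Rightarrow> ('g \<Rightarrow>\<^sub>0 'm)) \<Rightarrow> ('g list \<Rightarrow>\<^sub>0 'm::ab_group_add) \<Rightarrow> ('g list \<Rightarrow>\<^sub>0 'm)" where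
  "pre_cyc G \<rho> =
     lin_ext (\<lambda>hs m.
       lin_ext (\<lambda>x m0. Poly_Mapping.single ((last hs \<otimes>\<^bsub>G\<^esub> x) # butlast hs) m0) (\<rho> m))"

definition Z_cyclic ::
  "('g, 'z) monoid_scheme \<Rightarrow> ('k::field \<Rightarrow> 'm \<Rightarrow> 'm) \<Rightarrow> (('g \<Rightarrow>\<^sub>0 'k) \<Rightarrow> 'm \<Rightarrow> 'm) \<Rightarrow>
   ('m \<Rightarrow> ('g \<Rightarrow>\<^sub>0 'm)) \<Rightarrow> ('k, ('g list \<Rightarrow>\<^sub>0 'm::ab_group_add) set) cyclic_object" where
  "Z_cyclic G scale act \<rho> =
     (let ind = (\<lambda>n. induced_map (Z_pre G scale n) (Z_rel G scale act n)) in
      \<lparr>space = (\<lambda>n. vs_quot (Z_pre G scale n) (Z_rel G scale act n)),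
       face = (\<lambda>n i. ind (n - 1) (pre_face scale i)),
       degen = (\<lambda>n i. ind (n + 1) (pre_degen scale i)),
       cyc = (\<lambda>n. ind n (pre_cyc G \<rho>))\<rparr>)"

definition HC ::
  "('g, 'z) monoid_scheme \<Rightarrow> ('k::field \<Rightarrow> 'm \<Rightarrow> 'm) \<Rightarrow> (('g \<Rightarrow>\<^sub>0 'k) \<Rightarrow> 'm \<Rightarrow> 'm) \<Rightarrow>
   ('m \<Rightarrow> ('g \<Rightarrow>\<^sub>0 'm)) \<Rightarrow> nat \<Rightarrow> ('k, (nat \<Rightarrow> ('g list \<Rightarrow>\<^sub>0 'm::ab_group_add) set) set) module" where
  "HC G scale act \<rho> n = cyclic_homology (Z_cyclic G scale act \<rho>) n"


section \<open>Group homology\<close>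

text \<open>
  The homology of \<open>\<Gamma>\<close> with coefficients in a vector space \<open>V\<close> (a subspace of the type \<open>'m\<close>), on which
  \<open>\<Gamma>\<close> acts linearly from the left by \<open>a\<close>, computed from the standard (homogeneous) resolution: chains
  are the coinvariants of the tensor product of the free module on \<open>\<Gamma>\<^sup>n\<^sup>+\<^sup>1\<close>, with diagonal right
  translation, and \<open>V\<close>.
\<close>

definition grp_chain_pre ::
  "('q, 'z) monoid_scheme \<Rightarrow> ('k::field \<Rightarrow> 'm \<Rightarrow> 'm) \<Rightarrow> 'm set \<Rightarrow> nat \<Rightarrow>
   ('k, 'q list \<Rightarrow>\<^sub>0 'm::ab_group_add) module" where
  "grp_chain_pre \<Gamma> scale V n = fs_space scale (tuples (carrier \<Gamma>) (Suc n)) V"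

definition grp_chain_rel ::
  "('q, 'z) monoid_scheme \<Rightarrow> ('k::field \<Rightarrow> 'm \<Rightarrow> 'm) \<Rightarrow> ('q \<Rightarrow> 'm \<Rightarrow> 'm) \<Rightarrow> 'm set \<Rightarrow> nat \<Rightarrow>
   ('q list \<Rightarrow>\<^sub>0 'm::ab_group_add) set" where
  "grp_chain_rel \<Gamma> scale a V n =
     Modules.module.span (fs_scale scale)
       {Poly_Mapping.single (map (\<lambda>s. s \<otimes>\<^bsub>\<Gamma>\<^esub> g) gs) v - Poly_Mapping.single gs (a g v) |gs g v.
          gs \<in> tuples (carrier \<Gamma>) (Suc n) \<and> g \<in> carrier \<Gamma> \<and> v \<in> V}"

definition grp_chains ::
  "('q, 'z) monoid_scheme \<Rightarrow> ('k::field \<Rightarrow> 'm \<Rightarrow> 'm) \<Rightarrow> ('q \<Rightarrow> 'm \<Rightarrow> 'm) \<Rightarrow> 'm set \<Rightarrow> nat \<Rightarrow>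
   ('k, ('q list \<Rightarrow>\<^sub>0 'm::ab_group_add) set) module" where
  "grp_chains \<Gamma> scale a V n = vs_quot (grp_chain_pre \<Gamma> scale V n) (grp_chain_rel \<Gamma> scale a V n)"

definition grp_diff ::
  "('q, 'z) monoid_scheme \<Rightarrow> ('k::field \<Rightarrow> 'm \<Rightarrow> 'm) \<Rightarrow> ('q \<Rightarrow> 'm \<Rightarrow> 'm) \<Rightarrow> 'm set \<Rightarrow> nat \<Rightarrow>
   ('q list \<Rightarrow>\<^sub>0 'm::ab_group_add) set \<Rightarrow> ('q list \<Rightarrow>\<^sub>0 'm) set" where
  "grp_diff \<Gamma> scale a V n =
     alt_sum (grp_chains \<Gamma> scale a V (n - 1)) (Suc n)
       (\<lambda>i. induced_map (grp_chain_pre \<Gamma> scale V (n - 1)) (grp_chain_rel \<Gamma> scale a V (n - 1))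
              (lin_ext (\<lambda>gs v. Poly_Mapping.single (delete_nth i gs) v)))"

definition group_homology ::
  "('q, 'z) monoid_scheme \<Rightarrow> ('k::field \<Rightarrow> 'm \<Rightarrow> 'm) \<Rightarrow> ('q \<Rightarrow> 'm \<Rightarrow> 'm) \<Rightarrow> 'm set \<Rightarrow> int \<Rightarrow>
   ('k, ('q list \<Rightarrow>\<^sub>0 'm::ab_group_add) set set) module" where
  "group_homology \<Gamma> scale a V = homology (grp_chains \<Gamma> scale a V) (grp_diff \<Gamma> scale a V)"


section \<open>Conjugacy classes and centralizers\<close>

definition conjugacy_reps :: "('g, 'z) monoid_scheme \<Rightarrow> 'g set \<Rightarrow> bool" where
  "conjugacy_reps G T \<longleftrightarrow>
     T \<subseteq> carrier G \<and>
     (\<forall>y\<in>carrier G. \<exists>!x. x \<in> T \<and> (\<exists>g\<in>carrier G. y = g \<otimes>\<^bsub>G\<^esub> x \<otimes>\<^bsub>G\<^esub> inv\<^bsub>G\<^esub> g))"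

text \<open>In the library, elements of infinite order have order \<open>0\<close>.\<close>

definition finite_order_reps :: "('g, 'z) monoid_scheme \<Rightarrow> 'g set \<Rightarrow> 'g set" where
  "finite_order_reps G T = {x \<in> T. group.ord G x > 0}"

definition centralizer :: "('g, 'z) monoid_scheme \<Rightarrow> 'g \<Rightarrow> 'g set" where
  "centralizer G x = {g \<in> carrier G. g \<otimes>\<^bsub>G\<^esub> x = x \<otimes>\<^bsub>G\<^esub> g}"

definition centralizer_quot :: "('g, 'z) monoid_scheme \<Rightarrow> 'g \<Rightarrow> 'g set monoid" where
  "centralizer_quot G x = (G\<lparr>carrier := centralizer G x\<rparr>) Mod (generate G {x})"

text \<open>
  A coset of \<open>\<langle>x\<rangle>\<close> acts on \<open>M\<^sub>x\<close> by any of its elements; the choice does not matter by modularity.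
\<close>

definition coset_act :: "(('g \<Rightarrow>\<^sub>0 'k::field) \<Rightarrow> 'm \<Rightarrow> 'm) \<Rightarrow> 'g set \<Rightarrow> 'm \<Rightarrow> 'm" where
  "coset_act act U m = act (ga_basis (SOME g. g \<in> U)) m"

end

theory Submission
  imports Defs "HOL-Library.Function_Algebras"
begin

text \<open>
  Write \<open>M\<^sub>x\<close> for the homogeneous part of \<open>M\<close> of degree \<open>x\<close>. If \<open>y = k x k\<^sup>-\<^sup>1\<close> and \<open>m\<close> has degree
  \<open>y\<close>, then \<open>k\<^sup>-\<^sup>1 m\<close> has degree \<open>x\<close>, and in the tensor product over \<open>kG\<close> one has
  \<open>(h\<^sup>0, \<dots>, h\<^sup>n) \<otimes> m = (h\<^sup>0 k, \<dots>, h\<^sup>n k) \<otimes> k\<^sup>-\<^sup>1 m\<close>.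
  So every tensor can be moved to the representatives \<open>x \<in> T\<close> of the conjugacy classes, uniquely up to the
  centralizer \<open>G\<^sub>x\<close>, and the cyclic object splits into the cyclic objects of tuples in \<open>G\<close> with coefficients
  in \<open>M\<^sub>x\<close>, modulo the diagonal action of \<open>G\<^sub>x\<close> (\<open>decompose\<close>, \<open>proj_GR\<close>, \<open>presents_sum\<close>). In the summand
  of \<open>x\<close> the cyclic operator moves the last entry to the front and multiplies it by \<open>x\<close>; its \<open>(n+1)\<close>-st
  power is the action of \<open>x\<close>, which is trivial on coinvariants.

  Fix \<open>x\<close> and let \<open>Q\<close> be the group \<open>G\<^sub>x/\<langle>x\<rangle>\<close>. Representatives of the cosets of \<open>G\<^sub>x\<close> in \<open>G\<close> give a map
  \<open>\<pi>\<close> from \<open>G\<close> onto \<open>Q\<close> that is equivariant for \<open>G\<^sub>x\<close> and does not see multiplication by \<open>x\<close>. Let \<open>A\<close>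
  be the space of those chains on \<open>G\<close> whose image on \<open>Q\<close> vanishes in the alternating chains, where a tuple
  changes its sign when two entries are exchanged. Chains modulo \<open>A\<close> and modulo \<open>G\<^sub>x\<close> are the alternating chains of
  the standard resolution of \<open>Q\<close>, so they compute \<open>H\<^sub>*(Q, M\<^sub>x)\<close> (\<open>presents_group_homology\<close>). A rotation of
  a tuple is a product of transpositions, hence \<open>1 - t\<close> maps into \<open>A\<close>, where \<open>t\<close> is the cyclic operator with
  its sign.

  The remaining point is to compare \<open>A\<close> with a smaller space \<open>B\<close> of relations that is given by \<open>x\<close> or
  by \<open>t\<close>.
  \<^item> If \<open>x\<close> has finite order, let \<open>B\<close> be the image of \<open>1 - x\<close>. Averaging over the powers of \<open>x\<close> shows
  that \<open>A/B\<close> is acyclic. Hence each even column of the Tsygan double complex can be divided by \<open>A\<close>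
  without changing its homology, and then \<open>1 - t\<close> becomes zero. As the odd columns are contractible, the
  total homology is the direct sum of that of the even columns (\<open>presents_tot_periodic\<close>).
  \<^item> If \<open>x\<close> has infinite order, let \<open>B\<close> be the image of \<open>1 - t\<close>. In characteristic \<open>0\<close> the
  rows are exact, so the total complex is equivalent to the column \<open>0\<close> modulo \<open>1 - t\<close> (\<open>connes_qiso\<close>).
  A chain fixed by \<open>t\<close> is zero, because the orbits of \<open>x\<close> on tuples are infinite; so \<open>1 - t\<close> is
  injective and again \<open>A/B\<close> is acyclic.

  In both cases the acyclicity of \<open>A/B\<close> has to survive the passage to coinvariants (\<open>coinvariants_acyclic\<close>).
  It does because \<open>A/B\<close> is relatively projective: the weight of a tuple over a point \<open>u\<close> of \<open>Q\<close> is the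
  fraction of its entries over \<open>u\<close>, these weights form a partition of unity, and \<open>G\<^sub>x\<close> permutes the points
  transitively with stabilizers that act trivially modulo \<open>B\<close>. A linear choice of preimages at one point can
  be transported to all points, which makes the contracting homotopy equivariant.

  Quotients of quotients are awkward to compute in. Therefore the proof never leaves the spaces of finitely
  supported functions: a vector space \<open>A\<close> is presented by subspaces \<open>B \<subseteq> Z\<close> of an ambient space if it is
  isomorphic to \<open>Z/B\<close>. Homology groups and direct sums inherit presentations from their ingredients, and the
  theorem follows since its two sides are presented by the same pair \<open>B \<subseteq> Z\<close> (\<open>presents_isomorphic\<close>).
\<close>

section \<open>Linear maps\<close>

lemma linI:
  assumes "vector_space s1" "vector_space s2"
    "\<And>x y. f (x + y) = f x + f y" "\<And>c x. f (s1 c x) = s2 c (f x)"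
  shows "Vector_Spaces.linear s1 s2 f"
  using assms by (simp add: Vector_Spaces.linear_iff)

lemma lin_add: "Vector_Spaces.linear s1 s2 f \<Longrightarrow> f (x + y) = f x + f y"
  and lin_scale: "Vector_Spaces.linear s1 s2 f \<Longrightarrow> f (s1 c x) = s2 c (f x)"
  by (simp_all add: Vector_Spaces.linear_iff)

lemma lin_0: assumes "Vector_Spaces.linear s1 s2 f" shows "f 0 = 0"
  using lin_add[OF assms, of 0 0] by simp

lemma lin_neg: assumes "Vector_Spaces.linear s1 s2 f" shows "f (- x) = - f x"
  using lin_add[OF assms, of x "- x"] lin_0[OF assms] by (simp add: minus_unique)

lemma lin_diff: assumes "Vector_Spaces.linear s1 s2 f" shows "f (x - y) = f x - f y"
  using lin_add[OF assms, of x "- y"] lin_neg[OF assms, of y] by simp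

lemma lin_sum: assumes "Vector_Spaces.linear s1 s2 f" shows "f (sum g I) = (\<Sum>i\<in>I. f (g i))"
  by (induction I rule: infinite_finite_induct) (simp_all add: lin_0[OF assms] lin_add[OF assms])

lemma lin_vs: assumes "Vector_Spaces.linear s1 s2 f" shows "vector_space s1" "vector_space s2"
  using assms by (simp_all add: Vector_Spaces.linear_iff)

lemma lin_id: "vector_space s \<Longrightarrow> Vector_Spaces.linear s s (\<lambda>x. x)"
  by (rule linI) auto

lemma lin_zero:
  assumes "vector_space s1" "vector_space s2" shows "Vector_Spaces.linear s1 s2 (\<lambda>x. 0)"
proof -
  interpret vector_space s2 by fact
  show ?thesis using assms by (intro linI) simp_all
qed

lemma lin_comp:
  "Vector_Spaces.linear s2 s3 g \<Longrightarrow> Vector_Spaces.linear s1 s2 f \<Longrightarrow> Vector_Spaces.linear s1 s3 (\<lambda>x. g (f x))"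
  by (simp add: Vector_Spaces.linear_iff)

lemma lin_plus:
  assumes "Vector_Spaces.linear s1 s2 f" "Vector_Spaces.linear s1 s2 g"
  shows "Vector_Spaces.linear s1 s2 (\<lambda>x. f x + g x)"
proof -
  interpret V: vector_space s2 by (rule lin_vs(2)[OF assms(1)])
  show ?thesis using assms by (intro linI) (simp_all add: Vector_Spaces.linear_iff V.scale_right_distrib)
qed

lemma lin_uminus:
  assumes "Vector_Spaces.linear s1 s2 f" shows "Vector_Spaces.linear s1 s2 (\<lambda>x. - f x)"
proof -
  interpret V: vector_space s2 by (rule lin_vs(2)[OF assms])
  show ?thesis using assms by (intro linI) (simp_all add: Vector_Spaces.linear_iff)
qed

lemma lin_minus:
  assumes "Vector_Spaces.linear s1 s2 f" "Vector_Spaces.linear s1 s2 g"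
  shows "Vector_Spaces.linear s1 s2 (\<lambda>x. f x - g x)"
  using lin_plus[OF assms(1) lin_uminus[OF assms(2)]] by simp

lemma lin_smult:
  assumes "Vector_Spaces.linear s1 s2 f" shows "Vector_Spaces.linear s1 s2 (\<lambda>x. s2 c (f x))"
proof -
  interpret V: vector_space s2 by (rule lin_vs(2)[OF assms])
  show ?thesis using assms
    by (intro linI) (simp_all add: Vector_Spaces.linear_iff V.scale_right_distrib V.scale_left_commute)
qed

lemma lin_sums:
  assumes "vector_space s1" "vector_space s2" "\<And>i. i \<in> I \<Longrightarrow> Vector_Spaces.linear s1 s2 (f i)"
  shows "Vector_Spaces.linear s1 s2 (\<lambda>x. \<Sum>i\<in>I. f i x)"
  using assms(3) by (induction I rule: infinite_finite_induct) (simp_all add: lin_zero lin_plus assms(1,2))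

lemma lin_funpow:
  assumes "Vector_Spaces.linear s s f" shows "Vector_Spaces.linear s s (f ^^ n)"
proof (induction n)
  case 0
  then show ?case using lin_id[OF lin_vs(1)[OF assms]] by (simp add: id_def)
next
  case (Suc n)
  then show ?case using lin_comp[OF assms Suc] by (simp add: o_def)
qed

lemma subspace_vimage:
  assumes "Vector_Spaces.linear s1 s2 f" "module.subspace s1 A" "module.subspace s2 B"
  shows "module.subspace s1 {x \<in> A. f x \<in> B}"
proof -
  interpret V1: vector_space s1 by (rule lin_vs(1)[OF assms(1)])
  interpret V2: vector_space s2 by (rule lin_vs(2)[OF assms(1)])
  show ?thesis using assms(2,3)
    by (intro V1.subspaceI)
      (auto simp: V1.subspace_0 V1.subspace_add V1.subspace_scale lin_0[OF assms(1)] lin_add[OF assms(1)]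
        lin_scale[OF assms(1)] V2.subspace_0 V2.subspace_add V2.subspace_scale)
qed

lemma subspace_im:
  assumes "Vector_Spaces.linear s1 s2 f" "module.subspace s1 A"
  shows "module.subspace s2 (f ` A)"
proof -
  interpret V1: vector_space s1 by (rule lin_vs(1)[OF assms(1)])
  interpret V2: vector_space s2 by (rule lin_vs(2)[OF assms(1)])
  show ?thesis
  proof (rule V2.subspaceI)
    show "0 \<in> f ` A" using V1.subspace_0[OF assms(2)] lin_0[OF assms(1)] by force
  next
    fix x y assume "x \<in> f ` A" "y \<in> f ` A"
    then show "x + y \<in> f ` A"
      using V1.subspace_add[OF assms(2)] lin_add[OF assms(1)] by (metis (no_types, lifting) imageE imageI)
  next
    fix c x assume "x \<in> f ` A"
    then show "s2 c x \<in> f ` A"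
      using V1.subspace_scale[OF assms(2)] lin_scale[OF assms(1)] by (metis (no_types, lifting) imageE imageI)
  qed
qed

abbreviation ssum :: "'a::ab_group_add set \<Rightarrow> 'a set \<Rightarrow> 'a set" where
  "ssum A B \<equiv> {x + y |x y. x \<in> A \<and> y \<in> B}"

section \<open>Presentations of vector spaces as subquotients\<close>

text \<open>
  The relation to a quotient \<open>Z/B\<close> is expressed by a map on representatives, whose values outside \<open>Z\<close>
  are arbitrary.
\<close>

definition pres_map ::
  "('k::field \<Rightarrow> 'a::ab_group_add \<Rightarrow> 'a) \<Rightarrow> 'a set \<Rightarrow> 'a set \<Rightarrow> ('k, 'c) module \<Rightarrow> ('a \<Rightarrow> 'c) \<Rightarrow> bool" where
  "pres_map s Z B A \<phi> \<longleftrightarrow>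
     vector_space s \<and> module.subspace s Z \<and> module.subspace s B \<and> B \<subseteq> Z \<and>
     \<phi> ` Z = carrier A \<and> \<phi> 0 = \<zero>\<^bsub>A\<^esub> \<and>
     (\<forall>x\<in>Z. \<forall>y\<in>Z. \<phi> (x + y) = \<phi> x \<oplus>\<^bsub>A\<^esub> \<phi> y) \<and>
     (\<forall>c. \<forall>x\<in>Z. \<phi> (s c x) = c \<odot>\<^bsub>A\<^esub> \<phi> x) \<and>
     (\<forall>x\<in>Z. \<phi> x = \<zero>\<^bsub>A\<^esub> \<longleftrightarrow> x \<in> B)"

definition presents ::
  "('k::field \<Rightarrow> 'a::ab_group_add \<Rightarrow> 'a) \<Rightarrow> 'a set \<Rightarrow> 'a set \<Rightarrow> ('k, 'c) module \<Rightarrow> bool" where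
  "presents s Z B A \<longleftrightarrow> (\<exists>\<phi>. pres_map s Z B A \<phi>)"

lemma pres_mapD:
  assumes "pres_map s Z B A \<phi>"
  shows "vector_space s" "module.subspace s Z" "module.subspace s B" "B \<subseteq> Z"
    "\<phi> ` Z = carrier A" "\<phi> 0 = \<zero>\<^bsub>A\<^esub>"
    "\<And>x. x \<in> Z \<Longrightarrow> \<phi> x \<in> carrier A"
    "\<And>x y. x \<in> Z \<Longrightarrow> y \<in> Z \<Longrightarrow> \<phi> (x + y) = \<phi> x \<oplus>\<^bsub>A\<^esub> \<phi> y"
    "\<And>c x. x \<in> Z \<Longrightarrow> \<phi> (s c x) = c \<odot>\<^bsub>A\<^esub> \<phi> x"
    "\<And>x. x \<in> Z \<Longrightarrow> \<phi> x = \<zero>\<^bsub>A\<^esub> \<longleftrightarrow> x \<in> B"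
  using assms unfolding pres_map_def by auto

lemma pres_map_ex:
  assumes "pres_map s Z B A \<phi>" "a \<in> carrier A"
  shows "\<exists>z. z \<in> Z \<and> \<phi> z = a"
  using assms(2) unfolding pres_mapD(5)[OF assms(1), symmetric] by auto

lemma pres_map_eq_iff:
  assumes p: "pres_map s Z B A \<phi>" and x: "x \<in> Z" and y: "y \<in> Z"
  shows "\<phi> x = \<phi> y \<longleftrightarrow> x - y \<in> B"
proof -
  interpret V: vector_space s by (rule pres_mapD(1)[OF p])
  have xy: "x - y \<in> Z" using x y pres_mapD(2)[OF p] V.subspace_diff by blast
  have e: "\<phi> x = \<phi> (x - y) \<oplus>\<^bsub>A\<^esub> \<phi> y" using pres_mapD(8)[OF p xy y] by simp
  have z: "\<zero>\<^bsub>A\<^esub> \<oplus>\<^bsub>A\<^esub> \<phi> y = \<phi> y"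
    using pres_mapD(8)[OF p _ y, of 0] V.subspace_0[OF pres_mapD(2)[OF p]] pres_mapD(6)[OF p] by simp
  have ny: "- y \<in> Z" using y pres_mapD(2)[OF p] V.subspace_neg by blast
  show ?thesis
  proof
    assume "x - y \<in> B"
    then show "\<phi> x = \<phi> y" using e z pres_mapD(10)[OF p xy] by simp
  next
    assume a: "\<phi> x = \<phi> y"
    have "\<phi> (x - y) = \<phi> x \<oplus>\<^bsub>A\<^esub> \<phi> (- y)" using pres_mapD(8)[OF p x ny] by simp
    also have "\<dots> = \<phi> 0" using pres_mapD(8)[OF p y ny] a by simp
    finally show "x - y \<in> B" using pres_mapD(6,10)[OF p] xy by simp
  qed
qed

text \<open>
  The group laws descend along \<open>\<phi>\<close>. This makes finite sums in the record \<open>A\<close> available.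
\<close>

lemma pres_map_abelian_group:
  assumes p: "pres_map s Z B A \<phi>"
  shows "abelian_group A"
proof -
  interpret V: vector_space s by (rule pres_mapD(1)[OF p])
  note Z = pres_mapD(2)[OF p]
  have ex: "\<exists>z\<in>Z. \<phi> z = a" if "a \<in> carrier A" for a
    using pres_map_ex[OF p that] by blast
  show ?thesis
  proof (rule abelian_groupI)
    fix x y assume xy: "x \<in> carrier A" "y \<in> carrier A"
    obtain a b where ab: "a \<in> Z" "b \<in> Z" "x = \<phi> a" "y = \<phi> b" using ex xy by metis
    show "x \<oplus>\<^bsub>A\<^esub> y \<in> carrier A"
      using ab pres_mapD(8)[OF p ab(1,2)] pres_mapD(7)[OF p] V.subspace_add[OF Z] by metis
    show "x \<oplus>\<^bsub>A\<^esub> y = y \<oplus>\<^bsub>A\<^esub> x"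
      using ab pres_mapD(8)[OF p ab(1,2)] pres_mapD(8)[OF p ab(2,1)] by (simp add: add.commute)
    show "\<zero>\<^bsub>A\<^esub> \<oplus>\<^bsub>A\<^esub> x = x"
      using pres_mapD(8)[OF p _ ab(1), of 0] ab(3) V.subspace_0[OF Z] pres_mapD(6)[OF p] by simp
    show "\<exists>y\<in>carrier A. y \<oplus>\<^bsub>A\<^esub> x = \<zero>\<^bsub>A\<^esub>"
      using pres_mapD(8)[OF p _ ab(1), of "- a"] ab(1,3) V.subspace_neg[OF Z] pres_mapD(6,7)[OF p]
      by (metis add.left_inverse)
  next
    fix x y z assume xyz: "x \<in> carrier A" "y \<in> carrier A" "z \<in> carrier A"
    obtain a b c where abc: "a \<in> Z" "b \<in> Z" "c \<in> Z" "x = \<phi> a" "y = \<phi> b" "z = \<phi> c"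
      using ex xyz by metis
    show "x \<oplus>\<^bsub>A\<^esub> y \<oplus>\<^bsub>A\<^esub> z = x \<oplus>\<^bsub>A\<^esub> (y \<oplus>\<^bsub>A\<^esub> z)"
      using abc pres_mapD(8)[OF p] V.subspace_add[OF Z] by (metis add.assoc)
  next
    show "\<zero>\<^bsub>A\<^esub> \<in> carrier A" using pres_mapD(6,7)[OF p] V.subspace_0[OF Z] by metis
  qed
qed

lemma pres_map_minus:
  assumes p: "pres_map s Z B A \<phi>" and x: "x \<in> Z"
  shows "\<phi> (- x) = \<ominus>\<^bsub>A\<^esub> \<phi> x"
proof -
  interpret V: vector_space s by (rule pres_mapD(1)[OF p])
  interpret A: abelian_group A by (rule pres_map_abelian_group[OF p])
  have nx: "- x \<in> Z" using x V.subspace_neg[OF pres_mapD(2)[OF p]] by blast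
  show ?thesis
    using pres_mapD(8)[OF p nx x] pres_mapD(6,7)[OF p] x nx A.minus_equality by auto
qed

lemma pres_map_diff:
  assumes p: "pres_map s Z B A \<phi>" and x: "x \<in> Z" and y: "y \<in> Z"
  shows "\<phi> (x - y) = \<phi> x \<ominus>\<^bsub>A\<^esub> \<phi> y"
proof -
  interpret V: vector_space s by (rule pres_mapD(1)[OF p])
  have ny: "- y \<in> Z" using y V.subspace_neg[OF pres_mapD(2)[OF p]] by blast
  show ?thesis
    using pres_mapD(8)[OF p x ny] pres_map_minus[OF p y] by (simp add: a_minus_def)
qed

lemma pres_map_sum:
  assumes p: "pres_map s Z B A \<phi>" and I: "finite I" and x: "\<And>i. i \<in> I \<Longrightarrow> f i \<in> Z"
  shows "\<phi> (sum f I) = (\<Oplus>\<^bsub>A\<^esub>i\<in>I. \<phi> (f i))"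
proof -
  interpret V: vector_space s by (rule pres_mapD(1)[OF p])
  interpret A: abelian_group A by (rule pres_map_abelian_group[OF p])
  show ?thesis using I x
  proof (induction I)
    case empty
    then show ?case using pres_mapD(6)[OF p] by simp
  next
    case (insert i I)
    have "sum f I \<in> Z" using insert V.subspace_sum[OF pres_mapD(2)[OF p]] by blast
    moreover have "(\<lambda>i. \<phi> (f i)) \<in> insert i I \<rightarrow> carrier A" using insert pres_mapD(7)[OF p] by auto
    ultimately show ?case using insert pres_mapD(8)[OF p] by (simp add: A.finsum_insert)
  qed
qed

text \<open>
  Both records are copies of \<open>Z/B\<close>; the isomorphism applies the second presentation to any representative for
  the first one.
\<close>

lemma presents_isomorphic:
  assumes "presents s Z B A" "presents s Z B A'"
  shows "vs_isomorphic A A'"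
proof -
  from assms obtain \<phi> \<phi>' where p: "pres_map s Z B A \<phi>" and p': "pres_map s Z B A' \<phi>'"
    unfolding presents_def by auto
  interpret V: vector_space s by (rule pres_mapD(1)[OF p])
  note Z = pres_mapD(2)[OF p]
  have eq: "\<phi> x = \<phi> y \<longleftrightarrow> \<phi>' x = \<phi>' y" if "x \<in> Z" "y \<in> Z" for x y
    using pres_map_eq_iff[OF p that] pres_map_eq_iff[OF p' that] by simp
  define r where "r a = (SOME z. z \<in> Z \<and> \<phi> z = a)" for a
  have r: "r a \<in> Z \<and> \<phi> (r a) = a" if "a \<in> carrier A" for a
    unfolding r_def by (rule someI_ex) (rule pres_map_ex[OF p that])
  define f where "f a = \<phi>' (r a)" for a
  have f: "f (\<phi> z) = \<phi>' z" if "z \<in> Z" for z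
    unfolding f_def using eq[of "r (\<phi> z)" z] r[of "\<phi> z"] that pres_mapD(7)[OF p] by auto
  have "f \<in> hom (add_monoid A) (add_monoid A')"
  proof (rule homI)
    fix x assume "x \<in> carrier (add_monoid A)"
    then show "f x \<in> carrier (add_monoid A')" using r[of x] pres_mapD(7)[OF p'] by (simp add: f_def)
  next
    fix x y assume "x \<in> carrier (add_monoid A)" "y \<in> carrier (add_monoid A)"
    then obtain a b where ab: "a \<in> Z" "b \<in> Z" "x = \<phi> a" "y = \<phi> b" using r by force
    have "f (x \<oplus>\<^bsub>A\<^esub> y) = \<phi>' (a + b)"
      using pres_mapD(8)[OF p ab(1,2)] f[of "a + b"] V.subspace_add[OF Z] ab by simp
    then show "f (x \<otimes>\<^bsub>add_monoid A\<^esub> y) = f x \<otimes>\<^bsub>add_monoid A'\<^esub> f y"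
      using pres_mapD(8)[OF p' ab(1,2)] f ab by simp
  qed
  moreover have "bij_betw f (carrier (add_monoid A)) (carrier (add_monoid A'))"
  proof (rule bij_betwI')
    fix x y assume "x \<in> carrier (add_monoid A)" "y \<in> carrier (add_monoid A)"
    then show "(f x = f y) = (x = y)" using r[of x] r[of y] eq[of "r x" "r y"] by (auto simp: f_def)
  next
    fix x assume "x \<in> carrier (add_monoid A)"
    then show "f x \<in> carrier (add_monoid A')" using r[of x] pres_mapD(7)[OF p'] by (simp add: f_def)
  next
    fix y assume "y \<in> carrier (add_monoid A')"
    then obtain z where "z \<in> Z" "y = \<phi>' z" using pres_map_ex[OF p'] by force
    then show "\<exists>x\<in>carrier (add_monoid A). y = f x" using f pres_mapD(7)[OF p] by force
  qed
  moreover have "f (c \<odot>\<^bsub>A\<^esub> x) = c \<odot>\<^bsub>A'\<^esub> f x" if xc: "x \<in> carrier A" for c x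
  proof -
    obtain a where a: "a \<in> Z" "x = \<phi> a" using r[OF xc] by metis
    show ?thesis
      using pres_mapD(9)[OF p a(1)] pres_mapD(9)[OF p' a(1)] f V.subspace_scale[OF Z] a by metis
  qed
  ultimately show ?thesis unfolding vs_isomorphic_def iso_def by blast
qed

text \<open>
  A linear map on representatives that induces a bijection \<open>Z/B \<rightarrow> Z'/B'\<close>. For cycles and boundaries this
  says that a chain map induces an isomorphism in one degree.
\<close>

definition qiso ::
  "('k::field \<Rightarrow> 'a::ab_group_add \<Rightarrow> 'a) \<Rightarrow> ('k \<Rightarrow> 'b::ab_group_add \<Rightarrow> 'b) \<Rightarrow>
   'a set \<Rightarrow> 'a set \<Rightarrow> 'b set \<Rightarrow> 'b set \<Rightarrow> ('a \<Rightarrow> 'b) \<Rightarrow> bool" where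
  "qiso s s' Z B Z' B' f \<longleftrightarrow>
     Vector_Spaces.linear s s' f \<and>
     module.subspace s Z \<and> module.subspace s B \<and> B \<subseteq> Z \<and>
     module.subspace s' Z' \<and> module.subspace s' B' \<and> B' \<subseteq> Z' \<and>
     (\<forall>z\<in>Z. f z \<in> Z') \<and> (\<forall>z\<in>Z. f z \<in> B' \<longleftrightarrow> z \<in> B) \<and> (\<forall>z'\<in>Z'. \<exists>z\<in>Z. z' - f z \<in> B')"

lemma presents_pull:
  assumes q: "qiso s s' Z B Z' B' f" and P: "presents s' Z' B' A"
  shows "presents s Z B A"
proof -
  from P obtain \<phi> where p: "pres_map s' Z' B' A \<phi>" unfolding presents_def by auto
  note q' = q[unfolded qiso_def]
  have lin: "Vector_Spaces.linear s s' f" using q' by blast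
  interpret V: vector_space s' by (rule pres_mapD(1)[OF p])
  have "(\<lambda>z. \<phi> (f z)) ` Z = carrier A"
  proof
    show "(\<lambda>z. \<phi> (f z)) ` Z \<subseteq> carrier A" using q' pres_mapD(7)[OF p] by auto
    show "carrier A \<subseteq> (\<lambda>z. \<phi> (f z)) ` Z"
    proof
      fix a assume "a \<in> carrier A"
      then obtain z' where z': "z' \<in> Z'" "a = \<phi> z'" using pres_map_ex[OF p] by force
      then obtain z where z: "z \<in> Z" "z' - f z \<in> B'" using q' by blast
      then have "a = \<phi> (f z)" using pres_map_eq_iff[OF p z'(1)] q' z'(2) by blast
      then show "a \<in> (\<lambda>z. \<phi> (f z)) ` Z" using z by blast
    qed
  qed
  then have "pres_map s Z B A (\<lambda>z. \<phi> (f z))"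
    unfolding pres_map_def
    using q' pres_mapD(6,8,9,10)[OF p] lin_vs(1)[OF lin]
    by (intro conjI ballI allI) (simp_all add: lin_0[OF lin] lin_add[OF lin] lin_scale[OF lin])
  then show ?thesis unfolding presents_def by blast
qed

text \<open>
  A presentation is carried forward by choosing, for each \<open>z'\<close>, some \<open>z\<close> with \<open>f z\<close> congruent to \<open>z'\<close>
  modulo \<open>B'\<close>; the class of \<open>z\<close> modulo \<open>B\<close> is unique.
\<close>

lemma presents_push:
  assumes q: "qiso s s' Z B Z' B' f" and P: "presents s Z B A"
  shows "presents s' Z' B' A"
proof -
  from P obtain \<phi> where p: "pres_map s Z B A \<phi>" unfolding presents_def by auto
  note q' = q[unfolded qiso_def]
  have lin: "Vector_Spaces.linear s s' f" using q' by blast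
  interpret V: vector_space s by (rule lin_vs(1)[OF lin])
  interpret V': vector_space s' by (rule lin_vs(2)[OF lin])
  have sZ: "V.subspace Z" and sZ': "V'.subspace Z'" and sB': "V'.subspace B'" and fZ: "\<And>z. z \<in> Z \<Longrightarrow> f z \<in> Z'"
    and fB: "\<And>z. z \<in> Z \<Longrightarrow> f z \<in> B' \<longleftrightarrow> z \<in> B"
    and fsurj: "\<And>z'. z' \<in> Z' \<Longrightarrow> \<exists>z. z \<in> Z \<and> z' - f z \<in> B'"
    using q' by blast+
  define r where "r z' = (SOME z. z \<in> Z \<and> z' - f z \<in> B')" for z'
  have r: "r z' \<in> Z \<and> z' - f (r z') \<in> B'" if "z' \<in> Z'" for z'
    unfolding r_def by (rule someI_ex) (rule fsurj[OF that])
  have key: "\<phi> (r z') = \<phi> z" if "z' \<in> Z'" "z \<in> Z" "z' - f z \<in> B'" for z z'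
  proof -
    have "f (r z' - z) \<in> B'"
      using V'.subspace_diff[OF sB' that(3), of "z' - f (r z')"] r[OF that(1)] by (simp add: lin_diff[OF lin])
    then have "r z' - z \<in> B"
      using fB[of "r z' - z"] V.subspace_diff[OF sZ, of "r z'" z] r[OF that(1)] that(2) by simp
    then show ?thesis using pres_map_eq_iff[OF p, of "r z'" z] r[OF that(1)] that(2) by simp
  qed
  have "pres_map s' Z' B' A (\<lambda>z'. \<phi> (r z'))"
    unfolding pres_map_def
  proof (intro conjI ballI allI)
    show "vector_space s'" by (rule lin_vs(2)[OF lin])
    show "V'.subspace Z'" "V'.subspace B'" "B' \<subseteq> Z'" using q' by blast+
    show "(\<lambda>z'. \<phi> (r z')) ` Z' = carrier A"
    proof
      show "(\<lambda>z'. \<phi> (r z')) ` Z' \<subseteq> carrier A" using r pres_mapD(7)[OF p] by auto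
      show "carrier A \<subseteq> (\<lambda>z'. \<phi> (r z')) ` Z'"
      proof
        fix a assume "a \<in> carrier A"
        then obtain z where z: "z \<in> Z" "a = \<phi> z" using pres_map_ex[OF p] by force
        have "\<phi> (r (f z)) = a" using key[of "f z" z] z fZ V'.subspace_0[OF sB'] by simp
        then show "a \<in> (\<lambda>z'. \<phi> (r z')) ` Z'" using fZ z by blast
      qed
    qed
    show "\<phi> (r 0) = \<zero>\<^bsub>A\<^esub>"
      using key[of 0 0] V'.subspace_0[OF sZ'] V.subspace_0[OF sZ] V'.subspace_0[OF sB'] lin_0[OF lin]
        pres_mapD(6)[OF p] by simp
  next
    fix x y assume xy: "x \<in> Z'" "y \<in> Z'"
    have "(x - f (r x)) + (y - f (r y)) \<in> B'" using V'.subspace_add[OF sB'] r xy by blast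
    then have "(x + y) - f (r x + r y) \<in> B'" by (simp add: lin_add[OF lin] algebra_simps)
    then have "\<phi> (r (x + y)) = \<phi> (r x + r y)"
      using key[of "x + y" "r x + r y"] V'.subspace_add[OF sZ' xy] V.subspace_add[OF sZ] r[OF xy(1)] r[OF xy(2)]
      by simp
    then show "\<phi> (r (x + y)) = \<phi> (r x) \<oplus>\<^bsub>A\<^esub> \<phi> (r y)" using pres_mapD(8)[OF p] r xy by simp
  next
    fix c x assume x: "x \<in> Z'"
    have "s' c x - f (s c (r x)) = s' c (x - f (r x))" by (simp add: lin_scale[OF lin] V'.scale_right_diff_distrib)
    then have "\<phi> (r (s' c x)) = \<phi> (s c (r x))"
      using key[of "s' c x" "s c (r x)"] V'.subspace_scale[OF sZ' x] V.subspace_scale[OF sZ] r[OF x]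
        V'.subspace_scale[OF sB'] by simp
    then show "\<phi> (r (s' c x)) = c \<odot>\<^bsub>A\<^esub> \<phi> (r x)" using pres_mapD(9)[OF p] r x by simp
  next
    fix x assume x: "x \<in> Z'"
    have "\<phi> (r x) = \<zero>\<^bsub>A\<^esub> \<longleftrightarrow> f (r x) \<in> B'" using pres_mapD(10)[OF p] r[OF x] fB by blast
    also have "\<dots> \<longleftrightarrow> x \<in> B'"
      using r[OF x] V'.subspace_add[OF sB', of "x - f (r x)" "f (r x)"] V'.subspace_diff[OF sB', of x "x - f (r x)"]
      by auto
    finally show "\<phi> (r x) = \<zero>\<^bsub>A\<^esub> \<longleftrightarrow> x \<in> B'" .
  qed
  then show ?thesis unfolding presents_def by blast
qed

text \<open>
  The isomorphism theorem \<open>(Z1/B) / (B1/B) = Z1/B1\<close>. The record \<open>A1\<close> is \<open>A\<close> with the smaller carrier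
  \<open>Z1/B\<close>, as it occurs in the definition of homology.
\<close>

lemma pres_map_quot:
  assumes p: "pres_map s Z B A \<phi>" and sZ1: "module.subspace s Z1" and sB1: "module.subspace s B1"
    and sub: "B \<subseteq> B1" "B1 \<subseteq> Z1" "Z1 \<subseteq> Z" and c: "carrier A1 = \<phi> ` Z1"
    and ops: "add A1 = add A" "zero A1 = zero A" "smult A1 = smult A"
  shows "pres_map s Z1 B1 (vs_quot A1 (\<phi> ` B1)) (\<lambda>z. \<phi> ` B1 +>\<^bsub>A1\<^esub> \<phi> z)"
proof -
  interpret V: vector_space s by (rule pres_mapD(1)[OF p])
  have coset: "\<phi> ` B1 +>\<^bsub>A1\<^esub> \<phi> z = \<phi> ` {w. w - z \<in> B1}" if "z \<in> Z" for z
  proof -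
    have "\<phi> ` B1 +>\<^bsub>A1\<^esub> \<phi> z = {\<phi> b \<oplus>\<^bsub>A\<^esub> \<phi> z |b. b \<in> B1}"
      by (auto simp: a_r_coset_def r_coset_def ops)
    also have "\<dots> = {\<phi> (b + z) |b. b \<in> B1}"
    proof -
      have "\<phi> (b + z) = \<phi> b \<oplus>\<^bsub>A\<^esub> \<phi> z" if "b \<in> B1" for b
        using pres_mapD(8)[OF p _ \<open>z \<in> Z\<close>] that sub by blast
      then show ?thesis by (metis (no_types, lifting))
    qed
    also have "\<dots> = \<phi> ` {w. w - z \<in> B1}" by (force simp: image_def)
    finally show ?thesis .
  qed
  have inZ: "w \<in> Z1" if "w - z \<in> B1" "z \<in> Z1" for w z
    using V.subspace_add[OF sZ1, of "w - z" z] that sub by auto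
  have self: "z \<in> {w. w - z \<in> B1}" for z using V.subspace_0[OF sB1] by simp
  show ?thesis
    unfolding pres_map_def
  proof (intro conjI ballI allI)
    show "vector_space s" by (rule pres_mapD(1)[OF p])
    show "V.subspace Z1" "V.subspace B1" "B1 \<subseteq> Z1" by fact+
    show "(\<lambda>z. \<phi> ` B1 +>\<^bsub>A1\<^esub> \<phi> z) ` Z1 = carrier (vs_quot A1 (\<phi> ` B1))"
      by (auto simp: vs_quot_def A_RCOSETS_def RCOSETS_def a_r_coset_def c)
    have z0: "\<phi> ` B1 +>\<^bsub>A1\<^esub> \<phi> 0 = \<phi> ` B1"
      using coset[of 0] V.subspace_0[OF pres_mapD(2)[OF p]] by simp
    then show "\<phi> ` B1 +>\<^bsub>A1\<^esub> \<phi> 0 = \<zero>\<^bsub>vs_quot A1 (\<phi> ` B1)\<^esub>" by (simp add: vs_quot_def)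
    fix x assume x: "x \<in> Z1"
    show "(\<phi> ` B1 +>\<^bsub>A1\<^esub> \<phi> x = \<zero>\<^bsub>vs_quot A1 (\<phi> ` B1)\<^esub>) = (x \<in> B1)"
    proof -
      have "(\<phi> ` {w. w - x \<in> B1} = \<phi> ` B1) \<longleftrightarrow> x \<in> B1"
      proof
        assume "\<phi> ` {w. w - x \<in> B1} = \<phi> ` B1"
        then obtain b where b: "b \<in> B1" "\<phi> x = \<phi> b" using self by (metis imageE imageI)
        then have "x - b \<in> B" using pres_map_eq_iff[OF p, of x b] x sub by blast
        then show "x \<in> B1" using V.subspace_add[OF sB1, of "x - b" b] b sub by auto
      next
        assume xB: "x \<in> B1"
        have "w - x \<in> B1 \<longleftrightarrow> w \<in> B1" for w
          using V.subspace_add[OF sB1 _ xB, of "w - x"] V.subspace_diff[OF sB1 _ xB, of w] by auto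
        then have "{w. w - x \<in> B1} = B1" by simp
        then show "\<phi> ` {w. w - x \<in> B1} = \<phi> ` B1" by simp
      qed
      then show ?thesis using coset[OF subsetD[OF sub(3) x]] by (simp add: vs_quot_def)
    qed
    {
      fix y assume y: "y \<in> Z1"
      have "\<phi> ` {w. w - (x + y) \<in> B1} =
        (\<Union>h\<in>\<phi> ` {w. w - x \<in> B1}. \<Union>k\<in>\<phi> ` {w. w - y \<in> B1}. {h \<oplus>\<^bsub>A\<^esub> k})" (is "?l = ?r")
      proof
        show "?l \<subseteq> ?r"
        proof
          fix u assume "u \<in> ?l"
          then obtain w where w: "w - (x + y) \<in> B1" "u = \<phi> w" by auto
          have xZ: "w - y \<in> Z1" using inZ[of "w - y" x] w x by (simp add: algebra_simps)
          have "u = \<phi> (w - y) \<oplus>\<^bsub>A\<^esub> \<phi> y" using pres_mapD(8)[OF p, of "w - y" y] xZ y sub w by auto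
          moreover have "w - y \<in> {w. w - x \<in> B1}" using w by (simp add: algebra_simps)
          ultimately show "u \<in> ?r" using self[of y] by blast
        qed
        show "?r \<subseteq> ?l"
        proof
          fix u assume "u \<in> ?r"
          then obtain w v where wv: "w - x \<in> B1" "v - y \<in> B1" "u = \<phi> w \<oplus>\<^bsub>A\<^esub> \<phi> v" by auto
          moreover have "w \<in> Z" "v \<in> Z" using inZ[OF wv(1) x] inZ[OF wv(2) y] sub by auto
          ultimately have "u = \<phi> (w + v)" using pres_mapD(8)[OF p, of w v] by simp
          moreover have "(w + v) - (x + y) \<in> B1" using V.subspace_add[OF sB1 wv(1,2)] by (simp add: algebra_simps)
          ultimately show "u \<in> ?l" by blast
        qed
      qed
      then show "\<phi> ` B1 +>\<^bsub>A1\<^esub> \<phi> (x + y) =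
        (\<phi> ` B1 +>\<^bsub>A1\<^esub> \<phi> x) \<oplus>\<^bsub>vs_quot A1 (\<phi> ` B1)\<^esub> (\<phi> ` B1 +>\<^bsub>A1\<^esub> \<phi> y)"
        using coset[OF subsetD[OF sub(3) x]] coset[OF subsetD[OF sub(3) y]]
          coset[OF subsetD[OF sub(3) V.subspace_add[OF sZ1 x y]]]
        by (simp add: vs_quot_def set_add_def set_mult_def ops)
    }
    fix c
    have "\<phi> ` {w. w - s c x \<in> B1} = (\<Union>u\<in>\<phi> ` {w. w - x \<in> B1}. \<phi> ` B1 +>\<^bsub>A1\<^esub> (c \<odot>\<^bsub>A\<^esub> u))" (is "?l = ?r")
    proof -
      have "\<phi> ` B1 +>\<^bsub>A1\<^esub> (c \<odot>\<^bsub>A\<^esub> \<phi> w) = ?l" if w: "w - x \<in> B1" for w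
      proof -
        have wZ: "w \<in> Z1" using inZ w x by blast
        then have cw: "s c w \<in> Z" using V.subspace_scale[OF sZ1] sub by blast
        have "{v. v - s c w \<in> B1} = {v. v - s c x \<in> B1}"
        proof -
          have d: "s c w - s c x \<in> B1"
            using V.subspace_scale[OF sB1 w, of c] by (simp add: V.scale_right_diff_distrib)
          have "v - s c w \<in> B1 \<longleftrightarrow> v - s c x \<in> B1" for v
            using V.subspace_add[OF sB1 _ d, of "v - s c w"] V.subspace_diff[OF sB1 _ d, of "v - s c x"]
            by auto
          then show ?thesis by blast
        qed
        then show ?thesis
          using coset[OF cw] pres_mapD(9)[OF p, of w c] subsetD[OF sub(3) wZ] by simp
      qed
      then have "?r = (\<Union>u\<in>\<phi> ` {w. w - x \<in> B1}. ?l)" by (intro SUP_cong) auto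
      moreover have "{w. w - x \<in> B1} \<noteq> {}" using self[of x] by blast
      ultimately show ?thesis by auto
    qed
    then show "\<phi> ` B1 +>\<^bsub>A1\<^esub> \<phi> (s c x) = c \<odot>\<^bsub>vs_quot A1 (\<phi> ` B1)\<^esub> (\<phi> ` B1 +>\<^bsub>A1\<^esub> \<phi> x)"
      using coset[OF subsetD[OF sub(3) x]] coset[OF subsetD[OF sub(3) V.subspace_scale[OF sZ1 x]]]
      by (simp add: vs_quot_def ops)
  qed
qed

subsection \<open>Homology of complexes of subquotients\<close>

text \<open>
  The complex has the quotient \<open>V n / R n\<close> in degree \<open>n\<close>, so a cycle is closed only modulo \<open>R\<close>, and
  the boundaries contain \<open>R\<close>.
\<close>

definition cycles :: "(nat \<Rightarrow> 'a set) \<Rightarrow> (nat \<Rightarrow> 'a set) \<Rightarrow> (nat \<Rightarrow> 'a \<Rightarrow> 'a) \<Rightarrow> nat \<Rightarrow> 'a set" where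
  "cycles V R d n = {z \<in> V n. n > 0 \<longrightarrow> d n z \<in> R (n - 1)}"

definition boundaries :: "(nat \<Rightarrow> 'a set) \<Rightarrow> (nat \<Rightarrow> 'a::ab_group_add set) \<Rightarrow> (nat \<Rightarrow> 'a \<Rightarrow> 'a) \<Rightarrow> nat \<Rightarrow> 'a set" where
  "boundaries V R d n = ssum (d (Suc n) ` V (Suc n)) (R n)"

locale presented_complex = vector_space s for s :: "'k::field \<Rightarrow> 'a::ab_group_add \<Rightarrow> 'a" +
  fixes V R :: "nat \<Rightarrow> 'a set" and d :: "nat \<Rightarrow> 'a \<Rightarrow> 'a"
  assumes sub_V: "subspace (V n)" and sub_R: "subspace (R n)" and R_le: "R n \<subseteq> V n"
    and lin_d: "Vector_Spaces.linear s s (d n)"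
    and d_V: "z \<in> V (Suc n) \<Longrightarrow> d (Suc n) z \<in> V n"
    and d_R: "z \<in> R (Suc n) \<Longrightarrow> d (Suc n) z \<in> R n"
    and dd: "z \<in> V (Suc (Suc n)) \<Longrightarrow> d (Suc n) (d (Suc (Suc n)) z) \<in> R n"
begin

lemma sub_cycles: "subspace (cycles V R d n)"
proof (cases n)
  case 0
  then show ?thesis using sub_V by (simp add: cycles_def)
next
  case (Suc m)
  then show ?thesis
    using subspace_vimage[OF lin_d[of n] sub_V[of n] sub_R[of m]] by (simp add: cycles_def)
qed

lemma sub_boundaries: "subspace (boundaries V R d n)"
  unfolding boundaries_def by (intro subspace_sums subspace_im[OF lin_d] sub_V sub_R)

lemma boundaries_le: "boundaries V R d n \<subseteq> cycles V R d n"
proof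
  fix z assume "z \<in> boundaries V R d n"
  then obtain u r where ur: "z = d (Suc n) u + r" "u \<in> V (Suc n)" "r \<in> R n" by (auto simp: boundaries_def)
  have "z \<in> V n" using ur d_V R_le[of n] subspace_add[OF sub_V] by blast
  moreover have "d n z \<in> R (n - 1)" if pos: "n > 0"
  proof -
    obtain m where m: "n = Suc m" using pos gr0_conv_Suc by blast
    show ?thesis using ur dd[of u m] d_R[of r m] m subspace_add[OF sub_R] by (simp add: lin_add[OF lin_d])
  qed
  ultimately show "z \<in> cycles V R d n" by (simp add: cycles_def)
qed

lemma R_le_boundaries: "R n \<subseteq> boundaries V R d n"
proof
  fix r assume "r \<in> R n"
  moreover have "d (Suc n) 0 = 0" by (rule lin_0[OF lin_d])
  ultimately have "r = d (Suc n) 0 + r \<and> 0 \<in> V (Suc n) \<and> r \<in> R n" using subspace_0[OF sub_V] by simp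
  then show "r \<in> boundaries V R d n" unfolding boundaries_def by blast
qed

text \<open>
  The cycles and boundaries of the complex of records are the images of those of the representatives, so this is
  the isomorphism theorem for the subquotients of \<open>V n / R n\<close>.
\<close>

theorem presents_homology:
  assumes \<phi>: "\<And>n. pres_map s (V n) (R n) (C n) (\<phi> n)"
    and D: "\<And>n z. z \<in> V (Suc n) \<Longrightarrow> D (Suc n) (\<phi> (Suc n) z) = \<phi> n (d (Suc n) z)"
  shows "presents s (cycles V R d n) (boundaries V R d n) (homology C D (int n))"
proof -
  let ?Z = "{x \<in> carrier (C n). n > 0 \<longrightarrow> D n x = \<zero>\<^bsub>C (n - 1)\<^esub>}"
  have Z: "?Z = \<phi> n ` cycles V R d n"
  proof (cases n)
    case 0
    then show ?thesis using pres_mapD(5)[OF \<phi>, of 0] by (simp add: cycles_def)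
  next
    case (Suc m)
    have "D n (\<phi> n z) = \<zero>\<^bsub>C m\<^esub> \<longleftrightarrow> d n z \<in> R m" if "z \<in> V n" for z
      using D[of z m] that Suc pres_mapD(10)[OF \<phi>[of m], of "d n z"] d_V[of z m] by simp
    then have "cycles V R d n = {z \<in> V n. D n (\<phi> n z) = \<zero>\<^bsub>C m\<^esub>}" using Suc by (auto simp: cycles_def)
    moreover have "?Z = \<phi> n ` {z \<in> V n. D n (\<phi> n z) = \<zero>\<^bsub>C m\<^esub>}"
    proof -
      have "{x \<in> f ` S. P x} = f ` {z \<in> S. P (f z)}" for f :: "'a \<Rightarrow> 'c" and S P by auto
      then show ?thesis unfolding pres_mapD(5)[OF \<phi>, of n, symmetric] using Suc by simp
    qed
    ultimately show ?thesis by simp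
  qed
  have B: "D (Suc n) ` carrier (C (Suc n)) = \<phi> n ` boundaries V R d n"
  proof -
    have "D (Suc n) ` carrier (C (Suc n)) = (\<lambda>z. \<phi> n (d (Suc n) z)) ` V (Suc n)"
      using pres_mapD(5)[OF \<phi>, of "Suc n"] D by (force simp: image_def)
    also have "\<dots> = \<phi> n ` boundaries V R d n"
    proof
      have "d (Suc n) z \<in> boundaries V R d n" if "z \<in> V (Suc n)" for z
      proof -
        have "d (Suc n) z = d (Suc n) z + 0 \<and> 0 \<in> R n" using subspace_0[OF sub_R] by simp
        then show ?thesis unfolding boundaries_def using that by blast
      qed
      then show "(\<lambda>z. \<phi> n (d (Suc n) z)) ` V (Suc n) \<subseteq> \<phi> n ` boundaries V R d n" by auto
      show "\<phi> n ` boundaries V R d n \<subseteq> (\<lambda>z. \<phi> n (d (Suc n) z)) ` V (Suc n)"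
      proof
        fix a assume "a \<in> \<phi> n ` boundaries V R d n"
        then obtain u r where ur: "a = \<phi> n (d (Suc n) u + r)" "u \<in> V (Suc n)" "r \<in> R n"
          by (auto simp: boundaries_def)
        have "d (Suc n) u + r \<in> V n" using ur d_V R_le[of n] subspace_add[OF sub_V] by blast
        then have "a = \<phi> n (d (Suc n) u)"
          using pres_map_eq_iff[OF \<phi>[of n], of "d (Suc n) u + r" "d (Suc n) u"] ur d_V by simp
        then show "a \<in> (\<lambda>z. \<phi> n (d (Suc n) z)) ` V (Suc n)" using ur by blast
      qed
    qed
    finally show ?thesis .
  qed
  have le: "cycles V R d n \<subseteq> V n" by (auto simp: cycles_def)
  have "pres_map s (cycles V R d n) (boundaries V R d n)
     (vs_quot (C n \<lparr>carrier := ?Z\<rparr>) (\<phi> n ` boundaries V R d n))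
     (\<lambda>z. \<phi> n ` boundaries V R d n +>\<^bsub>C n \<lparr>carrier := ?Z\<rparr>\<^esub> \<phi> n z)"
    by (rule pres_map_quot[OF \<phi>[of n] sub_cycles sub_boundaries R_le_boundaries boundaries_le le])
      (simp_all add: Z[unfolded One_nat_def])
  then show ?thesis unfolding presents_def homology_def by (auto simp: B Let_def)
qed

end

lemma presents_vs_zero:
  assumes "vector_space s" "module.subspace s Z"
  shows "presents s Z Z vs_zero"
proof -
  interpret vector_space s by fact
  show ?thesis unfolding presents_def pres_map_def
    using assms subspace_0[OF assms(2)] by (intro exI[of _ "\<lambda>_. undefined"]) (auto simp: vs_zero_def)
qed

subsection \<open>Direct sums of subquotients\<close>

text \<open>
  The maps \<open>f i\<close> are the components of a map from \<open>Z\<close> to the product of the quotients. The last three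
  assumptions say that it takes values in the direct sum, has kernel \<open>B\<close>, and is surjective.
\<close>

lemma presents_dsum:
  assumes vs: "vector_space s" and Z: "module.subspace s Z" and B: "module.subspace s B" "B \<subseteq> Z"
    and A: "\<And>i. i \<in> I \<Longrightarrow> presents s' (Z' i) (B' i) (A i)"
    and f: "\<And>i. i \<in> I \<Longrightarrow> Vector_Spaces.linear s s' (f i)"
    and fZ: "\<And>i z. i \<in> I \<Longrightarrow> z \<in> Z \<Longrightarrow> f i z \<in> Z' i"
    and fin: "\<And>z. z \<in> Z \<Longrightarrow> finite {i \<in> I. f i z \<notin> B' i}"
    and ker: "\<And>z. z \<in> Z \<Longrightarrow> z \<in> B \<longleftrightarrow> (\<forall>i\<in>I. f i z \<in> B' i)"
    and surj: "\<And>w. \<forall>i\<in>I. w i \<in> Z' i \<Longrightarrow> finite {i \<in> I. w i \<noteq> 0} \<Longrightarrow> \<exists>z\<in>Z. \<forall>i\<in>I. w i - f i z \<in> B' i"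
  shows "presents s Z B (vs_dsum I A)"
proof -
  interpret V: vector_space s by fact
  from A obtain \<phi> where p: "\<And>i. i \<in> I \<Longrightarrow> pres_map s' (Z' i) (B' i) (A i) (\<phi> i)"
    unfolding presents_def by metis
  define F where "F z = (\<lambda>i\<in>I. \<phi> i (f i z))" for z
  have nz: "{i \<in> I. \<phi> i (f i z) \<noteq> \<zero>\<^bsub>A i\<^esub>} = {i \<in> I. f i z \<notin> B' i}" if "z \<in> Z" for z
    using pres_mapD(10)[OF p] fZ[OF _ that] by auto
  have FZ: "F z \<in> carrier (vs_dsum I A)" if "z \<in> Z" for z
  proof -
    have "{i \<in> I. F z i \<noteq> \<zero>\<^bsub>A i\<^esub>} = {i \<in> I. f i z \<notin> B' i}"
      using nz[OF that] by (auto simp: F_def)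
    moreover have "F z \<in> (\<Pi>\<^sub>E i\<in>I. carrier (A i))"
      unfolding F_def using pres_mapD(7)[OF p] fZ[OF _ that] by auto
    ultimately show ?thesis using fin[OF that] by (simp add: vs_dsum_def)
  qed
  have "pres_map s Z B (vs_dsum I A) F"
    unfolding pres_map_def
  proof (intro conjI ballI allI)
    show "vector_space s" "V.subspace Z" "V.subspace B" "B \<subseteq> Z" by fact+
    show "F ` Z = carrier (vs_dsum I A)"
    proof
      show "F ` Z \<subseteq> carrier (vs_dsum I A)" using FZ by auto
      show "carrier (vs_dsum I A) \<subseteq> F ` Z"
      proof
        fix g assume g: "g \<in> carrier (vs_dsum I A)"
        then have gA: "g \<in> (\<Pi>\<^sub>E i\<in>I. carrier (A i))" and gf: "finite {i \<in> I. g i \<noteq> \<zero>\<^bsub>A i\<^esub>}"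
          by (auto simp: vs_dsum_def)
        have "\<exists>w. w \<in> Z' i \<and> \<phi> i w = g i \<and> (g i = \<zero>\<^bsub>A i\<^esub> \<longrightarrow> w = 0)" if i: "i \<in> I" for i
        proof (cases "g i = \<zero>\<^bsub>A i\<^esub>")
          case True
          interpret V': vector_space s' by (rule pres_mapD(1)[OF p[OF i]])
          show ?thesis using True pres_mapD(6)[OF p[OF i]] V'.subspace_0[OF pres_mapD(2)[OF p[OF i]]] by auto
        next
          case False
          have "g i \<in> carrier (A i)" using gA i by auto
          then show ?thesis using False pres_map_ex[OF p[OF i]] by metis
        qed
        then obtain w where w: "\<And>i. i \<in> I \<Longrightarrow> w i \<in> Z' i \<and> \<phi> i (w i) = g i \<and> (g i = \<zero>\<^bsub>A i\<^esub> \<longrightarrow> w i = 0)"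
          by metis
        have "finite {i \<in> I. w i \<noteq> 0}" by (rule finite_subset[OF _ gf]) (use w in auto)
        then obtain z where z: "z \<in> Z" "\<And>i. i \<in> I \<Longrightarrow> w i - f i z \<in> B' i" using surj[of w] w by blast
        have "F z = g"
        proof
          fix i
          show "F z i = g i"
          proof (cases "i \<in> I")
            case True
            then have "\<phi> i (w i) = \<phi> i (f i z)"
              using pres_map_eq_iff[OF p[OF True], of "w i" "f i z"] w z fZ by blast
            then show ?thesis using w[OF True] True by (simp add: F_def)
          next
            case False
            then show ?thesis using gA by (auto simp: F_def)
          qed
        qed
        then show "g \<in> F ` Z" using z by blast
      qed
    qed
    show "F 0 = \<zero>\<^bsub>vs_dsum I A\<^esub>"
      using pres_mapD(6)[OF p] lin_0[OF f] by (auto simp: F_def vs_dsum_def)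
  next
    fix x y assume xy: "x \<in> Z" "y \<in> Z"
    show "F (x + y) = F x \<oplus>\<^bsub>vs_dsum I A\<^esub> F y"
      using pres_mapD(8)[OF p fZ[OF _ xy(1)] fZ[OF _ xy(2)]] lin_add[OF f] by (auto simp: F_def vs_dsum_def)
  next
    fix c x assume x: "x \<in> Z"
    show "F (s c x) = c \<odot>\<^bsub>vs_dsum I A\<^esub> F x"
      using pres_mapD(9)[OF p fZ[OF _ x]] lin_scale[OF f] by (auto simp: F_def vs_dsum_def)
  next
    fix x assume x: "x \<in> Z"
    have "F x = \<zero>\<^bsub>vs_dsum I A\<^esub> \<longleftrightarrow> (\<forall>i\<in>I. \<phi> i (f i x) = \<zero>\<^bsub>A i\<^esub>)"
      by (auto simp: F_def vs_dsum_def restrict_def fun_eq_iff)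
    also have "\<dots> \<longleftrightarrow> x \<in> B" using ker[OF x] pres_mapD(10)[OF p fZ[OF _ x]] by blast
    finally show "F x = \<zero>\<^bsub>vs_dsum I A\<^esub> \<longleftrightarrow> x \<in> B" .
  qed
  then show ?thesis unfolding presents_def by blast
qed

text \<open>
  This is the Chinese remainder theorem: the last assumption amounts to \<open>Z = B1 + B2\<close>.
\<close>

lemma presents_dsum2:
  assumes A: "presents s Z B1 A" and A': "presents s Z B2 A'"
    and Z: "\<And>z. z \<in> Z \<Longrightarrow> \<exists>z2\<in>B2. z - z2 \<in> B1"
  shows "presents s Z (B1 \<inter> B2) (vs_dsum2 A A')"
proof -
  from A A' obtain \<phi> \<phi>' where p: "pres_map s Z B1 A \<phi>" and p': "pres_map s Z B2 A' \<phi>'"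
    unfolding presents_def by metis
  interpret V: vector_space s by (rule pres_mapD(1)[OF p])
  note sZ = pres_mapD(2)[OF p]
  have "carrier A \<times> carrier A' \<subseteq> (\<lambda>z. (\<phi> z, \<phi>' z)) ` Z"
  proof
    fix aa' assume "aa' \<in> carrier A \<times> carrier A'"
    then obtain x y where xy: "x \<in> Z" "y \<in> Z" "aa' = (\<phi> x, \<phi>' y)"
      using pres_map_ex[OF p] pres_map_ex[OF p'] by (metis mem_Times_iff prod.collapse)
    obtain z2 where z2: "z2 \<in> B2" "(x - y) - z2 \<in> B1" using Z[of "x - y"] V.subspace_diff[OF sZ xy(1,2)] by blast
    have z: "y + z2 \<in> Z" using z2(1) pres_mapD(4)[OF p'] V.subspace_add[OF sZ xy(2)] by blast
    have "\<phi> x = \<phi> (y + z2)" using pres_map_eq_iff[OF p xy(1) z] z2(2) by (simp add: algebra_simps)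
    moreover have "\<phi>' (y + z2) = \<phi>' y" using pres_map_eq_iff[OF p' z xy(2)] z2(1) by simp
    ultimately show "aa' \<in> (\<lambda>z. (\<phi> z, \<phi>' z)) ` Z" using xy(3) z by auto
  qed
  then have "pres_map s Z (B1 \<inter> B2) (vs_dsum2 A A') (\<lambda>z. (\<phi> z, \<phi>' z))"
    unfolding pres_map_def
    using pres_mapD[OF p] pres_mapD[OF p'] V.subspace_inter
    by (intro conjI ballI allI) (auto simp: vs_dsum2_def)
  then show ?thesis unfolding presents_def by blast
qed

section \<open>Finitely supported functions with values in a vector space\<close>

lemma lin_ext_zero [simp]: "lin_ext \<phi> 0 = 0"
  by (simp add: lin_ext_def)

lemma lin_ext_superset:
  assumes "finite S" "Poly_Mapping.keys f \<subseteq> S" "\<And>x. x \<in> S \<Longrightarrow> \<phi> x 0 = 0"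
  shows "lin_ext \<phi> f = (\<Sum>x\<in>S. \<phi> x (Poly_Mapping.lookup f x))"
  unfolding lin_ext_def using assms
  by (intro sum.mono_neutral_left) (auto simp: in_keys_iff)

lemma lin_ext_single:
  assumes "\<phi> x 0 = 0" shows "lin_ext \<phi> (Poly_Mapping.single x v) = \<phi> x v"
  using assms by (cases "v = 0") (simp_all add: lin_ext_def)

lemma lin_ext_add:
  assumes "\<And>x v w. \<phi> x (v + w) = \<phi> x v + (\<phi> x w :: 'w::ab_group_add)"
  shows "lin_ext \<phi> (f + g) = lin_ext \<phi> f + lin_ext \<phi> g"
proof -
  have z: "\<phi> x 0 = 0" for x using assms[of x 0 0] by simp
  let ?S = "Poly_Mapping.keys f \<union> Poly_Mapping.keys g"
  have "lin_ext \<phi> (f + g) = (\<Sum>x\<in>?S. \<phi> x (Poly_Mapping.lookup (f + g) x))"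
    using Poly_Mapping.keys_add[of f g] by (intro lin_ext_superset) (auto simp: z)
  also have "\<dots> = (\<Sum>x\<in>?S. \<phi> x (Poly_Mapping.lookup f x)) + (\<Sum>x\<in>?S. \<phi> x (Poly_Mapping.lookup g x))"
    by (simp add: lookup_add assms sum.distrib)
  also have "\<dots> = lin_ext \<phi> f + lin_ext \<phi> g"
    by (simp add: lin_ext_superset[of ?S f] lin_ext_superset[of ?S g] z)
  finally show ?thesis .
qed

lemma lookup_fs_scale [simp]:
  assumes "scale c 0 = 0"
  shows "Poly_Mapping.lookup (fs_scale scale c f) x = scale c (Poly_Mapping.lookup f x)"
  unfolding fs_scale_def by (simp add: Poly_Mapping.map.rep_eq when_def assms)

lemma fs_expand: "f = (\<Sum>x\<in>Poly_Mapping.keys f. Poly_Mapping.single x (Poly_Mapping.lookup f x))"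
  by (rule poly_mapping_eqI)
    (simp add: lookup_sum lookup_single when_def in_keys_iff if_distrib cong: if_cong)

locale coeff_space = vector_space scale for scale :: "'k::field \<Rightarrow> 'm::ab_group_add \<Rightarrow> 'm"
begin

abbreviation ps :: "'k \<Rightarrow> ('x \<Rightarrow>\<^sub>0 'm) \<Rightarrow> ('x \<Rightarrow>\<^sub>0 'm)" where "ps \<equiv> fs_scale scale"

lemma lookup_ps [simp]: "Poly_Mapping.lookup (ps c f) x = scale c (Poly_Mapping.lookup f x)"
  by simp

lemma vs_ps: "vector_space (ps :: 'k \<Rightarrow> ('x \<Rightarrow>\<^sub>0 'm) \<Rightarrow> ('x \<Rightarrow>\<^sub>0 'm))"
  by unfold_locales
    (auto intro!: poly_mapping_eqI simp: lookup_add scale_right_distrib scale_left_distrib)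

sublocale P: vector_space "ps :: 'k \<Rightarrow> ('x \<Rightarrow>\<^sub>0 'm) \<Rightarrow> ('x \<Rightarrow>\<^sub>0 'm)"
  by (rule vs_ps)

lemma vs_scale: "vector_space scale" by unfold_locales

lemma ps_single [simp]: "ps c (Poly_Mapping.single x m) = Poly_Mapping.single x (scale c m)"
  by (rule poly_mapping_eqI) (simp add: lookup_single when_def)

lemma lin_single: "Vector_Spaces.linear scale ps (Poly_Mapping.single x)"
  by (rule linI[OF vs_scale vs_ps]) (simp_all add: single_add)

lemma lin_ext_lin:
  assumes "\<And>x. Vector_Spaces.linear scale s (\<phi> x)"
  shows "Vector_Spaces.linear ps s (lin_ext \<phi>)"
proof (rule linI[OF vs_ps])
  show "vector_space s" by (rule lin_vs(2)[OF assms])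
  interpret V: vector_space s by (rule lin_vs(2)[OF assms])
  show "lin_ext \<phi> (f + g) = lin_ext \<phi> f + lin_ext \<phi> g" for f g
    by (rule lin_ext_add) (rule lin_add[OF assms])
  show "lin_ext \<phi> (ps c f) = s c (lin_ext \<phi> f)" for c f
  proof -
    have "lin_ext \<phi> (ps c f) = (\<Sum>x\<in>Poly_Mapping.keys f. \<phi> x (Poly_Mapping.lookup (ps c f) x))"
      by (rule lin_ext_superset) (auto simp: in_keys_iff lin_0[OF assms])
    also have "\<dots> = s c (lin_ext \<phi> f)"
      by (simp add: lin_ext_def V.scale_sum_right lin_scale[OF assms])
    finally show ?thesis .
  qed
qed

lemma fin_supp_single: "x \<in> U \<Longrightarrow> m \<in> W \<Longrightarrow> subspace W \<Longrightarrow> Poly_Mapping.single x m \<in> fin_supp U W"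
  by (auto simp: fin_supp_def lookup_single when_def subspace_0)

lemma sub_fin_supp: "subspace W \<Longrightarrow> P.subspace (fin_supp U W)"
proof (rule P.subspaceI)
  assume W: "subspace W"
  show "0 \<in> fin_supp U W" using subspace_0[OF W] by (simp add: fin_supp_def)
  show "f + g \<in> fin_supp U W" if "f \<in> fin_supp U W" "g \<in> fin_supp U W" for f g
    using that Poly_Mapping.keys_add[of f g] subspace_add[OF W] by (auto simp: fin_supp_def lookup_add)
  show "ps c f \<in> fin_supp U W" if "f \<in> fin_supp U W" for c f
    using that subspace_scale[OF W] by (auto simp: fin_supp_def in_keys_iff subset_iff)
qed

text \<open>Identities between linear maps and membership in subspaces are checked on the tensors of basis
  elements with vectors.\<close>

lemma lin_eq_fin_supp:
  assumes F: "Vector_Spaces.linear ps s F" and G: "Vector_Spaces.linear ps s G" and f: "f \<in> fin_supp U W"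
    and e: "\<And>x m. x \<in> U \<Longrightarrow> m \<in> W \<Longrightarrow> F (Poly_Mapping.single x m) = G (Poly_Mapping.single x m)"
  shows "F f = G f"
proof -
  have "F f = (\<Sum>x\<in>Poly_Mapping.keys f. F (Poly_Mapping.single x (Poly_Mapping.lookup f x)))"
    by (subst fs_expand) (rule lin_sum[OF F])
  also have "\<dots> = (\<Sum>x\<in>Poly_Mapping.keys f. G (Poly_Mapping.single x (Poly_Mapping.lookup f x)))"
    using f e by (intro sum.cong) (auto simp: fin_supp_def)
  also have "\<dots> = G f" by (subst (3) fs_expand) (rule lin_sum[OF G, symmetric])
  finally show ?thesis .
qed

lemma lin_in_fin_supp:
  assumes F: "Vector_Spaces.linear ps s F" and S: "module.subspace s S" and f: "f \<in> fin_supp U W"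
    and e: "\<And>x m. x \<in> U \<Longrightarrow> m \<in> W \<Longrightarrow> F (Poly_Mapping.single x m) \<in> S"
  shows "F f \<in> S"
proof -
  interpret V: vector_space s by (rule lin_vs(2)[OF F])
  have "F f = (\<Sum>x\<in>Poly_Mapping.keys f. F (Poly_Mapping.single x (Poly_Mapping.lookup f x)))"
    by (subst fs_expand) (rule lin_sum[OF F])
  also have "\<dots> \<in> S" using f e by (intro V.subspace_sum[OF S]) (auto simp: fin_supp_def)
  finally show ?thesis .
qed

lemma lin_eq_all:
  assumes F: "Vector_Spaces.linear ps s F" and G: "Vector_Spaces.linear ps s G"
    and e: "\<And>x m. F (Poly_Mapping.single x m) = G (Poly_Mapping.single x m)"
  shows "F f = G f"
  by (rule lin_eq_fin_supp[OF F G, of _ UNIV UNIV]) (simp_all add: fin_supp_def e)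

lemma lin_span_in:
  assumes F: "Vector_Spaces.linear s s' F" and S: "module.subspace s' S" and v: "v \<in> module.span s X"
    and e: "\<And>x. x \<in> X \<Longrightarrow> F x \<in> S"
  shows "F v \<in> S"
proof -
  interpret V1: vector_space s by (rule lin_vs(1)[OF F])
  have "V1.span X \<subseteq> {x \<in> UNIV. F x \<in> S}"
    by (rule V1.span_minimal) (use e subspace_vimage[OF F V1.subspace_UNIV S] in auto)
  then show ?thesis using v by blast
qed

end

section \<open>Total complexes of Tsygan double complexes\<close>

text \<open>
  This is the long exact sequence of \<open>0 \<rightarrow> A/R \<rightarrow> V/R \<rightarrow> V/A \<rightarrow> 0\<close> for an acyclic complex \<open>A/R\<close>.
\<close>

lemma qiso_acyclic:
  assumes VR: "presented_complex s V R d" and VA: "presented_complex s V A d"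
    and RA: "\<And>n. R n \<subseteq> A n"
    and acyc: "\<And>n a. a \<in> A n \<Longrightarrow> (n > 0 \<longrightarrow> d n a \<in> R (n - 1)) \<Longrightarrow> \<exists>a'\<in>A (Suc n). a - d (Suc n) a' \<in> R n"
  shows "qiso s s (cycles V R d n) (boundaries V R d n) (cycles V A d n) (boundaries V A d n) (\<lambda>z. z)"
proof -
  interpret R: presented_complex s V R d by fact
  interpret A: presented_complex s V A d by fact
  have cyc: "cycles V R d n \<subseteq> cycles V A d n" using RA by (auto simp: cycles_def)
  have "z \<in> boundaries V R d n" if z: "z \<in> cycles V R d n" and zA: "z \<in> boundaries V A d n" for z
  proof -
    obtain v a where va: "z = d (Suc n) v + a" "v \<in> V (Suc n)" "a \<in> A n" using zA by (auto simp: boundaries_def)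
    have "n > 0 \<longrightarrow> d n a \<in> R (n - 1)"
    proof
      assume "n > 0"
      then obtain m where m: "n = Suc m" using gr0_conv_Suc by blast
      have "d n a = d n z - d n (d (Suc n) v)" using va by (simp add: lin_add[OF R.lin_d])
      also have "\<dots> \<in> R m"
        using z m va(2) R.dd[of v m] by (intro R.subspace_diff[OF R.sub_R]) (auto simp: cycles_def)
      finally show "d n a \<in> R (n - 1)" using m by simp
    qed
    then obtain a' where a': "a' \<in> A (Suc n)" "a - d (Suc n) a' \<in> R n" using acyc va(3) by blast
    have "z = d (Suc n) (v + a') + (a - d (Suc n) a')" using va by (simp add: lin_add[OF R.lin_d])
    moreover have "v + a' \<in> V (Suc n)" using R.subspace_add[OF R.sub_V va(2)] A.R_le a'(1) by blast
    ultimately show ?thesis unfolding boundaries_def using a'(2) by blast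
  qed
  moreover have "boundaries V R d n \<subseteq> boundaries V A d n" using RA unfolding boundaries_def by blast
  moreover have "\<exists>z'\<in>cycles V R d n. z - z' \<in> boundaries V A d n" if z: "z \<in> cycles V A d n" for z
  proof (cases n)
    case 0
    then have "z \<in> cycles V R d n" using z by (simp add: cycles_def)
    then show ?thesis using R.subspace_0[OF A.sub_boundaries] by (intro bexI[of _ z]) simp_all
  next
    case (Suc m)
    have dz: "d n z \<in> A m" and zV: "z \<in> V n" using z Suc by (auto simp: cycles_def)
    have "m > 0 \<longrightarrow> d m (d n z) \<in> R (m - 1)" using R.dd[of z "m - 1"] zV Suc by (cases m) auto
    then obtain a' where a': "a' \<in> A n" "d n z - d n a' \<in> R m" using acyc[OF dz] Suc by blast
    have "z - a' \<in> cycles V R d n"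
      using a' A.R_le R.subspace_diff[OF R.sub_V zV] Suc by (auto simp: cycles_def lin_diff[OF R.lin_d])
    moreover have "z - (z - a') \<in> boundaries V A d n" using a'(1) A.R_le_boundaries[of n] by auto
    ultimately show ?thesis by blast
  qed
  ultimately show ?thesis
    unfolding qiso_def
    using cyc R.sub_cycles R.sub_boundaries R.boundaries_le A.sub_cycles A.sub_boundaries A.boundaries_le
      lin_id[OF R.vector_space_axioms] by blast
qed

text \<open>
  The columns and rows of a Tsygan double complex, on representatives and modulo relations \<open>R\<close>. The operator
  \<open>t\<close> includes the sign, and the last assumption is what an extra degeneracy gives for the odd columns.
\<close>

locale tsygan_columns = vector_space s for s :: "'k::field_char_0 \<Rightarrow> 'a::ab_group_add \<Rightarrow> 'a" +
  fixes V R :: "nat \<Rightarrow> 'a set" and b b' t :: "'a \<Rightarrow> 'a"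
  assumes sub_V: "subspace (V n)" and sub_R: "subspace (R n)" and R_le: "R n \<subseteq> V n"
    and lin_b: "Vector_Spaces.linear s s b" and lin_b': "Vector_Spaces.linear s s b'"
    and lin_t: "Vector_Spaces.linear s s t"
    and b_V: "z \<in> V (Suc n) \<Longrightarrow> b z \<in> V n" and b_R: "z \<in> R (Suc n) \<Longrightarrow> b z \<in> R n"
    and b'_V: "z \<in> V (Suc n) \<Longrightarrow> b' z \<in> V n" and b'_R: "z \<in> R (Suc n) \<Longrightarrow> b' z \<in> R n"
    and t_V: "z \<in> V n \<Longrightarrow> t z \<in> V n" and t_R: "z \<in> R n \<Longrightarrow> t z \<in> R n"
    and bb: "z \<in> V (Suc (Suc n)) \<Longrightarrow> b (b z) \<in> R n"
    and b'b': "z \<in> V (Suc (Suc n)) \<Longrightarrow> b' (b' z) \<in> R n"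
    and bt: "z \<in> V (Suc n) \<Longrightarrow> b (z - t z) - (b' z - t (b' z)) \<in> R n"
    and b'N: "z \<in> V (Suc n) \<Longrightarrow> b' (\<Sum>i\<le>Suc n. (t ^^ i) z) - (\<Sum>i\<le>n. (t ^^ i) (b z)) \<in> R n"
    and t_period: "z \<in> V n \<Longrightarrow> (t ^^ Suc n) z - z \<in> R n"
    and b'_contractible: "z \<in> V n \<Longrightarrow> (n > 0 \<Longrightarrow> b' z \<in> R (n - 1)) \<Longrightarrow> \<exists>u\<in>V (Suc n). b' u - z \<in> R n"
begin

text \<open>Parities of differences \<open>n - q\<close> are to be kept as they are, as they name columns.\<close>

declare even_diff_nat [simp del]

definition N :: "nat \<Rightarrow> 'a \<Rightarrow> 'a" where "N n z = (\<Sum>i\<le>n. (t ^^ i) z)"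

lemma lin_N: "Vector_Spaces.linear s s (N n)"
  unfolding N_def by (rule lin_sums[OF vector_space_axioms vector_space_axioms lin_funpow[OF lin_t]])

lemmas lins = lin_add[OF lin_b] lin_diff[OF lin_b] lin_neg[OF lin_b] lin_0[OF lin_b]
  lin_add[OF lin_b'] lin_diff[OF lin_b'] lin_neg[OF lin_b'] lin_0[OF lin_b']
  lin_add[OF lin_t] lin_diff[OF lin_t] lin_neg[OF lin_t] lin_0[OF lin_t]
  lin_add[OF lin_N] lin_diff[OF lin_N] lin_neg[OF lin_N] lin_0[OF lin_N]

lemmas R_add = subspace_add[OF sub_R] and R_diff = subspace_diff[OF sub_R]
  and R_neg = subspace_neg[OF sub_R] and R_0 = subspace_0[OF sub_R]
lemmas V_add = subspace_add[OF sub_V] and V_diff = subspace_diff[OF sub_V]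
  and V_neg = subspace_neg[OF sub_V] and V_0 = subspace_0[OF sub_V]

lemma tpow_V: "z \<in> V n \<Longrightarrow> (t ^^ i) z \<in> V n" by (induction i) (auto intro: t_V)
lemma tpow_R: "z \<in> R n \<Longrightarrow> (t ^^ i) z \<in> R n" by (induction i) (auto intro: t_R)
lemma N_V: "z \<in> V n \<Longrightarrow> N n z \<in> V n" unfolding N_def by (intro subspace_sum[OF sub_V] tpow_V)
lemma N_R: "z \<in> R n \<Longrightarrow> N n z \<in> R n" unfolding N_def by (intro subspace_sum[OF sub_R] tpow_R)

lemma one_t_N: assumes "z \<in> V n" shows "N n z - t (N n z) \<in> R n" "N n z - N n (t z) \<in> R n"
proof -
  have "N n z - (\<Sum>i\<le>n. (t ^^ Suc i) z) = z - (t ^^ Suc n) z"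
    using sum_telescope[of "\<lambda>i. (t ^^ i) z" n] unfolding N_def by (simp add: sum_subtractf)
  moreover have "z - (t ^^ Suc n) z \<in> R n" using R_neg[OF t_period[OF assms]] by simp
  moreover have "t (N n z) = (\<Sum>i\<le>n. (t ^^ Suc i) z)" unfolding N_def by (simp add: lin_sum[OF lin_t])
  moreover have "N n (t z) = (\<Sum>i\<le>n. (t ^^ Suc i) z)" unfolding N_def by (simp add: funpow_swap1)
  ultimately show "N n z - t (N n z) \<in> R n" "N n z - N n (t z) \<in> R n" by simp_all
qed

lemma one_t_R: "z \<in> R n \<Longrightarrow> z - t z \<in> R n" by (intro R_diff t_R)

text \<open>
  The rows are exact in positive columns since \<open>n + 1\<close> is invertible in characteristic \<open>0\<close>.
  Summing \<open>1 - t\<^sup>i = (1 - t) (1 + \<dots> + t\<^sup>i\<^sup>-\<^sup>1)\<close> over \<open>i \<le> n\<close> writes \<open>(n + 1) z - N z\<close> as a value of \<open>1 - t\<close>.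
\<close>

lemma ker_N:
  assumes z: "z \<in> V n" and Nz: "N n z \<in> R n"
  shows "\<exists>v\<in>V n. z - (v - t v) \<in> R n"
proof -
  let ?c = "1 / of_nat (Suc n) :: 'k"
  have c: "?c * of_nat (Suc n) = 1" by (simp del: of_nat_Suc)
  define v where "v = s ?c (\<Sum>i\<le>n. \<Sum>j<i. (t ^^ j) z)"
  have "(\<Sum>j<i. (t ^^ j) z) - t (\<Sum>j<i. (t ^^ j) z) = z - (t ^^ i) z" for i
  proof (induction i)
    case (Suc i)
    have "(\<Sum>j<Suc i. (t ^^ j) z) - t (\<Sum>j<Suc i. (t ^^ j) z) =
      ((\<Sum>j<i. (t ^^ j) z) - t (\<Sum>j<i. (t ^^ j) z)) + ((t ^^ i) z - t ((t ^^ i) z))"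
      by (simp add: lins)
    then show ?case unfolding Suc.IH by simp
  qed (simp add: lins)
  then have "v - t v = s ?c (\<Sum>i\<le>n. z - (t ^^ i) z)"
    by (simp add: v_def lin_scale[OF lin_t] lin_sum[OF lin_t] flip: scale_right_diff_distrib sum_subtractf)
  also have "\<dots> = z - s ?c (N n z)"
    using c by (simp add: sum_subtractf N_def scale_right_diff_distrib sum_constant_scale del: of_nat_Suc)
  finally have "z - (v - t v) = s ?c (N n z)" by simp
  moreover have "v \<in> V n" unfolding v_def by (intro subspace_scale[OF sub_V] subspace_sum[OF sub_V] tpow_V z)
  ultimately show ?thesis using subspace_scale[OF sub_R Nz] by metis
qed

text \<open>
  If \<open>z\<close> is fixed by \<open>t\<close> modulo \<open>R\<close>, then \<open>N z\<close> is congruent to \<open>(n + 1) z\<close>.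
\<close>

lemma ker_one_t:
  assumes z: "z \<in> V n" and tz: "z - t z \<in> R n"
  shows "\<exists>v\<in>V n. z - N n v \<in> R n"
proof -
  let ?c = "1 / of_nat (Suc n) :: 'k"
  have c: "?c * of_nat (Suc n) = 1" by (simp del: of_nat_Suc)
  have i: "z - (t ^^ i) z \<in> R n" for i
  proof (induction i)
    case 0
    then show ?case by (simp add: R_0)
  next
    case (Suc i)
    have e: "z - (t ^^ Suc i) z = (z - (t ^^ i) z) + (t ^^ i) (z - t z)"
      by (simp add: lin_diff[OF lin_funpow[OF lin_t]] funpow_swap1)
    show ?case unfolding e by (rule R_add[OF Suc tpow_R[OF tz]])
  qed
  have "z - N n (s ?c z) = s ?c (\<Sum>i\<le>n. z - (t ^^ i) z)"
    using c by (simp add: sum_subtractf N_def scale_right_diff_distrib sum_constant_scale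
        lin_scale[OF lin_funpow[OF lin_t]] scale_sum_right del: of_nat_Suc)
  also have "\<dots> \<in> R n" by (intro subspace_scale[OF sub_R] subspace_sum[OF sub_R] i)
  finally show ?thesis using subspace_scale[OF sub_V z] by blast
qed

text \<open>
  In total degree \<open>n\<close> the component with index \<open>q \<le> n\<close> lies in bidegree \<open>(n - q, q)\<close>. Elements are
  functions on all of \<open>nat\<close>; the subspaces leave their values above \<open>n\<close> arbitrary, and so do the cycles and
  boundaries.
\<close>

definition tot_scale :: "'k \<Rightarrow> (nat \<Rightarrow> 'a) \<Rightarrow> nat \<Rightarrow> 'a" where "tot_scale c f = (\<lambda>q. s c (f q))"
definition tot_V :: "nat \<Rightarrow> (nat \<Rightarrow> 'a) set" where "tot_V n = {f. \<forall>q\<le>n. f q \<in> V q}"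
definition tot_R :: "nat \<Rightarrow> (nat \<Rightarrow> 'a) set" where "tot_R n = {f. \<forall>q\<le>n. f q \<in> R q}"
definition tot_d :: "nat \<Rightarrow> (nat \<Rightarrow> 'a) \<Rightarrow> nat \<Rightarrow> 'a" where
  "tot_d n f = (\<lambda>q. (if even (n - 1 - q) then b (f (Suc q)) else - b' (f (Suc q))) +
                    (if even (n - 1 - q) then f q - t (f q) else N q (f q)))"

lemma vs_tot: "vector_space tot_scale"
  by unfold_locales (auto simp: tot_scale_def scale_right_distrib scale_left_distrib)

lemma lin_tot_d: "Vector_Spaces.linear tot_scale tot_scale (tot_d n)"
  by (rule linI[OF vs_tot vs_tot])
    (auto simp: tot_scale_def tot_d_def fun_eq_iff lins lin_scale[OF lin_b] lin_scale[OF lin_b']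
      lin_scale[OF lin_t] lin_scale[OF lin_N] scale_right_distrib scale_right_diff_distrib algebra_simps)

lemma tot_complex: "presented_complex tot_scale tot_V tot_R tot_d"
proof -
  interpret T: vector_space tot_scale by (rule vs_tot)
  show ?thesis
  proof (intro presented_complex.intro presented_complex_axioms.intro)
    show "vector_space tot_scale" by (rule vs_tot)
    show "T.subspace (tot_V n)" for n
      by (rule T.subspaceI) (auto simp: tot_V_def tot_scale_def V_0 V_add subspace_scale[OF sub_V])
    show "T.subspace (tot_R n)" for n
      by (rule T.subspaceI) (auto simp: tot_R_def tot_scale_def R_0 R_add subspace_scale[OF sub_R])
    show "tot_R n \<subseteq> tot_V n" for n using R_le by (auto simp: tot_V_def tot_R_def)
    show "Vector_Spaces.linear tot_scale tot_scale (tot_d n)" for n by (rule lin_tot_d)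
    show "tot_d (Suc n) f \<in> tot_V n" if "f \<in> tot_V (Suc n)" for n f
      using that by (auto simp: tot_V_def tot_d_def intro!: V_add V_diff V_neg b_V b'_V t_V N_V)
    show "tot_d (Suc n) f \<in> tot_R n" if "f \<in> tot_R (Suc n)" for n f
      using that by (auto simp: tot_R_def tot_d_def intro!: R_add R_diff R_neg b_R b'_R t_R N_R)
    show "tot_d (Suc n) (tot_d (Suc (Suc n)) f) \<in> tot_R n" if f: "f \<in> tot_V (Suc (Suc n))" for n f
      unfolding tot_R_def
    proof (intro CollectI allI impI)
      fix q assume q: "q \<le> n"
      have fq: "f q \<in> V q" "f (Suc q) \<in> V (Suc q)" "f (Suc (Suc q)) \<in> V (Suc (Suc q))"
        using f q by (auto simp: tot_V_def)
      have e: "even (Suc n - q) \<longleftrightarrow> odd (n - q)" using q by (simp add: Suc_diff_le)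
      show "tot_d (Suc n) (tot_d (Suc (Suc n)) f) q \<in> R q"
      proof (cases "even (n - q)")
        case True
        have "tot_d (Suc n) (tot_d (Suc (Suc n)) f) q =
          b (b (f (Suc (Suc q)))) + (b (f (Suc q) - t (f (Suc q))) - (b' (f (Suc q)) - t (b' (f (Suc q))))) +
          (N q (f q) - t (N q (f q)))"
          using True e by (simp add: tot_d_def lins algebra_simps)
        then show ?thesis using bb[OF fq(3)] bt[OF fq(2)] one_t_N(1)[OF fq(1)] by (simp add: R_add)
      next
        case False
        have "tot_d (Suc n) (tot_d (Suc (Suc n)) f) q =
          b' (b' (f (Suc (Suc q)))) - (b' (N (Suc q) (f (Suc q))) - N q (b (f (Suc q)))) +
          (N q (f q) - N q (t (f q)))"
          using False e by (simp add: tot_d_def lins algebra_simps)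
        then show ?thesis
          using b'b'[OF fq(3)] b'N[OF fq(2), folded N_def] one_t_N(2)[OF fq(1)] by (simp add: R_add R_diff)
      qed
    qed
  qed
qed

abbreviation "tot_cycles \<equiv> cycles tot_V tot_R tot_d"
abbreviation "tot_boundaries \<equiv> boundaries tot_V tot_R tot_d"

lemma tot_cyclesD:
  assumes "f \<in> tot_cycles n"
  shows "q \<le> n \<Longrightarrow> f q \<in> V q"
    and "q < n \<Longrightarrow> odd (n - q) \<Longrightarrow> b (f (Suc q)) + (f q - t (f q)) \<in> R q"
    and "q < n \<Longrightarrow> even (n - q) \<Longrightarrow> - b' (f (Suc q)) + N q (f q) \<in> R q"
proof -
  show "q \<le> n \<Longrightarrow> f q \<in> V q" using assms by (auto simp: cycles_def tot_V_def)
  have r: "tot_d n f q \<in> R q" if "q < n" using assms that by (auto simp: cycles_def tot_R_def)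
  have e: "even (n - 1 - q) \<longleftrightarrow> odd (n - q)" if "q < n" using that by (cases n) (auto simp: Suc_diff_le)
  show "q < n \<Longrightarrow> odd (n - q) \<Longrightarrow> b (f (Suc q)) + (f q - t (f q)) \<in> R q"
    using r e by (simp add: tot_d_def)
  show "q < n \<Longrightarrow> even (n - q) \<Longrightarrow> - b' (f (Suc q)) + N q (f q) \<in> R q"
    using r e by (simp add: tot_d_def)
qed

lemma tot_cyclesI:
  assumes "\<And>q. q \<le> n \<Longrightarrow> f q \<in> V q"
    and "\<And>q. q < n \<Longrightarrow> odd (n - q) \<Longrightarrow> b (f (Suc q)) + (f q - t (f q)) \<in> R q"
    and "\<And>q. q < n \<Longrightarrow> even (n - q) \<Longrightarrow> - b' (f (Suc q)) + N q (f q) \<in> R q"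
  shows "f \<in> tot_cycles n"
proof -
  have e: "even (n - 1 - q) \<longleftrightarrow> odd (n - q)" if "q < n" for q using that by (cases n) (auto simp: Suc_diff_le)
  have "tot_d n f q \<in> R q" if "q < n" for q
    using assms(2,3)[OF that] e[OF that] by (cases "even (n - q)") (simp_all add: tot_d_def)
  then show ?thesis using assms(1) by (auto simp: cycles_def tot_V_def tot_R_def)
qed

lemma tot_boundariesI:
  assumes g: "\<And>q. q \<le> Suc n \<Longrightarrow> g q \<in> V q"
    and ev: "\<And>q. q \<le> n \<Longrightarrow> even (n - q) \<Longrightarrow> f q - (b (g (Suc q)) + (g q - t (g q))) \<in> R q"
    and od: "\<And>q. q \<le> n \<Longrightarrow> odd (n - q) \<Longrightarrow> f q - (- b' (g (Suc q)) + N q (g q)) \<in> R q"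
  shows "f \<in> tot_boundaries n"
proof -
  have "(f - tot_d (Suc n) g) q \<in> R q" if "q \<le> n" for q
    using ev[OF that] od[OF that] by (cases "even (n - q)") (simp_all add: tot_d_def fun_diff_def)
  then have "f - tot_d (Suc n) g \<in> tot_R n" by (simp add: tot_R_def)
  moreover have "f = tot_d (Suc n) g + (f - tot_d (Suc n) g)" by simp
  moreover have "g \<in> tot_V (Suc n)" using g by (simp add: tot_V_def)
  ultimately show ?thesis unfolding boundaries_def by blast
qed

lemma tot_boundariesD:
  assumes "f \<in> tot_boundaries n"
  obtains g where "\<And>q. q \<le> Suc n \<Longrightarrow> g q \<in> V q"
    "\<And>q. q \<le> n \<Longrightarrow> even (n - q) \<Longrightarrow> f q - (b (g (Suc q)) + (g q - t (g q))) \<in> R q"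
proof -
  obtain g r where gr: "f = tot_d (Suc n) g + r" "g \<in> tot_V (Suc n)" "r \<in> tot_R n"
    using assms by (auto simp: boundaries_def)
  have "f q - (b (g (Suc q)) + (g q - t (g q))) \<in> R q" if "q \<le> n" "even (n - q)" for q
    using gr that by (auto simp: tot_d_def tot_R_def)
  then show ?thesis using that[of g] gr(2) by (auto simp: tot_V_def)
qed

lemma column_complex: "presented_complex s V R (\<lambda>_. b)"
proof (intro presented_complex.intro presented_complex_axioms.intro)
  show "vector_space s" by (rule vector_space_axioms)
  show "subspace (V n)" "subspace (R n)" "R n \<subseteq> V n" "Vector_Spaces.linear s s b" for n
    by (fact sub_V sub_R R_le lin_b)+
qed (fact b_V b_R bb)+

subsection \<open>Coinvariants of the cyclic operator\<close>

text \<open>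
  The quotients by these subspaces form the complex of Connes.
\<close>

definition connes_rel :: "nat \<Rightarrow> 'a set" where
  "connes_rel n = ssum (R n) ((\<lambda>v. v - t v) ` V n)"

lemma lin_one_t: "Vector_Spaces.linear s s (\<lambda>v. v - t v)"
  by (rule lin_minus[OF lin_id[OF vector_space_axioms] lin_t])

lemma connes_relI: "r \<in> R n \<Longrightarrow> v \<in> V n \<Longrightarrow> r + (v - t v) \<in> connes_rel n"
  unfolding connes_rel_def by blast

lemma connes_complex: "presented_complex s V connes_rel (\<lambda>_. b)"
proof (intro presented_complex.intro presented_complex_axioms.intro)
  show "vector_space s" by (rule vector_space_axioms)
  show "subspace (connes_rel n)" for n
    unfolding connes_rel_def by (rule subspace_sums[OF sub_R subspace_im[OF lin_one_t sub_V]])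
  show "connes_rel n \<subseteq> V n" for n
    unfolding connes_rel_def using R_le by (auto intro!: V_add V_diff t_V)
  show "b z \<in> connes_rel n" if "z \<in> connes_rel (Suc n)" for n z
  proof -
    obtain r v where rv: "z = r + (v - t v)" "r \<in> R (Suc n)" "v \<in> V (Suc n)"
      using \<open>z \<in> connes_rel (Suc n)\<close> by (auto simp: connes_rel_def)
    have "b z = (b r + (b (v - t v) - (b' v - t (b' v)))) + (b' v - t (b' v))"
      using rv by (simp add: lins)
    also have "\<dots> \<in> connes_rel n" using rv by (intro connes_relI R_add b_R bt b'_V)
    finally show ?thesis .
  qed
  have R_connes: "R n \<subseteq> connes_rel n" for n
    using connes_relI[of _ n 0] by (auto simp: V_0 lins)
  show "b (b z) \<in> connes_rel n" if "z \<in> V (Suc (Suc n))" for n z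
    using bb[OF that] R_connes by blast
  show "subspace (V n)" "Vector_Spaces.linear s s b" for n by (fact sub_V lin_b)+
qed (fact b_V)

text \<open>
  Away from the column \<open>0\<close> the rows are exact, so only the cokernel of \<open>1 - t\<close> in the column \<open>0\<close>
  contributes to the total homology.
\<close>

lemma connes_qiso:
  "qiso tot_scale s (tot_cycles n) (tot_boundaries n)
     (cycles V connes_rel (\<lambda>_. b) n) (boundaries V connes_rel (\<lambda>_. b) n) (\<lambda>f. f n)"
proof -
  interpret T: presented_complex tot_scale tot_V tot_R tot_d by (rule tot_complex)
  interpret C: presented_complex s V connes_rel "\<lambda>_. b" by (rule connes_complex)
  have lin: "Vector_Spaces.linear tot_scale s (\<lambda>f. f n)"
    by (rule linI[OF vs_tot vector_space_axioms]) (simp_all add: tot_scale_def)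
  have cyc: "f n \<in> cycles V connes_rel (\<lambda>_. b) n" if f: "f \<in> tot_cycles n" for f
  proof -
    have "b (f n) \<in> connes_rel (n - 1)" if "n > 0"
    proof -
      obtain m where m: "n = Suc m" using \<open>n > 0\<close> gr0_conv_Suc by blast
      have "b (f n) = (b (f n) + (f m - t (f m))) + (- f m - t (- f m))" by (simp add: lins)
      also have "\<dots> \<in> connes_rel m"
        using tot_cyclesD(2)[OF f, of m] tot_cyclesD(1)[OF f, of m] m by (intro connes_relI V_neg) auto
      finally show ?thesis using m by simp
    qed
    then show ?thesis using tot_cyclesD(1)[OF f, of n] by (simp add: cycles_def)
  qed
  have bd1: "f n \<in> boundaries V connes_rel (\<lambda>_. b) n" if f: "f \<in> tot_boundaries n" for f
  proof -
    obtain g where g: "\<And>q. q \<le> Suc n \<Longrightarrow> g q \<in> V q"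
      "\<And>q. q \<le> n \<Longrightarrow> even (n - q) \<Longrightarrow> f q - (b (g (Suc q)) + (g q - t (g q))) \<in> R q"
      using tot_boundariesD[OF f] by metis
    have "f n = b (g (Suc n)) + ((f n - (b (g (Suc n)) + (g n - t (g n)))) + (g n - t (g n)))" by simp
    moreover have "(f n - (b (g (Suc n)) + (g n - t (g n)))) + (g n - t (g n)) \<in> connes_rel n"
      using g(1)[of n] g(2)[of n] by (intro connes_relI) auto
    ultimately show ?thesis unfolding boundaries_def using g(1)[of "Suc n"] by blast
  qed
  have bd2: "f \<in> tot_boundaries n"
    if f: "f \<in> tot_cycles n" and fn: "f n \<in> boundaries V connes_rel (\<lambda>_. b) n" for f
  proof -
    obtain u0 u1 r where u: "f n = b u0 + (r + (u1 - t u1))" "u0 \<in> V (Suc n)" "u1 \<in> V n" "r \<in> R n"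
      using fn by (auto simp: boundaries_def connes_rel_def)
    note fV = tot_cyclesD(1)[OF f] and f_odd = tot_cyclesD(2)[OF f] and f_even = tot_cyclesD(3)[OF f]
    \<comment> \<open>The components of the bounding chain are found from \<open>q = n\<close> downwards, by exactness of the row \<open>q\<close>.\<close>
    have "\<exists>g. (\<forall>q. n - k \<le> q \<and> q \<le> Suc n \<longrightarrow> g q \<in> V q) \<and>
        (\<forall>q. n - k \<le> q \<and> q \<le> n \<and> even (n - q) \<longrightarrow> f q - (b (g (Suc q)) + (g q - t (g q))) \<in> R q) \<and>
        (\<forall>q. n - k \<le> q \<and> q \<le> n \<and> odd (n - q) \<longrightarrow> f q - (- b' (g (Suc q)) + N q (g q)) \<in> R q)"
      if "k \<le> n" for k
      using that
    proof (induction k)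
      case 0
      have "f n - (b u0 + (u1 - t u1)) = r" using u(1) by simp
      then show ?case
        using u(2-4)
        by (intro exI[of _ "(\<lambda>_. 0)(Suc n := u0, n := u1)"]) (auto simp: le_Suc_eq)
    next
      case (Suc k)
      define q where "q = n - Suc k"
      have q: "q < n" "n - k = Suc q" using Suc.prems by (auto simp: q_def)
      obtain g where g: "\<And>p. Suc q \<le> p \<Longrightarrow> p \<le> Suc n \<Longrightarrow> g p \<in> V p"
        "\<And>p. Suc q \<le> p \<Longrightarrow> p \<le> n \<Longrightarrow> even (n - p) \<Longrightarrow> f p - (b (g (Suc p)) + (g p - t (g p))) \<in> R p"
        "\<And>p. Suc q \<le> p \<Longrightarrow> p \<le> n \<Longrightarrow> odd (n - p) \<Longrightarrow> f p - (- b' (g (Suc p)) + N p (g p)) \<in> R p"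
        using Suc q by auto
      have gV: "g (Suc q) \<in> V (Suc q)" "g (Suc (Suc q)) \<in> V (Suc (Suc q))" using g(1) q by auto
      have par: "even (n - Suc q) \<longleftrightarrow> odd (n - q)" using q by (simp add: Suc_diff_Suc[symmetric])
      have "\<exists>u\<in>V q. (even (n - q) \<longrightarrow> f q - (b (g (Suc q)) + (u - t u)) \<in> R q) \<and>
        (odd (n - q) \<longrightarrow> f q - (- b' (g (Suc q)) + N q u) \<in> R q)"
      proof (cases "even (n - q)")
        case True
        let ?z = "f q - b (g (Suc q))"
        have "N q ?z = (- b' (f (Suc q)) + N q (f q)) + b' (f (Suc q) - (- b' (g (Suc (Suc q))) + N (Suc q) (g (Suc q))))
           - b' (b' (g (Suc (Suc q)))) + (b' (N (Suc q) (g (Suc q))) - N q (b (g (Suc q))))"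
          by (simp add: lins)
        also have "\<dots> \<in> R q"
          using True q par gV by (intro R_add R_diff f_even b'_R g(3) b'b' b'N[folded N_def]) auto
        finally obtain u where "u \<in> V q" "?z - (u - t u) \<in> R q"
          using ker_N[of ?z q] fV q gV b_V V_diff by (meson less_imp_le)
        then show ?thesis using True by (intro bexI[of _ u]) (simp_all add: algebra_simps)
      next
        case False
        let ?z = "f q + b' (g (Suc q))"
        have "?z - t ?z = (b (f (Suc q)) + (f q - t (f q))) - b (f (Suc q) - (b (g (Suc (Suc q))) + (g (Suc q) - t (g (Suc q)))))
           - b (b (g (Suc (Suc q)))) - (b (g (Suc q) - t (g (Suc q))) - (b' (g (Suc q)) - t (b' (g (Suc q)))))"
          by (simp add: lins algebra_simps)
        also have "\<dots> \<in> R q"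
          using False q par gV by (intro R_add R_diff f_odd b_R g(2) bb bt) auto
        finally obtain u where "u \<in> V q" "?z - N q u \<in> R q"
          using ker_one_t[of ?z q] fV q gV b'_V V_add by (meson less_imp_le)
        then show ?thesis using False by (intro bexI[of _ u]) (simp_all add: algebra_simps)
      qed
      then obtain u where u: "u \<in> V q" "even (n - q) \<Longrightarrow> f q - (b (g (Suc q)) + (u - t u)) \<in> R q"
        "odd (n - q) \<Longrightarrow> f q - (- b' (g (Suc q)) + N q u) \<in> R q" by blast
      have nk: "n - Suc k = q" by (simp add: q_def)
      have spl: "q \<le> p \<longleftrightarrow> p = q \<or> Suc q \<le> p" for p by auto
      show ?case
        unfolding nk using g u by (intro exI[of _ "g(q := u)"]) (auto simp: spl)
    qed
    from this[of n] obtain g where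
      "\<And>q. q \<le> Suc n \<Longrightarrow> g q \<in> V q"
      "\<And>q. q \<le> n \<Longrightarrow> even (n - q) \<Longrightarrow> f q - (b (g (Suc q)) + (g q - t (g q))) \<in> R q"
      "\<And>q. q \<le> n \<Longrightarrow> odd (n - q) \<Longrightarrow> f q - (- b' (g (Suc q)) + N q (g q)) \<in> R q" by auto
    then show ?thesis by (rule tot_boundariesI)
  qed
  have surj: "\<exists>f\<in>tot_cycles n. w - f n \<in> boundaries V connes_rel (\<lambda>_. b) n"
    if w: "w \<in> cycles V connes_rel (\<lambda>_. b) n" for w
  proof -
    have wV: "w \<in> V n" using w by (simp add: cycles_def)
    \<comment> \<open>The components of the cycle are found from \<open>q = n\<close> downwards, by exactness of the row \<open>q\<close>.\<close>
    have "\<exists>f. f n = w \<and> (\<forall>q. n - k \<le> q \<and> q \<le> n \<longrightarrow> f q \<in> V q) \<and>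
        (\<forall>q. n - k \<le> q \<and> q < n \<and> odd (n - q) \<longrightarrow> b (f (Suc q)) + (f q - t (f q)) \<in> R q) \<and>
        (\<forall>q. n - k \<le> q \<and> q < n \<and> even (n - q) \<longrightarrow> - b' (f (Suc q)) + N q (f q) \<in> R q)"
      if "k \<le> n" for k
      using that
    proof (induction k)
      case 0
      then show ?case using wV by (intro exI[of _ "\<lambda>_. w"]) auto
    next
      case (Suc k)
      define q where "q = n - Suc k"
      have q: "q < n" "n - k = Suc q" using Suc.prems by (auto simp: q_def)
      obtain f where f: "f n = w" "\<And>p. Suc q \<le> p \<Longrightarrow> p \<le> n \<Longrightarrow> f p \<in> V p"
        "\<And>p. Suc q \<le> p \<Longrightarrow> p < n \<Longrightarrow> odd (n - p) \<Longrightarrow> b (f (Suc p)) + (f p - t (f p)) \<in> R p"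
        "\<And>p. Suc q \<le> p \<Longrightarrow> p < n \<Longrightarrow> even (n - p) \<Longrightarrow> - b' (f (Suc p)) + N p (f p) \<in> R p"
        using Suc q by auto
      have fV: "f (Suc q) \<in> V (Suc q)" using f(2) q by auto
      have fV2: "f (Suc (Suc q)) \<in> V (Suc (Suc q))" if "Suc q < n" using f(2) that by auto
      have par: "even (n - Suc q) \<longleftrightarrow> odd (n - q)" using q by (simp add: Suc_diff_Suc[symmetric])
      have "\<exists>u\<in>V q. (odd (n - q) \<longrightarrow> b (f (Suc q)) + (u - t u) \<in> R q) \<and>
        (even (n - q) \<longrightarrow> - b' (f (Suc q)) + N q u \<in> R q)"
      proof (cases "Suc q = n")
        case True
        then have "b w \<in> connes_rel q" using w q by (auto simp: cycles_def)
        then obtain r v where rv: "b w = r + (v - t v)" "r \<in> R q" "v \<in> V q" by (auto simp: connes_rel_def)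
        have "b w + (- v - t (- v)) = r" using rv(1) by (simp add: lins)
        then show ?thesis using rv True f(1) V_neg by (intro bexI[of _ "- v"]) auto
      next
        case False
        then have Sq: "Suc q < n" using q by simp
        show ?thesis
        proof (cases "even (n - q)")
          case True
          let ?z = "b' (f (Suc q))"
          have "?z - t ?z = b (b (f (Suc (Suc q)))) - (b (f (Suc q) - t (f (Suc q))) - (b' (f (Suc q)) - t (b' (f (Suc q)))))
             + b (f (Suc q) - t (f (Suc q))) - b (b (f (Suc (Suc q))))" by (simp add: lins)
          moreover have "b (f (Suc q) - t (f (Suc q))) = b (b (f (Suc (Suc q))) + (f (Suc q) - t (f (Suc q)))) - b (b (f (Suc (Suc q))))"
            by (simp add: lins)
          ultimately have "?z - t ?z = b (b (f (Suc (Suc q))) + (f (Suc q) - t (f (Suc q)))) - b (b (f (Suc (Suc q))))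
             - (b (f (Suc q) - t (f (Suc q))) - (b' (f (Suc q)) - t (b' (f (Suc q)))))" by simp
          also have "\<dots> \<in> R q"
            using True par Sq fV fV2[OF Sq] by (intro R_add R_diff bb bt b_R f(3)) auto
          finally obtain u where u: "u \<in> V q" "?z - N q u \<in> R q"
            using ker_one_t[of ?z q] fV b'_V by blast
          then show ?thesis using True R_neg[OF u(2)] by (intro bexI[of _ u]) simp_all
        next
          case False
          let ?z = "b (f (Suc q))"
          have "N q ?z = b' (- b' (f (Suc (Suc q))) + N (Suc q) (f (Suc q))) + b' (b' (f (Suc (Suc q))))
            - (b' (N (Suc q) (f (Suc q))) - N q (b (f (Suc q))))" by (simp add: lins)
          also have "\<dots> \<in> R q"
            using False par Sq fV fV2[OF Sq] by (intro R_add R_diff b'b' b'N[folded N_def] b'_R f(4)) auto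
          finally obtain u where u: "u \<in> V q" "?z - (u - t u) \<in> R q"
            using ker_N[of ?z q] fV b_V by blast
          then show ?thesis using False V_neg[OF u(1)]
            by (intro bexI[of _ "- u"]) (simp_all add: lins algebra_simps)
        qed
      qed
      then obtain u where u: "u \<in> V q" "odd (n - q) \<Longrightarrow> b (f (Suc q)) + (u - t u) \<in> R q"
        "even (n - q) \<Longrightarrow> - b' (f (Suc q)) + N q u \<in> R q" by blast
      have nk: "n - Suc k = q" by (simp add: q_def)
      have spl: "q \<le> p \<longleftrightarrow> p = q \<or> Suc q \<le> p" for p by auto
      show ?case
        unfolding nk using f u q by (intro exI[of _ "f(q := u)"]) (auto simp: spl)
    qed
    from this[of n] obtain f where f: "f n = w" "\<And>q. q \<le> n \<Longrightarrow> f q \<in> V q"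
        "\<And>q. q < n \<Longrightarrow> odd (n - q) \<Longrightarrow> b (f (Suc q)) + (f q - t (f q)) \<in> R q"
        "\<And>q. q < n \<Longrightarrow> even (n - q) \<Longrightarrow> - b' (f (Suc q)) + N q (f q) \<in> R q" by auto
    have "f \<in> tot_cycles n" by (rule tot_cyclesI) (use f in auto)
    then show ?thesis using f(1) subspace_0[OF C.sub_boundaries] by (intro bexI[of _ f]) simp_all
  qed
  show ?thesis
    unfolding qiso_def
    using lin T.sub_cycles T.sub_boundaries T.boundaries_le C.sub_cycles C.sub_boundaries C.boundaries_le
      cyc bd1 bd2 surj by blast
qed

subsection \<open>Splitting of the total complex\<close>

text \<open>
  Let \<open>A\<close> be a family of relations that contains the image of \<open>1 - t\<close>, such that \<open>A/R\<close> is acyclic for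
  \<open>b\<close>. Modulo \<open>A\<close> the even columns keep their homology and the maps \<open>1 - t\<close> between columns vanish. The odd
  columns are contractible, so the homology of the total complex is the direct sum of the homology of
  the even columns.
\<close>

context
  fixes A :: "nat \<Rightarrow> 'a set"
  assumes A_complex: "presented_complex s V A (\<lambda>_. b)"
    and R_A: "\<And>n. R n \<subseteq> A n"
    and one_t_A: "\<And>n v. v \<in> V n \<Longrightarrow> v - t v \<in> A n"
    and A_acyclic: "\<And>n a. a \<in> A n \<Longrightarrow> (n > 0 \<longrightarrow> b a \<in> R (n - 1)) \<Longrightarrow> \<exists>a'\<in>A (Suc n). a - b a' \<in> R n"
begin

abbreviation "A_cycles \<equiv> cycles V A (\<lambda>_. b)"
abbreviation "A_boundaries \<equiv> boundaries V A (\<lambda>_. b)"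
abbreviation "R_cycles \<equiv> cycles V R (\<lambda>_. b)"
abbreviation "R_boundaries \<equiv> boundaries V R (\<lambda>_. b)"

lemma A_qiso: "qiso s s (R_cycles n) (R_boundaries n) (A_cycles n) (A_boundaries n) (\<lambda>z. z)"
  by (rule qiso_acyclic[OF column_complex A_complex R_A A_acyclic])

lemma R_boundaryI: "z \<in> R_cycles n \<Longrightarrow> z \<in> A_boundaries n \<Longrightarrow> z \<in> R_boundaries n"
  using A_qiso[of n] unfolding qiso_def by blast

lemma R_cycle_ex: "z \<in> A_cycles n \<Longrightarrow> \<exists>z'\<in>R_cycles n. z - z' \<in> A_boundaries n"
  using A_qiso[of n] unfolding qiso_def by blast

lemma R_cyclesI: "z \<in> V n \<Longrightarrow> (\<And>m. n = Suc m \<Longrightarrow> b z \<in> R m) \<Longrightarrow> z \<in> R_cycles n"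
  unfolding cycles_def by (cases n) auto

text \<open>
  Classes in the even columns can be prescribed independently of each other. The components of the total cycle are
  found for increasing \<open>q\<close>: those in an odd column from the contraction of \<open>b'\<close>, those in an even column
  from the acyclicity of \<open>A/R\<close>, which makes the value of \<open>1 - t\<close> on the preceding component a boundary.
\<close>

lemma lift_A_cycles:
  assumes w: "\<And>q. q \<le> n \<Longrightarrow> even (n - q) \<Longrightarrow> w q \<in> A_cycles q"
  shows "\<exists>f\<in>tot_cycles n. \<forall>q\<le>n. even (n - q) \<longrightarrow> w q - f q \<in> A_boundaries q"
proof -
  interpret A: presented_complex s V A "\<lambda>_. b" by (rule A_complex)
  have "\<exists>f. (\<forall>q\<le>m. f q \<in> V q) \<and>
      (\<forall>q<m. odd (n - q) \<longrightarrow> b (f (Suc q)) + (f q - t (f q)) \<in> R q) \<and>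
      (\<forall>q<m. even (n - q) \<longrightarrow> - b' (f (Suc q)) + N q (f q) \<in> R q) \<and>
      (\<forall>q\<le>m. even (n - q) \<longrightarrow> w q - f q \<in> A_boundaries q)"
    if "m \<le> n" for m
    using that
  proof (induction m)
    case 0
    have "w 0 \<in> V 0" if "even n" using w[of 0] that by (simp add: cycles_def)
    then show ?case
      using V_0[of 0] subspace_0[OF A.sub_boundaries[of 0]]
      by (intro exI[of _ "\<lambda>_. if even n then w 0 else 0"]) auto
  next
    case (Suc m)
    then obtain f where f: "\<And>q. q \<le> m \<Longrightarrow> f q \<in> V q"
        "\<And>q. q < m \<Longrightarrow> odd (n - q) \<Longrightarrow> b (f (Suc q)) + (f q - t (f q)) \<in> R q"
        "\<And>q. q < m \<Longrightarrow> even (n - q) \<Longrightarrow> - b' (f (Suc q)) + N q (f q) \<in> R q"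
        "\<And>q. q \<le> m \<Longrightarrow> even (n - q) \<Longrightarrow> w q - f q \<in> A_boundaries q" by auto
    have fm: "f m \<in> V m" using f(1) by simp
    have par: "even (n - k) \<longleftrightarrow> odd (n - Suc k)" if "k < n" for k using that by (simp add: Suc_diff_Suc[symmetric])
    have "\<exists>u\<in>V (Suc m). (odd (n - m) \<longrightarrow> b u + (f m - t (f m)) \<in> R m) \<and>
       (even (n - m) \<longrightarrow> - b' u + N m (f m) \<in> R m) \<and>
       (even (n - Suc m) \<longrightarrow> w (Suc m) - u \<in> A_boundaries (Suc m))"
    proof (cases "even (n - m)")
      case True
      have "b' (N m (f m)) \<in> R (m - 1)" if "m > 0"
      proof -
        obtain k where k: "m = Suc k" using \<open>m > 0\<close> gr0_conv_Suc by blast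
        have "odd (n - k)" using True k par[of k] Suc.prems by simp
        have fk: "f k \<in> V k" using f(1) k by simp
        have "b' (N m (f m)) = (b' (N m (f m)) - N k (b (f m))) + N k (b (f m) + (f k - t (f k)))
          - (N k (f k) - N k (t (f k)))" by (simp add: lins)
        also have "\<dots> \<in> R k"
          using fm k f(2)[of k] \<open>odd (n - k)\<close> one_t_N(2)[OF fk] b'N[of "f m" k, folded N_def]
          by (intro R_diff[OF R_add[OF _ N_R]]) auto
        finally show ?thesis using k by simp
      qed
      then obtain u where u: "u \<in> V (Suc m)" "b' u - N m (f m) \<in> R m"
        using b'_contractible[OF N_V[OF fm]] by blast
      then show ?thesis using R_neg[OF u(2)] True par[of m] Suc.prems by (intro bexI[of _ u]) auto
    next
      case False
      let ?a = "f m - t (f m)"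
      have "b ?a \<in> R (m - 1)" if "m > 0"
      proof -
        obtain k where k: "m = Suc k" using \<open>m > 0\<close> gr0_conv_Suc by blast
        have ev: "even (n - k)" using False k par[of k] Suc.prems by simp
        have fk: "f k \<in> V k" using f(1) k by simp
        have "b ?a = (b ?a - (b' (f m) - t (b' (f m)))) - (- b' (f m) + N k (f k) - t (- b' (f m) + N k (f k)))
          + (N k (f k) - t (N k (f k)))" by (simp add: lins)
        also have "\<dots> \<in> R k"
          using fm k f(3)[of k] ev one_t_N(1)[OF fk] bt[of "f m" k]
          by (intro R_add[OF R_diff[OF _ one_t_R]]) auto
        finally show ?thesis using k by simp
      qed
      then obtain a' where a': "a' \<in> A (Suc m)" "?a - b a' \<in> R m"
        using A_acyclic[OF one_t_A[OF fm]] by blast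
      have wc: "w (Suc m) \<in> A_cycles (Suc m)" using w[of "Suc m"] False par[of m] Suc.prems by simp
      have "a' \<in> A_cycles (Suc m)" using A.R_le_boundaries A.boundaries_le a'(1) by blast
      then have "w (Suc m) + a' \<in> A_cycles (Suc m)" using subspace_add[OF A.sub_cycles wc] by blast
      then obtain z where z: "z \<in> R_cycles (Suc m)" "(w (Suc m) + a') - z \<in> A_boundaries (Suc m)"
        using R_cycle_ex by blast
      have zV: "z - a' \<in> V (Suc m)" using z(1) subsetD[OF A.R_le a'(1)] V_diff by (auto simp: cycles_def)
      have "b (z - a') + ?a = b z + (?a - b a')" by (simp add: lins)
      also have "\<dots> \<in> R m" using z(1) a'(2) by (intro R_add) (auto simp: cycles_def)
      finally show ?thesis using zV z(2) False by (intro bexI[of _ "z - a'"]) (auto simp: algebra_simps)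
    qed
    then obtain u where u: "u \<in> V (Suc m)" "odd (n - m) \<Longrightarrow> b u + (f m - t (f m)) \<in> R m"
       "even (n - m) \<Longrightarrow> - b' u + N m (f m) \<in> R m"
       "even (n - Suc m) \<Longrightarrow> w (Suc m) - u \<in> A_boundaries (Suc m)" by blast
    show ?case
      using f u by (intro exI[of _ "f(Suc m := u)"]) (auto simp: less_Suc_eq le_Suc_eq)
  qed
  from this[of n] obtain f where "\<And>q. q \<le> n \<Longrightarrow> f q \<in> V q"
      "\<And>q. q < n \<Longrightarrow> odd (n - q) \<Longrightarrow> b (f (Suc q)) + (f q - t (f q)) \<in> R q"
      "\<And>q. q < n \<Longrightarrow> even (n - q) \<Longrightarrow> - b' (f (Suc q)) + N q (f q) \<in> R q"
      "\<forall>q\<le>n. even (n - q) \<longrightarrow> w q - f q \<in> A_boundaries q" by auto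
  then show ?thesis by (intro bexI[of _ f] tot_cyclesI) blast+
qed

text \<open>
  The bounding chain is found in the same order and from the same two facts as the cycle in \<open>lift_A_cycles\<close>.
\<close>

lemma tot_boundary_if_A_boundaries:
  assumes f: "f \<in> tot_cycles n" and fA: "\<And>q. q \<le> n \<Longrightarrow> even (n - q) \<Longrightarrow> f q \<in> A_boundaries q"
  shows "f \<in> tot_boundaries n"
proof -
  interpret A: presented_complex s V A "\<lambda>_. b" by (rule A_complex)
  note fV = tot_cyclesD(1)[OF f] and f_odd = tot_cyclesD(2)[OF f] and f_even = tot_cyclesD(3)[OF f]
  have "\<exists>g. (\<forall>q\<le>m. g q \<in> V q) \<and>
      (\<forall>q<m. even (n - q) \<longrightarrow> f q - (b (g (Suc q)) + (g q - t (g q))) \<in> R q) \<and>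
      (\<forall>q<m. odd (n - q) \<longrightarrow> f q - (- b' (g (Suc q)) + N q (g q)) \<in> R q)"
    if "m \<le> Suc n" for m
    using that
  proof (induction m)
    case 0
    show ?case using V_0 by (intro exI[of _ "\<lambda>_. 0"]) auto
  next
    case (Suc m)
    then obtain g where g: "\<And>q. q \<le> m \<Longrightarrow> g q \<in> V q"
        "\<And>q. q < m \<Longrightarrow> even (n - q) \<Longrightarrow> f q - (b (g (Suc q)) + (g q - t (g q))) \<in> R q"
        "\<And>q. q < m \<Longrightarrow> odd (n - q) \<Longrightarrow> f q - (- b' (g (Suc q)) + N q (g q)) \<in> R q" by auto
    have gm: "g m \<in> V m" and fm: "f m \<in> V m" using g(1) fV Suc.prems by auto
    have par: "even (n - k) \<longleftrightarrow> odd (n - Suc k)" if "k < n" for k using that by (simp add: Suc_diff_Suc[symmetric])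
    have "\<exists>u\<in>V (Suc m). (even (n - m) \<longrightarrow> f m - (b u + (g m - t (g m))) \<in> R m) \<and>
       (odd (n - m) \<longrightarrow> f m - (- b' u + N m (g m)) \<in> R m)"
    proof (cases "even (n - m)")
      case True
      let ?c = "f m - (g m - t (g m))"
      have "b ?c \<in> R k" if k: "m = Suc k" for k
      proof -
        have od: "odd (n - k)" using True k par[of k] Suc.prems by simp
        have gk: "g k \<in> V k" using g(1) k by simp
        have "b ?c = (b (f m) + (f k - t (f k))) - (b (g m - t (g m)) - (b' (g m) - t (b' (g m))))
          - (f k - (- b' (g m) + N k (g k)) - t (f k - (- b' (g m) + N k (g k))))
          - (N k (g k) - t (N k (g k)))" by (simp add: lins)
        also have "\<dots> \<in> R k"
          using gm fm k Suc.prems f_odd[of k] od g(3)[of k] one_t_N(1)[OF gk] bt[of "g m" k]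
          by (intro R_diff[OF R_diff[OF R_diff[OF _ _] one_t_R]]) auto
        finally show ?thesis .
      qed
      moreover have "?c \<in> V m" by (intro V_diff fm gm t_V)
      ultimately have "?c \<in> R_cycles m" by (intro R_cyclesI) auto
      moreover have "g m - t (g m) \<in> A_boundaries m" using one_t_A[OF gm] A.R_le_boundaries by blast
      then have "?c \<in> A_boundaries m"
        using fA[of m] True Suc.prems subspace_diff[OF A.sub_boundaries] by simp
      ultimately have "?c \<in> R_boundaries m" by (rule R_boundaryI)
      then obtain u r where ur: "?c = b u + r" "u \<in> V (Suc m)" "r \<in> R m" by (auto simp: boundaries_def)
      have "f m - (b u + (g m - t (g m))) = r" using ur(1) by (simp add: algebra_simps)
      then show ?thesis using ur True by (intro bexI[of _ u]) auto
    next
      case False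
      let ?z = "N m (g m) - f m"
      have "b' ?z \<in> R (m - 1)" if "m > 0"
      proof -
        obtain k where k: "m = Suc k" using \<open>m > 0\<close> gr0_conv_Suc by blast
        have ev: "even (n - k)" using False k par[of k] Suc.prems by simp
        have gk: "g k \<in> V k" using g(1) k by simp
        have "b' ?z = (b' (N m (g m)) - N k (b (g m))) + (- b' (f m) + N k (f k))
          - N k (f k - (b (g m) + (g k - t (g k)))) - (N k (g k) - N k (t (g k)))" by (simp add: lins)
        also have "\<dots> \<in> R k"
          using gm fm k Suc.prems f_even[of k] ev g(2)[of k] one_t_N(2)[OF gk] b'N[of "g m" k, folded N_def]
          by (intro R_diff[OF R_diff[OF R_add[OF _ _] N_R]]) auto
        finally show ?thesis using k by simp
      qed
      moreover have "?z \<in> V m" by (intro V_diff fm gm N_V)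
      ultimately obtain u where u: "u \<in> V (Suc m)" "b' u - ?z \<in> R m" using b'_contractible by blast
      have "f m - (- b' u + N m (g m)) = b' u - ?z" by simp
      then have "f m - (- b' u + N m (g m)) \<in> R m" using u(2) by metis
      then show ?thesis using u(1) False by blast
    qed
    then obtain u where u: "u \<in> V (Suc m)" "even (n - m) \<Longrightarrow> f m - (b u + (g m - t (g m))) \<in> R m"
       "odd (n - m) \<Longrightarrow> f m - (- b' u + N m (g m)) \<in> R m" by blast
    show ?case
      using g u by (intro exI[of _ "g(Suc m := u)"]) (auto simp: less_Suc_eq le_Suc_eq)
  qed
  from this[of "Suc n"] obtain g where "\<And>q. q \<le> Suc n \<Longrightarrow> g q \<in> V q"
      "\<And>q. q \<le> n \<Longrightarrow> even (n - q) \<Longrightarrow> f q - (b (g (Suc q)) + (g q - t (g q))) \<in> R q"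
      "\<And>q. q \<le> n \<Longrightarrow> odd (n - q) \<Longrightarrow> f q - (- b' (g (Suc q)) + N q (g q)) \<in> R q"
    by (auto simp: less_Suc_eq_le)
  then show ?thesis by (rule tot_boundariesI)
qed

text \<open>
  The summand \<open>i\<close> is the contribution of the column \<open>2 i\<close>, which has the index \<open>q = n - 2 i\<close>; it is zero
  for \<open>2 i > n\<close>.
\<close>

theorem presents_tot_periodic:
  fixes H :: "int \<Rightarrow> ('k, 'c) module"
  assumes H: "\<And>n. presents s (A_cycles n) (A_boundaries n) (H (int n))"
    and H_neg: "\<And>j. j < 0 \<Longrightarrow> H j = vs_zero"
  shows "presents tot_scale (tot_cycles n) (tot_boundaries n) (vs_dsum (UNIV :: nat set) (\<lambda>i. H (int n - 2 * int i)))"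
proof -
  interpret A: presented_complex s V A "\<lambda>_. b" by (rule A_complex)
  interpret T: presented_complex tot_scale tot_V tot_R tot_d by (rule tot_complex)
  define Z' where "Z' i = (if 2 * i \<le> n then A_cycles (n - 2 * i) else {0})" for i
  define B' where "B' i = (if 2 * i \<le> n then A_boundaries (n - 2 * i) else {0})" for i
  define p where "p i f = (if 2 * i \<le> n then f (n - 2 * i) else 0)" for i and f :: "nat \<Rightarrow> 'a"
  have idx: "\<exists>i. q = n - 2 * i \<and> 2 * i \<le> n" if "q \<le> n" "even (n - q)" for q
    using that by (intro exI[of _ "(n - q) div 2"]) auto
  have A_cyc: "f q \<in> A_cycles q" if f: "f \<in> tot_cycles n" and q: "q \<le> n" "even (n - q)" for f q
  proof -
    have "b (f q) \<in> A (q - 1)" if "q > 0"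
    proof -
      obtain m where m: "q = Suc m" using \<open>q > 0\<close> gr0_conv_Suc by blast
      then have "odd (n - m)" using q by (simp add: Suc_diff_Suc[symmetric])
      have "b (f q) = (b (f q) + (f m - t (f m))) - (f m - t (f m))" by simp
      also have "\<dots> \<in> A m"
        using tot_cyclesD(2)[OF f, of m] tot_cyclesD(1)[OF f, of m] \<open>odd (n - m)\<close> m q(1) R_A one_t_A
        by (intro subspace_diff[OF A.sub_R _ one_t_A]) auto
      finally show ?thesis using m by simp
    qed
    then show ?thesis using tot_cyclesD(1)[OF f q(1)] by (simp add: cycles_def)
  qed
  have A_bd: "f q \<in> A_boundaries q" if f: "f \<in> tot_boundaries n" and q: "q \<le> n" "even (n - q)" for f q
  proof -
    obtain g where g: "\<And>q. q \<le> Suc n \<Longrightarrow> g q \<in> V q"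
      "\<And>q. q \<le> n \<Longrightarrow> even (n - q) \<Longrightarrow> f q - (b (g (Suc q)) + (g q - t (g q))) \<in> R q"
      using tot_boundariesD[OF f] by metis
    have "f q = b (g (Suc q)) + ((f q - (b (g (Suc q)) + (g q - t (g q)))) + (g q - t (g q)))" by simp
    moreover have "(f q - (b (g (Suc q)) + (g q - t (g q)))) + (g q - t (g q)) \<in> A q"
      using g(2)[OF q] g(1)[of q] q(1) R_A one_t_A by (intro subspace_add[OF A.sub_R _ one_t_A]) auto
    ultimately show ?thesis unfolding boundaries_def using g(1)[of "Suc q"] q(1) by blast
  qed
  show ?thesis
  proof (rule presents_dsum[OF vs_tot T.sub_cycles T.sub_boundaries T.boundaries_le])
    show "presents s (Z' i) (B' i) (H (int n - 2 * int i))" for i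
    proof (cases "2 * i \<le> n")
      case True
      then have "int n - 2 * int i = int (n - 2 * i)" by linarith
      then show ?thesis using H[of "n - 2 * i"] True by (simp add: Z'_def B'_def)
    next
      case False
      then show ?thesis using H_neg[of "int n - 2 * int i"] presents_vs_zero[OF vector_space_axioms subspace_single_0]
        by (simp add: Z'_def B'_def)
    qed
    show "Vector_Spaces.linear tot_scale s (p i)" for i
      by (rule linI[OF vs_tot vector_space_axioms]) (simp_all add: p_def tot_scale_def)
    show "p i f \<in> Z' i" if "f \<in> tot_cycles n" for i f
      using A_cyc[OF that, of "n - 2 * i"] by (simp add: p_def Z'_def)
    show "finite {i \<in> UNIV. p i f \<notin> B' i}" for f
      by (rule finite_subset[of _ "{..n}"]) (auto simp: p_def B'_def split: if_splits)
    show "f \<in> tot_boundaries n \<longleftrightarrow> (\<forall>i\<in>UNIV. p i f \<in> B' i)" if f: "f \<in> tot_cycles n" for f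
    proof
      assume "f \<in> tot_boundaries n"
      then show "\<forall>i\<in>UNIV. p i f \<in> B' i" using A_bd by (simp add: p_def B'_def)
    next
      assume a: "\<forall>i\<in>UNIV. p i f \<in> B' i"
      have "f q \<in> A_boundaries q" if q: "q \<le> n" "even (n - q)" for q
      proof -
        obtain i where i: "q = n - 2 * i" "2 * i \<le> n" using idx[OF q] by blast
        then show ?thesis using a[rule_format, of i] by (simp add: p_def B'_def)
      qed
      then show "f \<in> tot_boundaries n" by (rule tot_boundary_if_A_boundaries[OF f])
    qed
    show "\<exists>f\<in>tot_cycles n. \<forall>i\<in>UNIV. w i - p i f \<in> B' i"
      if w: "\<forall>i\<in>UNIV. w i \<in> Z' i" and "finite {i \<in> UNIV. w i \<noteq> 0}" for w
    proof -
      have "w ((n - q) div 2) \<in> A_cycles q" if q: "q \<le> n" "even (n - q)" for q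
      proof -
        have "2 * ((n - q) div 2) = n - q" using q(2) by simp
        then show ?thesis using w[rule_format, of "(n - q) div 2"] q(1) by (simp add: Z'_def)
      qed
      then obtain f where f: "f \<in> tot_cycles n"
        "\<And>q. q \<le> n \<Longrightarrow> even (n - q) \<Longrightarrow> w ((n - q) div 2) - f q \<in> A_boundaries q"
        using lift_A_cycles[of n "\<lambda>q. w ((n - q) div 2)"] by blast
      have "w i - p i f \<in> B' i" for i
        using f(2)[of "n - 2 * i"] w[rule_format, of i] by (auto simp: p_def B'_def Z'_def)
      then show ?thesis using f(1) by blast
    qed
  qed
qed

end

end

section \<open>Simplicial operators on tuples with coefficients\<close>

lemma tuples_0: "tuples U 0 = {[]}"
  and tuples_Cons [simp]: "y # ys \<in> tuples U (Suc m) \<longleftrightarrow> y \<in> U \<and> ys \<in> tuples U m"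
  by (auto simp: tuples_def)

lemma tuplesD: "ys \<in> tuples U m \<Longrightarrow> length ys = m" "ys \<in> tuples U m \<Longrightarrow> set ys \<subseteq> U"
  by (auto simp: tuples_def)

lemma map_tuples: "ys \<in> tuples U m \<Longrightarrow> (\<And>y. y \<in> U \<Longrightarrow> f y \<in> U') \<Longrightarrow> map f ys \<in> tuples U' m"
  by (auto simp: tuples_def)

lemma delete_nth_Cons [simp]:
  "delete_nth 0 (y # ys) = ys" "delete_nth (Suc i) (y # ys) = y # delete_nth i ys"
  by (auto simp: delete_nth_def)

lemma delete_nth_tuples: "ys \<in> tuples U (Suc m) \<Longrightarrow> i \<le> m \<Longrightarrow> delete_nth i ys \<in> tuples U m"
  by (auto simp: tuples_def delete_nth_def dest: in_set_takeD in_set_dropD)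

lemma delete_nth_map: "delete_nth i (map f ys) = map f (delete_nth i ys)"
  by (simp add: delete_nth_def take_map drop_map)

context coeff_space
begin

text \<open>
  Tuples of length \<open>m\<close> have degree \<open>m - 1\<close>, so \<open>bd\<close> on tuples of length \<open>1\<close> is the augmentation, and
  chains on any nonempty set are contractible by \<open>cone\<close>. The operator \<open>bd'\<close> omits the last face.
\<close>

definition push :: "('x \<Rightarrow> 'y) \<Rightarrow> ('x \<Rightarrow>\<^sub>0 'm) \<Rightarrow> ('y \<Rightarrow>\<^sub>0 'm)" where
  "push F = lin_ext (\<lambda>x m. Poly_Mapping.single (F x) m)"

definition tmap :: "('x \<Rightarrow> 'y) \<Rightarrow> ('m \<Rightarrow> 'm) \<Rightarrow> ('x list \<Rightarrow>\<^sub>0 'm) \<Rightarrow> ('y list \<Rightarrow>\<^sub>0 'm)" where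
  "tmap f c = lin_ext (\<lambda>ys m. Poly_Mapping.single (map f ys) (c m))"

definition bd :: "('x list \<Rightarrow>\<^sub>0 'm) \<Rightarrow> ('x list \<Rightarrow>\<^sub>0 'm)" where
  "bd = lin_ext (\<lambda>ys m. \<Sum>i<length ys. ps ((-1) ^ i) (Poly_Mapping.single (delete_nth i ys) m))"

definition bd' :: "('x list \<Rightarrow>\<^sub>0 'm) \<Rightarrow> ('x list \<Rightarrow>\<^sub>0 'm)" where
  "bd' = lin_ext (\<lambda>ys m. \<Sum>i<length ys - 1. ps ((-1) ^ i) (Poly_Mapping.single (delete_nth i ys) m))"

abbreviation cone :: "'x \<Rightarrow> ('x list \<Rightarrow>\<^sub>0 'm) \<Rightarrow> ('x list \<Rightarrow>\<^sub>0 'm)" where "cone y \<equiv> push ((#) y)"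

lemma lin_push: "Vector_Spaces.linear ps ps (push F)"
  unfolding push_def by (rule lin_ext_lin[OF lin_single])

lemma lin_tmap:
  assumes "Vector_Spaces.linear scale scale c" shows "Vector_Spaces.linear ps ps (tmap f c)"
  unfolding tmap_def by (rule lin_ext_lin) (rule lin_comp[OF lin_single assms])

lemma lin_bd: "Vector_Spaces.linear ps ps bd"
  unfolding bd_def by (intro lin_ext_lin lin_sums[OF vs_scale vs_ps] lin_smult lin_single)

lemma lin_bd': "Vector_Spaces.linear ps ps bd'"
  unfolding bd'_def by (intro lin_ext_lin lin_sums[OF vs_scale vs_ps] lin_smult lin_single)

lemma push_single [simp]: "push F (Poly_Mapping.single x m) = Poly_Mapping.single (F x) m"
  unfolding push_def by (simp add: lin_ext_single)

lemma tmap_single [simp]: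
  "Vector_Spaces.linear scale scale c \<Longrightarrow> tmap f c (Poly_Mapping.single ys m) = Poly_Mapping.single (map f ys) (c m)"
  unfolding tmap_def by (simp add: lin_ext_single lin_0)

lemma bd_single:
  "bd (Poly_Mapping.single ys m) = (\<Sum>i<length ys. ps ((-1) ^ i) (Poly_Mapping.single (delete_nth i ys) m))"
  unfolding bd_def by (rule lin_ext_single) simp

lemma bd'_single:
  "bd' (Poly_Mapping.single ys m) = (\<Sum>i<length ys - 1. ps ((-1) ^ i) (Poly_Mapping.single (delete_nth i ys) m))"
  unfolding bd'_def by (rule lin_ext_single) simp

lemma push_L:
  assumes "subspace W" "f \<in> fin_supp U W" "\<And>x. x \<in> U \<Longrightarrow> F x \<in> U'"
  shows "push F f \<in> fin_supp U' W"
  by (rule lin_in_fin_supp[OF lin_push sub_fin_supp[OF assms(1)] assms(2)])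
    (simp add: fin_supp_single assms)

lemma tmap_L:
  assumes c: "Vector_Spaces.linear scale scale c" and "subspace W" "subspace W'" "f \<in> fin_supp (tuples U m) W"
    "\<And>x. x \<in> U \<Longrightarrow> F x \<in> U'" "\<And>w. w \<in> W \<Longrightarrow> c w \<in> W'"
  shows "tmap F c f \<in> fin_supp (tuples U' m) W'"
  by (rule lin_in_fin_supp[OF lin_tmap[OF c] sub_fin_supp[OF assms(3)] assms(4)])
    (simp add: fin_supp_single assms map_tuples)

lemma bd_L:
  assumes W: "subspace W" and f: "f \<in> fin_supp (tuples U (Suc m)) W"
  shows "bd f \<in> fin_supp (tuples U m) W"
  by (rule lin_in_fin_supp[OF lin_bd sub_fin_supp[OF W] f])
    (auto simp: bd_single tuplesD(1) less_Suc_eq_le simp del: sum.lessThan_Suc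
      intro!: P.subspace_sum[OF sub_fin_supp[OF W]] fin_supp_single delete_nth_tuples subspace_scale[OF W] W)

lemma bd'_L:
  assumes W: "subspace W" and f: "f \<in> fin_supp (tuples U (Suc m)) W"
  shows "bd' f \<in> fin_supp (tuples U m) W"
  by (rule lin_in_fin_supp[OF lin_bd' sub_fin_supp[OF W] f])
    (auto simp: bd'_single tuplesD(1) less_Suc_eq_le
      intro!: P.subspace_sum[OF sub_fin_supp[OF W]] fin_supp_single delete_nth_tuples subspace_scale[OF W] W)

lemma bd_Nil: "bd (Poly_Mapping.single [] m) = 0"
  by (simp add: bd_single)

lemma bd_Cons:
  "bd (Poly_Mapping.single (y # ys) m) = Poly_Mapping.single ys m - cone y (bd (Poly_Mapping.single ys m))"
  unfolding bd_single
  by (simp add: sum.lessThan_Suc_shift lin_sum[OF lin_push] single_uminus flip: sum_negf del: sum.lessThan_Suc)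

lemma bd'_Cons:
  "ys \<noteq> [] \<Longrightarrow> bd' (Poly_Mapping.single (y # ys) m) = Poly_Mapping.single ys m - cone y (bd' (Poly_Mapping.single ys m))"
  unfolding bd'_single
  by (cases ys)
    (simp_all add: sum.lessThan_Suc_shift lin_sum[OF lin_push] single_uminus flip: sum_negf del: sum.lessThan_Suc)

lemma bd_cone: "bd (cone y f) = f - cone y (bd f)"
  by (rule lin_eq_all[OF lin_comp[OF lin_bd lin_push] lin_minus[OF lin_id[OF vs_ps] lin_comp[OF lin_push lin_bd]]])
    (simp add: bd_Cons)

lemma bd_bd: "bd (bd f) = 0"
proof (rule lin_eq_all[OF lin_comp[OF lin_bd lin_bd] lin_zero[OF vs_ps vs_ps]])
  show "bd (bd (Poly_Mapping.single ys m)) = 0" for ys :: "'x list" and m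
  proof (induction ys)
    case Nil
    then show ?case by (simp add: bd_Nil lin_0[OF lin_bd])
  next
    case (Cons y ys)
    then show ?case by (simp add: bd_Cons lin_diff[OF lin_bd] bd_cone lin_0[OF lin_push])
  qed
qed

lemma bd'_cone:
  assumes "f \<in> fin_supp {ys. ys \<noteq> []} UNIV"
  shows "bd' (cone y f) = f - cone y (bd' f)"
  by (rule lin_eq_fin_supp[OF lin_comp[OF lin_bd' lin_push] lin_minus[OF lin_id[OF vs_ps] lin_comp[OF lin_push lin_bd']] assms])
    (simp add: bd'_Cons)

lemma bd'_bd': "bd' (bd' f) = 0"
proof (rule lin_eq_all[OF lin_comp[OF lin_bd' lin_bd'] lin_zero[OF vs_ps vs_ps]])
  show "bd' (bd' (Poly_Mapping.single ys m)) = 0" for ys :: "'x list" and m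
  proof (induction ys)
    case Nil
    then show ?case by (simp add: bd'_single lin_0[OF lin_bd'])
  next
    case (Cons y ys)
    show ?case
    proof (cases "length ys \<le> 1")
      case True
      then show ?thesis by (cases ys) (simp_all add: bd'_single lin_0[OF lin_bd'])
    next
      case False
      have "bd' (Poly_Mapping.single ys m) \<in> fin_supp {ys. ys \<noteq> []} UNIV"
        unfolding bd'_single using False
        by (intro P.subspace_sum[OF sub_fin_supp[OF subspace_UNIV]])
          (auto simp: delete_nth_def intro!: fin_supp_single)
      moreover have "ys \<noteq> []" using False by auto
      ultimately show ?thesis
        using Cons by (simp add: bd'_Cons lin_diff[OF lin_bd'] bd'_cone lin_0[OF lin_push])
    qed
  qed
qed

lemma bd_tmap:
  assumes c: "Vector_Spaces.linear scale scale c" shows "bd (tmap f c v) = tmap f c (bd v)"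
  by (rule lin_eq_all[OF lin_comp[OF lin_bd lin_tmap[OF c]] lin_comp[OF lin_tmap[OF c] lin_bd]])
    (simp add: c bd_single lin_sum[OF lin_tmap[OF c]] delete_nth_map lin_scale[OF c])

lemma bd'_tmap:
  assumes c: "Vector_Spaces.linear scale scale c" shows "bd' (tmap f c v) = tmap f c (bd' v)"
  by (rule lin_eq_all[OF lin_comp[OF lin_bd' lin_tmap[OF c]] lin_comp[OF lin_tmap[OF c] lin_bd']])
    (simp add: c bd'_single lin_sum[OF lin_tmap[OF c]] delete_nth_map lin_scale[OF c])

lemma lin_ident: "Vector_Spaces.linear scale scale (\<lambda>m. m)" by (rule lin_id[OF vs_scale])

end

section \<open>Relative acyclicity by a partition of unity\<close>

lemma count_list_map_inj: "inj_on f (insert x (set xs)) \<Longrightarrow> count_list (map f xs) (f x) = count_list xs x"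
  by (induction xs) (auto simp: inj_on_def)

text \<open>
  A right \<open>\<Gamma>\<close>-set \<open>X\<close> with an equivariant map \<open>\<pi>\<close> to a transitive \<open>\<Gamma>\<close>-set \<open>Q\<close>, and a left
  \<open>\<Gamma>\<close>-module \<open>W\<close>. The elements of \<open>X\<close> are the vertices of the chains, and those of \<open>Q\<close> are the points
  at which chains are localized.
\<close>

locale gset_coeff = coeff_space scale + \<Gamma>: group \<Gamma>
  for scale :: "'k::field_char_0 \<Rightarrow> 'm::ab_group_add \<Rightarrow> 'm" and \<Gamma> :: "('g, 'z) monoid_scheme" (structure) +
  fixes X :: "'y set" and ra :: "'y \<Rightarrow> 'g \<Rightarrow> 'y" and a :: "'g \<Rightarrow> 'm \<Rightarrow> 'm" and W :: "'m set"
    and Q :: "'u set" and qa :: "'u \<Rightarrow> 'g \<Rightarrow> 'u" and u0 :: 'u and \<pi> :: "'y \<Rightarrow> 'u"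
  assumes sub_W: "subspace W"
    and ra_closed: "y \<in> X \<Longrightarrow> g \<in> carrier \<Gamma> \<Longrightarrow> ra y g \<in> X"
    and ra_mult: "y \<in> X \<Longrightarrow> g \<in> carrier \<Gamma> \<Longrightarrow> h \<in> carrier \<Gamma> \<Longrightarrow> ra (ra y g) h = ra y (g \<otimes> h)"
    and ra_one: "y \<in> X \<Longrightarrow> ra y \<one> = y"
    and lin_a: "g \<in> carrier \<Gamma> \<Longrightarrow> Vector_Spaces.linear scale scale (a g)"
    and a_mult: "g \<in> carrier \<Gamma> \<Longrightarrow> h \<in> carrier \<Gamma> \<Longrightarrow> a (g \<otimes> h) m = a g (a h m)"
    and a_one: "a \<one> m = m"
    and a_closed: "g \<in> carrier \<Gamma> \<Longrightarrow> w \<in> W \<Longrightarrow> a g w \<in> W"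
    and \<pi>_closed: "y \<in> X \<Longrightarrow> \<pi> y \<in> Q"
    and \<pi>_equiv: "y \<in> X \<Longrightarrow> g \<in> carrier \<Gamma> \<Longrightarrow> \<pi> (ra y g) = qa (\<pi> y) g"
    and qa_closed: "u \<in> Q \<Longrightarrow> g \<in> carrier \<Gamma> \<Longrightarrow> qa u g \<in> Q"
    and qa_mult: "u \<in> Q \<Longrightarrow> g \<in> carrier \<Gamma> \<Longrightarrow> h \<in> carrier \<Gamma> \<Longrightarrow> qa (qa u g) h = qa u (g \<otimes> h)"
    and qa_one: "u \<in> Q \<Longrightarrow> qa u \<one> = u"
    and u0: "u0 \<in> Q"
    and qa_trans: "u \<in> Q \<Longrightarrow> \<exists>g\<in>carrier \<Gamma>. u = qa u0 g"
begin

text \<open>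
  The quotient of \<open>L m\<close> by \<open>Rel m\<close> is the tensor product over \<open>k\<Gamma>\<close> of the free module on the tuples with
  \<open>W\<close>. It is the space of coinvariants for the action \<open>ac\<close>, which has an inverse on the coefficients to be a
  right action like \<open>ra\<close>.
\<close>

definition L :: "nat \<Rightarrow> ('y list \<Rightarrow>\<^sub>0 'm) set" where "L m = fin_supp (tuples X m) W"

definition ac :: "'g \<Rightarrow> ('y list \<Rightarrow>\<^sub>0 'm) \<Rightarrow> ('y list \<Rightarrow>\<^sub>0 'm)" where
  "ac g = tmap (\<lambda>y. ra y g) (a (inv g))"

definition Rel :: "nat \<Rightarrow> ('y list \<Rightarrow>\<^sub>0 'm) set" where
  "Rel m = P.span {Poly_Mapping.single (map (\<lambda>y. ra y g) ys) w - Poly_Mapping.single ys (a g w) |ys g w.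
     ys \<in> tuples X m \<and> g \<in> carrier \<Gamma> \<and> w \<in> W}"

text \<open>
  The part of a tensor that lies over the point \<open>u\<close>: the weight of a tuple is the fraction of its entries that
  \<open>\<pi>\<close> maps to \<open>u\<close>. The weights do not depend on the order of the entries, and they add up to \<open>1\<close> on
  nonempty tuples, where division by the length needs characteristic \<open>0\<close>.
\<close>

definition e :: "'u \<Rightarrow> ('y list \<Rightarrow>\<^sub>0 'm) \<Rightarrow> ('y list \<Rightarrow>\<^sub>0 'm)" where
  "e u = lin_ext (\<lambda>ys w. Poly_Mapping.single ys (scale (of_nat (count_list (map \<pi> ys) u) / of_nat (length ys)) w))"

lemma sub_L: "P.subspace (L m)" unfolding L_def by (rule sub_fin_supp[OF sub_W])

lemma L_single: "ys \<in> tuples X m \<Longrightarrow> w \<in> W \<Longrightarrow> Poly_Mapping.single ys w \<in> L m"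
  unfolding L_def by (rule fin_supp_single[OF _ _ sub_W])

lemma L_bd: "v \<in> L (Suc m) \<Longrightarrow> bd v \<in> L m" unfolding L_def by (rule bd_L[OF sub_W])

lemma L_cone: "y \<in> X \<Longrightarrow> v \<in> L m \<Longrightarrow> cone y v \<in> L (Suc m)"
  unfolding L_def by (rule push_L[OF sub_W]) auto

lemma lin_eq_L:
  assumes "Vector_Spaces.linear ps s F" "Vector_Spaces.linear ps s G" "v \<in> L m"
    "\<And>ys w. ys \<in> tuples X m \<Longrightarrow> w \<in> W \<Longrightarrow> F (Poly_Mapping.single ys w) = G (Poly_Mapping.single ys w)"
  shows "F v = G v"
  using lin_eq_fin_supp[OF assms(1,2) assms(3)[unfolded L_def] assms(4)] .

lemma lin_in_L:
  assumes "Vector_Spaces.linear ps s F" "module.subspace s S" "v \<in> L m"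
    "\<And>ys w. ys \<in> tuples X m \<Longrightarrow> w \<in> W \<Longrightarrow> F (Poly_Mapping.single ys w) \<in> S"
  shows "F v \<in> S"
  using lin_in_fin_supp[OF assms(1,2) assms(3)[unfolded L_def] assms(4)] .

lemma lin_ac: "g \<in> carrier \<Gamma> \<Longrightarrow> Vector_Spaces.linear ps ps (ac g)"
  unfolding ac_def by (rule lin_tmap) (simp add: lin_a)

lemma ac_single [simp]:
  "g \<in> carrier \<Gamma> \<Longrightarrow> ac g (Poly_Mapping.single ys w) = Poly_Mapping.single (map (\<lambda>y. ra y g) ys) (a (inv g) w)"
  unfolding ac_def by (simp add: lin_a)

lemma ac_L: "g \<in> carrier \<Gamma> \<Longrightarrow> v \<in> L m \<Longrightarrow> ac g v \<in> L m"
  unfolding ac_def L_def by (rule tmap_L[OF lin_a sub_W sub_W]) (auto simp: ra_closed a_closed)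

lemma bd_ac: "g \<in> carrier \<Gamma> \<Longrightarrow> bd (ac g v) = ac g (bd v)"
  unfolding ac_def by (rule bd_tmap[OF lin_a]) simp

lemma map_ra_ra:
  assumes "ys \<in> tuples X m" "g \<in> carrier \<Gamma>" "h \<in> carrier \<Gamma>"
  shows "map (\<lambda>y. ra (ra y g) h) ys = map (\<lambda>y. ra y (g \<otimes> h)) ys"
  using assms tuplesD(2)[OF assms(1)] by (auto intro!: ra_mult)

lemma ac_ac:
  assumes g: "g \<in> carrier \<Gamma>" and h: "h \<in> carrier \<Gamma>" and v: "v \<in> L m"
  shows "ac h (ac g v) = ac (g \<otimes> h) v"
  by (rule lin_eq_L[OF lin_comp[OF lin_ac lin_ac] lin_ac v])
    (use g h in \<open>auto simp: comp_def map_ra_ra \<Gamma>.inv_mult_group a_mult\<close>)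

lemma ac_one: "v \<in> L m \<Longrightarrow> ac \<one> v = v"
  by (rule lin_eq_L[OF lin_ac lin_id[OF vs_ps]])
    (auto simp: a_one ra_one dest!: tuplesD(2) intro!: map_idI arg_cong2[where f=Poly_Mapping.single])

lemma ac_inv:
  assumes "g \<in> carrier \<Gamma>" "v \<in> L m" shows "ac g (ac (inv g) v) = v"
  using assms by (simp add: ac_ac ac_one)

lemma sub_Rel: "P.subspace (Rel m)" by (simp add: Rel_def)

lemma Rel_gen: "ys \<in> tuples X m \<Longrightarrow> g \<in> carrier \<Gamma> \<Longrightarrow> w \<in> W \<Longrightarrow>
    Poly_Mapping.single (map (\<lambda>y. ra y g) ys) w - Poly_Mapping.single ys (a g w) \<in> Rel m"
  unfolding Rel_def by (rule P.span_base) blast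

lemma ac_Rel:
  assumes g: "g \<in> carrier \<Gamma>" and v: "v \<in> L m" shows "ac g v - v \<in> Rel m"
proof (rule lin_in_L[OF lin_minus[OF lin_ac[OF g] lin_id[OF vs_ps]] sub_Rel v])
  fix ys w assume y: "ys \<in> tuples X m" "w \<in> W"
  have "a g (a (inv g) w) = w" using g by (simp flip: a_mult add: a_one)
  then show "ac g (Poly_Mapping.single ys w) - Poly_Mapping.single ys w \<in> Rel m"
    using Rel_gen[OF y(1) g, of "a (inv g) w"] y g by (simp add: a_closed)
qed

text \<open>
  The relations are spanned by the differences \<open>ac g v - v\<close>.
\<close>

lemma Rel_in:
  assumes F: "Vector_Spaces.linear ps s F" and S: "module.subspace s S" and r: "r \<in> Rel m"
    and e: "\<And>g v. g \<in> carrier \<Gamma> \<Longrightarrow> v \<in> L m \<Longrightarrow> F (ac g v) - F v \<in> S"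
  shows "F r \<in> S"
proof (rule lin_span_in[OF F S r[unfolded Rel_def]])
  fix x assume "x \<in> {Poly_Mapping.single (map (\<lambda>y. ra y g) ys) w - Poly_Mapping.single ys (a g w) |ys g w.
     ys \<in> tuples X m \<and> g \<in> carrier \<Gamma> \<and> w \<in> W}"
  then obtain ys g w where x: "x = Poly_Mapping.single (map (\<lambda>y. ra y g) ys) w - Poly_Mapping.single ys (a g w)"
    and y: "ys \<in> tuples X m" "g \<in> carrier \<Gamma>" "w \<in> W" by blast
  have "a (inv g) (a g w) = w" using y by (simp flip: a_mult add: a_one)
  then have "x = ac g (Poly_Mapping.single ys (a g w)) - Poly_Mapping.single ys (a g w)" using x y by simp
  then show "F x \<in> S" using e[OF y(2) L_single[OF y(1) a_closed[OF y(2,3)]]] by (simp add: lin_diff[OF F])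
qed

lemma Rel_L: "Rel m \<subseteq> L m"
proof
  fix r assume r: "r \<in> Rel m"
  show "r \<in> L m"
    by (rule Rel_in[OF lin_id[OF vs_ps] sub_L r]) (intro P.subspace_diff[OF sub_L] ac_L)
qed

lemma Rel_bd: assumes r: "r \<in> Rel (Suc m)" shows "bd r \<in> Rel m"
  by (rule Rel_in[OF lin_bd sub_Rel r]) (simp add: bd_ac ac_Rel L_bd)

lemma lin_e: "Vector_Spaces.linear ps ps (e u)"
  unfolding e_def
  by (intro lin_ext_lin lin_comp[OF lin_single lin_smult[OF lin_ident]])

lemma e_single: "e u (Poly_Mapping.single ys w) =
    Poly_Mapping.single ys (scale (of_nat (count_list (map \<pi> ys) u) / of_nat (length ys)) w)"
  unfolding e_def by (rule lin_ext_single) simp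

lemma e_L: assumes v: "v \<in> L m" shows "e u v \<in> L m"
  by (rule lin_in_L[OF lin_e sub_L v]) (simp add: e_single L_single subspace_scale[OF sub_W])

lemma qa_inj: "g \<in> carrier \<Gamma> \<Longrightarrow> inj_on (\<lambda>u. qa u g) Q"
  by (rule inj_on_inverseI[where g = "\<lambda>u. qa u (inv g)"]) (simp add: qa_mult qa_one)

lemma e_ac:
  assumes g: "g \<in> carrier \<Gamma>" and u: "u \<in> Q" and v: "v \<in> L m"
  shows "e (qa u g) (ac g v) = ac g (e u v)"
proof (rule lin_eq_L[OF lin_comp[OF lin_e lin_ac[OF g]] lin_comp[OF lin_ac[OF g] lin_e] v])
  fix ys w assume y: "ys \<in> tuples X m" "w \<in> W"
  have m: "map \<pi> (map (\<lambda>y. ra y g) ys) = map (\<lambda>u. qa u g) (map \<pi> ys)"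
    using tuplesD(2)[OF y(1)] g by (auto simp: \<pi>_equiv)
  have i: "inj_on (\<lambda>u. qa u g) (insert u (set (map \<pi> ys)))"
    by (rule inj_on_subset[OF qa_inj[OF g]]) (use tuplesD(2)[OF y(1)] u in \<open>auto simp: \<pi>_closed\<close>)
  have "count_list (map \<pi> (map (\<lambda>y. ra y g) ys)) (qa u g) = count_list (map \<pi> ys) u"
    unfolding m by (rule count_list_map_inj[OF i])
  then show "e (qa u g) (ac g (Poly_Mapping.single ys w)) = ac g (e u (Poly_Mapping.single ys w))"
    using g by (simp add: e_single lin_scale[OF lin_a] del: map_map)
qed

text \<open>
  The operators \<open>K u\<close> vanish on tuples without an entry over \<open>u\<close>; so the points of the individual tuples can be
  replaced by one finite set of points for the whole chain.
\<close>

lemma sum_over_support: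
  assumes K: "\<And>u. Vector_Spaces.linear ps ps (K u)" and F: "Vector_Spaces.linear ps ps F"
    and K0: "\<And>u ys w. u \<notin> set (map \<pi> ys) \<Longrightarrow> K u (Poly_Mapping.single ys w) = 0"
    and FK: "\<And>ys w. ys \<in> tuples X m \<Longrightarrow> w \<in> W \<Longrightarrow>
      F (Poly_Mapping.single ys w) = (\<Sum>u\<in>set (map \<pi> ys). K u (Poly_Mapping.single ys w))"
    and S: "finite S" "\<pi> ` \<Union>(set ` Poly_Mapping.keys v) \<subseteq> S" and v: "v \<in> L m"
  shows "F v = (\<Sum>u\<in>S. K u v)"
proof -
  let ?s = "\<lambda>ys. Poly_Mapping.single ys (Poly_Mapping.lookup v ys)"
  have "F v = (\<Sum>ys\<in>Poly_Mapping.keys v. F (?s ys))" by (subst fs_expand) (rule lin_sum[OF F])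
  also have "\<dots> = (\<Sum>ys\<in>Poly_Mapping.keys v. \<Sum>u\<in>S. K u (?s ys))"
  proof (rule sum.cong[OF refl])
    fix ys assume ys: "ys \<in> Poly_Mapping.keys v"
    then have "F (?s ys) = (\<Sum>u\<in>set (map \<pi> ys). K u (?s ys))" using v by (intro FK) (auto simp: L_def fin_supp_def)
    also have "\<dots> = (\<Sum>u\<in>S. K u (?s ys))"
      using S ys K0[of _ ys] by (intro sum.mono_neutral_left) force+
    finally show "F (?s ys) = (\<Sum>u\<in>S. K u (?s ys))" .
  qed
  also have "\<dots> = (\<Sum>u\<in>S. \<Sum>ys\<in>Poly_Mapping.keys v. K u (?s ys))" by (rule sum.swap)
  also have "\<dots> = (\<Sum>u\<in>S. K u v)" by (subst (4) fs_expand) (simp add: lin_sum[OF K])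
  finally show ?thesis .
qed

lemma e_single_0: "u \<notin> set (map \<pi> ys) \<Longrightarrow> e u (Poly_Mapping.single ys w) = 0"
  by (simp add: e_single count_list_0_iff)

lemma sum_e:
  assumes S: "finite S" "\<pi> ` \<Union>(set ` Poly_Mapping.keys v) \<subseteq> S" and v: "v \<in> L (Suc m)"
  shows "(\<Sum>u\<in>S. e u v) = v"
proof (rule sum_over_support[OF lin_e lin_id[OF vs_ps] e_single_0 _ S v, symmetric])
  fix ys w assume y: "ys \<in> tuples X (Suc m)"
  have "(\<Sum>u\<in>set (map \<pi> ys). of_nat (count_list (map \<pi> ys) u) / of_nat (length ys) :: 'k) =
    of_nat (\<Sum>u\<in>set (map \<pi> ys). count_list (map \<pi> ys) u) / of_nat (length ys)"
    by (simp add: sum_divide_distrib)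
  also have "\<dots> = 1" using tuplesD(1)[OF y] by (simp only: sum_count_set[OF subset_refl] finite_set length_map) (simp del: of_nat_Suc)
  finally show "Poly_Mapping.single ys w = (\<Sum>u\<in>set (map \<pi> ys). e u (Poly_Mapping.single ys w))"
    by (simp add: e_single flip: lin_sum[OF lin_single] scale_sum_left)
qed

end

text \<open>
  Preimages under \<open>d\<close> modulo \<open>B\<close> can be chosen linearly: a complement of \<open>B\<close> gives a projection \<open>p\<close>
  with kernel \<open>B\<close>, and \<open>p d\<close> has a linear right inverse on the image of \<open>A\<close>.
\<close>

lemma (in vector_space) linear_preimage_mod:
  assumes d: "Vector_Spaces.linear scale scale d" and A: "subspace A" and B: "subspace B"
  obtains q where "Vector_Spaces.linear scale scale q" "range q \<subseteq> A" "\<And>b. b \<in> B \<Longrightarrow> q b = 0"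
    "\<And>v a. a \<in> A \<Longrightarrow> v - d a \<in> B \<Longrightarrow> d (q v) - v \<in> B"
proof -
  interpret VP: vector_space_pair scale scale by unfold_locales
  obtain r where r: "range r \<subseteq> B" "Vector_Spaces.linear scale scale r" "\<And>b. b \<in> B \<Longrightarrow> r b = b"
    using VP.linear_exists_left_inverse_on[OF lin_id[OF vector_space_axioms] B] by auto
  define p where "p v = v - r v" for v
  have lp: "Vector_Spaces.linear scale scale p"
    unfolding p_def by (rule lin_minus[OF lin_id[OF vector_space_axioms] r(2)])
  have p0: "p v = 0 \<longleftrightarrow> v \<in> B" for v
    unfolding p_def using r(1) r(3)[of v] by (metis eq_iff_diff_eq_0 rangeI subsetD)
  obtain g where g: "range g \<subseteq> A" "Vector_Spaces.linear scale scale g" "\<And>v. v \<in> (\<lambda>x. p (d x)) ` A \<Longrightarrow> p (d (g v)) = v"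
    using VP.linear_exists_right_inverse_on[OF lin_comp[OF lp d] A] by blast
  show ?thesis
  proof
    show "Vector_Spaces.linear scale scale (\<lambda>v. g (p v))" by (rule lin_comp[OF g(2) lp])
    show "range (\<lambda>v. g (p v)) \<subseteq> A" using g(1) by auto
    show "g (p b) = 0" if "b \<in> B" for b using that by (simp add: iffD2[OF p0] lin_0[OF g(2)])
    show "d (g (p v)) - v \<in> B" if "a \<in> A" "v - d a \<in> B" for v a
    proof -
      have "p v = p (d a)" using that(2) p0[of "v - d a"] by (simp add: lin_diff[OF lp])
      then have "p (d (g (p v))) = p v" using g(3)[of "p v"] that(1) by simp
      then show ?thesis using p0[of "d (g (p v)) - v"] by (simp add: lin_diff[OF lp])
    qed
  qed
qed

text \<open>
  An acyclic complex \<open>A/B\<close> of \<open>\<Gamma>\<close>-modules need not stay acyclic on coinvariants. It does if it is relatively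
  projective, which is what compatibility with the partition of unity and trivial action of the stabilizers of points
  of \<open>Q\<close> achieve.
\<close>

locale relative_acyclic = gset_coeff scale \<Gamma> X ra a W Q qa u0 \<pi>
  for scale :: "'k::field_char_0 \<Rightarrow> 'm::ab_group_add \<Rightarrow> 'm" and \<Gamma> :: "('g, 'z) monoid_scheme" (structure)
    and X :: "'y set" and ra :: "'y \<Rightarrow> 'g \<Rightarrow> 'y" and a :: "'g \<Rightarrow> 'm \<Rightarrow> 'm" and W :: "'m set"
    and Q :: "'u set" and qa :: "'u \<Rightarrow> 'g \<Rightarrow> 'u" and u0 :: 'u and \<pi> :: "'y \<Rightarrow> 'u" +
  fixes A B :: "nat \<Rightarrow> ('y list \<Rightarrow>\<^sub>0 'm) set"
  assumes sub_A: "P.subspace (A m)" and sub_B: "P.subspace (B m)" and B_A: "B m \<subseteq> A m" and A_L: "A m \<subseteq> L m"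
    and A_0: "A 0 = {0}"
    and bd_A: "v \<in> A (Suc m) \<Longrightarrow> bd v \<in> A m" and bd_B: "v \<in> B (Suc m) \<Longrightarrow> bd v \<in> B m"
    and ac_A: "g \<in> carrier \<Gamma> \<Longrightarrow> v \<in> A m \<Longrightarrow> ac g v \<in> A m"
    and ac_B: "g \<in> carrier \<Gamma> \<Longrightarrow> v \<in> B m \<Longrightarrow> ac g v \<in> B m"
    and e_A: "v \<in> A m \<Longrightarrow> e u v \<in> A m" and e_B: "v \<in> B m \<Longrightarrow> e u v \<in> B m"
    and stabilizer: "g \<in> carrier \<Gamma> \<Longrightarrow> h \<in> carrier \<Gamma> \<Longrightarrow> qa u0 g = qa u0 h \<Longrightarrow> v \<in> L (Suc m) \<Longrightarrow>
      ac g v - ac h v \<in> B (Suc m)"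
    and exact: "v \<in> A (Suc m) \<Longrightarrow> bd v \<in> B m \<Longrightarrow> \<exists>v'\<in>A (Suc (Suc m)). v - bd v' \<in> B (Suc m)"
begin

definition preim :: "nat \<Rightarrow> ('y list \<Rightarrow>\<^sub>0 'm) \<Rightarrow> ('y list \<Rightarrow>\<^sub>0 'm)" where
  "preim m = (SOME q. Vector_Spaces.linear ps ps q \<and> range q \<subseteq> A (Suc (Suc m)) \<and> (\<forall>b\<in>B (Suc m). q b = 0) \<and>
     (\<forall>v. \<forall>a\<in>A (Suc (Suc m)). v - bd a \<in> B (Suc m) \<longrightarrow> bd (q v) - v \<in> B (Suc m)))"

lemma preim: "Vector_Spaces.linear ps ps (preim m)" "preim m v \<in> A (Suc (Suc m))"
  "v \<in> B (Suc m) \<Longrightarrow> preim m v = 0"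
  "v \<in> A (Suc m) \<Longrightarrow> bd v \<in> B m \<Longrightarrow> bd (preim m v) - v \<in> B (Suc m)"
proof -
  obtain q where "Vector_Spaces.linear ps ps q" "range q \<subseteq> A (Suc (Suc m))" "\<And>b. b \<in> B (Suc m) \<Longrightarrow> q b = 0"
    "\<And>v a. a \<in> A (Suc (Suc m)) \<Longrightarrow> v - bd a \<in> B (Suc m) \<Longrightarrow> bd (q v) - v \<in> B (Suc m)"
    using P.linear_preimage_mod[OF lin_bd sub_A sub_B] by blast
  then have "\<exists>q. Vector_Spaces.linear ps ps q \<and> range q \<subseteq> A (Suc (Suc m)) \<and> (\<forall>b\<in>B (Suc m). q b = 0) \<and>
     (\<forall>v. \<forall>a\<in>A (Suc (Suc m)). v - bd a \<in> B (Suc m) \<longrightarrow> bd (q v) - v \<in> B (Suc m))"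
    by (intro exI[of _ q]) simp
  from someI_ex[OF this, folded preim_def]
  have "Vector_Spaces.linear ps ps (preim m) \<and> range (preim m) \<subseteq> A (Suc (Suc m)) \<and> (\<forall>b\<in>B (Suc m). preim m b = 0) \<and>
     (\<forall>v. \<forall>a\<in>A (Suc (Suc m)). v - bd a \<in> B (Suc m) \<longrightarrow> bd (preim m v) - v \<in> B (Suc m))" .
  then show "Vector_Spaces.linear ps ps (preim m)" "preim m v \<in> A (Suc (Suc m))"
    "v \<in> B (Suc m) \<Longrightarrow> preim m v = 0"
    "v \<in> A (Suc m) \<Longrightarrow> bd v \<in> B m \<Longrightarrow> bd (preim m v) - v \<in> B (Suc m)"
    using exact[of v m] by blast+
qed

definition rep :: "'u \<Rightarrow> 'g" where "rep u = (SOME g. g \<in> carrier \<Gamma> \<and> u = qa u0 g)"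

lemma rep: "u \<in> Q \<Longrightarrow> rep u \<in> carrier \<Gamma>" "u \<in> Q \<Longrightarrow> qa u0 (rep u) = u"
proof -
  have "rep u \<in> carrier \<Gamma> \<and> u = qa u0 (rep u)" if "u \<in> Q"
    unfolding rep_def by (rule someI_ex) (use qa_trans[OF that] in blast)
  then show "u \<in> Q \<Longrightarrow> rep u \<in> carrier \<Gamma>" "u \<in> Q \<Longrightarrow> qa u0 (rep u) = u" by auto
qed

text \<open>
  The choice \<open>preim\<close> is used at the base point \<open>u0\<close> and transported to \<open>u\<close> by an element \<open>rep u\<close> that moves
  \<open>u0\<close> to \<open>u\<close>. Modulo \<open>B\<close> the result depends on \<open>u\<close> only, so the family is equivariant
  (\<open>preim_at_ac\<close>).
\<close>

definition preim_at :: "nat \<Rightarrow> 'u \<Rightarrow> ('y list \<Rightarrow>\<^sub>0 'm) \<Rightarrow> ('y list \<Rightarrow>\<^sub>0 'm)" where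
  "preim_at m u v = (if u \<in> Q then ac (rep u) (preim m (ac (inv (rep u)) v)) else 0)"

lemma lin_preim_at: "Vector_Spaces.linear ps ps (preim_at m u)"
  unfolding preim_at_def
  by (cases "u \<in> Q")
    (simp_all add: rep lin_zero[OF vs_ps vs_ps] lin_comp[OF lin_ac lin_comp[OF preim(1) lin_ac]])

lemma preim_at_A: "preim_at m u v \<in> A (Suc (Suc m))"
  by (simp add: preim_at_def ac_A preim(2) rep P.subspace_0[OF sub_A])

lemma preim_at_B: "v \<in> B (Suc m) \<Longrightarrow> preim_at m u v = 0"
  by (simp add: preim_at_def preim(3) ac_B rep lin_0[OF lin_ac])

lemma bd_preim_at:
  assumes u: "u \<in> Q" and v: "v \<in> A (Suc m)" "bd v \<in> B m"
  shows "bd (preim_at m u v) - v \<in> B (Suc m)"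
proof -
  have vL: "v \<in> L (Suc m)" using v A_L by blast
  have "bd (preim_at m u v) - v = ac (rep u) (bd (preim m (ac (inv (rep u)) v)) - ac (inv (rep u)) v)"
    using u vL by (simp add: preim_at_def bd_ac rep lin_diff[OF lin_ac] ac_inv)
  also have "\<dots> \<in> B (Suc m)" using u v by (intro ac_B preim(4) ac_A) (simp_all add: rep bd_ac ac_B)
  finally show ?thesis .
qed

lemma preim_at_ac:
  assumes u: "u \<in> Q" and g: "g \<in> carrier \<Gamma>" and v: "v \<in> L (Suc m)"
  shows "preim_at m (qa u g) (ac g v) - ac g (preim_at m u v) \<in> B (Suc (Suc m))"
proof -
  have ug: "qa u g \<in> Q" by (rule qa_closed[OF u g])
  let ?h = "rep (qa u g)" and ?h' = "rep u \<otimes> g"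
  have h: "?h \<in> carrier \<Gamma>" "?h' \<in> carrier \<Gamma>" using rep[OF ug] rep[OF u] g by auto
  have same: "qa u0 ?h = qa u0 ?h'" using rep[OF ug] rep[OF u] g u0 by (simp flip: qa_mult)
  let ?v = "ac (inv (rep u)) v"
  have v': "?v \<in> L (Suc m)" using rep[OF u] v by (simp add: ac_L)
  have e1: "ac (inv ?h') (ac g v) = ?v"
    using rep[OF u] g v by (simp add: ac_ac \<Gamma>.inv_mult_group flip: \<Gamma>.m_assoc)
  \<comment> \<open>The two ways to reach \<open>qa u g\<close> from the base point differ by an element of the stabilizer.\<close>
  have "qa u0 (?h' \<otimes> inv ?h) = qa (qa u0 ?h) (inv ?h)"
    using h u0 same by (simp add: qa_mult)
  also have "\<dots> = qa u0 \<one>" using h u0 by (simp add: qa_mult)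
  finally have st: "qa u0 (?h' \<otimes> inv ?h) = qa u0 \<one>" .
  have "ac (inv ?h) (ac g v) = ac (?h' \<otimes> inv ?h) ?v"
    using h rep[OF u] g v by (simp add: ac_ac \<Gamma>.m_assoc flip: \<Gamma>.m_assoc[of "inv (rep u)"])
  moreover have "ac (?h' \<otimes> inv ?h) ?v - ac \<one> ?v \<in> B (Suc m)"
    using h v' st by (intro stabilizer) auto
  ultimately have "ac (inv ?h) (ac g v) - ?v \<in> B (Suc m)" using v' by (simp add: ac_one)
  then have "preim m (ac (inv ?h) (ac g v)) = preim m ?v"
    using preim(3)[of _ m] lin_diff[OF preim(1)] by (metis eq_iff_diff_eq_0)
  then have p: "preim_at m (qa u g) (ac g v) = ac ?h (preim m ?v)" using ug by (simp add: preim_at_def)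
  have q: "preim m ?v \<in> L (Suc (Suc m))" using preim(2) A_L by blast
  have "ac g (preim_at m u v) = ac ?h' (preim m ?v)"
    using u rep[OF u] g q by (simp add: preim_at_def ac_ac)
  then show ?thesis using p stabilizer[OF h same q] by simp
qed

text \<open>
  The usual recursion for a contracting homotopy takes a preimage of \<open>v - htpy (bd v)\<close>. Here it is applied to the
  parts \<open>e u v\<close>, and each part uses the preimages that belong to its own point; this makes the sum
  equivariant.
\<close>

primrec htpy :: "nat \<Rightarrow> ('y list \<Rightarrow>\<^sub>0 'm) \<Rightarrow> ('y list \<Rightarrow>\<^sub>0 'm)" where
  "htpy 0 = (\<lambda>_. 0)"
| "htpy (Suc m) = lin_ext (\<lambda>ys w. \<Sum>u\<in>set (map \<pi> ys).
     preim_at m u (e u (Poly_Mapping.single ys w) - htpy m (bd (e u (Poly_Mapping.single ys w)))))"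

lemma lin_htpy: "Vector_Spaces.linear ps ps (htpy m)"
proof (induction m)
  case 0
  then show ?case by (simp add: lin_zero[OF vs_ps vs_ps])
next
  case (Suc m)
  have "Vector_Spaces.linear scale ps (\<lambda>w. preim_at m u (e u (Poly_Mapping.single ys w) - htpy m (bd (e u (Poly_Mapping.single ys w)))))"
    for u ys
    by (intro lin_comp[OF lin_preim_at] lin_minus lin_comp[OF lin_e lin_single]
        lin_comp[OF Suc] lin_comp[OF lin_bd lin_comp[OF lin_e lin_single]])
  then show ?case by (auto intro!: lin_ext_lin lin_sums[OF vs_scale vs_ps])
qed

definition K :: "nat \<Rightarrow> 'u \<Rightarrow> ('y list \<Rightarrow>\<^sub>0 'm) \<Rightarrow> ('y list \<Rightarrow>\<^sub>0 'm)" where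
  "K m u v = preim_at m u (e u v - htpy m (bd (e u v)))"

lemma lin_K: "Vector_Spaces.linear ps ps (K m u)"
  unfolding K_def
  by (intro lin_comp[OF lin_preim_at] lin_minus lin_e lin_comp[OF lin_htpy] lin_comp[OF lin_bd lin_e])

lemma htpy_single: "htpy (Suc m) (Poly_Mapping.single ys w) = (\<Sum>u\<in>set (map \<pi> ys). K m u (Poly_Mapping.single ys w))"
proof -
  have "K m u 0 = 0" for u by (rule lin_0[OF lin_K])
  then show ?thesis unfolding htpy.simps K_def[symmetric] by (intro lin_ext_single) simp
qed

lemma K_single_0: "u \<notin> set (map \<pi> ys) \<Longrightarrow> K m u (Poly_Mapping.single ys w) = 0"
  unfolding K_def
  by (subst (1 2) e_single_0) (simp_all add: lin_0[OF lin_bd] lin_0[OF lin_htpy] lin_0[OF lin_preim_at])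

lemma htpy_eq:
  assumes "finite S" "\<pi> ` \<Union>(set ` Poly_Mapping.keys v) \<subseteq> S" "v \<in> L m'"
  shows "htpy (Suc m) v = (\<Sum>u\<in>S. K m u v)"
  by (rule sum_over_support[OF lin_K lin_htpy K_single_0 htpy_single assms])

definition pts :: "('y list \<Rightarrow>\<^sub>0 'm) \<Rightarrow> 'u set" where "pts v = \<pi> ` \<Union>(set ` Poly_Mapping.keys v)"

lemma pts: "finite (pts v)" "v \<in> L m \<Longrightarrow> pts v \<subseteq> Q"
  unfolding pts_def L_def fin_supp_def using \<pi>_closed by (auto dest!: tuplesD(2))

lemmas htpy_pts = htpy_eq[OF pts(1), unfolded pts_def, OF subset_refl, folded pts_def]
lemmas sum_e_pts = sum_e[OF pts(1), unfolded pts_def, OF subset_refl, folded pts_def]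

lemma htpy_A: "v \<in> A m \<Longrightarrow> htpy m v \<in> A (Suc m)"
proof (cases m)
  case 0
  then show ?thesis by (simp add: P.subspace_0[OF sub_A])
next
  case (Suc k)
  assume "v \<in> A m"
  then have "v \<in> L m" using A_L by blast
  then show ?thesis
    using Suc by (simp only: htpy_pts) (auto simp: K_def intro!: P.subspace_sum[OF sub_A] preim_at_A)
qed

lemma htpy_B: "v \<in> B m \<Longrightarrow> htpy m v \<in> B (Suc m)"
proof (induction m arbitrary: v)
  case 0
  then show ?case by (simp add: P.subspace_0[OF sub_B])
next
  case (Suc m)
  have "v \<in> L (Suc m)" using Suc(2) B_A A_L by blast
  moreover have "K m u v = 0" for u
    unfolding K_def using Suc by (intro preim_at_B P.subspace_diff[OF sub_B] e_B Suc.IH bd_B)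
  ultimately show ?case by (simp only: htpy_pts) (simp add: P.subspace_0[OF sub_B])
qed

lemma htpy_ac:
  assumes "g \<in> carrier \<Gamma>" "v \<in> L m" shows "htpy m (ac g v) - ac g (htpy m v) \<in> B (Suc m)"
  using assms
proof (induction m arbitrary: v)
  case 0
  then show ?case by (simp add: lin_0[OF lin_ac] P.subspace_0[OF sub_B])
next
  case (Suc m)
  note g = Suc.prems(1)
  have KK: "K m (qa u g) (ac g v) - ac g (K m u v) \<in> B (Suc (Suc m))" if u: "u \<in> Q" and v: "v \<in> L (Suc m)" for u v
  proof -
    let ?v = "e u v - htpy m (bd (e u v))"
    have eL: "e u v \<in> L (Suc m)" by (rule e_L[OF v])
    have hL: "htpy m x \<in> L (Suc m)" if x: "x \<in> L m" for x
    proof (cases m)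
      case 0
      then show ?thesis by (simp add: P.subspace_0[OF sub_L])
    next
      case (Suc k)
      show ?thesis
        unfolding Suc htpy_pts[OF x] K_def
        by (intro P.subspace_sum[OF sub_L] subsetD[OF A_L] preim_at_A)
    qed
    have vL: "?v \<in> L (Suc m)" by (intro P.subspace_diff[OF sub_L] eL hL L_bd)
    define \<beta> where "\<beta> = htpy m (ac g (bd (e u v))) - ac g (htpy m (bd (e u v)))"
    have \<beta>: "\<beta> \<in> B (Suc m)" unfolding \<beta>_def by (rule Suc.IH[OF g L_bd[OF eL]])
    have "e (qa u g) (ac g v) - htpy m (bd (e (qa u g) (ac g v))) = ac g ?v - \<beta>"
      using g u v by (simp add: e_ac bd_ac lin_diff[OF lin_ac] \<beta>_def)
    then have "K m (qa u g) (ac g v) = preim_at m (qa u g) (ac g ?v)"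
      using preim_at_B[OF \<beta>] by (simp add: K_def lin_diff[OF lin_preim_at])
    then show ?thesis using preim_at_ac[OF u g vL] by (simp add: K_def)
  qed
  show ?case
  proof (rule lin_in_L[OF lin_minus[OF lin_comp[OF lin_htpy lin_ac[OF g]] lin_comp[OF lin_ac[OF g] lin_htpy]] sub_B Suc.prems(2)])
    fix ys w assume y: "ys \<in> tuples X (Suc m)" "w \<in> W"
    let ?v = "Poly_Mapping.single ys w"
    have Qs: "set (map \<pi> ys) \<subseteq> Q" using tuplesD(2)[OF y(1)] \<pi>_closed by auto
    have m: "set (map \<pi> (map (\<lambda>y. ra y g) ys)) = (\<lambda>u. qa u g) ` set (map \<pi> ys)"
      using tuplesD(2)[OF y(1)] g by (force simp: \<pi>_equiv)
    have "htpy (Suc m) (ac g ?v) = (\<Sum>u\<in>set (map \<pi> (map (\<lambda>y. ra y g) ys)). K m u (ac g ?v))"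
      using g by (simp only: ac_single htpy_single)
    also have "\<dots> = (\<Sum>u\<in>set (map \<pi> ys). K m (qa u g) (ac g ?v))"
      unfolding m by (rule sum.reindex[unfolded comp_def]) (rule inj_on_subset[OF qa_inj[OF g] Qs])
    finally have "htpy (Suc m) (ac g ?v) - ac g (htpy (Suc m) ?v) =
      (\<Sum>u\<in>set (map \<pi> ys). K m (qa u g) (ac g ?v) - ac g (K m u ?v))"
      by (simp only: htpy_single lin_sum[OF lin_ac[OF g]] sum_subtractf)
    also have "\<dots> \<in> B (Suc (Suc m))"
      using Qs by (intro P.subspace_sum[OF sub_B] KK L_single y) auto
    finally show "htpy (Suc m) (ac g ?v) - ac g (htpy (Suc m) ?v) \<in> B (Suc (Suc m))" .
  qed
qed

text \<open>
  By induction \<open>e u v - htpy (bd (e u v))\<close> is a cycle modulo \<open>B\<close>, so its preimage is a true preimage;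
  the parts add up to \<open>v\<close>.
\<close>

lemma htpy_contracts:
  assumes "v \<in> A (Suc m)" shows "bd (htpy (Suc m) v) + htpy m (bd v) - v \<in> B (Suc m)"
  using assms
proof (induction m arbitrary: v)
  case 0
  have *: "bd (K 0 u v) - e u v \<in> B (Suc 0)" if "u \<in> Q" for u
  proof -
    have "bd (e u v) = 0" using bd_A[OF e_A[OF 0]] by (simp add: A_0)
    then show ?thesis
      using bd_preim_at[OF that e_A[OF 0]] by (simp add: K_def P.subspace_0[OF sub_B])
  qed
  have vL: "v \<in> L (Suc 0)" using 0 A_L by blast
  have "bd (htpy (Suc 0) v) + htpy 0 (bd v) - v = (\<Sum>u\<in>pts v. bd (K 0 u v) - e u v)"
    unfolding htpy_pts[OF vL] by (simp add: lin_sum[OF lin_bd] sum_subtractf sum_e_pts[OF vL])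
  also have "\<dots> \<in> B (Suc 0)" using pts(2)[OF vL] by (intro P.subspace_sum[OF sub_B] *) auto
  finally show ?case .
next
  case (Suc m)
  have vL: "v \<in> L (Suc (Suc m))" using Suc.prems A_L by blast
  have *: "bd (K (Suc m) u v) + htpy (Suc m) (bd (e u v)) - e u v \<in> B (Suc (Suc m))" if u: "u \<in> Q" for u
  proof -
    let ?v = "e u v - htpy (Suc m) (bd (e u v))"
    have eA: "e u v \<in> A (Suc (Suc m))" by (rule e_A[OF Suc.prems])
    have "bd ?v = - (bd (htpy (Suc m) (bd (e u v))) + htpy m (bd (bd (e u v))) - bd (e u v))"
      by (simp add: lin_diff[OF lin_bd] bd_bd lin_0[OF lin_htpy])
    also have "\<dots> \<in> B (Suc m)" by (intro P.subspace_neg[OF sub_B] Suc.IH bd_A eA)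
    finally have "bd (preim_at (Suc m) u ?v) - ?v \<in> B (Suc (Suc m))"
      by (intro bd_preim_at[OF u] P.subspace_diff[OF sub_A] eA htpy_A bd_A)
    then show ?thesis by (simp add: K_def algebra_simps)
  qed
  have "htpy (Suc m) (bd v) = (\<Sum>u\<in>pts v. htpy (Suc m) (bd (e u v)))"
    by (subst (1) sum_e_pts[OF vL, symmetric]) (simp add: lin_sum[OF lin_bd] lin_sum[OF lin_htpy] del: htpy.simps)
  then have "bd (htpy (Suc (Suc m)) v) + htpy (Suc m) (bd v) - v =
      (\<Sum>u\<in>pts v. bd (K (Suc m) u v) + htpy (Suc m) (bd (e u v)) - e u v)"
    unfolding htpy_pts[OF vL]
    by (simp add: lin_sum[OF lin_bd] sum_subtractf sum.distrib sum_e_pts[OF vL] del: htpy.simps)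
  also have "\<dots> \<in> B (Suc (Suc m))" using pts(2)[OF vL] by (intro P.subspace_sum[OF sub_B] *) auto
  finally show ?case .
qed

lemma htpy_Rel:
  assumes "r \<in> Rel m" shows "htpy m r \<in> ssum (B (Suc m)) (Rel (Suc m))"
proof (rule Rel_in[OF lin_htpy P.subspace_sums[OF sub_B sub_Rel] assms])
  fix g v assume gv: "g \<in> carrier \<Gamma>" "v \<in> L m"
  have "htpy m v \<in> L (Suc m)"
  proof (cases m)
    case 0
    then show ?thesis by (simp add: P.subspace_0[OF sub_L])
  next
    case (Suc k)
    show ?thesis
      unfolding Suc htpy_pts[OF gv(2)] K_def
      by (intro P.subspace_sum[OF sub_L] subsetD[OF A_L] preim_at_A)
  qed
  then have "ac g (htpy m v) - htpy m v \<in> Rel (Suc m)" by (rule ac_Rel[OF gv(1)])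
  moreover have "htpy m (ac g v) - htpy m v = (htpy m (ac g v) - ac g (htpy m v)) + (ac g (htpy m v) - htpy m v)" by simp
  ultimately show "htpy m (ac g v) - htpy m v \<in> ssum (B (Suc m)) (Rel (Suc m))" using htpy_ac[OF gv] by blast
qed

text \<open>
  An equivariant contracting homotopy descends to coinvariants. In the lowest degree \<open>m = 0\<close> the homotopy on
  \<open>bd v\<close> is zero by definition.
\<close>

theorem coinvariants_acyclic:
  assumes v: "v \<in> A (Suc m)" and bv: "m > 0 \<Longrightarrow> bd v \<in> ssum (B m) (Rel m)"
  shows "\<exists>v'\<in>A (Suc (Suc m)). v - bd v' \<in> ssum (B (Suc m)) (Rel (Suc m))"
proof -
  have S: "P.subspace (ssum (B (Suc m)) (Rel (Suc m)))" by (rule P.subspace_sums[OF sub_B sub_Rel])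
  have B_S: "\<beta> \<in> ssum (B (Suc m)) (Rel (Suc m))" if "\<beta> \<in> B (Suc m)" for \<beta>
  proof -
    have "\<beta> = \<beta> + 0 \<and> \<beta> \<in> B (Suc m) \<and> 0 \<in> Rel (Suc m)" using that P.subspace_0[OF sub_Rel] by simp
    then show ?thesis by blast
  qed
  have "htpy m (bd v) \<in> ssum (B (Suc m)) (Rel (Suc m))"
  proof (cases "m = 0")
    case True
    then show ?thesis using P.subspace_0[OF S] by simp
  next
    case False
    then obtain \<beta> r where br: "bd v = \<beta> + r" "\<beta> \<in> B m" "r \<in> Rel m" using bv by auto
    then show ?thesis
      using P.subspace_add[OF S B_S[OF htpy_B[OF br(2)]] htpy_Rel[OF br(3)]] by (simp add: lin_add[OF lin_htpy])
  qed
  then have "htpy m (bd v) - (bd (htpy (Suc m) v) + htpy m (bd v) - v) \<in> ssum (B (Suc m)) (Rel (Suc m))"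
    by (rule P.subspace_diff[OF S _ B_S[OF htpy_contracts[OF v]]])
  moreover have "htpy m (bd v) - (bd (htpy (Suc m) v) + htpy m (bd v) - v) = v - bd (htpy (Suc m) v)" by simp
  ultimately have "v - bd (htpy (Suc m) v) \<in> ssum (B (Suc m)) (Rel (Suc m))" by (simp only:)
  then show ?thesis using htpy_A[OF v] by blast
qed

end

section \<open>Alternating chains\<close>

context coeff_space
begin

text \<open>
  The quotient by these relations is the space of alternating chains.
\<close>

definition Alt :: "'u set \<Rightarrow> 'm set \<Rightarrow> nat \<Rightarrow> ('u list \<Rightarrow>\<^sub>0 'm) set" where
  "Alt U W m = P.span {Poly_Mapping.single (zs @ y # z # ys) w + Poly_Mapping.single (zs @ z # y # ys) w |zs y z ys w.
     zs @ y # z # ys \<in> tuples U m \<and> w \<in> W}"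

lemma sub_Alt: "P.subspace (Alt U W m)" by (simp add: Alt_def)

lemma Alt_gen: "zs @ y # z # ys \<in> tuples U m \<Longrightarrow> w \<in> W \<Longrightarrow>
    Poly_Mapping.single (zs @ y # z # ys) w + Poly_Mapping.single (zs @ z # y # ys) w \<in> Alt U W m"
  unfolding Alt_def by (rule P.span_base) blast

lemma Alt_in:
  assumes F: "Vector_Spaces.linear ps s F" and S: "module.subspace s S" and v: "v \<in> Alt U W m"
    and g: "\<And>zs y z ys w. zs @ y # z # ys \<in> tuples U m \<Longrightarrow> w \<in> W \<Longrightarrow>
      F (Poly_Mapping.single (zs @ y # z # ys) w) + F (Poly_Mapping.single (zs @ z # y # ys) w) \<in> S"
  shows "F v \<in> S"
  by (rule lin_span_in[OF F S v[unfolded Alt_def]]) (auto simp: lin_add[OF F] g)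

lemma swap_tuples: "zs @ y # z # ys \<in> tuples U m \<longleftrightarrow> zs @ z # y # ys \<in> tuples U m"
  by (auto simp: tuples_def)

lemma Alt_L: assumes W: "subspace W" shows "Alt U W m \<subseteq> fin_supp (tuples U m) W"
proof
  fix v assume v: "v \<in> Alt U W m"
  show "v \<in> fin_supp (tuples U m) W"
    by (rule Alt_in[OF lin_id[OF vs_ps] sub_fin_supp[OF W] v])
      (auto intro!: P.subspace_add[OF sub_fin_supp[OF W]] fin_supp_single[OF _ _ W] simp: swap_tuples)
qed

lemma Alt_0: "Alt U W 0 = {0}"
proof -
  have "zs @ y # z # ys \<notin> tuples U 0" for zs ys y z by (simp add: tuples_0)
  then show ?thesis unfolding Alt_def by simp
qed

lemma cone_Alt: assumes u: "u \<in> U" and v: "v \<in> Alt U W m" shows "cone u v \<in> Alt U W (Suc m)"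
proof (rule Alt_in[OF lin_push sub_Alt v])
  fix zs y z ys w assume "zs @ y # z # ys \<in> tuples U m" "w \<in> W"
  then show "cone u (Poly_Mapping.single (zs @ y # z # ys) w) + cone u (Poly_Mapping.single (zs @ z # y # ys) w) \<in> Alt U W (Suc m)"
    using Alt_gen[of "u # zs" y z ys U "Suc m" w W] u by simp
qed

lemma tmap_Alt:
  assumes c: "Vector_Spaces.linear scale scale c" and F: "\<And>u. u \<in> U \<Longrightarrow> F u \<in> U'" and cW: "\<And>w. w \<in> W \<Longrightarrow> c w \<in> W'"
    and v: "v \<in> Alt U W m"
  shows "tmap F c v \<in> Alt U' W' m"
proof (rule Alt_in[OF lin_tmap[OF c] sub_Alt v])
  fix zs y z ys w assume y: "zs @ y # z # ys \<in> tuples U m" "w \<in> W"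
  then show "tmap F c (Poly_Mapping.single (zs @ y # z # ys) w) + tmap F c (Poly_Mapping.single (zs @ z # y # ys) w) \<in> Alt U' W' m"
    using Alt_gen[of "map F zs" "F y" "F z" "map F ys" U' m "c w" W'] map_tuples[OF y(1), of F U'] F cW c by simp
qed

lemma bd_Alt:
  assumes W: "subspace W" and v: "v \<in> Alt U W (Suc m)" shows "bd v \<in> Alt U W m"
proof (rule Alt_in[OF lin_bd sub_Alt v])
  fix zs y z ys w assume "zs @ y # z # ys \<in> tuples U (Suc m)" and w: "w \<in> W"
  then show "bd (Poly_Mapping.single (zs @ y # z # ys) w) + bd (Poly_Mapping.single (zs @ z # y # ys) w) \<in> Alt U W m"
  proof (induction zs arbitrary: m)
    case Nil
    then obtain k where m: "m = Suc k" and ys: "ys \<in> tuples U k" and yz: "y \<in> U" "z \<in> U"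
      by (cases m) (auto simp: tuples_0)
    have lin: "Vector_Spaces.linear ps ps (\<lambda>v. cone y (cone z v) + cone z (cone y v))"
      by (intro lin_plus lin_comp[OF lin_push lin_push])
    have "cone y (cone z (bd (Poly_Mapping.single ys w))) + cone z (cone y (bd (Poly_Mapping.single ys w))) \<in> Alt U W m"
    proof (cases k)
      case 0
      then have "ys = []" using ys by (simp add: tuples_0)
      then show ?thesis by (simp add: bd_Nil lin_0[OF lin_push] P.subspace_0[OF sub_Alt])
    next
      case (Suc j)
      have b: "bd (Poly_Mapping.single ys w) \<in> fin_supp (tuples U j) W"
        using ys w Suc by (intro bd_L[OF W] fin_supp_single[OF _ _ W]) simp_all
      show ?thesis
      proof (rule lin_in_fin_supp[OF lin sub_Alt b])
        fix us v assume "us \<in> tuples U j" "v \<in> W"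
        then show "cone y (cone z (Poly_Mapping.single us v)) + cone z (cone y (Poly_Mapping.single us v)) \<in> Alt U W m"
          using yz m Suc Alt_gen[of "[]" y z us U m v W] by simp
      qed
    qed
    then show ?case by (simp add: bd_Cons lin_diff[OF lin_push])
  next
    case (Cons u zs)
    then obtain k where m: "m = Suc k" by (cases m) (auto simp: tuples_0)
    have t: "zs @ y # z # ys \<in> tuples U (Suc k)" and u: "u \<in> U" using Cons.prems m by auto
    have "bd (Poly_Mapping.single ((u # zs) @ y # z # ys) w) + bd (Poly_Mapping.single ((u # zs) @ z # y # ys) w) =
      (Poly_Mapping.single (zs @ y # z # ys) w + Poly_Mapping.single (zs @ z # y # ys) w) -
      cone u (bd (Poly_Mapping.single (zs @ y # z # ys) w) + bd (Poly_Mapping.single (zs @ z # y # ys) w))"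
      by (simp add: bd_Cons lin_add[OF lin_push])
    also have "\<dots> \<in> Alt U W m"
      unfolding m by (intro P.subspace_diff[OF sub_Alt] Alt_gen cone_Alt u Cons.IH t w)
    finally show ?case .
  qed
qed

text \<open>
  Moving an entry past \<open>ys\<close> takes \<open>length ys\<close> exchanges of neighbours.
\<close>

lemma rotate_Alt:
  assumes "zs @ y # ys \<in> tuples U m" "w \<in> W"
  shows "Poly_Mapping.single (zs @ y # ys) w - ps ((-1) ^ length ys) (Poly_Mapping.single (zs @ ys @ [y]) w) \<in> Alt U W m"
  using assms(1)
proof (induction ys arbitrary: zs)
  case Nil
  then show ?case by (simp add: P.subspace_0[OF sub_Alt] del: ps_single)
next
  case (Cons z ys)
  let ?s = "\<lambda>l. Poly_Mapping.single l w"
  have "zs @ z # y # ys \<in> tuples U m" by (rule iffD1[OF swap_tuples Cons.prems])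
  then have r: "?s ((zs @ [z]) @ y # ys) - ps ((-1) ^ length ys) (?s ((zs @ [z]) @ ys @ [y])) \<in> Alt U W m"
    by (intro Cons.IH) simp
  have s: "?s (zs @ y # z # ys) + ?s (zs @ z # y # ys) \<in> Alt U W m" by (rule Alt_gen[OF Cons.prems assms(2)])
  show ?case using P.subspace_diff[OF sub_Alt s r] by (simp add: single_uminus)
qed

end

section \<open>Tuples twisted by a group element\<close>

lemma (in group) subgroup_centralizer:
  assumes x: "x \<in> carrier G" shows "subgroup (centralizer G x) G"
proof (rule subgroupI)
  show "centralizer G x \<subseteq> carrier G" by (auto simp: centralizer_def)
  show "centralizer G x \<noteq> {}" using x by (auto simp: centralizer_def)
  show "inv g \<in> centralizer G x" if "g \<in> centralizer G x" for g
  proof -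
    have g: "g \<in> carrier G" "g \<otimes> x = x \<otimes> g" using that by (auto simp: centralizer_def)
    have "x \<otimes> inv g = inv g \<otimes> (g \<otimes> x) \<otimes> inv g" using g(1) x by (simp flip: m_assoc)
    also have "\<dots> = inv g \<otimes> x" unfolding g(2) using g(1) x by (simp add: m_assoc)
    finally have "x \<otimes> inv g = inv g \<otimes> x" .
    then show ?thesis using g by (simp add: centralizer_def)
  qed
  show "g \<otimes> h \<in> centralizer G x" if "g \<in> centralizer G x" "h \<in> centralizer G x" for g h
    using that x by (auto simp: centralizer_def m_assoc) (simp flip: m_assoc)
qed

text \<open>
  The summand of \<open>x\<close> in a modular crossed module: \<open>W\<close> is the homogeneous part of degree \<open>x\<close>, and the last
  assumption is modularity.
\<close>

locale twisted_coeff = coeff_space scale + G: group G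
  for scale :: "'k::field_char_0 \<Rightarrow> 'm::ab_group_add \<Rightarrow> 'm" and G :: "('g, 'z) monoid_scheme" (structure) +
  fixes a :: "'g \<Rightarrow> 'm \<Rightarrow> 'm" and W :: "'m set" and x :: 'g
  assumes sub_W: "subspace W" and x: "x \<in> carrier G"
    and lin_a: "g \<in> carrier G \<Longrightarrow> Vector_Spaces.linear scale scale (a g)"
    and a_mult: "g \<in> carrier G \<Longrightarrow> h \<in> carrier G \<Longrightarrow> a (g \<otimes> h) m = a g (a h m)"
    and a_one: "a \<one> m = m"
    and a_closed: "g \<in> centralizer G x \<Longrightarrow> w \<in> W \<Longrightarrow> a g w \<in> W"
    and a_x: "w \<in> W \<Longrightarrow> a x w = w"
begin

text \<open>
  The map \<open>\<pi>\<close> writes \<open>h\<close> as \<open>r g\<close> with the chosen representative \<open>r\<close> of its left coset of the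
  centralizer, and takes the coset of \<open>g\<close> modulo the powers of \<open>x\<close>.
\<close>

definition \<Gamma> :: "('g, 'z) monoid_scheme" where "\<Gamma> = G\<lparr>carrier := centralizer G x\<rparr>"
definition cyc_x :: "'g set" where "cyc_x = generate G {x}"
definition Q :: "'g set set" where "Q = carrier (centralizer_quot G x)"
definition qa :: "'g set \<Rightarrow> 'g \<Rightarrow> 'g set" where "qa U g = U #> g"
definition coset_rep :: "'g \<Rightarrow> 'g" where "coset_rep h = (SOME r. r \<in> {h \<otimes> g |g. g \<in> centralizer G x})"
definition \<pi> :: "'g \<Rightarrow> 'g set" where "\<pi> h = cyc_x #> (inv (coset_rep h) \<otimes> h)"

lemmas cent_sub = G.subgroup_centralizer[OF x]

lemma group_\<Gamma>: "group \<Gamma>" unfolding \<Gamma>_def by (rule subgroup.subgroup_is_group[OF cent_sub G.is_group])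

lemma \<Gamma>_simps [simp]: "carrier \<Gamma> = centralizer G x" "mult \<Gamma> = mult G" "one \<Gamma> = one G"
  by (simp_all add: \<Gamma>_def)

lemma centD: "g \<in> centralizer G x \<Longrightarrow> g \<in> carrier G" "g \<in> centralizer G x \<Longrightarrow> g \<otimes> x = x \<otimes> g"
  by (auto simp: centralizer_def)

lemma x_cent: "x \<in> centralizer G x" using x by (simp add: centralizer_def)

lemma cyc_x: "cyc_x = {x [^] k |k::int. True}"
  unfolding cyc_x_def using G.generate_pow[OF x] by simp

lemma cyc_x_sub: "subgroup cyc_x G" unfolding cyc_x_def by (rule G.generate_is_subgroup) (simp add: x)

lemma cyc_x_carrier: "cyc_x \<subseteq> carrier G" by (rule subgroup.subset[OF cyc_x_sub])

lemma Q: "Q = {cyc_x #> g |g. g \<in> centralizer G x}"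
  unfolding Q_def centralizer_quot_def FactGroup_def RCOSETS_def cyc_x_def r_coset_def by auto

lemma Q_coset: "cyc_x #> g \<in> Q" if "g \<in> centralizer G x" using that Q by blast

lemma QE: assumes "u \<in> Q" obtains g where "g \<in> centralizer G x" "u = cyc_x #> g" using assms Q by blast

lemma coset_coset: "g \<in> carrier G \<Longrightarrow> h \<in> carrier G \<Longrightarrow> (cyc_x #> g) #> h = cyc_x #> (g \<otimes> h)"
  by (rule G.coset_mult_assoc[OF cyc_x_carrier])

lemma cyc_x_one: "cyc_x #> \<one> = cyc_x" by (rule G.coset_mult_one[OF cyc_x_carrier])

lemma cyc_x_x: "cyc_x #> x = cyc_x"
  by (rule G.coset_join2[OF x cyc_x_sub]) (simp add: cyc_x_def generate.incl)

lemma coset_rep: assumes h: "h \<in> carrier G"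
  shows "coset_rep h \<in> carrier G" "inv (coset_rep h) \<otimes> h \<in> centralizer G x"
proof -
  have "h \<in> {h \<otimes> g |g. g \<in> centralizer G x}"
    using h subgroup.one_closed[OF cent_sub] by (auto intro!: exI[of _ \<one>])
  then have "coset_rep h \<in> {h \<otimes> g |g. g \<in> centralizer G x}"
    unfolding coset_rep_def by (rule someI)
  then obtain g where g: "g \<in> centralizer G x" "coset_rep h = h \<otimes> g" by blast
  then show "coset_rep h \<in> carrier G" using h centD by simp
  have "inv (coset_rep h) \<otimes> h = inv g" using g h centD by (simp add: G.inv_mult_group G.m_assoc)
  then show "inv (coset_rep h) \<otimes> h \<in> centralizer G x" using g subgroup.m_inv_closed[OF cent_sub] by simp
qed

lemma coset_rep_mult:
  assumes h: "h \<in> carrier G" and g: "g \<in> centralizer G x" shows "coset_rep (h \<otimes> g) = coset_rep h"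
proof -
  have "{h \<otimes> g \<otimes> k |k. k \<in> centralizer G x} = {h \<otimes> k |k. k \<in> centralizer G x}"
  proof
    show "{h \<otimes> g \<otimes> k |k. k \<in> centralizer G x} \<subseteq> {h \<otimes> k |k. k \<in> centralizer G x}"
      using h g subgroup.m_closed[OF cent_sub] centD by (auto simp: G.m_assoc)
    show "{h \<otimes> k |k. k \<in> centralizer G x} \<subseteq> {h \<otimes> g \<otimes> k |k. k \<in> centralizer G x}"
    proof
      fix y assume "y \<in> {h \<otimes> k |k. k \<in> centralizer G x}"
      then obtain k where k: "k \<in> centralizer G x" "y = h \<otimes> k" by blast
      then have "y = h \<otimes> g \<otimes> (inv g \<otimes> k)" using h g centD by (simp add: G.m_assoc flip: G.m_assoc[of g])
      moreover have "inv g \<otimes> k \<in> centralizer G x"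
        using g k by (intro subgroup.m_closed[OF cent_sub] subgroup.m_inv_closed[OF cent_sub])
      ultimately show "y \<in> {h \<otimes> g \<otimes> k |k. k \<in> centralizer G x}" by blast
    qed
  qed
  then show ?thesis by (simp add: coset_rep_def)
qed

lemma \<pi>_Q: "h \<in> carrier G \<Longrightarrow> \<pi> h \<in> Q" unfolding \<pi>_def by (intro Q_coset coset_rep)

lemma \<pi>_mult: "h \<in> carrier G \<Longrightarrow> g \<in> centralizer G x \<Longrightarrow> \<pi> (h \<otimes> g) = qa (\<pi> h) g"
  unfolding \<pi>_def qa_def by (simp add: coset_rep_mult coset_coset coset_rep centD G.m_assoc)

lemma qa_x: assumes u: "u \<in> Q" shows "qa u x = u"
proof -
  obtain g where g: "g \<in> centralizer G x" "u = cyc_x #> g" by (rule QE[OF u])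
  have "qa u x = cyc_x #> (x \<otimes> g)" using g x centD by (simp add: qa_def coset_coset)
  also have "\<dots> = (cyc_x #> x) #> g" using x g centD by (simp add: coset_coset)
  finally show ?thesis using g cyc_x_x by simp
qed

lemma \<pi>_x: "h \<in> carrier G \<Longrightarrow> \<pi> (h \<otimes> x) = \<pi> h" by (simp add: \<pi>_mult x_cent qa_x \<pi>_Q)

lemma \<pi>_surj: assumes u: "u \<in> Q" shows "\<exists>h\<in>carrier G. \<pi> h = u"
proof -
  obtain g where g: "g \<in> centralizer G x" "u = cyc_x #> g" by (rule QE[OF u])
  let ?r = "coset_rep \<one>"
  have r: "?r \<in> carrier G" "inv ?r \<in> centralizer G x" using coset_rep[of \<one>] by auto
  then have rc: "?r \<in> centralizer G x" using subgroup.m_inv_closed[OF cent_sub, of "inv ?r"] by simp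
  have "coset_rep (\<one> \<otimes> (?r \<otimes> g)) = ?r" by (rule coset_rep_mult) (simp_all add: subgroup.m_closed[OF cent_sub] rc g)
  then have "\<pi> (?r \<otimes> g) = u" using r g centD by (simp add: \<pi>_def flip: G.m_assoc)
  then show ?thesis using r g centD by (intro bexI[of _ "?r \<otimes> g"]) auto
qed

text \<open>
  Two sets of vertices are used: the group \<open>G\<close>, from which the cyclic object is built, and the cosets
  \<open>Q\<close>, from which the standard resolution of the quotient group is built.
\<close>

sublocale C: gset_coeff scale \<Gamma> "carrier G" "\<lambda>y g. y \<otimes> g" a W Q qa cyc_x \<pi>
proof (intro gset_coeff.intro gset_coeff_axioms.intro)
  show "coeff_space scale" by (rule coeff_space_axioms)
  show "group \<Gamma>" by (rule group_\<Gamma>)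
  show "\<And>g. g \<in> carrier \<Gamma> \<Longrightarrow> Vector_Spaces.linear scale scale (a g)" by (simp add: lin_a centD)
  show "\<And>u. u \<in> Q \<Longrightarrow> \<exists>g\<in>carrier \<Gamma>. u = qa cyc_x g" using Q by (auto simp: qa_def)
  show "\<And>u g. u \<in> Q \<Longrightarrow> g \<in> carrier \<Gamma> \<Longrightarrow> qa u g \<in> Q"
    by (erule QE) (simp add: qa_def coset_coset centD Q_coset subgroup.m_closed[OF cent_sub])
  show "\<And>u g h. u \<in> Q \<Longrightarrow> g \<in> carrier \<Gamma> \<Longrightarrow> h \<in> carrier \<Gamma> \<Longrightarrow> qa (qa u g) h = qa u (g \<otimes>\<^bsub>\<Gamma>\<^esub> h)"
    by (erule QE) (simp add: qa_def coset_coset centD G.m_assoc)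
  show "\<And>u. u \<in> Q \<Longrightarrow> qa u \<one>\<^bsub>\<Gamma>\<^esub> = u"
    by (erule QE) (simp add: qa_def coset_coset centD)
  show "cyc_x \<in> Q" using Q_coset[of \<one>] subgroup.one_closed[OF cent_sub] by (simp add: cyc_x_one)
qed (simp_all add: sub_W a_mult a_one a_closed centD G.m_assoc \<pi>_Q \<pi>_mult)

sublocale D: gset_coeff scale \<Gamma> Q qa a W Q qa cyc_x "\<lambda>u. u"
proof (intro gset_coeff.intro gset_coeff_axioms.intro)
  show "coeff_space scale" by (rule coeff_space_axioms)
  show "group \<Gamma>" by (rule group_\<Gamma>)
  show "\<And>g. g \<in> carrier \<Gamma> \<Longrightarrow> Vector_Spaces.linear scale scale (a g)" by (simp add: lin_a centD)
  show "\<And>u. u \<in> Q \<Longrightarrow> \<exists>g\<in>carrier \<Gamma>. u = qa cyc_x g" by (rule C.qa_trans)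
qed (use C.qa_closed C.qa_mult C.qa_one C.u0 sub_W a_mult a_one a_closed centD in simp_all)

end

lemma (in gset_coeff) stabilizer_mod:
  assumes S: "P.subspace S" "\<And>g v. g \<in> carrier \<Gamma> \<Longrightarrow> v \<in> S \<Longrightarrow> ac g v \<in> S"
    and x: "x \<in> carrier \<Gamma>" "\<And>v. v \<in> L m \<Longrightarrow> ac x v - v \<in> S"
    and h: "h \<in> carrier \<Gamma>" and v: "v \<in> L m"
  shows "ac (x [^] (i::int) \<otimes> h) v - ac h v \<in> S"
proof -
  have nat: "ac (x [^] (k::nat)) v - v \<in> S" if v: "v \<in> L m" for k v
  proof (induction k)
    case 0
    then show ?case using v by (simp add: ac_one P.subspace_0[OF S(1)])
  next
    case (Suc k)
    have "ac (x [^] Suc k) v - v = (ac x (ac (x [^] k) v) - ac (x [^] k) v) + (ac (x [^] k) v - v)"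
      using x(1) v by (simp add: ac_ac)
    then show ?case using x v by (metis P.subspace_add[OF S(1)] Suc ac_L \<Gamma>.nat_pow_closed)
  qed
  have int: "ac (x [^] i) v - v \<in> S"
  proof (cases i rule: int_cases2)
    case (nonneg k)
    then show ?thesis using nat[OF v] by (simp add: int_pow_int)
  next
    case (nonpos k)
    let ?v = "ac (inv (x [^] k)) v"
    have "?v \<in> L m" using x(1) v by (simp add: ac_L)
    then have "- (ac (x [^] k) ?v - ?v) \<in> S" by (intro P.subspace_neg[OF S(1)] nat)
    moreover have "- (ac (x [^] k) ?v - ?v) = ac (x [^] i) v - v"
      using x(1) v nonpos by (simp add: ac_inv \<Gamma>.int_pow_neg int_pow_int)
    ultimately show ?thesis by simp
  qed
  have "ac (x [^] i \<otimes> h) v - ac h v = ac h (ac (x [^] i) v - v)"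
    using x(1) h v by (simp add: ac_ac lin_diff[OF lin_ac])
  then show ?thesis using S(2)[OF h int] by simp
qed

context twisted_coeff
begin

lemma same_coset:
  assumes g: "g \<in> centralizer G x" and h: "h \<in> centralizer G x" and e: "qa cyc_x g = qa cyc_x h"
  shows "\<exists>i::int. g = x [^]\<^bsub>\<Gamma>\<^esub> i \<otimes>\<^bsub>\<Gamma>\<^esub> h"
proof -
  have "g \<in> cyc_x #> h"
    using G.rcos_self[OF centD(1)[OF g] cyc_x_sub] e by (simp add: qa_def)
  then obtain i :: int where i: "g = x [^] i \<otimes> h" by (auto simp: r_coset_def cyc_x)
  have "x [^]\<^bsub>\<Gamma>\<^esub> i = x [^] i" unfolding \<Gamma>_def by (rule G.int_pow_consistent[OF cent_sub x_cent, symmetric])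
  then show ?thesis using i by (intro exI[of _ i]) simp
qed

lemma a_inv_x: assumes w: "w \<in> W" shows "a (inv\<^bsub>\<Gamma>\<^esub> x) w = w"
proof -
  have "a (inv\<^bsub>\<Gamma>\<^esub> x) (a x w) = w"
    using C.a_mult[of "inv\<^bsub>\<Gamma>\<^esub> x" x w] C.\<Gamma>.inv_closed[of x] C.\<Gamma>.l_inv[of x] x_cent C.a_one
    by (simp del: \<Gamma>_simps(2,3) add: \<Gamma>_simps(1))
  then show ?thesis by (simp add: a_x w)
qed

lemma ac_x_single:
  "w \<in> W \<Longrightarrow> C.ac x (Poly_Mapping.single ys w) = Poly_Mapping.single (map (\<lambda>y. y \<otimes> x) ys) w"
  using x_cent by (simp add: a_inv_x)

subsection \<open>Alternation over the cosets of the cyclic subgroup\<close>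

lemma e_Alt: assumes v: "v \<in> Alt Q W m" shows "D.e u v \<in> Alt Q W m"
proof (rule Alt_in[OF D.lin_e sub_Alt v])
  fix zs y z ys w assume y: "zs @ y # z # ys \<in> tuples Q m" "w \<in> W"
  have "count_list (zs @ z # y # ys) u = count_list (zs @ y # z # ys) u" by simp
  then show "D.e u (Poly_Mapping.single (zs @ y # z # ys) w) + D.e u (Poly_Mapping.single (zs @ z # y # ys) w) \<in> Alt Q W m"
    using Alt_gen[OF y(1) subspace_scale[OF sub_W y(2)]] by (simp add: D.e_single)
qed

lemma D_ac_x: assumes v: "v \<in> D.L m" shows "D.ac x v = v"
proof (rule D.lin_eq_L[OF D.lin_ac lin_id[OF vs_ps] v])
  fix us w assume u: "us \<in> tuples Q m" "w \<in> W"
  then have "map (\<lambda>u. qa u x) us = us" using tuplesD(2)[OF u(1)] by (auto intro!: map_idI qa_x)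
  then show "D.ac x (Poly_Mapping.single us w) = Poly_Mapping.single us w" using x_cent u by (simp add: a_inv_x)
qed (simp add: x_cent)

text \<open>
  Over \<open>Q\<close> the powers of \<open>x\<close> act trivially, so the stabilizers act trivially and \<open>B = 0\<close> is possible. The
  alternating relations are contractible, by coning from the base point.
\<close>

lemma Alt_relative_acyclic: "relative_acyclic scale \<Gamma> Q qa a W Q qa cyc_x (\<lambda>u. u) (Alt Q W) (\<lambda>_. {0})"
proof (intro relative_acyclic.intro relative_acyclic_axioms.intro)
  show "gset_coeff scale \<Gamma> Q qa a W Q qa cyc_x (\<lambda>u. u)" by (rule D.gset_coeff_axioms)
  show "Alt Q W m \<subseteq> D.L m" for m unfolding D.L_def by (rule Alt_L[OF sub_W])
  show "D.ac g v \<in> Alt Q W m" if "g \<in> carrier \<Gamma>" "v \<in> Alt Q W m" for g v m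
    unfolding D.ac_def
    by (rule tmap_Alt[OF D.lin_a _ _ that(2)])
      (use that(1) C.\<Gamma>.inv_closed[OF that(1)] in \<open>auto simp: C.qa_closed C.a_closed simp del: \<Gamma>_simps\<close>)
  show "D.ac g v - D.ac h v \<in> {0}"
    if g: "g \<in> carrier \<Gamma>" and h: "h \<in> carrier \<Gamma>" and e: "qa cyc_x g = qa cyc_x h" and v: "v \<in> D.L (Suc m)" for g h v m
  proof -
    obtain i :: int where i: "g = x [^]\<^bsub>\<Gamma>\<^esub> i \<otimes>\<^bsub>\<Gamma>\<^esub> h" using same_coset[of g h] g h e by auto
    show ?thesis unfolding i
      by (rule D.stabilizer_mod[OF P.subspace_single_0 _ _ _ h v])
        (auto simp: lin_0[OF D.lin_ac] D_ac_x x_cent)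
  qed
  show "\<exists>v'\<in>Alt Q W (Suc (Suc m)). v - bd v' \<in> {0}" if "v \<in> Alt Q W (Suc m)" "bd v \<in> {0}" for v m
    using that by (intro bexI[of _ "cone cyc_x v"]) (auto simp: bd_cone lin_0[OF lin_push] intro!: cone_Alt C.u0)
  show "bd v \<in> Alt Q W m" if "v \<in> Alt Q W (Suc m)" for v m by (rule bd_Alt[OF sub_W that])
qed (auto simp: sub_Alt Alt_0 P.subspace_0[OF sub_Alt] lin_0[OF lin_bd] lin_0[OF D.lin_ac] lin_0[OF D.lin_e] e_Alt)

definition pm :: "('g list \<Rightarrow>\<^sub>0 'm) \<Rightarrow> ('g set list \<Rightarrow>\<^sub>0 'm)" where "pm = tmap \<pi> (\<lambda>m. m)"

lemma lin_pm: "Vector_Spaces.linear ps ps pm" unfolding pm_def by (rule lin_tmap[OF lin_ident])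
lemma pm_single [simp]: "pm (Poly_Mapping.single ys w) = Poly_Mapping.single (map \<pi> ys) w"
  unfolding pm_def by (simp add: lin_ident)
lemma pm_L: "v \<in> C.L m \<Longrightarrow> pm v \<in> D.L m"
  unfolding pm_def C.L_def D.L_def by (rule tmap_L[OF lin_ident sub_W sub_W]) (auto simp: \<pi>_Q)
lemma bd_pm: "bd (pm v) = pm (bd v)" unfolding pm_def by (rule bd_tmap[OF lin_ident])
lemma pm_cone: "pm (cone h v) = cone (\<pi> h) (pm v)"
  by (rule lin_eq_all[OF lin_comp[OF lin_pm lin_push] lin_comp[OF lin_push lin_pm]]) simp
lemma pm_e: "pm (C.e u v) = D.e u (pm v)"
  by (rule lin_eq_all[OF lin_comp[OF lin_pm C.lin_e] lin_comp[OF D.lin_e lin_pm]]) (simp add: C.e_single D.e_single)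

lemma pm_ac: assumes g: "g \<in> centralizer G x" and v: "v \<in> C.L m" shows "pm (C.ac g v) = D.ac g (pm v)"
proof (rule C.lin_eq_L[OF lin_comp[OF lin_pm C.lin_ac] lin_comp[OF D.lin_ac lin_pm] v])
  fix ys w assume y: "ys \<in> tuples (carrier G) m" "w \<in> W"
  then have "map \<pi> (map (\<lambda>y. y \<otimes> g) ys) = map (\<lambda>u. qa u g) (map \<pi> ys)"
    using tuplesD(2)[OF y(1)] g by (auto simp: \<pi>_mult)
  then show "pm (C.ac g (Poly_Mapping.single ys w)) = D.ac g (pm (Poly_Mapping.single ys w))"
    using g by (simp del: map_map)
qed (simp_all add: g)

lemma pm_surj: assumes v: "v \<in> D.L m" shows "v \<in> pm ` C.L m"
proof (rule D.lin_in_L[OF lin_id[OF vs_ps] subspace_im[OF lin_pm C.sub_L] v])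
  fix us w assume u: "us \<in> tuples Q m" "w \<in> W"
  obtain \<sigma> where \<sigma>: "\<And>u. u \<in> Q \<Longrightarrow> \<sigma> u \<in> carrier G" "\<And>u. u \<in> Q \<Longrightarrow> \<pi> (\<sigma> u) = u" using \<pi>_surj by metis
  have "map \<pi> (map \<sigma> us) = us" using tuplesD(2)[OF u(1)] \<sigma> by (auto intro!: map_idI)
  then have "Poly_Mapping.single us w = pm (Poly_Mapping.single (map \<sigma> us) w)" by simp
  moreover have "map \<sigma> us \<in> tuples (carrier G) m" by (rule map_tuples[OF u(1)]) (rule \<sigma>(1))
  ultimately show "Poly_Mapping.single us w \<in> pm ` C.L m" using C.L_single[OF _ u(2)] by blast
qed

lemma pm_Rel: assumes r: "r \<in> C.Rel m" shows "pm r \<in> D.Rel m"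
  by (rule C.Rel_in[OF lin_pm D.sub_Rel r]) (simp add: pm_ac D.ac_Rel pm_L)

lemma pm_Rel_surj: assumes r: "r \<in> D.Rel m" shows "r \<in> pm ` C.Rel m"
proof (rule D.Rel_in[OF lin_id[OF vs_ps] subspace_im[OF lin_pm C.sub_Rel] r])
  fix g v assume g: "g \<in> carrier \<Gamma>" and v: "v \<in> D.L m"
  obtain u where u: "u \<in> C.L m" "v = pm u" using pm_surj[OF v] by blast
  have "D.ac g v - v = pm (C.ac g u - u)" using u g by (simp add: pm_ac lin_diff[OF lin_pm])
  then show "D.ac g v - v \<in> pm ` C.Rel m" using C.ac_Rel[OF g u(1)] by blast
qed

definition A :: "nat \<Rightarrow> ('g list \<Rightarrow>\<^sub>0 'm) set" where "A m = {v \<in> C.L m. pm v \<in> Alt Q W m}"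

lemma sub_A: "P.subspace (A m)" unfolding A_def by (rule subspace_vimage[OF lin_pm C.sub_L sub_Alt])

lemma A_bd: "v \<in> A (Suc m) \<Longrightarrow> bd v \<in> A m"
  by (simp add: A_def C.L_bd bd_Alt[OF sub_W] flip: bd_pm)

lemma A_ac: assumes "g \<in> carrier \<Gamma>" "v \<in> A m" shows "C.ac g v \<in> A m"
proof -
  interpret R: relative_acyclic scale \<Gamma> Q qa a W Q qa cyc_x "\<lambda>u. u" "Alt Q W" "\<lambda>_. {0}" by (rule Alt_relative_acyclic)
  have "pm (C.ac g v) = D.ac g (pm v)" using assms by (intro pm_ac[of _ _ m]) (simp_all add: A_def)
  then show ?thesis using assms R.ac_A[of g "pm v" m] by (simp add: A_def C.ac_L)
qed

lemma A_0: "A 0 = {0}"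
proof
  show "A 0 \<subseteq> {0}"
  proof
    fix v assume v: "v \<in> A 0"
    then have k: "Poly_Mapping.keys v \<subseteq> {[]}" and p: "pm v = 0"
      by (auto simp: A_def Alt_0 C.L_def fin_supp_def tuples_0)
    have v1: "v = Poly_Mapping.single [] (Poly_Mapping.lookup v [])"
      using k by (intro poly_mapping_eqI) (auto simp: lookup_single when_def in_keys_iff)
    then have "pm v = Poly_Mapping.single [] (Poly_Mapping.lookup v [])" by (metis pm_single list.map_disc_iff)
    then show "v \<in> {0}" using p v1 by (metis insertI1 lookup_single_eq lookup_zero single_zero)
  qed
  show "{0} \<subseteq> A 0" using P.subspace_0[OF sub_A] by simp
qed

text \<open>The chains modulo alternation are exact, by coning from a point over the base point.\<close>

lemma mod_A_exact:
  assumes v: "v \<in> C.L (Suc k)" and bv: "bd v \<in> A k"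
  shows "\<exists>u\<in>C.L (Suc (Suc k)). v - bd u \<in> A (Suc k)"
proof -
  obtain h where h: "h \<in> carrier G" "\<pi> h = cyc_x" using \<pi>_surj[OF C.u0] by blast
  have "v - bd (cone h v) = cone h (bd v)" by (simp add: bd_cone)
  moreover have "cone h (bd v) \<in> A (Suc k)"
    using bv h C.L_cone[OF h(1)] by (auto simp: A_def pm_cone intro!: cone_Alt C.u0)
  ultimately show ?thesis using C.L_cone[OF h(1) v] by (intro bexI[of _ "cone h v"]) simp_all
qed

text \<open>
  This is applied to the action of \<open>x\<close> and to the cyclic operator as \<open>F\<close>. Chains modulo \<open>A\<close> are acyclic
  (\<open>mod_A_exact\<close>), so \<open>A\<close> modulo the image of \<open>1 - F\<close> is acyclic as soon as all chains modulo that image are.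
\<close>

lemma relative_acyclic_image:
  fixes F :: "('g list \<Rightarrow>\<^sub>0 'm) \<Rightarrow> ('g list \<Rightarrow>\<^sub>0 'm)"
  defines "B \<equiv> \<lambda>m. (\<lambda>v. v - F v) ` C.L m"
  assumes lin_F: "Vector_Spaces.linear ps ps F"
    and F_L: "\<And>m v. v \<in> C.L m \<Longrightarrow> F v \<in> C.L m"
    and F_ac: "\<And>g m v. g \<in> centralizer G x \<Longrightarrow> v \<in> C.L m \<Longrightarrow> F (C.ac g v) = C.ac g (F v)"
    and F_e: "\<And>u m v. v \<in> C.L m \<Longrightarrow> F (C.e u v) = C.e u (F v)"
    and F_pm: "\<And>m v. v \<in> C.L m \<Longrightarrow> pm (v - F v) \<in> Alt Q W m"
    and F_bd: "\<And>m v. v \<in> C.L (Suc m) \<Longrightarrow> bd (v - F v) \<in> B m"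
    and F_x: "\<And>m v. v \<in> C.L (Suc m) \<Longrightarrow> C.ac x v - v \<in> B (Suc m)"
    and F_exact: "\<And>m v. v \<in> C.L (Suc m) \<Longrightarrow> bd v \<in> B m \<Longrightarrow> \<exists>u\<in>C.L (Suc (Suc m)). v - bd u \<in> B (Suc m)"
  shows "relative_acyclic scale \<Gamma> (carrier G) (\<lambda>y g. y \<otimes> g) a W Q qa cyc_x \<pi> A B"
proof -
  have lin1: "Vector_Spaces.linear ps ps (\<lambda>v. v - F v)" by (rule lin_minus[OF lin_id[OF vs_ps] lin_F])
  have sub_B: "P.subspace (B m)" for m unfolding B_def by (rule subspace_im[OF lin1 C.sub_L])
  have B_A: "B m \<subseteq> A m" for m
    unfolding B_def A_def by (auto intro!: P.subspace_diff[OF C.sub_L] F_L F_pm)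
  have ac_B: "C.ac g v \<in> B m" if g: "g \<in> centralizer G x" and v: "v \<in> B m" for g v m
  proof -
    obtain w where w: "w \<in> C.L m" "v = w - F w" using v by (auto simp: B_def)
    then have "C.ac g v = C.ac g w - F (C.ac g w)" using g F_ac by (simp add: lin_diff[OF C.lin_ac])
    then show ?thesis unfolding B_def using C.ac_L[of g w m] g w by simp
  qed
  show ?thesis
  proof (intro relative_acyclic.intro relative_acyclic_axioms.intro)
    show "gset_coeff scale \<Gamma> (carrier G) (\<lambda>y g. y \<otimes> g) a W Q qa cyc_x \<pi>" by (rule C.gset_coeff_axioms)
    show "A m \<subseteq> C.L m" for m by (auto simp: A_def)
    show "bd v \<in> B m" if "v \<in> B (Suc m)" for v m using that F_bd by (auto simp: B_def)
    show "C.e u v \<in> A m" if "v \<in> A m" for u v m using that by (simp add: A_def C.e_L pm_e e_Alt)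
    show "C.e u v \<in> B m" if v: "v \<in> B m" for u v m
    proof -
      obtain w where w: "w \<in> C.L m" "v = w - F w" using v by (auto simp: B_def)
      then have "C.e u v = C.e u w - F (C.e u w)" by (simp add: lin_diff[OF C.lin_e] F_e)
      then show ?thesis unfolding B_def using C.e_L[OF w(1), of u] by simp
    qed
    show "C.ac g v - C.ac h v \<in> B (Suc m)"
      if g: "g \<in> carrier \<Gamma>" and h: "h \<in> carrier \<Gamma>" and e: "qa cyc_x g = qa cyc_x h" and v: "v \<in> C.L (Suc m)" for g h v m
    proof -
      obtain i :: int where i: "g = x [^]\<^bsub>\<Gamma>\<^esub> i \<otimes>\<^bsub>\<Gamma>\<^esub> h" using same_coset[of g h] g h e by auto
      show ?thesis unfolding i
        by (rule C.stabilizer_mod[OF sub_B _ _ F_x h v]) (auto simp: ac_B x_cent)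
    qed
    show "\<exists>v'\<in>A (Suc (Suc m)). v - bd v' \<in> B (Suc m)" if v: "v \<in> A (Suc m)" and bv: "bd v \<in> B m" for v m
    proof -
      obtain u where u: "u \<in> C.L (Suc (Suc m))" "v - bd u \<in> B (Suc m)" using F_exact[OF _ bv] v by (auto simp: A_def)
      \<comment> \<open>A preimage among all chains is corrected by a boundary, so that it lies in \<open>A\<close>.\<close>
      have "bd u \<in> A (Suc m)" using P.subspace_diff[OF sub_A v, of "v - bd u"] B_A u(2) by auto
      then obtain u' where u': "u' \<in> C.L (Suc (Suc (Suc m)))" "u - bd u' \<in> A (Suc (Suc m))"
        using mod_A_exact[OF u(1)] by blast
      then show ?thesis using u(2) by (intro bexI[of _ "u - bd u'"]) (simp_all add: lin_diff[OF lin_bd] bd_bd)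
    qed
  qed (auto simp: sub_A sub_B A_0 A_bd A_ac ac_B dest: subsetD[OF B_A])
qed

end

subsection \<open>Faces and the cyclic operator\<close>

context coeff_space
begin

definition face :: "nat \<Rightarrow> ('x list \<Rightarrow>\<^sub>0 'm) \<Rightarrow> ('x list \<Rightarrow>\<^sub>0 'm)" where
  "face i v = ps ((-1) ^ i) (push (delete_nth i) v)"

lemma lin_face: "Vector_Spaces.linear ps ps (face i)"
  unfolding face_def by (intro lin_smult lin_push)

lemma face_single: "face i (Poly_Mapping.single ys w) = Poly_Mapping.single (delete_nth i ys) (scale ((-1) ^ i) w)"
  by (simp add: face_def)

lemma bd_face: "v \<in> fin_supp (tuples U m) W \<Longrightarrow> bd v = (\<Sum>i<m. face i v)"
  by (rule lin_eq_fin_supp[OF lin_bd lin_sums[OF vs_ps vs_ps lin_face]])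
    (auto simp: bd_single face_single tuples_def)

lemma bd'_face: "v \<in> fin_supp (tuples U m) W \<Longrightarrow> bd' v = (\<Sum>i<m - 1. face i v)"
  by (rule lin_eq_fin_supp[OF lin_bd' lin_sums[OF vs_ps vs_ps lin_face]])
    (auto simp: bd'_single face_single tuples_def)

abbreviation snoc :: "'x \<Rightarrow> ('x list \<Rightarrow>\<^sub>0 'm) \<Rightarrow> ('x list \<Rightarrow>\<^sub>0 'm)" where "snoc y \<equiv> push (\<lambda>l. l @ [y])"

lemma delete_nth_append: "i < length zs \<Longrightarrow> delete_nth i (zs @ ys) = delete_nth i zs @ ys"
  by (simp add: delete_nth_def)

lemma bd'_snoc: "bd' (Poly_Mapping.single (zs @ [y]) w) = snoc y (bd (Poly_Mapping.single zs w))"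
  by (simp add: bd'_single bd_single lin_sum[OF lin_push] delete_nth_append)

lemma bd_snoc: "bd (Poly_Mapping.single (zs @ [y]) w) =
    bd' (Poly_Mapping.single (zs @ [y]) w) + Poly_Mapping.single zs (scale ((-1) ^ length zs) w)"
  by (simp add: bd'_single bd_single) (simp add: delete_nth_def)

text \<open>Repeating the last entry in front of a tuple is an extra degeneracy for the faces of \<open>bd'\<close>.\<close>

definition extra :: "('x list \<Rightarrow>\<^sub>0 'm) \<Rightarrow> ('x list \<Rightarrow>\<^sub>0 'm)" where "extra = push (\<lambda>ys. last ys # ys)"

lemma lin_extra: "Vector_Spaces.linear ps ps extra" unfolding extra_def by (rule lin_push)

lemma extra_single [simp]: "extra (Poly_Mapping.single ys w) = Poly_Mapping.single (last ys # ys) w"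
  by (simp add: extra_def)

lemma tuples_snocE:
  assumes "ys \<in> tuples U (Suc m)" obtains zs y where "ys = zs @ [y]" "zs \<in> tuples U m" "y \<in> U"
  using assms by (cases ys rule: rev_cases) (auto simp: tuples_def)

lemma bd'_extra:
  assumes v: "v \<in> fin_supp (tuples U (Suc m)) W" shows "bd' (extra v) = v - extra (bd' v)"
proof (rule lin_eq_fin_supp[OF lin_comp[OF lin_bd' lin_extra] lin_minus[OF lin_id[OF vs_ps] lin_comp[OF lin_extra lin_bd']] v])
  fix ys w assume "ys \<in> tuples U (Suc m)"
  then obtain zs y where ys: "ys = zs @ [y]" by (rule tuples_snocE)
  have "extra (snoc y v) = cone y (snoc y v)" for v :: "_ list \<Rightarrow>\<^sub>0 'm"
    by (rule lin_eq_all[OF lin_comp[OF lin_extra lin_push] lin_comp[OF lin_push lin_push]]) simp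
  then show "bd' (extra (Poly_Mapping.single ys w)) = Poly_Mapping.single ys w - extra (bd' (Poly_Mapping.single ys w))"
    unfolding ys using bd'_Cons[of "zs @ [y]" y w] by (simp add: bd'_snoc)
qed

end

lemma sum_funpow_shift:
  assumes "Vector_Spaces.linear s s t"
  shows "t (\<Sum>i\<le>n. (t ^^ i) u) - (\<Sum>i\<le>n. (t ^^ i) u) = (t ^^ Suc n) u - u"
proof -
  have "t (\<Sum>i\<le>n. (t ^^ i) u) = (\<Sum>i\<le>n. (t ^^ Suc i) u)" by (simp add: lin_sum[OF assms])
  then show ?thesis using sum_telescope[of "\<lambda>i. - (t ^^ i) u" n] by (simp add: sum_negf sum_subtractf algebra_simps)
qed

context twisted_coeff
begin

text \<open>
  The empty tuple, which has degree \<open>-1\<close>, is fixed by convention. The sign of \<open>t\<close> on a nonempty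
  tuple is that of its degree, which is one less than the length.
\<close>

definition rot :: "'g list \<Rightarrow> 'g list" where
  "rot ys = (if ys = [] then [] else (last ys \<otimes> x) # butlast ys)"

definition t :: "('g list \<Rightarrow>\<^sub>0 'm) \<Rightarrow> ('g list \<Rightarrow>\<^sub>0 'm)" where
  "t = lin_ext (\<lambda>ys w. Poly_Mapping.single (rot ys) (scale ((-1) ^ (length ys - 1)) w))"

lemma lin_t: "Vector_Spaces.linear ps ps t"
  unfolding t_def by (intro lin_ext_lin lin_comp[OF lin_single lin_smult[OF lin_ident]])

lemma t_single: "t (Poly_Mapping.single ys w) = Poly_Mapping.single (rot ys) (scale ((-1) ^ (length ys - 1)) w)"
  unfolding t_def by (rule lin_ext_single) simp

lemma t_snoc [simp]: "t (Poly_Mapping.single (ys @ [y]) w) = Poly_Mapping.single ((y \<otimes> x) # ys) (scale ((-1) ^ length ys) w)"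
  by (simp add: t_single rot_def)

lemma t_Nil [simp]: "t (Poly_Mapping.single [] w) = Poly_Mapping.single [] w"
  by (simp add: t_single rot_def)

lemma rot_tuples: assumes "ys \<in> tuples (carrier G) m" shows "rot ys \<in> tuples (carrier G) m"
proof (cases m)
  case 0
  then show ?thesis using assms by (simp add: tuples_0 rot_def)
next
  case (Suc k)
  then obtain zs y where "ys = zs @ [y]" "zs \<in> tuples (carrier G) k" "y \<in> carrier G"
    using assms by (auto elim: tuples_snocE)
  then show ?thesis using Suc x by (simp add: rot_def)
qed

lemma t_L: assumes v: "v \<in> C.L m" shows "t v \<in> C.L m"
  by (rule C.lin_in_L[OF lin_t C.sub_L v])
    (auto simp: t_single intro!: C.L_single rot_tuples subspace_scale[OF sub_W])

lemma t_ac: assumes g: "g \<in> centralizer G x" and v: "v \<in> C.L m" shows "t (C.ac g v) = C.ac g (t v)"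
proof (rule C.lin_eq_L[OF lin_comp[OF lin_t C.lin_ac] lin_comp[OF C.lin_ac lin_t] v])
  fix ys w assume y: "ys \<in> tuples (carrier G) m" "w \<in> W"
  have "rot (map (\<lambda>y. y \<otimes> g) ys) = map (\<lambda>y. y \<otimes> g) (rot ys)"
  proof (cases ys rule: rev_cases)
    case (snoc zs z)
    then have "z \<in> carrier G" using tuplesD(2)[OF y(1)] by simp
    then have "z \<otimes> g \<otimes> x = z \<otimes> x \<otimes> g" using g x centD[OF g] by (simp add: G.m_assoc)
    then show ?thesis using snoc by (simp add: rot_def)
  qed (simp add: rot_def)
  then show "t (C.ac g (Poly_Mapping.single ys w)) = C.ac g (t (Poly_Mapping.single ys w))"
    using g C.lin_a[of "inv\<^bsub>\<Gamma>\<^esub> g"] C.\<Gamma>.inv_closed[of g] by (simp add: t_single lin_scale del: \<Gamma>_simps(2,3))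
qed (simp_all add: g)

lemma t_Rel: assumes r: "r \<in> C.Rel m" shows "t r \<in> C.Rel m"
  by (rule C.Rel_in[OF lin_t C.sub_Rel r]) (simp add: t_ac C.ac_Rel t_L)

lemma push_tl_L: assumes v: "v \<in> C.L (Suc m)" shows "push tl v \<in> C.L m"
  by (rule C.lin_in_L[OF lin_push C.sub_L v]) (auto simp: tuples_def length_Suc_conv intro!: C.L_single)

lemma push_tl_Rel: assumes r: "r \<in> C.Rel (Suc m)" shows "push tl r \<in> C.Rel m"
proof (rule C.Rel_in[OF lin_push C.sub_Rel r])
  fix g v assume g: "g \<in> carrier \<Gamma>" and v: "v \<in> C.L (Suc m)"
  have "push tl (C.ac g v) = C.ac g (push tl v)"
    by (rule lin_eq_all[OF lin_comp[OF lin_push C.lin_ac[OF g]] lin_comp[OF C.lin_ac[OF g] lin_push]])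
      (use g in \<open>simp add: map_tl\<close>)
  then show "push tl (C.ac g v) - push tl v \<in> C.Rel m" using C.ac_Rel[OF g push_tl_L[OF v]] by simp
qed

text \<open>
  Each step moves one entry of \<open>vs\<close> to the front, multiplies it by \<open>x\<close>, and contributes the sign of the
  degree.
\<close>

lemma tpow_snoc:
  "(t ^^ length vs) (Poly_Mapping.single (us @ vs) w) =
    Poly_Mapping.single (map (\<lambda>y. y \<otimes> x) vs @ us) (scale ((-1) ^ ((length us + length vs - 1) * length vs)) w)"
proof (induction vs arbitrary: us w rule: rev_induct)
  case Nil
  then show ?case by simp
next
  case (snoc z vs)
  have "(t ^^ length (vs @ [z])) (Poly_Mapping.single (us @ vs @ [z]) w) =
    (t ^^ length vs) (t (Poly_Mapping.single ((us @ vs) @ [z]) w))" by (simp add: funpow_swap1)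
  also have "\<dots> = (t ^^ length vs) (Poly_Mapping.single (((z \<otimes> x) # us) @ vs) (scale ((-1) ^ (length us + length vs)) w))"
    by (simp only: t_snoc) simp
  also have "\<dots> = Poly_Mapping.single (map (\<lambda>y. y \<otimes> x) vs @ (z \<otimes> x) # us)
     (scale ((-1) ^ ((length us + length vs) * length vs)) (scale ((-1) ^ (length us + length vs)) w))"
    unfolding snoc.IH by simp
  finally show ?case by (simp add: power_add algebra_simps)
qed

text \<open>
  After \<open>n + 1\<close> steps each entry has been multiplied by \<open>x\<close> once, with the sign \<open>(-1)\<^sup>n\<^sup>(\<^sup>n\<^sup>+\<^sup>1\<^sup>) = 1\<close>; and \<open>x\<close> acts
  trivially on \<open>W\<close>.
\<close>

lemma t_period: assumes v: "v \<in> C.L (Suc n)" shows "(t ^^ Suc n) v = C.ac x v"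
proof (rule C.lin_eq_L[OF lin_funpow[OF lin_t] C.lin_ac v])
  fix ys w assume y: "ys \<in> tuples (carrier G) (Suc n)" "w \<in> W"
  have "(-1 :: 'k) ^ (n * Suc n) = 1" by (simp add: minus_one_power_iff)
  then show "(t ^^ Suc n) (Poly_Mapping.single ys w) = C.ac x (Poly_Mapping.single ys w)"
    using tpow_snoc[of ys "[]" w] tuplesD(1)[OF y(1)] y(2)
    by (simp add: ac_x_single del: funpow.simps C.ac_single)
qed (simp add: x_cent)

lemma bd_one_minus_t:
  assumes v: "v \<in> C.L (Suc (Suc m))" shows "bd (v - t v) = bd' v - t (bd' v)"
proof (rule C.lin_eq_L[OF lin_comp[OF lin_bd lin_minus[OF lin_id[OF vs_ps] lin_t]]
      lin_minus[OF lin_bd' lin_comp[OF lin_t lin_bd']] v])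
  fix ys w assume y: "ys \<in> tuples (carrier G) (Suc (Suc m))" "w \<in> W"
  then obtain zs z where ys: "ys = zs @ [z]" and zs: "zs \<in> tuples (carrier G) (Suc m)" by (auto elim: tuples_snocE)
  let ?c = "(-1) ^ m :: 'k"
  have "bd (Poly_Mapping.single zs w) \<in> C.L m" by (intro C.L_bd C.L_single zs y)
  then have "t (snoc z (bd (Poly_Mapping.single zs w))) = ps ?c (cone (z \<otimes> x) (bd (Poly_Mapping.single zs w)))"
    by (rule C.lin_eq_L[OF lin_comp[OF lin_t lin_push] lin_smult[OF lin_push]]) (simp add: tuplesD(1))
  moreover have "bd (Poly_Mapping.single zs (scale ?c w)) = ps ?c (bd (Poly_Mapping.single zs w))"
    using lin_scale[OF lin_bd, of ?c "Poly_Mapping.single zs w"] by simp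
  ultimately show "bd (Poly_Mapping.single ys w - t (Poly_Mapping.single ys w)) =
      bd' (Poly_Mapping.single ys w) - t (bd' (Poly_Mapping.single ys w))"
    unfolding ys using tuplesD(1)[OF zs]
    by (simp add: lin_diff[OF lin_bd] lin_add[OF lin_bd] bd_snoc bd_Cons bd'_snoc single_uminus lin_neg[OF lin_bd] lin_neg[OF lin_push]
        lin_scale[OF lin_push])
qed

text \<open>Up to the action of \<open>x\<close>, all faces are conjugate to the face \<open>0\<close> by powers of \<open>t\<close>.\<close>

lemma face_conjugate:
  assumes v: "v \<in> C.L (Suc (Suc n))" and j: "j \<le> Suc n"
  shows "(t ^^ j) (push tl ((t ^^ (Suc (Suc n) - j)) v)) = C.ac x (face j v)"
proof (rule C.lin_eq_L[OF lin_comp[OF lin_funpow[OF lin_t] lin_comp[OF lin_push lin_funpow[OF lin_t]]]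
      lin_comp[OF C.lin_ac lin_face] v])
  fix ys w assume y: "ys \<in> tuples (carrier G) (Suc (Suc n))" "w \<in> W"
  define us vs where "us = take j ys" and "vs = drop (Suc j) ys"
  have len: "length ys = Suc (Suc n)" by (rule tuplesD(1)[OF y(1)])
  have ys: "ys = us @ ys ! j # vs" using j len by (simp add: us_def vs_def id_take_nth_drop)
  have lu: "length us = j" and lv: "length vs = Suc n - j" using j len by (auto simp: us_def vs_def)
  have d: "delete_nth j ys = us @ vs" by (simp add: delete_nth_def us_def vs_def)
  have 1: "(t ^^ (Suc (Suc n) - j)) (Poly_Mapping.single ys w) =
      Poly_Mapping.single (map (\<lambda>y. y \<otimes> x) (ys ! j # vs) @ us) (scale ((-1) ^ (Suc n * (Suc (Suc n) - j))) w)"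
    using tpow_snoc[of "ys ! j # vs" us w] lu lv j ys[symmetric] by (simp add: Suc_diff_le del: funpow.simps)
  have 2: "(t ^^ j) (Poly_Mapping.single (map (\<lambda>y. y \<otimes> x) vs @ us) w') =
      Poly_Mapping.single (map (\<lambda>y. y \<otimes> x) (us @ vs)) (scale ((-1) ^ (n * j)) w')" for w'
    using tpow_snoc[of us "map (\<lambda>y. y \<otimes> x) vs" w'] lu lv j by simp
  have "even (n * j + Suc n * (Suc (Suc n) - j)) \<longleftrightarrow> even j" using j by (auto simp: even_diff_nat)
  then have "(-1 :: 'k) ^ (n * j + Suc n * (Suc (Suc n) - j)) = (-1) ^ j"
    by (simp only: minus_one_power_iff)
  then have 3: "(-1 :: 'k) ^ (n * j) * (-1) ^ (Suc n * (Suc (Suc n) - j)) = (-1) ^ j"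
    by (simp only: power_add)
  have "(t ^^ j) (push tl ((t ^^ (Suc (Suc n) - j)) (Poly_Mapping.single ys w))) =
      Poly_Mapping.single (map (\<lambda>y. y \<otimes> x) (us @ vs)) (scale ((-1) ^ (n * j)) (scale ((-1) ^ (Suc n * (Suc (Suc n) - j))) w))"
    unfolding 1 push_single by (simp only: list.map append_Cons list.sel 2)
  also have "\<dots> = C.ac x (face j (Poly_Mapping.single ys w))"
    unfolding face_single d scale_scale 3
    by (rule ac_x_single[symmetric]) (rule subspace_scale[OF sub_W y(2)])
  finally show "(t ^^ j) (push tl ((t ^^ (Suc (Suc n) - j)) (Poly_Mapping.single ys w))) =
      C.ac x (face j (Poly_Mapping.single ys w))" .
qed (simp add: x_cent)

abbreviation cong :: "nat \<Rightarrow> ('g list \<Rightarrow>\<^sub>0 'm) \<Rightarrow> ('g list \<Rightarrow>\<^sub>0 'm) \<Rightarrow> bool" where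
  "cong m u v \<equiv> u - v \<in> C.Rel m"

lemma cong_sym: "cong m u v \<Longrightarrow> cong m v u" using P.subspace_neg[OF C.sub_Rel, of "u - v" m] by simp
lemma cong_trans: "cong m u v \<Longrightarrow> cong m v w \<Longrightarrow> cong m u w"
  using P.subspace_add[OF C.sub_Rel, of "u - v" m "v - w"] by simp
lemma cong_sum: "(\<And>i. i \<in> I \<Longrightarrow> cong m (f i) (g i)) \<Longrightarrow> cong m (sum f I) (sum g I)"
  by (simp add: P.subspace_sum[OF C.sub_Rel] flip: sum_subtractf)
lemma cong_lin:
  "Vector_Spaces.linear ps ps F \<Longrightarrow> (\<And>r. r \<in> C.Rel m \<Longrightarrow> F r \<in> C.Rel m') \<Longrightarrow> cong m u v \<Longrightarrow> cong m' (F u) (F v)"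
  by (simp flip: lin_diff)

lemma tpow_Rel: "r \<in> C.Rel m \<Longrightarrow> (t ^^ k) r \<in> C.Rel m" by (induction k) (simp_all add: t_Rel)
lemma tpow_L: "v \<in> C.L m \<Longrightarrow> (t ^^ k) v \<in> C.L m" by (induction k) (simp_all add: t_L)

definition nrm :: "nat \<Rightarrow> ('g list \<Rightarrow>\<^sub>0 'm) \<Rightarrow> ('g list \<Rightarrow>\<^sub>0 'm)" where "nrm n v = (\<Sum>i\<le>n. (t ^^ i) v)"

lemma lin_nrm: "Vector_Spaces.linear ps ps (nrm n)"
  unfolding nrm_def by (intro lin_sums[OF vs_ps vs_ps] lin_funpow lin_t)
lemma nrm_L: "v \<in> C.L m \<Longrightarrow> nrm n v \<in> C.L m"
  unfolding nrm_def by (intro P.subspace_sum[OF C.sub_L] tpow_L)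
lemma nrm_Rel: "r \<in> C.Rel m \<Longrightarrow> nrm n r \<in> C.Rel m"
  unfolding nrm_def by (intro P.subspace_sum[OF C.sub_Rel] tpow_Rel)

lemma tpow_nrm: assumes v: "v \<in> C.L (Suc n)" shows "cong (Suc n) ((t ^^ k) (nrm n v)) (nrm n v)"
proof (induction k)
  case 0
  then show ?case by (simp add: P.subspace_0[OF C.sub_Rel])
next
  case (Suc k)
  have "t (nrm n v) - nrm n v = (t ^^ Suc n) v - v" unfolding nrm_def by (rule sum_funpow_shift[OF lin_t])
  also have "\<dots> \<in> C.Rel (Suc n)" unfolding t_period[OF v] by (rule C.ac_Rel[OF _ v]) (simp add: x_cent)
  finally show ?case using cong_trans[OF cong_lin[OF lin_t t_Rel Suc]] by simp
qed

lemma tpow_nrm_commute: "(t ^^ k) (nrm n v) = nrm n ((t ^^ k) v)"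
  by (simp add: nrm_def lin_sum[OF lin_funpow[OF lin_t]] add.commute flip: funpow_add[unfolded comp_def, THEN fun_cong])

lemma face_L: assumes v: "v \<in> C.L (Suc m)" "i \<le> m" shows "face i v \<in> C.L m"
  by (rule C.lin_in_L[OF lin_face C.sub_L v(1)])
    (simp add: face_single C.L_single delete_nth_tuples v(2) subspace_scale[OF sub_W])

text \<open>
  Since \<open>t\<close> does not change a norm modulo the relations, \<open>face_conjugate\<close> shows that both sides are the norm
  of the face \<open>0\<close> of the norm of \<open>v\<close>.
\<close>

lemma bd'_norm:
  assumes v: "v \<in> C.L (Suc (Suc n))" shows "cong (Suc n) (bd' (nrm (Suc n) v)) (nrm n (bd v))"
proof -
  have ac: "cong m u (C.ac x u)" if "u \<in> C.L m" for u m
    by (rule cong_sym) (rule C.ac_Rel[OF _ that], simp add: x_cent)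
  let ?w = "nrm (Suc n) v"
  have w: "?w \<in> C.L (Suc (Suc n))" by (rule nrm_L[OF v])
  have lin: "Vector_Spaces.linear ps ps (\<lambda>v. nrm n (push tl v))" by (rule lin_comp[OF lin_nrm lin_push])
  have left: "cong (Suc n) (bd' ?w) (nrm n (push tl ?w))"
  proof -
    have "bd' ?w = (\<Sum>j\<le>n. face j ?w)"
      using bd'_face[OF w[unfolded C.L_def]] by (simp add: lessThan_Suc_atMost)
    moreover have "cong (Suc n) (face j ?w) ((t ^^ j) (push tl ?w))" if j: "j \<le> n" for j
    proof (rule cong_trans[OF ac])
      show "face j ?w \<in> C.L (Suc n)" using j by (intro face_L[OF w]) simp
      have "cong (Suc n) ((t ^^ j) (push tl ((t ^^ (Suc (Suc n) - j)) ?w))) ((t ^^ j) (push tl ?w))"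
        by (rule cong_lin[OF lin_funpow[OF lin_t] tpow_Rel cong_lin[OF lin_push push_tl_Rel tpow_nrm[OF v]]])
      then show "cong (Suc n) (C.ac x (face j ?w)) ((t ^^ j) (push tl ?w))"
        using face_conjugate[OF w] j by simp
    qed
    ultimately show ?thesis by (simp only: nrm_def) (intro cong_sum, simp)
  qed
  have right: "cong (Suc n) (nrm n (bd v)) (nrm n (push tl ?w))"
  proof -
    have "nrm n (bd v) = (\<Sum>j\<le>Suc n. nrm n (face j v))"
      using bd_face[OF v[unfolded C.L_def]] by (simp add: lin_sum[OF lin_nrm] lessThan_Suc_atMost[of "Suc n"] del: sum.lessThan_Suc sum.atMost_Suc)
    moreover have "cong (Suc n) (nrm n (face j v)) (nrm n (push tl ((t ^^ (Suc (Suc n) - j)) v)))" if j: "j \<le> Suc n" for j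
    proof -
      let ?u = "push tl ((t ^^ (Suc (Suc n) - j)) v)"
      have u: "?u \<in> C.L (Suc n)" by (intro push_tl_L tpow_L v)
      have "cong (Suc n) (nrm n (face j v)) (nrm n (C.ac x (face j v)))"
        by (rule cong_lin[OF lin_nrm nrm_Rel ac[OF face_L[OF v j]]])
      moreover have "nrm n (C.ac x (face j v)) = (t ^^ j) (nrm n ?u)"
        using face_conjugate[OF v j] by (simp add: tpow_nrm_commute)
      ultimately show ?thesis using cong_trans[OF _ tpow_nrm[OF u]] by simp
    qed
    ultimately have "cong (Suc n) (nrm n (bd v)) (\<Sum>j\<le>Suc n. nrm n (push tl ((t ^^ (Suc (Suc n) - j)) v)))"
      by (simp only:) (intro cong_sum, simp)
    also have "(\<Sum>j\<le>Suc n. nrm n (push tl ((t ^^ (Suc (Suc n) - j)) v))) = nrm n (push tl (t ?w))"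
    proof -
      have "(\<Sum>j\<le>Suc n. (t ^^ (Suc (Suc n) - j)) v) = (\<Sum>j\<le>Suc n. t ((t ^^ (Suc n - j)) v))"
        by (intro sum.cong refl) (simp add: Suc_diff_le)
      also have "\<dots> = t (\<Sum>j\<le>Suc n. (t ^^ (Suc n - j)) v)" by (rule lin_sum[OF lin_t, symmetric])
      also have "(\<Sum>j\<le>Suc n. (t ^^ (Suc n - j)) v) = ?w"
        unfolding nrm_def by (rule sum.reindex_bij_witness[of _ "\<lambda>j. Suc n - j" "\<lambda>j. Suc n - j"]) auto
      finally show ?thesis by (simp only: lin_sum[OF lin, symmetric])
    qed
    finally have "cong (Suc n) (nrm n (bd v)) (nrm n (push tl (t ?w)))" .
    moreover have "cong (Suc (Suc n)) (t ?w) ?w" using tpow_nrm[OF v, of 1] by simp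
    from cong_lin[OF lin nrm_Rel[OF push_tl_Rel] this]
    have "cong (Suc n) (nrm n (push tl (t ?w))) (nrm n (push tl ?w))" .
    ultimately show ?thesis by (rule cong_trans)
  qed
  show ?thesis by (rule cong_trans[OF left cong_sym[OF right]])
qed

lemma extra_L: assumes v: "v \<in> C.L (Suc m)" shows "extra v \<in> C.L (Suc (Suc m))"
proof (rule C.lin_in_L[OF lin_extra C.sub_L v])
  fix ys w assume y: "ys \<in> tuples (carrier G) (Suc m)" "w \<in> W"
  then have "last ys \<in> carrier G" by (auto elim: tuples_snocE)
  then show "extra (Poly_Mapping.single ys w) \<in> C.L (Suc (Suc m))" using y by (simp add: C.L_single)
qed

lemma extra_Rel: assumes r: "r \<in> C.Rel (Suc m)" shows "extra r \<in> C.Rel (Suc (Suc m))"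
proof (rule C.Rel_in[OF lin_extra C.sub_Rel r])
  fix g v assume g: "g \<in> carrier \<Gamma>" and v: "v \<in> C.L (Suc m)"
  have "extra (C.ac g v) = C.ac g (extra v)"
    by (rule C.lin_eq_L[OF lin_comp[OF lin_extra C.lin_ac[OF g]] lin_comp[OF C.lin_ac[OF g] lin_extra] v])
      (use g in \<open>auto elim!: tuples_snocE\<close>)
  then show "extra (C.ac g v) - extra v \<in> C.Rel (Suc (Suc m))" using C.ac_Rel[OF g extra_L[OF v]] by simp
qed

lemma bd'_L': "v \<in> C.L (Suc m) \<Longrightarrow> bd' v \<in> C.L m" unfolding C.L_def by (rule bd'_L[OF sub_W])

lemma bd'_Rel: assumes r: "r \<in> C.Rel (Suc m)" shows "bd' r \<in> C.Rel m"
proof (rule C.Rel_in[OF lin_bd' C.sub_Rel r])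
  fix g v assume g: "g \<in> carrier \<Gamma>" and v: "v \<in> C.L (Suc m)"
  have "bd' (C.ac g v) = C.ac g (bd' v)"
    unfolding C.ac_def by (rule bd'_tmap[OF C.lin_a]) (use C.\<Gamma>.inv_closed[OF g] in simp)
  then show "bd' (C.ac g v) - bd' v \<in> C.Rel m" using C.ac_Rel[OF g bd'_L'[OF v]] by simp
qed

lemma bd'_1: assumes v: "v \<in> C.L (Suc 0)" shows "bd' v = 0"
  using bd'_face[OF v[unfolded C.L_def]] by simp

sublocale T: tsygan_columns ps "\<lambda>n. C.L (Suc n)" "\<lambda>n. C.Rel (Suc n)" bd bd' t
proof (intro tsygan_columns.intro tsygan_columns_axioms.intro)
  show "vector_space (ps :: 'k \<Rightarrow> ('g list \<Rightarrow>\<^sub>0 'm) \<Rightarrow> _)" by (rule vs_ps)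
  show "bd (z - t z) - (bd' z - t (bd' z)) \<in> C.Rel (Suc n)" if "z \<in> C.L (Suc (Suc n))" for z n
    using bd_one_minus_t[OF that] P.subspace_0[OF C.sub_Rel] by simp
  show "bd' (\<Sum>i\<le>Suc n. (t ^^ i) z) - (\<Sum>i\<le>n. (t ^^ i) (bd z)) \<in> C.Rel (Suc n)" if "z \<in> C.L (Suc (Suc n))" for z n
    using bd'_norm[OF that] by (simp only: nrm_def)
  show "(t ^^ Suc n) z - z \<in> C.Rel (Suc n)" if "z \<in> C.L (Suc n)" for z n
    unfolding t_period[OF that] by (rule C.ac_Rel[OF _ that]) (simp add: x_cent)
  show "\<exists>u\<in>C.L (Suc (Suc n)). bd' u - z \<in> C.Rel (Suc n)"
    if z: "z \<in> C.L (Suc n)" and bz: "n > 0 \<Longrightarrow> bd' z \<in> C.Rel (Suc (n - 1))" for z n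
  proof -
    have "extra (bd' z) \<in> C.Rel (Suc n)"
    proof (cases n)
      case 0
      then show ?thesis using bd'_1 z by (simp add: lin_0[OF lin_extra] P.subspace_0[OF C.sub_Rel])
    next
      case (Suc m)
      then show ?thesis using bz extra_Rel by simp
    qed
    then have "bd' (extra z) - z \<in> C.Rel (Suc n)"
      using P.subspace_neg[OF C.sub_Rel] bd'_extra[OF z[unfolded C.L_def]] by simp
    then show ?thesis using extra_L[OF z] by blast
  qed
  show "bd (bd z) \<in> C.Rel (Suc n)" "bd' (bd' z) \<in> C.Rel (Suc n)" for z :: "'g list \<Rightarrow>\<^sub>0 'm" and n
    by (simp_all add: bd_bd bd'_bd' P.subspace_0[OF C.sub_Rel])
qed (simp_all add: C.sub_L C.sub_Rel C.Rel_L lin_bd lin_bd' lin_t C.L_bd C.Rel_bd bd'_L' bd'_Rel t_L t_Rel)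

end

section \<open>Quotients of spaces of finitely supported functions\<close>

lemma alt_sum_pres:
  assumes p: "pres_map s Z B A \<phi>" and f: "\<And>i. i < m \<Longrightarrow> f i y = \<phi> (g i)" and g: "\<And>i. i < m \<Longrightarrow> g i \<in> Z"
  shows "alt_sum A m f y = \<phi> (\<Sum>i<m. s ((-1) ^ i) (g i))"
proof -
  interpret V: vector_space s by (rule pres_mapD(1)[OF p])
  interpret A: abelian_group A by (rule pres_map_abelian_group[OF p])
  have "\<phi> (\<Sum>i<m. s ((-1) ^ i) (g i)) = (\<Oplus>\<^bsub>A\<^esub>i\<in>{..<m}. \<phi> (s ((-1) ^ i) (g i)))"
    using g by (intro pres_map_sum[OF p]) (auto intro!: V.subspace_scale[OF pres_mapD(2)[OF p]])
  also have "\<dots> = (\<Oplus>\<^bsub>A\<^esub>i\<in>{..<m}. ((-1) ^ i) \<odot>\<^bsub>A\<^esub> f i y)"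
  proof (rule A.finsum_cong'[OF refl])
    show "(\<lambda>i. ((-1) ^ i) \<odot>\<^bsub>A\<^esub> f i y) \<in> {..<m} \<rightarrow> carrier A"
      using g f pres_mapD(7)[OF p] V.subspace_scale[OF pres_mapD(2)[OF p]]
      by (auto simp flip: pres_mapD(9)[OF p])
    show "\<phi> (s ((-1) ^ i) (g i)) = ((-1) ^ i) \<odot>\<^bsub>A\<^esub> f i y" if "i \<in> {..<m}" for i
      using g f that pres_mapD(9)[OF p] by simp
  qed
  finally show ?thesis by (simp add: alt_sum_def)
qed

context coeff_space
begin

lemma coset_fs: "R +>\<^bsub>fs_space scale U W\<^esub> v = {w. w - v \<in> R}"
proof -
  have "R +>\<^bsub>fs_space scale U W\<^esub> v = {r + v |r. r \<in> R}"
    by (auto simp: a_r_coset_def r_coset_def fs_space_def)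
  also have "\<dots> = {w. w - v \<in> R}" by (auto, metis diff_add_cancel)
  finally show ?thesis .
qed

lemma pres_fs: assumes W: "subspace W" shows "pres_map ps (fin_supp U W) {0} (fs_space scale U W) (\<lambda>v. v)"
  by (simp add: pres_map_def fs_space_def vs_ps sub_fin_supp[OF W] P.subspace_0[OF sub_fin_supp[OF W]])

lemma pres_quot_fs:
  assumes W: "subspace W" and R: "P.subspace R" "R \<subseteq> fin_supp U W"
  shows "pres_map ps (fin_supp U W) R (vs_quot (fs_space scale U W) R) (\<lambda>v. R +>\<^bsub>fs_space scale U W\<^esub> v)"
  using pres_map_quot[OF pres_fs[OF W] sub_fin_supp[OF W] R(1) _ R(2) subset_refl, of "fs_space scale U W"]
    P.subspace_0[OF R(1)] by (simp add: fs_space_def)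

lemma induced_fs:
  assumes f: "Vector_Spaces.linear ps ps f" and R: "P.subspace R" and R': "P.subspace R'"
    and fR: "\<And>r. r \<in> R \<Longrightarrow> f r \<in> R'"
  shows "induced_map (fs_space scale U' W') R' f (R +>\<^bsub>fs_space scale U W\<^esub> v) = R' +>\<^bsub>fs_space scale U' W'\<^esub> f v"
proof -
  have "{u. u - f w \<in> R'} = {u. u - f v \<in> R'}" if "w - v \<in> R" for w
  proof -
    have d: "f w - f v \<in> R'" using fR[OF that] by (simp add: lin_diff[OF f])
    have "u - f w \<in> R' \<longleftrightarrow> u - f v \<in> R'" for u
      using P.subspace_add[OF R' _ d, of "u - f w"] P.subspace_diff[OF R' _ d, of "u - f v"] by auto
    then show ?thesis by blast
  qed
  moreover have "v \<in> {w. w - v \<in> R}" using P.subspace_0[OF R] by simp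
  ultimately show ?thesis unfolding induced_map_def coset_fs by blast
qed

end

section \<open>Homology of coinvariants\<close>

lemma ssum_zero: "ssum {0} S = S" by auto
lemma ssum_commute: "ssum S S' = ssum S' S" by (metis (no_types, opaque_lifting) add.commute)

lemma (in vector_space) ssum_absorb:
  assumes S: "subspace S" and le: "S' \<subseteq> S" and S': "subspace S'" shows "ssum S' S = S"
proof
  show "ssum S' S \<subseteq> S" using le subspace_add[OF S] by blast
  show "S \<subseteq> ssum S' S"
  proof
    fix v assume "v \<in> S"
    then have "v = 0 + v \<and> 0 \<in> S' \<and> v \<in> S" using subspace_0[OF S'] by simp
    then show "v \<in> ssum S' S" by blast
  qed
qed

context gset_coeff
begin

lemma quotient_complex:
  assumes S: "\<And>m. P.subspace (S m)" "\<And>m. S m \<subseteq> L m" "\<And>m v. v \<in> S (Suc m) \<Longrightarrow> bd v \<in> S m"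
  shows "presented_complex ps (\<lambda>n. L (Suc n)) (\<lambda>n. ssum (S (Suc n)) (Rel (Suc n))) (\<lambda>_. bd)"
proof (intro presented_complex.intro presented_complex_axioms.intro)
  show "vector_space (ps :: 'k \<Rightarrow> ('y list \<Rightarrow>\<^sub>0 'm) \<Rightarrow> _)" by (rule vs_ps)
  show "P.subspace (ssum (S (Suc n)) (Rel (Suc n)))" for n by (rule P.subspace_sums[OF S(1) sub_Rel])
  show "ssum (S (Suc n)) (Rel (Suc n)) \<subseteq> L (Suc n)" for n
    using S(2)[of "Suc n"] Rel_L[of "Suc n"] P.subspace_add[OF sub_L] by blast
  show "bd z \<in> ssum (S (Suc n)) (Rel (Suc n))" if z: "z \<in> ssum (S (Suc (Suc n))) (Rel (Suc (Suc n)))" for z n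
  proof -
    obtain v r where "z = v + r" "v \<in> S (Suc (Suc n))" "r \<in> Rel (Suc (Suc n))" using z by blast
    then have "bd z = bd v + bd r \<and> bd v \<in> S (Suc n) \<and> bd r \<in> Rel (Suc n)"
      using S(3) Rel_bd by (simp add: lin_add[OF lin_bd])
    then show ?thesis by blast
  qed
  show "bd (bd z) \<in> ssum (S (Suc n)) (Rel (Suc n))" for z n
    using P.subspace_0[OF P.subspace_sums[OF S(1) sub_Rel]] by (simp add: bd_bd)
qed (simp_all add: sub_L lin_bd L_bd)

end

context relative_acyclic
begin

lemma coinvariants_acyclic_mod:
  assumes v: "v \<in> ssum (A (Suc n)) (Rel (Suc n))" and bv: "n > 0 \<longrightarrow> bd v \<in> ssum (B (Suc (n - 1))) (Rel (Suc (n - 1)))"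
  shows "\<exists>v'\<in>ssum (A (Suc (Suc n))) (Rel (Suc (Suc n))). v - bd v' \<in> ssum (B (Suc n)) (Rel (Suc n))"
proof -
  have S: "P.subspace (ssum (B m) (Rel m))" for m by (rule P.subspace_sums[OF sub_B sub_Rel])
  have R_S: "r \<in> ssum (B m) (Rel m)" if "r \<in> Rel m" for r m
  proof -
    have "r = 0 + r \<and> 0 \<in> B m \<and> r \<in> Rel m" using that P.subspace_0[OF sub_B] by simp
    then show ?thesis by blast
  qed
  obtain w r where wr: "v = w + r" "w \<in> A (Suc n)" "r \<in> Rel (Suc n)" using v by blast
  have "bd w \<in> ssum (B n) (Rel n)" if n: "n > 0"
  proof -
    have "bd v - bd r \<in> ssum (B n) (Rel n)" using bv n Rel_bd[OF wr(3)] by (intro P.subspace_diff[OF S _ R_S]) auto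
    then show ?thesis using wr(1) by (simp add: lin_add[OF lin_bd])
  qed
  then obtain w' where w': "w' \<in> A (Suc (Suc n))" "w - bd w' \<in> ssum (B (Suc n)) (Rel (Suc n))"
    using coinvariants_acyclic[OF wr(2)] by blast
  have e: "(w - bd w') + r = v - bd w'" using wr(1) by simp
  have "v - bd w' \<in> ssum (B (Suc n)) (Rel (Suc n))"
    using P.subspace_add[OF S w'(2) R_S[OF wr(3)]] unfolding e .
  moreover have "w' = w' + 0 \<and> w' \<in> A (Suc (Suc n)) \<and> 0 \<in> Rel (Suc (Suc n))" using w'(1) P.subspace_0[OF sub_Rel] by simp
  then have "w' \<in> ssum (A (Suc (Suc n))) (Rel (Suc (Suc n)))" by blast
  ultimately show ?thesis by blast
qed

lemma coinvariants_qiso: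
  "qiso ps ps
    (cycles (\<lambda>n. L (Suc n)) (\<lambda>n. ssum (B (Suc n)) (Rel (Suc n))) (\<lambda>_. bd) n)
    (boundaries (\<lambda>n. L (Suc n)) (\<lambda>n. ssum (B (Suc n)) (Rel (Suc n))) (\<lambda>_. bd) n)
    (cycles (\<lambda>n. L (Suc n)) (\<lambda>n. ssum (A (Suc n)) (Rel (Suc n))) (\<lambda>_. bd) n)
    (boundaries (\<lambda>n. L (Suc n)) (\<lambda>n. ssum (A (Suc n)) (Rel (Suc n))) (\<lambda>_. bd) n) (\<lambda>z. z)"
proof (rule qiso_acyclic)
  show "presented_complex ps (\<lambda>n. L (Suc n)) (\<lambda>n. ssum (B (Suc n)) (Rel (Suc n))) (\<lambda>_. bd)"
    using B_A A_L by (intro quotient_complex sub_B bd_B) auto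
  show "presented_complex ps (\<lambda>n. L (Suc n)) (\<lambda>n. ssum (A (Suc n)) (Rel (Suc n))) (\<lambda>_. bd)"
    using A_L by (intro quotient_complex sub_A bd_A) auto
  show "ssum (B (Suc n)) (Rel (Suc n)) \<subseteq> ssum (A (Suc n)) (Rel (Suc n))" for n using B_A by blast
qed (rule coinvariants_acyclic_mod)

end

section \<open>Group homology of the centralizer quotient\<close>

context twisted_coeff
begin

definition rel_A :: "nat \<Rightarrow> ('g list \<Rightarrow>\<^sub>0 'm) set" where "rel_A n = ssum (A (Suc n)) (C.Rel (Suc n))"

abbreviation CL :: "nat \<Rightarrow> ('g list \<Rightarrow>\<^sub>0 'm) set" where "CL n \<equiv> C.L (Suc n)"
abbreviation CR :: "nat \<Rightarrow> ('g list \<Rightarrow>\<^sub>0 'm) set" where "CR n \<equiv> C.Rel (Suc n)"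

lemma A_complex: "presented_complex ps CL rel_A (\<lambda>_. bd)"
  unfolding rel_A_def by (intro C.quotient_complex sub_A A_bd) (auto simp: A_def)

text \<open>
  The map \<open>pm\<close> is surjective, on chains and on relations, and \<open>A\<close> is the full preimage of the
  alternating relations; so the two quotient complexes are isomorphic.
\<close>

lemma pm_qiso:
  "qiso ps ps (cycles CL rel_A (\<lambda>_. bd) n) (boundaries CL rel_A (\<lambda>_. bd) n)
    (cycles (\<lambda>n. D.L (Suc n)) (\<lambda>n. ssum (Alt Q W (Suc n)) (D.Rel (Suc n))) (\<lambda>_. bd) n)
    (boundaries (\<lambda>n. D.L (Suc n)) (\<lambda>n. ssum (Alt Q W (Suc n)) (D.Rel (Suc n))) (\<lambda>_. bd) n) pm"
proof -
  interpret I: relative_acyclic scale \<Gamma> Q qa a W Q qa cyc_x "\<lambda>u. u" "Alt Q W" "\<lambda>_. {0}" by (rule Alt_relative_acyclic)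
  interpret CA: presented_complex ps CL rel_A "\<lambda>_. bd" by (rule A_complex)
  interpret DA: presented_complex ps "\<lambda>n. D.L (Suc n)" "\<lambda>n. ssum (Alt Q W (Suc n)) (D.Rel (Suc n))" "\<lambda>_. bd"
    by (intro D.quotient_complex I.sub_A I.A_L I.bd_A)
  have rel: "pm z \<in> ssum (Alt Q W (Suc n)) (D.Rel (Suc n)) \<longleftrightarrow> z \<in> rel_A n" if z: "z \<in> CL n" for z n
  proof
    assume "pm z \<in> ssum (Alt Q W (Suc n)) (D.Rel (Suc n))"
    then obtain \<alpha> r where r: "pm z = \<alpha> + r" "\<alpha> \<in> Alt Q W (Suc n)" "r \<in> D.Rel (Suc n)" by blast
    obtain r' where r': "r' \<in> CR n" "r = pm r'" using pm_Rel_surj[OF r(3)] by blast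
    have "z - r' \<in> A (Suc n)"
      using z r r' C.Rel_L[of "Suc n"] P.subspace_diff[OF C.sub_L] by (auto simp: A_def lin_diff[OF lin_pm])
    moreover have "z = (z - r') + r'" by simp
    ultimately show "z \<in> rel_A n" unfolding rel_A_def using r'(1) by blast
  next
    assume "z \<in> rel_A n"
    then obtain v r where "z = v + r" "v \<in> A (Suc n)" "r \<in> CR n" unfolding rel_A_def by blast
    then have "pm z = pm v + pm r \<and> pm v \<in> Alt Q W (Suc n) \<and> pm r \<in> D.Rel (Suc n)"
      using pm_Rel by (simp add: A_def lin_add[OF lin_pm])
    then show "pm z \<in> ssum (Alt Q W (Suc n)) (D.Rel (Suc n))" by blast
  qed
  let ?DR = "\<lambda>n. ssum (Alt Q W (Suc n)) (D.Rel (Suc n))"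
  have cyc: "pm z \<in> cycles (\<lambda>n. D.L (Suc n)) ?DR (\<lambda>_. bd) n \<longleftrightarrow> z \<in> cycles CL rel_A (\<lambda>_. bd) n"
    if z: "z \<in> CL n" for z
  proof (cases n)
    case 0
    then show ?thesis using z pm_L by (simp add: cycles_def)
  next
    case (Suc m)
    then have "bd z \<in> CL m" using z C.L_bd by simp
    from rel[OF this] show ?thesis using z pm_L Suc by (simp add: cycles_def bd_pm)
  qed
  have bds: "z \<in> boundaries CL rel_A (\<lambda>_. bd) n"
    if z: "z \<in> cycles CL rel_A (\<lambda>_. bd) n" and pz: "pm z \<in> boundaries (\<lambda>n. D.L (Suc n)) ?DR (\<lambda>_. bd) n" for z
  proof -
    obtain v r where vr: "pm z = bd v + r" "v \<in> D.L (Suc (Suc n))" "r \<in> ?DR n"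
      using pz unfolding boundaries_def by blast
    obtain v' where v': "v' \<in> C.L (Suc (Suc n))" "v = pm v'" using pm_surj[OF vr(2)] by blast
    have zL: "z - bd v' \<in> CL n" using z v' C.L_bd P.subspace_diff[OF C.sub_L] by (auto simp: cycles_def)
    have "pm (z - bd v') = r" using vr(1) v'(2) by (simp add: lin_diff[OF lin_pm] bd_pm)
    then have "z - bd v' \<in> rel_A n" using rel[OF zL] vr(3) by simp
    moreover have "z = bd v' + (z - bd v')" by simp
    ultimately show ?thesis unfolding boundaries_def using v'(1) by blast
  qed
  have bds': "pm z \<in> boundaries (\<lambda>n. D.L (Suc n)) ?DR (\<lambda>_. bd) n" if z: "z \<in> boundaries CL rel_A (\<lambda>_. bd) n" for z
  proof -
    obtain v r where vr: "z = bd v + r" "v \<in> CL (Suc n)" "r \<in> rel_A n" using z unfolding boundaries_def by blast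
    have "pm z = bd (pm v) + pm r" using vr by (simp add: lin_add[OF lin_pm] bd_pm)
    moreover have "pm r \<in> ?DR n" using rel CA.R_le vr(3) by blast
    ultimately show ?thesis unfolding boundaries_def using pm_L[OF vr(2)] by blast
  qed
  have surj: "\<exists>z\<in>cycles CL rel_A (\<lambda>_. bd) n. w - pm z \<in> boundaries (\<lambda>n. D.L (Suc n)) ?DR (\<lambda>_. bd) n"
    if w: "w \<in> cycles (\<lambda>n. D.L (Suc n)) ?DR (\<lambda>_. bd) n" for w
  proof -
    obtain z where z: "z \<in> CL n" "w = pm z" using pm_surj[of w "Suc n"] w by (auto simp: cycles_def)
    then have "z \<in> cycles CL rel_A (\<lambda>_. bd) n" using cyc w by blast
    then show ?thesis using z(2) P.subspace_0[OF DA.sub_boundaries] by (intro bexI[of _ z]) simp_all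
  qed
  have cL: "cycles CL rel_A (\<lambda>_. bd) n \<subseteq> CL n" by (auto simp: cycles_def)
  show ?thesis
    unfolding qiso_def
    using lin_pm CA.sub_cycles CA.sub_boundaries CA.boundaries_le DA.sub_cycles DA.sub_boundaries DA.boundaries_le
      cyc bds bds' surj cL by blast
qed

lemma cyc_x_normal: "cyc_x \<lhd> \<Gamma>"
proof -
  have sub: "subgroup cyc_x \<Gamma>"
    unfolding \<Gamma>_def
    by (rule G.subgroup_incl[OF cyc_x_sub cent_sub])
      (auto simp: cyc_x_def intro!: G.generate_subgroup_incl[OF _ cent_sub] x_cent)
  have comm: "k \<otimes> g = g \<otimes> k" if k: "k \<in> cyc_x" and g: "g \<in> centralizer G x" for k g
  proof -
    have "x \<in> centralizer G g" using g x by (simp add: centralizer_def)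
    then have "cyc_x \<subseteq> centralizer G g"
      unfolding cyc_x_def by (intro G.generate_subgroup_incl G.subgroup_centralizer centD(1)[OF g]) auto
    then show ?thesis using k by (auto simp: centralizer_def)
  qed
  show ?thesis
  proof (rule C.\<Gamma>.normalI[OF sub], rule ballI)
    fix g assume "g \<in> carrier \<Gamma>"
    then have "(\<Union>k\<in>cyc_x. {k \<otimes> g}) = (\<Union>k\<in>cyc_x. {g \<otimes> k})" by (intro SUP_cong refl) (subst comm, simp_all)
    then show "cyc_x #>\<^bsub>\<Gamma>\<^esub> g = g <#\<^bsub>\<Gamma>\<^esub> cyc_x" by (simp add: r_coset_def l_coset_def)
  qed
qed

lemma Q_mult: assumes u: "u \<in> Q" and g: "g \<in> centralizer G x"
  shows "u \<otimes>\<^bsub>centralizer_quot G x\<^esub> (cyc_x #> g) = qa u g"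
proof -
  obtain h where h: "h \<in> centralizer G x" "u = cyc_x #> h" by (rule QE[OF u])
  have "u \<otimes>\<^bsub>centralizer_quot G x\<^esub> (cyc_x #> g) = (cyc_x #>\<^bsub>\<Gamma>\<^esub> h) <#>\<^bsub>\<Gamma>\<^esub> (cyc_x #>\<^bsub>\<Gamma>\<^esub> g)"
    using h by (simp add: centralizer_quot_def FactGroup_def r_coset_def set_mult_def)
  also have "\<dots> = cyc_x #>\<^bsub>\<Gamma>\<^esub> (h \<otimes>\<^bsub>\<Gamma>\<^esub> g)" using h g by (intro normal.rcos_sum[OF cyc_x_normal]) simp_all
  also have "\<dots> = qa u g" using h g by (simp add: qa_def coset_coset centD) (simp add: r_coset_def)
  finally show ?thesis .
qed

definition ca :: "'g set \<Rightarrow> 'm \<Rightarrow> 'm" where "ca U m = a (SOME g. g \<in> U) m"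

text \<open>
  The chosen element of the coset is a power of \<open>x\<close> times \<open>g\<close>, and \<open>x\<close> acts trivially on \<open>W\<close>.
\<close>

lemma ca: assumes g: "g \<in> centralizer G x" and w: "w \<in> W" shows "ca (cyc_x #> g) w = a g w"
proof -
  have "g \<in> cyc_x #> g" by (rule G.rcos_self[OF centD(1)[OF g] cyc_x_sub])
  then have "(SOME k. k \<in> cyc_x #> g) \<in> cyc_x #> g" by (rule someI)
  then obtain i :: int where i: "(SOME k. k \<in> cyc_x #> g) = x [^] i \<otimes> g" by (auto simp: r_coset_def cyc_x)
  have aw: "a g w \<in> W" by (rule a_closed[OF g w])
  have "w' = a (x [^] (k::nat)) w'" if "w' \<in> W" for w' k
    using that x by (induction k) (simp_all add: a_one a_mult a_x)
  moreover have "a (x [^] - int k) w' = w'" if "w' \<in> W" for w' k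
  proof -
    have "a (x [^] - int k) (a (x [^] k) w') = w'"
      using x by (simp add: G.int_pow_neg int_pow_int a_one flip: a_mult)
    then show ?thesis using calculation[OF that, of k] by simp
  qed
  ultimately have "a (x [^] i) (a g w) = a g w" using aw by (cases i rule: int_cases2) (auto simp: int_pow_int)
  then show ?thesis using i x centD(1)[OF g] by (simp add: ca_def a_mult)
qed

lemma grp_chain_rel_eq: "grp_chain_rel (centralizer_quot G x) scale ca W n = D.Rel (Suc n)"
proof -
  have eq: "Poly_Mapping.single (map (\<lambda>s. s \<otimes>\<^bsub>centralizer_quot G x\<^esub> (cyc_x #> g)) us) w - Poly_Mapping.single us (ca (cyc_x #> g) w) =
      Poly_Mapping.single (map (\<lambda>s. qa s g) us) w - Poly_Mapping.single us (a g w)"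
    if "us \<in> tuples Q (Suc n)" "g \<in> centralizer G x" "w \<in> W" for us g w
  proof -
    have m: "map (\<lambda>s. s \<otimes>\<^bsub>centralizer_quot G x\<^esub> (cyc_x #> g)) us = map (\<lambda>s. qa s g) us"
      using tuplesD(2)[OF that(1)] that(2) by (auto simp: Q_mult)
    show ?thesis by (simp only: m ca[OF that(2,3)])
  qed
  have "{Poly_Mapping.single (map (\<lambda>s. s \<otimes>\<^bsub>centralizer_quot G x\<^esub> g) gs) v - Poly_Mapping.single gs (ca g v) |gs g v.
          gs \<in> tuples (carrier (centralizer_quot G x)) (Suc n) \<and> g \<in> carrier (centralizer_quot G x) \<and> v \<in> W} =
    {Poly_Mapping.single (map (\<lambda>y. qa y g) ys) w - Poly_Mapping.single ys (a g w) |ys g w.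
     ys \<in> tuples Q (Suc n) \<and> g \<in> carrier \<Gamma> \<and> w \<in> W}" (is "?l = ?r")
  proof
    show "?l \<subseteq> ?r"
    proof
      fix z assume "z \<in> ?l"
      then obtain us u w where z: "z = Poly_Mapping.single (map (\<lambda>s. s \<otimes>\<^bsub>centralizer_quot G x\<^esub> u) us) w - Poly_Mapping.single us (ca u w)"
        and u: "us \<in> tuples Q (Suc n)" "u \<in> Q" "w \<in> W" by (auto simp: Q_def)
      obtain g where g: "g \<in> centralizer G x" "u = cyc_x #> g" by (rule QE[OF u(2)])
      have "z = Poly_Mapping.single (map (\<lambda>s. qa s g) us) w - Poly_Mapping.single us (a g w)"
        unfolding z g(2) by (rule eq[OF u(1) g(1) u(3)])
      then show "z \<in> ?r" using u g by auto
    qed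
    show "?r \<subseteq> ?l"
    proof
      fix z assume "z \<in> ?r"
      then obtain us g w where z: "z = Poly_Mapping.single (map (\<lambda>s. qa s g) us) w - Poly_Mapping.single us (a g w)"
        and u: "us \<in> tuples Q (Suc n)" "g \<in> centralizer G x" "w \<in> W" by auto
      have "z = Poly_Mapping.single (map (\<lambda>s. s \<otimes>\<^bsub>centralizer_quot G x\<^esub> (cyc_x #> g)) us) w - Poly_Mapping.single us (ca (cyc_x #> g) w)"
        unfolding z by (rule eq[OF u, symmetric])
      then show "z \<in> ?l" using u Q_coset[OF u(2)] by (auto simp: Q_def)
    qed
  qed
  then show ?thesis by (simp only: grp_chain_rel_def D.Rel_def)
qed

lemma presents_group_homology_D:
  "presents ps (cycles (\<lambda>n. D.L (Suc n)) (\<lambda>n. D.Rel (Suc n)) (\<lambda>_. bd) n)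
     (boundaries (\<lambda>n. D.L (Suc n)) (\<lambda>n. D.Rel (Suc n)) (\<lambda>_. bd) n)
     (group_homology (centralizer_quot G x) scale ca W (int n))"
proof -
  have cpx: "presented_complex ps (\<lambda>n. D.L (Suc n)) (\<lambda>n. D.Rel (Suc n)) (\<lambda>_. bd)"
    using D.quotient_complex[of "\<lambda>_. {0}"] by (simp add: P.subspace_0[OF D.sub_L] lin_0[OF lin_bd] ssum_zero)
  let ?\<phi> = "\<lambda>n v. D.Rel (Suc n) +>\<^bsub>fs_space scale (tuples Q (Suc n)) W\<^esub> v"
  have pres: "pres_map ps (D.L (Suc n)) (D.Rel (Suc n)) (grp_chains (centralizer_quot G x) scale ca W n) (?\<phi> n)" for n
    using pres_quot_fs[OF sub_W D.sub_Rel D.Rel_L[unfolded D.L_def]]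
    by (simp only: grp_chains_def grp_chain_pre_def grp_chain_rel_eq D.L_def Q_def[symmetric])
  show ?thesis
    unfolding group_homology_def
  proof (rule presented_complex.presents_homology[OF cpx pres])
    fix n z assume z: "z \<in> D.L (Suc (Suc n))"
    have dR: "push (delete_nth i) r \<in> D.Rel (Suc n)" if r: "r \<in> D.Rel (Suc (Suc n))" and i: "i \<le> Suc n" for r i
    proof (rule D.Rel_in[OF lin_push D.sub_Rel r])
      fix g v assume g: "g \<in> carrier \<Gamma>" and v: "v \<in> D.L (Suc (Suc n))"
      have "push (delete_nth i) (D.ac g v) = D.ac g (push (delete_nth i) v)"
        by (rule lin_eq_all[OF lin_comp[OF lin_push D.lin_ac[OF g]] lin_comp[OF D.lin_ac[OF g] lin_push]])
          (use g in \<open>simp add: delete_nth_map\<close>)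
      moreover have "push (delete_nth i) v \<in> D.L (Suc n)"
        using i v unfolding D.L_def by (intro push_L[OF sub_W]) (auto intro: delete_nth_tuples)
      ultimately show "push (delete_nth i) (D.ac g v) - push (delete_nth i) v \<in> D.Rel (Suc n)"
        using D.ac_Rel[OF g] by simp
    qed
    have "grp_diff (centralizer_quot G x) scale ca W (Suc n) (?\<phi> (Suc n) z) =
        ?\<phi> n (\<Sum>i<Suc (Suc n). ps ((-1) ^ i) (push (delete_nth i) z))"
      unfolding grp_diff_def diff_Suc_1 push_def[symmetric] grp_chain_pre_def grp_chain_rel_eq Q_def[symmetric]
    proof (rule alt_sum_pres[OF pres])
      fix i assume i: "i < Suc (Suc n)"
      show "induced_map (fs_space scale (tuples Q (Suc n)) W) (D.Rel (Suc n)) (push (delete_nth i)) (?\<phi> (Suc n) z) =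
          ?\<phi> n (push (delete_nth i) z)"
        using i by (intro induced_fs[OF lin_push D.sub_Rel D.sub_Rel] dR) simp_all
      show "push (delete_nth i) z \<in> D.L (Suc n)"
        using i z unfolding D.L_def by (intro push_L[OF sub_W]) (auto intro: delete_nth_tuples)
    qed
    also have "(\<Sum>i<Suc (Suc n). ps ((-1) ^ i) (push (delete_nth i) z)) = bd z"
      using bd_face[OF z[unfolded D.L_def]] by (simp only: face_def)
    finally show "grp_diff (centralizer_quot G x) scale ca W (Suc n) (?\<phi> (Suc n) z) = ?\<phi> n (bd z)" .
  qed
qed

text \<open>
  Dividing by alternation does not change the homology of the chains on \<open>Q\<close>, as the alternating relations are
  relatively acyclic; and \<open>pm\<close> compares the result with chains on \<open>G\<close>.
\<close>

theorem presents_group_homology: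
  "presents ps (cycles CL rel_A (\<lambda>_. bd) n) (boundaries CL rel_A (\<lambda>_. bd) n)
     (group_homology (centralizer_quot G x) scale ca W (int n))"
proof -
  interpret I: relative_acyclic scale \<Gamma> Q qa a W Q qa cyc_x "\<lambda>u. u" "Alt Q W" "\<lambda>_. {0}" by (rule Alt_relative_acyclic)
  show ?thesis
    by (rule presents_pull[OF pm_qiso presents_push[OF I.coinvariants_qiso]])
      (simp only: ssum_zero presents_group_homology_D)
qed

end

section \<open>Elements of finite and of infinite order\<close>

context twisted_coeff
begin

text \<open>
  An operator commutes with the parts \<open>e u\<close> if it sends a basis tensor to a basis tensor with the same number of
  entries over each point.
\<close>

lemma e_unchanged:
  assumes F: "Vector_Spaces.linear ps ps F" and v: "v \<in> C.L m"
    and Fs: "\<And>ys w. ys \<in> tuples (carrier G) m \<Longrightarrow> w \<in> W \<Longrightarrow> \<exists>zs c. F (Poly_Mapping.single ys w) = Poly_Mapping.single zs (scale c w) \<and>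
      (\<forall>c'. F (Poly_Mapping.single ys (scale c' w)) = Poly_Mapping.single zs (scale c (scale c' w))) \<and>
      length zs = length ys \<and> (\<forall>u. count_list (map \<pi> zs) u = count_list (map \<pi> ys) u)"
  shows "F (C.e u v) = C.e u (F v)"
proof (rule C.lin_eq_L[OF lin_comp[OF F C.lin_e] lin_comp[OF C.lin_e F] v])
  fix ys w assume "ys \<in> tuples (carrier G) m" "w \<in> W"
  from Fs[OF this] obtain zs c where z: "F (Poly_Mapping.single ys w) = Poly_Mapping.single zs (scale c w)"
    "\<And>c'. F (Poly_Mapping.single ys (scale c' w)) = Poly_Mapping.single zs (scale c (scale c' w))"
    "length zs = length ys" "\<And>u. count_list (map \<pi> zs) u = count_list (map \<pi> ys) u" by blast
  show "F (C.e u (Poly_Mapping.single ys w)) = C.e u (F (Poly_Mapping.single ys w))"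
    unfolding z(1) C.e_single z(2) z(3,4) by (simp add: mult.commute)
qed

subsection \<open>Finite order\<close>

definition rel_x :: "nat \<Rightarrow> ('g list \<Rightarrow>\<^sub>0 'm) set" where "rel_x m = (\<lambda>v. v - C.ac x v) ` C.L m"

lemma lin_ac_x: "Vector_Spaces.linear ps ps (C.ac x)" by (rule C.lin_ac) (simp add: x_cent)

lemma sub_rel_x: "P.subspace (rel_x m)"
  unfolding rel_x_def by (rule subspace_im[OF lin_minus[OF lin_id[OF vs_ps] lin_ac_x] C.sub_L])

lemma ac_x_L: "v \<in> C.L m \<Longrightarrow> C.ac x v \<in> C.L m" by (rule C.ac_L) (simp add: x_cent)

text \<open>
  The operator \<open>1 - F\<close> divides \<open>1 - F\<^sup>i\<close>.
\<close>

lemma tpow_sum_in: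
  assumes F: "Vector_Spaces.linear ps ps F" and FL: "\<And>v. v \<in> C.L m \<Longrightarrow> F v \<in> C.L m" and v: "v \<in> C.L m"
  shows "v - (F ^^ i) v \<in> (\<lambda>v. v - F v) ` C.L m"
proof -
  have FiL: "(F ^^ j) v \<in> C.L m" for j by (induction j) (simp_all add: FL v)
  have "v - (F ^^ i) v = (\<Sum>j<i. (F ^^ j) v) - F (\<Sum>j<i. (F ^^ j) v)"
  proof (induction i)
    case 0
    then show ?case by (simp add: lin_0[OF F])
  next
    case (Suc i)
    have "v - (F ^^ Suc i) v = (v - (F ^^ i) v) + ((F ^^ i) v - F ((F ^^ i) v))" by simp
    then show ?case unfolding Suc.IH by (simp add: lin_add[OF F] algebra_simps)
  qed
  moreover have "(\<Sum>j<i. (F ^^ j) v) \<in> C.L m" by (intro P.subspace_sum[OF C.sub_L] FiL)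
  ultimately show ?thesis by blast
qed

text \<open>
  The average of \<open>v\<close> over the powers of \<open>x\<close> is congruent to \<open>v\<close> modulo the image of \<open>1 - x\<close>. If
  \<open>bd v = w - x w\<close>, the boundary of the average telescopes to zero, and a cone bounds it.
\<close>

lemma finite_relative_acyclic:
  assumes d: "d > 0" "x [^] (d::nat) = \<one>"
  shows "relative_acyclic scale \<Gamma> (carrier G) (\<lambda>y g. y \<otimes> g) a W Q qa cyc_x \<pi> A rel_x"
  unfolding rel_x_def
proof (rule relative_acyclic_image[OF lin_ac_x ac_x_L])
  have pow: "(C.ac x ^^ i) v = C.ac (x [^] i) v" if "v \<in> C.L m" for i v m
  proof (induction i)
    case 0
    then show ?case using C.ac_one[OF that] by simp
  next
    case (Suc i)
    have "x [^] i \<in> centralizer G x"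
      using x by (simp add: centralizer_def) (metis G.nat_pow_Suc G.nat_pow_Suc2)
    then show ?case using Suc C.ac_ac[of "x [^] i" x v m] x_cent that by simp
  qed
  show "C.ac x (C.ac g v) = C.ac g (C.ac x v)" if "g \<in> centralizer G x" "v \<in> C.L m" for g v m
    using that x_cent centD(2)[OF that(1)] by (simp add: C.ac_ac)
  show "C.ac x (C.e u v) = C.e u (C.ac x v)" if v: "v \<in> C.L m" for u v m
  proof (rule e_unchanged[OF lin_ac_x v])
    fix ys w assume y: "ys \<in> tuples (carrier G) m" "w \<in> W"
    have "map \<pi> (map (\<lambda>y. y \<otimes> x) ys) = map \<pi> ys" using tuplesD(2)[OF y(1)] by (auto simp: \<pi>_x)
    then show "\<exists>zs c. C.ac x (Poly_Mapping.single ys w) = Poly_Mapping.single zs (scale c w) \<and>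
      (\<forall>c'. C.ac x (Poly_Mapping.single ys (scale c' w)) = Poly_Mapping.single zs (scale c (scale c' w))) \<and>
      length zs = length ys \<and> (\<forall>u. count_list (map \<pi> zs) u = count_list (map \<pi> ys) u)"
      using y by (intro exI[of _ "map (\<lambda>y. y \<otimes> x) ys"] exI[of _ 1])
        (simp add: ac_x_single subspace_scale[OF sub_W] del: C.ac_single map_map)
  qed
  show "pm (v - C.ac x v) \<in> Alt Q W m" if "v \<in> C.L m" for v m
    using pm_ac[OF x_cent that] D_ac_x[OF pm_L[OF that]] by (simp add: lin_diff[OF lin_pm] P.subspace_0[OF sub_Alt])
  show "bd (v - C.ac x v) \<in> (\<lambda>v. v - C.ac x v) ` C.L m" if "v \<in> C.L (Suc m)" for v m
    using C.L_bd[OF that] x_cent by (simp add: lin_diff[OF lin_bd] C.bd_ac)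
  show "C.ac x v - v \<in> (\<lambda>v. v - C.ac x v) ` C.L (Suc m)" if "v \<in> C.L (Suc m)" for v m
    using P.subspace_neg[OF C.sub_L that]
    by (intro image_eqI[of _ _ "- v"]) (simp_all add: lin_neg[OF lin_ac_x])
  show "\<exists>u\<in>C.L (Suc (Suc m)). v - bd u \<in> (\<lambda>v. v - C.ac x v) ` C.L (Suc m)"
    if v: "v \<in> C.L (Suc m)" and bv: "bd v \<in> (\<lambda>v. v - C.ac x v) ` C.L m" for v m
  proof -
    let ?c = "1 / of_nat d :: 'k"
    define z where "z = ps ?c (\<Sum>i<d. (C.ac x ^^ i) v)"
    have iL: "(C.ac x ^^ i) u \<in> C.L k" if "u \<in> C.L k" for i u k
      using that by (induction i) (simp_all add: ac_x_L)
    have zL: "z \<in> C.L (Suc m)"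
      unfolding z_def by (intro P.subspace_scale[OF C.sub_L] P.subspace_sum[OF C.sub_L] iL v)
    have lin_i: "Vector_Spaces.linear ps ps (C.ac x ^^ i)" for i by (rule lin_funpow[OF lin_ac_x])
    obtain w where w: "w \<in> C.L m" "bd v = w - C.ac x w" using bv by blast
    have "bd ((C.ac x ^^ i) v) = (C.ac x ^^ i) (bd v)" for i
      using x_cent by (induction i) (simp_all add: C.bd_ac)
    then have "bd z = ps ?c (\<Sum>i<d. (C.ac x ^^ i) w - (C.ac x ^^ Suc i) w)"
      unfolding z_def by (simp add: lin_scale[OF lin_bd] lin_sum[OF lin_bd] w(2) lin_diff[OF lin_i] funpow_swap1)
    also have "(\<Sum>i<d. (C.ac x ^^ i) w - (C.ac x ^^ Suc i) w) = w - (C.ac x ^^ d) w"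
      by (subst sum_lessThan_telescope') simp
    also have "\<dots> = 0" using pow[OF w(1), of d] d(2) C.ac_one[OF w(1)] by simp
    finally have bz: "bd z = 0" by simp
    have "v - z = ps ?c (\<Sum>i<d. v - (C.ac x ^^ i) v)"
      using d(1) by (simp add: z_def sum_subtractf P.scale_right_diff_distrib P.sum_constant_scale)
    also have "\<dots> \<in> (\<lambda>v. v - C.ac x v) ` C.L (Suc m)"
      using sub_rel_x[of "Suc m", unfolded rel_x_def]
      by (intro P.subspace_scale P.subspace_sum tpow_sum_in[OF lin_ac_x ac_x_L v])
    finally have "v - bd (cone \<one> z) \<in> (\<lambda>v. v - C.ac x v) ` C.L (Suc m)"
      by (simp add: bd_cone bz lin_0[OF lin_push])
    then show ?thesis using C.L_cone[OF G.one_closed zL] by blast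
  qed
qed

lemma rel_x_Rel: "rel_x m \<subseteq> C.Rel m"
proof
  fix v assume "v \<in> rel_x m"
  then obtain w where w: "w \<in> C.L m" "v = w - C.ac x w" by (auto simp: rel_x_def)
  have "- (C.ac x w - w) \<in> C.Rel m" by (intro P.subspace_neg[OF C.sub_Rel] C.ac_Rel w) (simp add: x_cent)
  then show "v \<in> C.Rel m" using w by simp
qed

text \<open>
  Over \<open>Q\<close> the rotation is a cyclic permutation, because multiplication by \<open>x\<close> is not seen there.
\<close>

lemma one_t_Alt: assumes v: "v \<in> C.L m" shows "pm (v - t v) \<in> Alt Q W m"
proof (rule C.lin_in_L[OF lin_comp[OF lin_pm lin_minus[OF lin_id[OF vs_ps] lin_t]] sub_Alt v])
  fix ys w assume y: "ys \<in> tuples (carrier G) m" "w \<in> W"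
  show "pm (Poly_Mapping.single ys w - t (Poly_Mapping.single ys w)) \<in> Alt Q W m"
  proof (cases ys rule: rev_cases)
    case Nil
    then show ?thesis by (simp add: lin_0[OF lin_pm] P.subspace_0[OF sub_Alt])
  next
    case (snoc zs z)
    let ?c = "(-1) ^ length zs :: 'k"
    have z: "z \<in> carrier G" using tuplesD(2)[OF y(1)] snoc by simp
    have "[] @ \<pi> z # map \<pi> zs \<in> tuples Q m" using tuplesD[OF y(1)] snoc by (auto simp: tuples_def \<pi>_Q)
    from rotate_Alt[OF this y(2)]
    have "ps (- ?c) (Poly_Mapping.single (\<pi> z # map \<pi> zs) w - ps ?c (Poly_Mapping.single (map \<pi> zs @ [\<pi> z]) w)) \<in> Alt Q W m"
      by (intro P.subspace_scale[OF sub_Alt]) simp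
    moreover have "?c * ?c = 1" by (simp flip: power_mult_distrib)
    ultimately show ?thesis
      using z by (simp add: snoc lin_diff[OF lin_pm] \<pi>_x P.scale_right_diff_distrib single_uminus)
  qed
qed

lemma one_t_A: "v \<in> C.L m \<Longrightarrow> v - t v \<in> A m"
  by (simp add: A_def one_t_Alt t_L P.subspace_diff[OF C.sub_L])

lemma A_rel_A: "A (Suc n) \<subseteq> rel_A n"
proof
  fix v assume "v \<in> A (Suc n)"
  then have "v = v + 0 \<and> v \<in> A (Suc n) \<and> 0 \<in> C.Rel (Suc n)" using P.subspace_0[OF C.sub_Rel] by simp
  then show "v \<in> rel_A n" unfolding rel_A_def by blast
qed

lemma Rel_rel_A: "C.Rel (Suc n) \<subseteq> rel_A n"
proof
  fix v assume "v \<in> C.Rel (Suc n)"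
  then have "v = 0 + v \<and> 0 \<in> A (Suc n) \<and> v \<in> C.Rel (Suc n)" using P.subspace_0[OF sub_A] by simp
  then show "v \<in> rel_A n" unfolding rel_A_def by blast
qed

theorem presents_tot_finite:
  assumes d: "d > 0" "x [^] (d::nat) = \<one>"
  shows "presents T.tot_scale (T.tot_cycles n) (T.tot_boundaries n)
    (vs_dsum (UNIV :: nat set) (\<lambda>i. group_homology (centralizer_quot G x) scale ca W (int n - 2 * int i)))"
proof -
  interpret I: relative_acyclic scale \<Gamma> "carrier G" "\<lambda>y g. y \<otimes> g" a W Q qa cyc_x \<pi> A rel_x
    by (rule finite_relative_acyclic[OF d])
  have absorb: "ssum (rel_x m) (C.Rel m) = C.Rel m" for m by (rule P.ssum_absorb[OF C.sub_Rel rel_x_Rel sub_rel_x])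
  show ?thesis
  proof (rule T.presents_tot_periodic[OF A_complex Rel_rel_A _ _ presents_group_homology])
    show "v - t v \<in> rel_A n" if "v \<in> C.L (Suc n)" for n v using one_t_A[OF that] A_rel_A by blast
    show "\<exists>a'\<in>rel_A (Suc n). v - bd a' \<in> C.Rel (Suc n)"
      if "v \<in> rel_A n" "0 < n \<longrightarrow> bd v \<in> C.Rel (Suc (n - 1))" for n v
      using I.coinvariants_acyclic_mod[of v n] that unfolding absorb rel_A_def by blast
    show "group_homology (centralizer_quot G x) scale ca W j = vs_zero" if "j < 0" for j
      using that by (simp add: group_homology_def homology_def)
  qed
qed

subsection \<open>Infinite order\<close>

text \<open>
  A chain fixed by \<open>t\<close> is fixed by a power of \<open>t\<close> that acts as \<open>x\<close>. So its finite support is invariant under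
  multiplication by \<open>x\<close>, although the orbit of a nonempty tuple is infinite.
\<close>

lemma one_t_injective:
  assumes inf: "G.ord x = 0" and v: "v \<in> C.L (Suc m)" and tv: "t v = v"
  shows "v = 0"
proof (rule ccontr)
  assume "v \<noteq> 0"
  then have ne: "Poly_Mapping.keys v \<noteq> {}" by simp
  let ?K = "Poly_Mapping.keys v" and ?\<phi> = "map (\<lambda>y. y \<otimes> x)"
  have "(t ^^ k) v = v" for k by (induction k) (simp_all add: tv)
  then have "C.ac x v = v" using t_period[OF v] by metis
  moreover have "C.ac x v = push ?\<phi> v"
    by (rule C.lin_eq_L[OF lin_ac_x lin_push v]) (simp add: ac_x_single del: C.ac_single)
  ultimately have pv: "push ?\<phi> v = v" by simp
  have "Poly_Mapping.keys (push ?\<phi> v) \<subseteq> ?\<phi> ` ?K"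
    unfolding push_def lin_ext_def by (rule order_trans[OF keys_sum]) auto
  then have "?K \<subseteq> ?\<phi> ` ?K" unfolding pv .
  then have K: "?\<phi> ` ?K = ?K" by (intro card_seteq[symmetric]) (simp_all add: card_image_le)
  obtain ys where ys: "ys \<in> ?K" using ne by blast
  then have yt: "ys \<in> tuples (carrier G) (Suc m)" using v by (auto simp: C.L_def fin_supp_def)
  have orbit: "map (\<lambda>y. y \<otimes> x [^] (i::nat)) ys \<in> ?K" for i
  proof (induction i)
    case 0
    have "map (\<lambda>y. y \<otimes> x [^] (0::nat)) ys = ys" using tuplesD(2)[OF yt] by (auto intro!: map_idI)
    then show ?case using ys by simp
  next
    case (Suc i)
    have "map (\<lambda>y. y \<otimes> x [^] Suc i) ys = ?\<phi> (map (\<lambda>y. y \<otimes> x [^] i) ys)"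
      using tuplesD(2)[OF yt] x by (auto simp: G.m_assoc)
    then show ?case using Suc K by blast
  qed
  have "inj (\<lambda>i::nat. map (\<lambda>y. y \<otimes> x [^] i) ys)"
  proof (rule injI)
    fix i j :: nat assume e: "map (\<lambda>y. y \<otimes> x [^] i) ys = map (\<lambda>y. y \<otimes> x [^] j) ys"
    obtain z where z: "z \<in> set ys" "z \<in> carrier G"
      using tuplesD[OF yt] by (cases ys) auto
    have "z \<otimes> x [^] i = z \<otimes> x [^] j" using e z(1) by simp
    then have xx: "x [^] i = x [^] j" using z(2) x by simp
    have no: "x [^] d \<noteq> \<one>" if "d \<noteq> 0" for d :: nat
      using inf that G.ord_eq_0[OF x] by auto
    show "i = j"
    proof (cases "i \<le> j")
      case True
      then show ?thesis using G.pow_eq_div2[OF x xx[symmetric]] no[of "j - i"] by auto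
    next
      case False
      then show ?thesis using G.pow_eq_div2[OF x xx] no[of "i - j"] by auto
    qed
  qed
  moreover have "finite (range (\<lambda>i::nat. map (\<lambda>y. y \<otimes> x [^] i) ys))"
    by (rule finite_subset[of _ ?K]) (use orbit in auto)
  ultimately show False using finite_imageD infinite_UNIV_nat by blast
qed

definition rel_t :: "nat \<Rightarrow> ('g list \<Rightarrow>\<^sub>0 'm) set" where "rel_t m = (\<lambda>v. v - t v) ` C.L m"

lemma t_0: assumes v: "v \<in> C.L 0" shows "t v = v"
  by (rule C.lin_eq_L[OF lin_t lin_id[OF vs_ps] v]) (simp add: tuples_0)

text \<open>
  Let \<open>bd v = w - t w\<close>. Then \<open>(1 - t) (bd' w) = bd (bd v) = 0\<close>, so \<open>bd' w = 0\<close> by injectivity, and the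
  extra degeneracy gives \<open>w = bd' u\<close>. Hence \<open>bd v = bd (u - t u)\<close>, and \<open>v - (u - t u)\<close> is a cycle, which is
  bounded by its cone.
\<close>

lemma infinite_relative_acyclic:
  assumes inf: "G.ord x = 0"
  shows "relative_acyclic scale \<Gamma> (carrier G) (\<lambda>y g. y \<otimes> g) a W Q qa cyc_x \<pi> A rel_t"
  unfolding rel_t_def
proof (rule relative_acyclic_image[OF lin_t t_L t_ac _ one_t_Alt])
  show "t (C.e u v) = C.e u (t v)" if v: "v \<in> C.L m" for u v m
  proof (rule e_unchanged[OF lin_t v])
    fix ys w assume y: "ys \<in> tuples (carrier G) m" "w \<in> W"
    have "length (rot ys) = length ys" by (simp add: rot_def)
    moreover have "count_list (map \<pi> (rot ys)) u = count_list (map \<pi> ys) u" for u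
    proof (cases ys rule: rev_cases)
      case (snoc zs z)
      then have "z \<in> carrier G" using tuplesD(2)[OF y(1)] by simp
      then show ?thesis using snoc by (simp add: rot_def \<pi>_x)
    qed (simp add: rot_def)
    ultimately show "\<exists>zs c. t (Poly_Mapping.single ys w) = Poly_Mapping.single zs (scale c w) \<and>
      (\<forall>c'. t (Poly_Mapping.single ys (scale c' w)) = Poly_Mapping.single zs (scale c (scale c' w))) \<and>
      length zs = length ys \<and> (\<forall>u. count_list (map \<pi> zs) u = count_list (map \<pi> ys) u)"
      unfolding t_single by blast
  qed
  have zero_L: "0 \<in> C.L m" for m by (rule P.subspace_0[OF C.sub_L])
  show "bd (v - t v) \<in> (\<lambda>v. v - t v) ` C.L m" if v: "v \<in> C.L (Suc m)" for v m
  proof (cases m)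
    case 0
    have "bd (v - t v) = 0"
    proof (rule C.lin_eq_L[OF lin_comp[OF lin_bd lin_minus[OF lin_id[OF vs_ps] lin_t]] lin_zero[OF vs_ps vs_ps] v])
      fix ys w assume "ys \<in> tuples (carrier G) (Suc m)"
      then obtain y where "ys = [] @ [y]" using 0 by (auto elim!: tuples_snocE simp: tuples_0)
      then show "bd (Poly_Mapping.single ys w - t (Poly_Mapping.single ys w)) = 0"
        by (simp only: t_snoc lin_diff[OF lin_bd]) (simp add: bd_single delete_nth_def)
    qed
    then show ?thesis using zero_L by (intro image_eqI[of _ _ 0]) (simp_all add: lin_0[OF lin_t])
  next
    case (Suc k)
    then show ?thesis using bd_one_minus_t[of v k] bd'_L'[of v m] v by simp
  qed
  show "C.ac x v - v \<in> (\<lambda>v. v - t v) ` C.L (Suc m)" if v: "v \<in> C.L (Suc m)" for v m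
  proof -
    have "C.ac x v - v = t (nrm m v) - nrm m v"
      unfolding nrm_def t_period[OF v, symmetric] by (rule sum_funpow_shift[OF lin_t, symmetric])
    then show ?thesis using P.subspace_neg[OF C.sub_L nrm_L[OF v, of m]]
      by (intro image_eqI[of _ _ "- nrm m v"]) (simp_all add: lin_neg[OF lin_t])
  qed
  show "\<exists>u\<in>C.L (Suc (Suc m)). v - bd u \<in> (\<lambda>v. v - t v) ` C.L (Suc m)"
    if v: "v \<in> C.L (Suc m)" and bv: "bd v \<in> (\<lambda>v. v - t v) ` C.L m" for v m
  proof -
    have "\<exists>u\<in>C.L (Suc m). bd v = bd (u - t u)"
    proof (cases m)
      case 0
      then have "bd v = 0" using bv t_0 by auto
      then show ?thesis using zero_L by (intro bexI[of _ 0]) (simp_all add: lin_0[OF lin_t] lin_0[OF lin_bd])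
    next
      case (Suc k)
      obtain w where w: "w \<in> C.L (Suc k)" "bd v = w - t w" using bv Suc by auto
      have "bd' w = 0"
      proof (cases k)
        case 0
        then show ?thesis using bd'_1 w by simp
      next
        case (Suc j)
        have "bd' w - t (bd' w) = bd (bd v)" using bd_one_minus_t[of w j] w Suc by simp
        then have "t (bd' w) = bd' w" by (simp add: bd_bd)
        then show ?thesis using one_t_injective[OF inf, of "bd' w" j] bd'_L'[of w k] w Suc by simp
      qed
      then have "bd' (extra w) = w" using bd'_extra[OF w(1)[unfolded C.L_def]] by (simp add: lin_0[OF lin_extra])
      then have "bd v = bd (extra w - t (extra w))" using bd_one_minus_t[OF extra_L[OF w(1)]] w(2) by simp
      then show ?thesis using extra_L[OF w(1)] Suc by blast
    qed
    then obtain u where u: "u \<in> C.L (Suc m)" "bd v = bd (u - t u)" by blast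
    let ?z = "v - (u - t u)"
    have "bd (cone \<one> ?z) = ?z" using u(2) by (simp add: bd_cone lin_diff[OF lin_bd] lin_0[OF lin_push])
    then have "v - bd (cone \<one> ?z) = u - t u" by simp
    then have "v - bd (cone \<one> ?z) \<in> (\<lambda>v. v - t v) ` C.L (Suc m)" using u(1) by simp
    moreover have "?z \<in> C.L (Suc m)" using v u(1) by (intro P.subspace_diff[OF C.sub_L] t_L)
    ultimately show ?thesis using C.L_cone[OF G.one_closed] by blast
  qed
qed

theorem presents_tot_infinite:
  assumes inf: "G.ord x = 0"
  shows "presents T.tot_scale (T.tot_cycles n) (T.tot_boundaries n)
    (group_homology (centralizer_quot G x) scale ca W (int n))"
proof -
  interpret I: relative_acyclic scale \<Gamma> "carrier G" "\<lambda>y g. y \<otimes> g" a W Q qa cyc_x \<pi> A rel_t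
    by (rule infinite_relative_acyclic[OF inf])
  have c: "T.connes_rel = (\<lambda>n. ssum (rel_t (Suc n)) (C.Rel (Suc n)))"
    unfolding T.connes_rel_def rel_t_def by (intro ext ssum_commute)
  show ?thesis
    by (rule presents_pull[OF T.connes_qiso[unfolded c] presents_pull[OF I.coinvariants_qiso[folded rel_A_def] presents_group_homology]])
qed

end

section \<open>Crossed modules over group algebras\<close>

lemma ga_counit_basis: "ga_counit (ga_basis g) = (1 :: 'k::field)"
  by (simp add: ga_counit_def lin_ext_single)

lemma tens_single: "tens scale (Poly_Mapping.single y c) m = Poly_Mapping.single y (scale c m)"
  if "scale 0 m = 0"
  by (rule poly_mapping_eqI) (simp add: tens_def Poly_Mapping.map.rep_eq lookup_single when_def that)

lemma ga_mult_single: "ga_mult G (Poly_Mapping.single g c) (Poly_Mapping.single h d) = Poly_Mapping.single (g \<otimes>\<^bsub>G\<^esub> h) (c * d)"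
  by (simp add: ga_mult_def lin_ext_single)

lemma ga_comult_basis: "ga_comult (ga_basis g) = Poly_Mapping.single (g, g) 1"
  by (simp add: ga_comult_def lin_ext_single)

lemma ga_comult_iter_basis: "ga_comult_iter n (ga_basis g) = Poly_Mapping.single (replicate n g) 1"
  by (induction n) (simp_all add: ga_counit_basis ga_comult_basis lin_ext_single)

locale modular_coeff = modular_crossed_module G scale act \<rho>
  for G :: "('g, 'z) monoid_scheme" (structure)
    and scale :: "'k::field_char_0 \<Rightarrow> 'm::ab_group_add \<Rightarrow> 'm"
    and act :: "('g \<Rightarrow>\<^sub>0 'k) \<Rightarrow> 'm \<Rightarrow> 'm"
    and \<rho> :: "'m \<Rightarrow> ('g \<Rightarrow>\<^sub>0 'm)"
begin

sublocale coeff_space scale by unfold_locales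

definition a :: "'g \<Rightarrow> 'm \<Rightarrow> 'm" where "a g = act (ga_basis g)"
definition comp :: "'g \<Rightarrow> 'm \<Rightarrow> 'm" where "comp y m = Poly_Mapping.lookup (\<rho> m) y"
abbreviation W :: "'g \<Rightarrow> 'm set" where "W \<equiv> homogeneous_part scale \<rho>"

lemma tens_s: "tens scale (Poly_Mapping.single y c) m = Poly_Mapping.single y (scale c m)"
  by (simp add: tens_single)

lemma ga_single: "g \<in> carrier G \<Longrightarrow> Poly_Mapping.single g c \<in> group_alg G"
  by (auto simp: group_alg_def fin_supp_def lookup_single when_def)

lemma lin_a: assumes g: "g \<in> carrier G" shows "Vector_Spaces.linear scale scale (a g)"
proof (rule linI[OF vs_scale vs_scale])
  show "a g (m + m') = a g m + a g m'" for m m'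
    unfolding a_def by (rule act_add_right[OF ga_single[OF g]])
  show "a g (scale c m) = scale c (a g m)" for c m
  proof -
    have "a g (scale c m) = act (ga_mult G (ga_basis g) (Poly_Mapping.single \<one> c)) m"
      using g by (simp add: a_def act_mult ga_single act_scalar)
    also have "\<dots> = act (ga_mult G (Poly_Mapping.single \<one> c) (ga_basis g)) m"
      using g by (simp add: ga_mult_single)
    also have "\<dots> = scale c (a g m)"
      using g by (simp add: a_def act_mult ga_single act_scalar)
    finally show ?thesis .
  qed
qed

lemma a_mult: "g \<in> carrier G \<Longrightarrow> h \<in> carrier G \<Longrightarrow> a (g \<otimes> h) m = a g (a h m)"
  unfolding a_def by (simp add: ga_single ga_mult_single flip: act_mult)

lemma a_one: "a \<one> m = m" by (simp add: a_def act_scalar)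

lemma a_inv: "g \<in> carrier G \<Longrightarrow> a g (a (inv g) m) = m"
  by (simp flip: a_mult add: a_one)

lemma lin_\<rho>: "Vector_Spaces.linear scale ps \<rho>" by (rule coact_linear)

lemma keys_\<rho>: "Poly_Mapping.keys (\<rho> m) \<subseteq> carrier G"
  using coact_closed[of m] by (auto simp: fin_supp_def)

lemma sum_comp: "(\<Sum>y\<in>Poly_Mapping.keys (\<rho> m). comp y m) = m"
  using coact_counit[of m] by (simp add: lin_ext_def ga_counit_basis comp_def)

lemma W_iff: "m \<in> W y \<longleftrightarrow> \<rho> m = Poly_Mapping.single y m"
  by (simp add: homogeneous_part_def tens_s)

text \<open>
  Coassociativity at the basis element \<open>(z, y)\<close>.
\<close>

lemma \<rho>_comp: "\<rho> (comp y m) = Poly_Mapping.single y (comp y m)"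
proof (rule poly_mapping_eqI)
  fix z
  have "lin_ext (\<lambda>x m0. lin_ext (\<lambda>y m00. Poly_Mapping.single (y, x) m00) (\<rho> m0)) (\<rho> m) =
       lin_ext (\<lambda>x m0. Poly_Mapping.single (x, x) m0) (\<rho> m)"
    using coact_coassoc[of m] by (simp add: ga_comult_basis tens_s)
  then have "Poly_Mapping.lookup (lin_ext (\<lambda>x m0. lin_ext (\<lambda>y m00. Poly_Mapping.single (y, x) m00) (\<rho> m0)) (\<rho> m)) (z, y) =
       Poly_Mapping.lookup (lin_ext (\<lambda>x m0. Poly_Mapping.single (x, x) m0) (\<rho> m)) (z, y)" by simp
  moreover have "Poly_Mapping.lookup (lin_ext (\<lambda>y' m00. Poly_Mapping.single (y', x) m00) f) (z, y) =
      (if x = y then Poly_Mapping.lookup f z else 0)" for x and f :: "'g \<Rightarrow>\<^sub>0 'm"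
    by (simp add: lin_ext_def lookup_sum lookup_single when_def in_keys_iff if_distrib cong: if_cong)
  then have "Poly_Mapping.lookup (lin_ext (\<lambda>x m0. lin_ext (\<lambda>y m00. Poly_Mapping.single (y, x) m00) (\<rho> m0)) (\<rho> m)) (z, y) =
      (\<Sum>x\<in>Poly_Mapping.keys (\<rho> m). if x = y then Poly_Mapping.lookup (\<rho> (Poly_Mapping.lookup (\<rho> m) x)) z else 0)"
    by (subst lin_ext_def) (simp add: lookup_sum)
  moreover have "\<dots> = Poly_Mapping.lookup (\<rho> (comp y m)) z"
    by (simp add: comp_def in_keys_iff lin_0[OF lin_\<rho>])
  moreover have "Poly_Mapping.lookup (lin_ext (\<lambda>x m0. Poly_Mapping.single (x, x) m0) (\<rho> m)) (z, y) =
      (\<Sum>x\<in>Poly_Mapping.keys (\<rho> m). if x = y then (if y = z then comp y m else 0) else 0)"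
    unfolding lin_ext_def lookup_sum by (intro sum.cong) (auto simp: lookup_single when_def comp_def)
  moreover have "\<dots> = (if y = z then comp y m else 0)"
    by (simp add: comp_def in_keys_iff)
  ultimately show "Poly_Mapping.lookup (\<rho> (comp y m)) z = Poly_Mapping.lookup (Poly_Mapping.single y (comp y m)) z"
    by (simp add: lookup_single when_def)
qed

lemma comp_W: "comp y m \<in> W y" by (simp add: W_iff \<rho>_comp)

lemma sub_W: "subspace (W y)"
  by (rule subspaceI)
    (simp_all add: W_iff lin_0[OF lin_\<rho>] lin_add[OF lin_\<rho>] lin_scale[OF lin_\<rho>] single_add)

lemma W_a: assumes g: "g \<in> carrier G" and m: "m \<in> W y" shows "a g m \<in> W (g \<otimes> y \<otimes> inv g)"
proof -
  have "\<rho> (act (ga_basis g) m) = lin_ext (\<lambda>x m0. Poly_Mapping.single (g \<otimes> x \<otimes> inv g) (a g m0)) (\<rho> m)"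
    unfolding crossed[OF ga_single[OF g]]
    by (simp add: ga_comult_iter_basis lin_ext_single ga_antipode_def ga_mult_single tens_s a_def numeral_3_eq_3
        numeral_2_eq_2 lin_ext_def lin_0[OF lin_a[OF g], unfolded a_def])
  also have "\<dots> = Poly_Mapping.single (g \<otimes> y \<otimes> inv g) (a g m)"
    using m by (simp add: W_iff lin_ext_single lin_0[OF lin_a[OF g]])
  finally show ?thesis by (simp add: W_iff a_def)
qed

lemma W_modular: assumes m: "m \<in> W y" and y: "y \<in> carrier G" shows "a y m = m"
  using modular[of m] m lin_0[OF lin_a[OF y]] by (simp add: W_iff lin_ext_single a_def)

lemma twisted: assumes x: "x \<in> carrier G" shows "twisted_coeff scale G a (W x) x"
proof (intro twisted_coeff.intro twisted_coeff_axioms.intro)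
  show "coeff_space scale" by (rule coeff_space_axioms)
  show "group G" by (rule is_group)
  show "a g w \<in> W x" if g: "g \<in> centralizer G x" and w: "w \<in> W x" for g w
  proof -
    have "g \<in> carrier G" "g \<otimes> x = x \<otimes> g" using g by (auto simp: centralizer_def)
    then have "g \<otimes> x \<otimes> inv g = x" using x by (simp add: m_assoc)
    then show ?thesis using W_a[OF \<open>g \<in> carrier G\<close> w] by simp
  qed
qed (simp_all add: x sub_W lin_a a_mult a_one W_modular)

text \<open>Linear identities only need to be checked on homogeneous coefficients.\<close>

lemma hom_in:
  assumes F: "Vector_Spaces.linear ps s F" and S: "module.subspace s S" and v: "v \<in> fin_supp U UNIV"
    and e: "\<And>ys y m. ys \<in> U \<Longrightarrow> y \<in> carrier G \<Longrightarrow> m \<in> W y \<Longrightarrow> F (Poly_Mapping.single ys m) \<in> S"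
  shows "F v \<in> S"
proof (rule lin_in_fin_supp[OF F S v])
  interpret V: vector_space s by (rule lin_vs(2)[OF F])
  fix ys m assume ys: "ys \<in> U"
  have "Poly_Mapping.single ys m = (\<Sum>y\<in>Poly_Mapping.keys (\<rho> m). Poly_Mapping.single ys (comp y m))"
    by (simp add: sum_comp flip: lin_sum[OF lin_single])
  then have "F (Poly_Mapping.single ys m) = (\<Sum>y\<in>Poly_Mapping.keys (\<rho> m). F (Poly_Mapping.single ys (comp y m)))"
    by (simp add: lin_sum[OF F])
  also have "\<dots> \<in> S" using keys_\<rho>[of m] ys by (intro V.subspace_sum[OF S] e[OF _ _ comp_W]) auto
  finally show "F (Poly_Mapping.single ys m) \<in> S" .
qed

lemma hom_eq:
  assumes F: "Vector_Spaces.linear ps s F" and F': "Vector_Spaces.linear ps s F'" and v: "v \<in> fin_supp U UNIV"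
    and e: "\<And>ys y m. ys \<in> U \<Longrightarrow> y \<in> carrier G \<Longrightarrow> m \<in> W y \<Longrightarrow> F (Poly_Mapping.single ys m) = F' (Poly_Mapping.single ys m)"
  shows "F v = F' v"
proof -
  interpret V: vector_space s by (rule lin_vs(2)[OF F])
  have "F v - F' v \<in> {0}" by (rule hom_in[OF lin_minus[OF F F'] V.subspace_single_0 v]) (simp add: e)
  then show ?thesis by simp
qed

text \<open>
  Representatives and relations for the cyclic object, with relations for elements of the group only.
\<close>

definition GV :: "nat \<Rightarrow> ('g list \<Rightarrow>\<^sub>0 'm) set" where "GV n = fin_supp (tuples (carrier G) (Suc n)) UNIV"
definition GR :: "nat \<Rightarrow> ('g list \<Rightarrow>\<^sub>0 'm) set" where
  "GR n = P.span {Poly_Mapping.single (map (\<lambda>y. y \<otimes> g) ys) m - Poly_Mapping.single ys (a g m) |ys g m.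
     ys \<in> tuples (carrier G) (Suc n) \<and> g \<in> carrier G}"

lemma sub_GV: "P.subspace (GV n)" unfolding GV_def by (rule sub_fin_supp[OF subspace_UNIV])
lemma sub_GR: "P.subspace (GR n)" by (simp add: GR_def)
lemma GR_gen: "ys \<in> tuples (carrier G) (Suc n) \<Longrightarrow> g \<in> carrier G \<Longrightarrow>
    Poly_Mapping.single (map (\<lambda>y. y \<otimes> g) ys) m - Poly_Mapping.single ys (a g m) \<in> GR n"
  unfolding GR_def by (rule P.span_base) blast
lemma GV_single: "ys \<in> tuples (carrier G) (Suc n) \<Longrightarrow> Poly_Mapping.single ys m \<in> GV n"
  unfolding GV_def by (rule fin_supp_single[OF _ _ subspace_UNIV]) simp_all

lemma GR_in:
  assumes F: "Vector_Spaces.linear ps s F" and S: "module.subspace s S" and r: "r \<in> GR n"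
    and e: "\<And>ys g y m. ys \<in> tuples (carrier G) (Suc n) \<Longrightarrow> g \<in> carrier G \<Longrightarrow> y \<in> carrier G \<Longrightarrow> m \<in> W y \<Longrightarrow>
      F (Poly_Mapping.single (map (\<lambda>z. z \<otimes> g) ys) m) - F (Poly_Mapping.single ys (a g m)) \<in> S"
  shows "F r \<in> S"
proof (rule lin_span_in[OF F S r[unfolded GR_def]])
  interpret V: vector_space s by (rule lin_vs(2)[OF F])
  fix v assume "v \<in> {Poly_Mapping.single (map (\<lambda>y. y \<otimes> g) ys) m - Poly_Mapping.single ys (a g m) |ys g m.
     ys \<in> tuples (carrier G) (Suc n) \<and> g \<in> carrier G}"
  then obtain ys g m where v: "v = Poly_Mapping.single (map (\<lambda>y. y \<otimes> g) ys) m - Poly_Mapping.single ys (a g m)"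
    and ys: "ys \<in> tuples (carrier G) (Suc n)" and g: "g \<in> carrier G" by blast
  let ?F = "\<lambda>m. F (Poly_Mapping.single (map (\<lambda>y. y \<otimes> g) ys) m) - F (Poly_Mapping.single ys (a g m))"
  have lin: "Vector_Spaces.linear scale s ?F"
    by (intro lin_minus lin_comp[OF F lin_single] lin_comp[OF F lin_comp[OF lin_single lin_a[OF g]]])
  have "F v = ?F m" by (simp add: v lin_diff[OF F])
  also have "\<dots> = ?F (\<Sum>y\<in>Poly_Mapping.keys (\<rho> m). comp y m)" by (simp only: sum_comp)
  also have "\<dots> = (\<Sum>y\<in>Poly_Mapping.keys (\<rho> m). ?F (comp y m))" by (rule lin_sum[OF lin])
  also have "\<dots> \<in> S" using keys_\<rho>[of m] by (intro V.subspace_sum[OF S] e[OF ys g _ comp_W]) auto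
  finally show "F v \<in> S" .
qed

lemma GR_le: "GR n \<subseteq> GV n"
proof
  fix r assume r: "r \<in> GR n"
  show "r \<in> GV n"
    by (rule GR_in[OF lin_id[OF vs_ps] sub_GV r])
      (auto intro!: P.subspace_diff[OF sub_GV] GV_single map_tuples)
qed

text \<open>
  The relation for \<open>v\<close>, \<open>h\<close> and \<open>m\<close> is linear in \<open>v\<close> and in \<open>h\<close>, so it is enough to consider tuples
  \<open>v\<close> and group elements \<open>h\<close>, up to a scalar that can be moved to \<open>m\<close>.
\<close>

lemma Z_rel_eq: "Z_rel G scale act n = GR n"
proof
  let ?gen = "{tens scale (tpow_diag G (Suc n) v h) m - tens scale v (act h m) |v h m.
          v \<in> tpow G (Suc n) \<and> h \<in> group_alg G}"
  have diag: "tpow_diag G (Suc n) (Poly_Mapping.single ys c) (Poly_Mapping.single g 1) =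
      Poly_Mapping.single (map (\<lambda>y. y \<otimes> g) ys) c"
    if "ys \<in> tuples (carrier G) (Suc n)" for ys g and c :: 'k
  proof -
    have "map2 (\<otimes>) ys (replicate (Suc n) g) = map (\<lambda>y. y \<otimes> g) ys"
      using tuplesD(1)[OF that] by (simp add: zip_replicate2 del: replicate_Suc)
    then show ?thesis
      unfolding tpow_diag_def ga_comult_iter_basis tpow_mult_def
      by (simp add: lin_ext_single del: replicate_Suc)
  qed
  show "GR n \<subseteq> Z_rel G scale act n"
    unfolding GR_def Z_rel_def
  proof (rule P.span_mono, rule subsetI)
    fix z assume "z \<in> {Poly_Mapping.single (map (\<lambda>y. y \<otimes> g) ys) m - Poly_Mapping.single ys (a g m) |ys g m.
       ys \<in> tuples (carrier G) (Suc n) \<and> g \<in> carrier G}"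
    then obtain ys g m where z: "z = Poly_Mapping.single (map (\<lambda>y. y \<otimes> g) ys) m - Poly_Mapping.single ys (a g m)"
      and ys: "ys \<in> tuples (carrier G) (Suc n)" and g: "g \<in> carrier G" by blast
    have "Poly_Mapping.single ys 1 \<in> (tpow G (Suc n) :: ('g list \<Rightarrow>\<^sub>0 'k) set)"
      using ys by (auto simp: tpow_def fin_supp_def)
    moreover have "z = tens scale (tpow_diag G (Suc n) (Poly_Mapping.single ys 1) (ga_basis g)) m -
        tens scale (Poly_Mapping.single ys 1) (act (ga_basis g) m)"
      unfolding diag[OF ys] by (simp add: z tens_s a_def)
    ultimately show "z \<in> ?gen" using ga_single[OF g] by blast
  qed
  show "Z_rel G scale act n \<subseteq> GR n"
    unfolding Z_rel_def
  proof (rule P.span_minimal[OF _ sub_GR], rule subsetI)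
    fix z assume "z \<in> ?gen"
    then obtain v h m where z: "z = tens scale (tpow_diag G (Suc n) v h) m - tens scale v (act h m)"
      and v: "v \<in> tpow G (Suc n)" and h: "h \<in> group_alg G" by blast
    \<comment> \<open>The field as a coefficient space turns \<open>kG\<close> and its tensor powers into spaces of the same kind.\<close>
    interpret K: coeff_space "(*) :: 'k \<Rightarrow> 'k \<Rightarrow> 'k"
      by (intro coeff_space.intro) (unfold_locales, simp_all add: algebra_simps)
    have lookup_tens: "Poly_Mapping.lookup (tens scale f m') k = scale (Poly_Mapping.lookup f k) m'"
      for f :: "'x \<Rightarrow>\<^sub>0 'k" and m' k
      by (simp add: tens_def Poly_Mapping.map.rep_eq when_def)
    have lin_tens_l: "Vector_Spaces.linear K.ps ps (\<lambda>f. tens scale f m')" for m' :: 'm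
      by (rule linI[OF K.vs_ps vs_ps]; rule poly_mapping_eqI)
        (simp_all add: lookup_tens lookup_add scale_left_distrib)
    have lin_one: "Vector_Spaces.linear (*) K.ps (\<lambda>c. Poly_Mapping.single k (c * d))" for k :: 'x and d :: 'k
      by (rule lin_comp[OF K.lin_single linI[OF K.vs_scale K.vs_scale]]) (auto simp only: distrib_right mult.assoc)
    have lin_one': "Vector_Spaces.linear (*) K.ps (\<lambda>d. Poly_Mapping.single k (c * d))" for k :: 'x and c :: 'k
      by (rule lin_comp[OF K.lin_single linI[OF K.vs_scale K.vs_scale]]) (auto simp only: distrib_left mult.left_commute)
    have lin_mult_l: "Vector_Spaces.linear K.ps K.ps (\<lambda>u. tpow_mult G u w)" for w
      unfolding tpow_mult_def
      by (intro K.lin_ext_lin) (unfold lin_ext_def, intro lin_sums[OF K.vs_scale K.vs_ps] lin_one)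
    have lin_mult_r: "Vector_Spaces.linear K.ps K.ps (\<lambda>w. tpow_mult G u w)" for u
      unfolding tpow_mult_def lin_ext_def[of _ u]
      by (intro lin_sums[OF K.vs_ps K.vs_ps] K.lin_ext_lin lin_one')
    have lin_iter: "Vector_Spaces.linear K.ps K.ps (ga_comult_iter k :: ('g \<Rightarrow>\<^sub>0 'k) \<Rightarrow> _)" for k
    proof (cases k)
      case 0
      have "Vector_Spaces.linear K.ps (*) (ga_counit :: ('g \<Rightarrow>\<^sub>0 'k) \<Rightarrow> 'k)"
        unfolding ga_counit_def by (rule K.lin_ext_lin[OF K.lin_ident])
      moreover have "(ga_comult_iter 0 :: ('g \<Rightarrow>\<^sub>0 'k) \<Rightarrow> _) = (\<lambda>h. Poly_Mapping.single [] (ga_counit h))" by (rule ext) simp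
      ultimately show ?thesis unfolding 0 by (simp only: lin_comp[OF K.lin_single])
    next
      case (Suc j)
      have c: "Vector_Spaces.linear K.ps K.ps (ga_comult :: ('g \<Rightarrow>\<^sub>0 'k) \<Rightarrow> _)"
        unfolding ga_comult_def by (rule K.lin_ext_lin[OF K.lin_single])
      have "Vector_Spaces.linear K.ps K.ps (lin_ext (\<lambda>(a, b) c.
         lin_ext (\<lambda>gs d. Poly_Mapping.single (a # gs) (c * d)) (ga_comult_iter j (ga_basis b))) :: ('g \<times> 'g \<Rightarrow>\<^sub>0 'k) \<Rightarrow> _)"
        by (intro K.lin_ext_lin) (simp add: case_prod_beta lin_ext_def, intro lin_sums[OF K.vs_scale K.vs_ps] lin_one)
      moreover have "(\<lambda>h. lin_ext (\<lambda>(a, b) c.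
         lin_ext (\<lambda>gs d. Poly_Mapping.single (a # gs) (c * d)) (ga_comult_iter j (ga_basis b))) (ga_comult h)) =
         (ga_comult_iter (Suc j) :: ('g \<Rightarrow>\<^sub>0 'k) \<Rightarrow> _)" by (rule ext) simp
      ultimately show ?thesis using lin_comp[OF _ c] unfolding Suc by metis
    qed
    let ?F = "\<lambda>v h m. tens scale (tpow_diag G (Suc n) v h) m - tens scale v (act h m)"
    have act0: "act 0 m' = 0" for m'
      using act_add_left[of 0 0 m'] by (simp add: group_alg_def fin_supp_def)
    have act_h: "act h m = (\<Sum>g\<in>Poly_Mapping.keys h. act (Poly_Mapping.single g (Poly_Mapping.lookup h g)) m)"
    proof -
      have "act (\<Sum>g\<in>S. Poly_Mapping.single g (Poly_Mapping.lookup h g)) m =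
        (\<Sum>g\<in>S. act (Poly_Mapping.single g (Poly_Mapping.lookup h g)) m)
        \<and> (\<Sum>g\<in>S. Poly_Mapping.single g (Poly_Mapping.lookup h g)) \<in> group_alg G"
        if "finite S" "S \<subseteq> carrier G" for S
        using that
      proof (induction S)
        case empty
        then show ?case by (simp add: act0 group_alg_def fin_supp_def)
      next
        case (insert g S)
        have K: "K.P.subspace (group_alg G :: ('g \<Rightarrow>\<^sub>0 'k) set)"
          unfolding group_alg_def by (rule K.sub_fin_supp[OF K.subspace_UNIV])
        show ?case using insert by (simp add: act_add_left ga_single K.P.subspace_add[OF K])
      qed
      from this[of "Poly_Mapping.keys h"] show ?thesis
        using h unfolding fs_expand[symmetric] by (simp add: group_alg_def fin_supp_def)
    qed
    have act_s: "act (Poly_Mapping.single g c) m = a g (scale c m)" if "g \<in> carrier G" for g c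
    proof -
      have "act (Poly_Mapping.single g c) m = act (ga_mult G (ga_basis g) (Poly_Mapping.single \<one> c)) m"
        using that by (simp add: ga_mult_single)
      then show ?thesis using that by (simp add: a_def act_mult ga_single act_scalar)
    qed
    have lin_v: "Vector_Spaces.linear K.ps ps (\<lambda>v. ?F v h m)"
      unfolding tpow_diag_def by (intro lin_minus lin_comp[OF lin_tens_l lin_mult_l] lin_tens_l)
    have "(\<lambda>v. ?F v h m) v \<in> GR n"
    proof (rule K.lin_in_fin_supp[OF lin_v sub_GR v[unfolded tpow_def]])
      fix ys and c :: 'k assume ys: "ys \<in> tuples (carrier G) (Suc n)"
      let ?s = "Poly_Mapping.single ys c"
      have lin_h: "Vector_Spaces.linear K.ps ps (\<lambda>h. tens scale (tpow_diag G (Suc n) ?s h) m)"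
        unfolding tpow_diag_def by (intro lin_comp[OF lin_tens_l lin_comp[OF lin_mult_r lin_iter]])
      have tens_sum: "tens scale ?s (\<Sum>g\<in>S. f g) = (\<Sum>g\<in>S. tens scale ?s (f g))" for S :: "'g set" and f
        by (simp add: tens_s scale_sum_right lin_sum[OF lin_single])
      have "?F ?s h m = (\<Sum>g\<in>Poly_Mapping.keys h. tens scale (tpow_diag G (Suc n) ?s (Poly_Mapping.single g (Poly_Mapping.lookup h g))) m
          - tens scale ?s (act (Poly_Mapping.single g (Poly_Mapping.lookup h g)) m))"
        unfolding act_h tens_sum sum_subtractf
        by (subst (1) fs_expand) (simp add: lin_sum[OF lin_h])
      also have "\<dots> \<in> GR n"
      proof (rule P.subspace_sum[OF sub_GR])
        fix g assume "g \<in> Poly_Mapping.keys h"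
        then have g: "g \<in> carrier G" using h by (auto simp: group_alg_def fin_supp_def)
        let ?l = "Poly_Mapping.lookup h g"
        have "Poly_Mapping.single g ?l = K.ps ?l (Poly_Mapping.single g 1)" by simp
        then have "tens scale (tpow_diag G (Suc n) ?s (Poly_Mapping.single g ?l)) m =
            ps ?l (tens scale (tpow_diag G (Suc n) ?s (Poly_Mapping.single g 1)) m)"
          using lin_scale[OF lin_h, of ?l "Poly_Mapping.single g 1"] by simp
        also have "\<dots> = Poly_Mapping.single (map (\<lambda>y. y \<otimes> g) ys) (scale c (scale ?l m))"
          unfolding diag[OF ys] by (simp add: tens_s mult.commute)
        finally show "tens scale (tpow_diag G (Suc n) ?s (Poly_Mapping.single g ?l)) m - tens scale ?s (act (Poly_Mapping.single g ?l) m) \<in> GR n"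
          using GR_gen[OF ys g, of "scale c (scale ?l m)"] by (simp add: tens_s act_s[OF g] lin_scale[OF lin_a[OF g]])
      qed
      finally show "?F ?s h m \<in> GR n" .
    qed
    then show "z \<in> GR n" by (simp add: z)
  qed
qed

end

section \<open>Decomposition along conjugacy classes\<close>

context modular_coeff
begin

definition cls :: "'g \<Rightarrow> 'g \<Rightarrow> bool" where "cls x y \<longleftrightarrow> (\<exists>k\<in>carrier G. y = k \<otimes> x \<otimes> inv k)"

text \<open>
  A conjugating element for each \<open>y\<close> in the class of \<open>x\<close>. The choice \<open>\<one>\<close> for \<open>y = x\<close> makes \<open>proj x\<close>
  the identity on the summand of \<open>x\<close>.
\<close>

definition cnj :: "'g \<Rightarrow> 'g \<Rightarrow> 'g" where
  "cnj x y = (if y = x then \<one> else SOME k. k \<in> carrier G \<and> y = k \<otimes> x \<otimes> inv k)"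

lemma cnj: assumes x: "x \<in> carrier G" and y: "cls x y" shows "cnj x y \<in> carrier G" "cnj x y \<otimes> x = y \<otimes> cnj x y"
proof -
  have "cnj x y \<in> carrier G \<and> y = cnj x y \<otimes> x \<otimes> inv (cnj x y)"
  proof (cases "y = x")
    case True
    then show ?thesis using x by (simp add: cnj_def)
  next
    case False
    then show ?thesis unfolding cnj_def using y by (simp add: cls_def) (rule someI_ex, blast)
  qed
  then obtain k where k: "cnj x y = k" "k \<in> carrier G" "y = k \<otimes> x \<otimes> inv k" by metis
  have "k \<otimes> x = y \<otimes> k" unfolding k(3) using k(2) x by (simp add: m_assoc)
  then show "cnj x y \<in> carrier G" "cnj x y \<otimes> x = y \<otimes> cnj x y" unfolding k(1) using k(2) by auto
qed

lemma cls_refl: "x \<in> carrier G \<Longrightarrow> cls x x" unfolding cls_def by (rule bexI[of _ \<one>]) simp_all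

lemma cls_conj:
  assumes x: "x \<in> carrier G" and y: "y \<in> carrier G" and g: "g \<in> carrier G"
  shows "cls x (g \<otimes> y \<otimes> inv g) \<longleftrightarrow> cls x y"
proof
  assume "cls x y"
  then obtain k where k: "k \<in> carrier G" "y = k \<otimes> x \<otimes> inv k" by (auto simp: cls_def)
  then have "g \<otimes> y \<otimes> inv g = (g \<otimes> k) \<otimes> x \<otimes> inv (g \<otimes> k)" using x g by (simp add: inv_mult_group m_assoc)
  then show "cls x (g \<otimes> y \<otimes> inv g)" unfolding cls_def using k g by blast
next
  assume "cls x (g \<otimes> y \<otimes> inv g)"
  then obtain k where k: "k \<in> carrier G" "g \<otimes> y \<otimes> inv g = k \<otimes> x \<otimes> inv k" by (auto simp: cls_def)
  have "y = inv g \<otimes> (g \<otimes> y \<otimes> inv g) \<otimes> g" using y g by (simp add: m_assoc) (simp flip: m_assoc)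
  also have "\<dots> = (inv g \<otimes> k) \<otimes> x \<otimes> inv (inv g \<otimes> k)" unfolding k(2) using x g k(1) by (simp add: inv_mult_group m_assoc)
  finally show "cls x y" unfolding cls_def using k(1) g by blast
qed

text \<open>
  The projection to the summand of \<open>x\<close> on representatives: a coefficient of degree \<open>y = k x k\<^sup>-\<^sup>1\<close> is moved
  to degree \<open>x\<close> by \<open>k\<^sup>-\<^sup>1\<close>, with \<open>k = cnj x y\<close>, while \<open>k\<close> is multiplied into the tuple.
\<close>

definition proj :: "'g \<Rightarrow> ('g list \<Rightarrow>\<^sub>0 'm) \<Rightarrow> ('g list \<Rightarrow>\<^sub>0 'm)" where
  "proj x = lin_ext (\<lambda>ys m. lin_ext (\<lambda>y m0. if cls x y
     then Poly_Mapping.single (map (\<lambda>z. z \<otimes> cnj x y) ys) (a (inv (cnj x y)) m0) else 0) (\<rho> m))"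

text \<open>
  On representatives, \<open>gt\<close> is the signed cyclic operator and \<open>gn\<close> is the norm.
\<close>

definition pcyc :: "('g list \<Rightarrow>\<^sub>0 'm) \<Rightarrow> ('g list \<Rightarrow>\<^sub>0 'm)" where "pcyc = pre_cyc G \<rho>"
definition gt :: "nat \<Rightarrow> ('g list \<Rightarrow>\<^sub>0 'm) \<Rightarrow> ('g list \<Rightarrow>\<^sub>0 'm)" where "gt q v = ps ((-1) ^ q) (pcyc v)"
definition gn :: "nat \<Rightarrow> ('g list \<Rightarrow>\<^sub>0 'm) \<Rightarrow> ('g list \<Rightarrow>\<^sub>0 'm)" where "gn q v = (\<Sum>i\<le>q. (gt q ^^ i) v)"

lemma lin_proj: assumes x: "x \<in> carrier G" shows "Vector_Spaces.linear ps ps (proj x)"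
proof -
  have "Vector_Spaces.linear scale ps (\<lambda>m0. if cls x y
     then Poly_Mapping.single (map (\<lambda>z. z \<otimes> cnj x y) ys) (a (inv (cnj x y)) m0) else 0)" for y ys
    using cnj[OF x, of y] by (cases "cls x y") (simp_all add: lin_zero[OF vs_scale vs_ps] lin_comp[OF lin_single lin_a])
  then show ?thesis unfolding proj_def by (intro lin_ext_lin lin_comp[OF lin_ext_lin lin_\<rho>])
qed

lemma proj_single: assumes x: "x \<in> carrier G" and m: "m \<in> W y"
  shows "proj x (Poly_Mapping.single ys m) =
    (if cls x y then Poly_Mapping.single (map (\<lambda>z. z \<otimes> cnj x y) ys) (a (inv (cnj x y)) m) else 0)"
proof -
  have z: "a (inv (cnj x y)) 0 = 0" if "cls x y" for y using cnj[OF x that] by (intro lin_0[OF lin_a]) simp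
  have r0: "\<rho> 0 = 0" by (rule lin_0[OF lin_\<rho>])
  show ?thesis using m z unfolding proj_def
    by (subst lin_ext_single) (auto simp: r0 W_iff lin_ext_single)
qed

lemma lin_pcyc: "Vector_Spaces.linear ps ps pcyc"
  unfolding pcyc_def pre_cyc_def by (intro lin_ext_lin lin_comp[OF lin_ext_lin lin_\<rho>] lin_single)

lemma pcyc_single: assumes m: "m \<in> W y"
  shows "pcyc (Poly_Mapping.single ys m) = Poly_Mapping.single ((last ys \<otimes> y) # butlast ys) m"
  using m unfolding pcyc_def pre_cyc_def
  by (subst lin_ext_single) (auto simp: lin_0[OF lin_\<rho>] W_iff lin_ext_single)

lemma lin_gt: "Vector_Spaces.linear ps ps (gt q)" unfolding gt_def by (rule lin_smult[OF lin_pcyc])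
lemma lin_gn: "Vector_Spaces.linear ps ps (gn q)"
  unfolding gn_def by (intro lin_sums[OF vs_ps vs_ps] lin_funpow[OF lin_gt])

lemma gt_single: assumes m: "m \<in> W y"
  shows "gt q (Poly_Mapping.single ys m) = Poly_Mapping.single ((last ys \<otimes> y) # butlast ys) (scale ((-1) ^ q) m)"
  by (simp add: gt_def pcyc_single[OF m])

text \<open>
  In the summand of \<open>x\<close> only the relations for the centralizer remain, as they are the ones that preserve the
  degree \<open>x\<close>.
\<close>

definition Lx :: "'g \<Rightarrow> nat \<Rightarrow> ('g list \<Rightarrow>\<^sub>0 'm) set" where "Lx x q = fin_supp (tuples (carrier G) (Suc q)) (W x)"
definition Rx :: "'g \<Rightarrow> nat \<Rightarrow> ('g list \<Rightarrow>\<^sub>0 'm) set" where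
  "Rx x q = P.span {Poly_Mapping.single (map (\<lambda>y. y \<otimes> g) ys) w - Poly_Mapping.single ys (a g w) |ys g w.
     ys \<in> tuples (carrier G) (Suc q) \<and> g \<in> centralizer G x \<and> w \<in> W x}"

lemma sub_Lx: "P.subspace (Lx x q)" unfolding Lx_def by (rule sub_fin_supp[OF sub_W])
lemma sub_Rx: "P.subspace (Rx x q)" by (simp add: Rx_def)
lemma Lx_GV: "Lx x q \<subseteq> GV q" by (auto simp: Lx_def GV_def fin_supp_def)
lemma Rx_GR: "Rx x q \<subseteq> GR q" unfolding Rx_def GR_def by (rule P.span_mono) (auto simp: centralizer_def)

lemma proj_W: assumes x: "x \<in> carrier G" and y: "cls x y" and m: "m \<in> W y"
  shows "a (inv (cnj x y)) m \<in> W x"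
proof -
  note k = cnj[OF x y]
  obtain k' where "k' \<in> carrier G" "y = k' \<otimes> x \<otimes> inv k'" using y by (auto simp: cls_def)
  then have yc: "y \<in> carrier G" using x by simp
  have "inv (cnj x y) \<otimes> y \<otimes> inv (inv (cnj x y)) = inv (cnj x y) \<otimes> (y \<otimes> cnj x y)" using k(1) yc by (simp add: m_assoc)
  also have "\<dots> = x" unfolding k(2)[symmetric] using k(1) x by (simp flip: m_assoc)
  finally show ?thesis using W_a[of "inv (cnj x y)" m y] k(1) m by simp
qed

lemma proj_Lx: assumes x: "x \<in> carrier G" and v: "v \<in> GV q" shows "proj x v \<in> Lx x q"
proof (rule hom_in[OF lin_proj[OF x] sub_Lx v[unfolded GV_def]])
  fix ys y m assume ys: "ys \<in> tuples (carrier G) (Suc q)" and m: "m \<in> W y"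
  show "proj x (Poly_Mapping.single ys m) \<in> Lx x q"
  proof (cases "cls x y")
    case True
    then have "map (\<lambda>z. z \<otimes> cnj x y) ys \<in> tuples (carrier G) (Suc q)" using ys cnj[OF x] by (intro map_tuples[OF ys]) simp
    then show ?thesis using True proj_W[OF x True m] by (simp add: proj_single[OF x m] Lx_def fin_supp_single sub_W)
  next
    case False
    then show ?thesis by (simp add: proj_single[OF x m] P.subspace_0[OF sub_Lx])
  qed
qed

lemma all_GV: "v \<in> fin_supp UNIV UNIV" by (simp add: fin_supp_def)

lemma bd_proj: assumes x: "x \<in> carrier G" shows "bd (proj x v) = proj x (bd v)"
proof (rule hom_eq[OF lin_comp[OF lin_bd lin_proj[OF x]] lin_comp[OF lin_proj[OF x] lin_bd] all_GV])
  fix ys :: "'g list" and y m assume m: "m \<in> W y"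
  show "bd (proj x (Poly_Mapping.single ys m)) = proj x (bd (Poly_Mapping.single ys m))"
    using cnj[OF x, of y]
    by (simp add: proj_single[OF x m] bd_single lin_sum[OF lin_proj[OF x]] proj_single[OF x subspace_scale[OF sub_W m]]
        lin_0[OF lin_bd] delete_nth_map lin_scale[OF lin_a])
qed

lemma bd'_proj: assumes x: "x \<in> carrier G" shows "bd' (proj x v) = proj x (bd' v)"
proof (rule hom_eq[OF lin_comp[OF lin_bd' lin_proj[OF x]] lin_comp[OF lin_proj[OF x] lin_bd'] all_GV])
  fix ys :: "'g list" and y m assume m: "m \<in> W y"
  show "bd' (proj x (Poly_Mapping.single ys m)) = proj x (bd' (Poly_Mapping.single ys m))"
    using cnj[OF x, of y]
    by (simp add: proj_single[OF x m] bd'_single lin_sum[OF lin_proj[OF x]] proj_single[OF x subspace_scale[OF sub_W m]]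
        lin_0[OF lin_bd'] delete_nth_map lin_scale[OF lin_a])
qed

lemma gt_proj: assumes x: "x \<in> carrier G" and v: "v \<in> GV q" shows "gt q (proj x v) = proj x (gt q v)"
proof (rule hom_eq[OF lin_comp[OF lin_gt lin_proj[OF x]] lin_comp[OF lin_proj[OF x] lin_gt] v[unfolded GV_def]])
  fix ys y m assume ys: "ys \<in> tuples (carrier G) (Suc q)" and y: "y \<in> carrier G" and m: "m \<in> W y"
  note sm = subspace_scale[OF sub_W m]
  show "gt q (proj x (Poly_Mapping.single ys m)) = proj x (gt q (Poly_Mapping.single ys m))"
  proof (cases "cls x y")
    case True
    note k = cnj[OF x True]
    obtain zs z where z: "ys = zs @ [z]" "z \<in> carrier G" using ys by (auto elim: tuples_snocE)
    have "z \<otimes> cnj x y \<otimes> x = z \<otimes> y \<otimes> cnj x y" using z k x y by (simp add: m_assoc)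
    then show ?thesis
      using True k(1) by (simp add: proj_single[OF x m] gt_single[OF m] gt_single[OF proj_W[OF x True m]] proj_single[OF x sm]
          lin_scale[OF lin_a] z(1))
  next
    case False
    then show ?thesis by (simp add: proj_single[OF x m] gt_single[OF m] proj_single[OF x sm] lin_0[OF lin_gt])
  qed
qed

lemma gt_GV: assumes v: "v \<in> GV q" shows "gt q v \<in> GV q"
proof (rule hom_in[OF lin_gt sub_GV v[unfolded GV_def]])
  fix ys y m assume ys: "ys \<in> tuples (carrier G) (Suc q)" and y: "y \<in> carrier G" and m: "m \<in> W y"
  have "(last ys \<otimes> y) # butlast ys \<in> tuples (carrier G) (Suc q)" using ys y by (auto elim: tuples_snocE)
  then show "gt q (Poly_Mapping.single ys m) \<in> GV q" by (simp add: gt_single[OF m] GV_single)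
qed

lemma gtpow_GV: "v \<in> GV q \<Longrightarrow> (gt q ^^ i) v \<in> GV q" by (induction i) (simp_all add: gt_GV)

lemma gn_proj: assumes x: "x \<in> carrier G" and v: "v \<in> GV q" shows "gn q (proj x v) = proj x (gn q v)"
proof -
  have "(gt q ^^ i) (proj x v) = proj x ((gt q ^^ i) v)" for i
    by (induction i) (simp_all add: gt_proj[OF x gtpow_GV[OF v]])
  then show ?thesis by (simp add: gn_def lin_sum[OF lin_proj[OF x]])
qed

text \<open>
  The chosen conjugating elements for \<open>y\<close> and for \<open>g y g\<^sup>-\<^sup>1\<close> fit together only up to the element \<open>k\<close> of the
  centralizer, so a relation for \<open>g\<close> becomes a relation for \<open>k\<close>.
\<close>

lemma proj_GR: assumes x: "x \<in> carrier G" and r: "r \<in> GR q" shows "proj x r \<in> Rx x q"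
proof (rule GR_in[OF lin_proj[OF x] sub_Rx r])
  fix ys g y m
  assume ys: "ys \<in> tuples (carrier G) (Suc q)" and g: "g \<in> carrier G" and y: "y \<in> carrier G" and m: "m \<in> W y"
  let ?y' = "g \<otimes> y \<otimes> inv g"
  note m' = W_a[OF g m]
  show "proj x (Poly_Mapping.single (map (\<lambda>z. z \<otimes> g) ys) m) - proj x (Poly_Mapping.single ys (a g m)) \<in> Rx x q"
  proof (cases "cls x y")
    case True
    then have c': "cls x ?y'" using cls_conj[OF x y g] by simp
    define k1 k2 k where "k1 = cnj x y" and "k2 = cnj x ?y'" and "k = inv k2 \<otimes> g \<otimes> k1"
    have k1: "k1 \<in> carrier G" "k1 \<otimes> x = y \<otimes> k1" unfolding k1_def by (rule cnj[OF x True])+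
    have k2: "k2 \<in> carrier G" "k2 \<otimes> x = ?y' \<otimes> k2" unfolding k2_def by (rule cnj[OF x c'])+
    have kc: "k \<in> carrier G" using k1 k2 g by (simp add: k_def)
    have k: "k2 \<otimes> k = g \<otimes> k1" using k1 k2 g by (simp add: k_def m_assoc flip: m_assoc[of k2])
    have yc: "?y' \<in> carrier G" using g y by simp
    have "k2 \<otimes> (k \<otimes> x) = g \<otimes> (k1 \<otimes> x)" using k kc k1(1) k2(1) g x by (metis m_assoc)
    also have "\<dots> = g \<otimes> y \<otimes> k1" using k1 g y by (simp add: m_assoc)
    also have "\<dots> = ?y' \<otimes> (g \<otimes> k1)" using k1 g y by (simp add: m_assoc) (simp flip: m_assoc)
    also have "\<dots> = k2 \<otimes> (x \<otimes> k)" unfolding k[symmetric] using k2 kc x yc by (metis m_assoc)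
    finally have "k \<otimes> x = x \<otimes> k" using k2(1) kc x by simp
    then have kz: "k \<in> centralizer G x" using kc by (simp add: centralizer_def)
    have w: "a (inv k1) m \<in> W x" unfolding k1_def by (rule proj_W[OF x True m])
    have ys2: "map (\<lambda>z. z \<otimes> k2) ys \<in> tuples (carrier G) (Suc q)" using k2(1) by (intro map_tuples[OF ys]) simp
    have "map (\<lambda>z. z \<otimes> k1) (map (\<lambda>z. z \<otimes> g) ys) = map (\<lambda>z. z \<otimes> k) (map (\<lambda>z. z \<otimes> k2) ys)"
      using tuplesD(2)[OF ys] k k1 k2 g kc by (auto simp: m_assoc)
    moreover have "a (inv k2) (a g m) = a k (a (inv k1) m)"
      using k1 k2 g by (simp add: k_def m_assoc flip: a_mult)
    moreover have "Poly_Mapping.single (map (\<lambda>z. z \<otimes> k) (map (\<lambda>z. z \<otimes> k2) ys)) (a (inv k1) m) -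
        Poly_Mapping.single (map (\<lambda>z. z \<otimes> k2) ys) (a k (a (inv k1) m)) \<in> Rx x q"
      unfolding Rx_def using ys2 kz w by (intro P.span_base) blast
    ultimately show ?thesis
      using True c' by (simp add: proj_single[OF x m] proj_single[OF x m'] flip: k1_def k2_def del: map_map)
  next
    case False
    then show ?thesis using cls_conj[OF x y g] by (simp add: proj_single[OF x m] proj_single[OF x m'] P.subspace_0[OF sub_Rx])
  qed
qed

lemma proj_id: assumes x: "x \<in> carrier G" and v: "v \<in> Lx x q" shows "proj x v = v"
proof (rule lin_eq_fin_supp[OF lin_proj[OF x] lin_id[OF vs_ps] v[unfolded Lx_def]])
  fix ys m assume ys: "ys \<in> tuples (carrier G) (Suc q)" and m: "m \<in> W x"
  have "map (\<lambda>z. z \<otimes> \<one>) ys = ys" using tuplesD(2)[OF ys] by (auto intro!: map_idI)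
  then show "proj x (Poly_Mapping.single ys m) = Poly_Mapping.single ys m"
    using x by (simp add: proj_single[OF x m] cls_refl cnj_def a_one)
qed

lemma proj_other: assumes x: "x \<in> carrier G" and v: "v \<in> Lx x' q" and n: "\<not> cls x x'" shows "proj x v = 0"
  by (rule lin_eq_fin_supp[OF lin_proj[OF x] lin_zero[OF vs_ps vs_ps] v[unfolded Lx_def]])
    (simp add: proj_single[OF x] n)

text \<open>
  Modulo the relations a tensor of degree \<open>y\<close> equals its projection for the representative of the class of
  \<open>y\<close>, and all its other projections are zero.
\<close>

lemma decompose:
  assumes T: "conjugacy_reps G T" and v: "v \<in> GV q"
  shows "\<exists>S. finite S \<and> S \<subseteq> T \<and> (\<forall>x\<in>T - S. proj x v = 0) \<and> v - (\<Sum>x\<in>S. proj x v) \<in> GR q"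
proof -
  have Tc: "x \<in> carrier G" if "x \<in> T" for x using T that by (auto simp: conjugacy_reps_def)
  let ?good = "\<lambda>v. \<exists>S. finite S \<and> S \<subseteq> T \<and> (\<forall>x\<in>T - S. proj x v = 0) \<and> v - (\<Sum>x\<in>S. proj x v) \<in> GR q"
  have p0: "proj x 0 = 0" if "x \<in> T" for x by (rule lin_0[OF lin_proj[OF Tc[OF that]]])
  have sub: "P.subspace {v. ?good v}"
  proof (rule P.subspaceI; unfold mem_Collect_eq)
    show "?good 0" using p0 P.subspace_0[OF sub_GR] by (intro exI[of _ "{}"]) auto
  next
    fix v w assume "?good v" "?good w"
    then obtain S S' where S: "finite S" "S \<subseteq> T" "\<forall>x\<in>T - S. proj x v = 0" "v - (\<Sum>x\<in>S. proj x v) \<in> GR q"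
      and S': "finite S'" "S' \<subseteq> T" "\<forall>x\<in>T - S'. proj x w = 0" "w - (\<Sum>x\<in>S'. proj x w) \<in> GR q" by metis
    have "(\<Sum>x\<in>S \<union> S'. proj x v) = (\<Sum>x\<in>S. proj x v)" "(\<Sum>x\<in>S \<union> S'. proj x w) = (\<Sum>x\<in>S'. proj x w)"
      using S S' by (intro sum.mono_neutral_right; auto)+
    moreover have "(\<Sum>x\<in>S \<union> S'. proj x (v + w)) = (\<Sum>x\<in>S \<union> S'. proj x v) + (\<Sum>x\<in>S \<union> S'. proj x w)"
      unfolding sum.distrib[symmetric] using S(2) S'(2) by (intro sum.cong refl lin_add[OF lin_proj] Tc) auto
    ultimately have e: "v + w - (\<Sum>x\<in>S \<union> S'. proj x (v + w)) = (v - (\<Sum>x\<in>S. proj x v)) + (w - (\<Sum>x\<in>S'. proj x w))" by simp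
    have "v + w - (\<Sum>x\<in>S \<union> S'. proj x (v + w)) \<in> GR q" unfolding e by (rule P.subspace_add[OF sub_GR S(4) S'(4)])
    moreover have "\<forall>x\<in>T - (S \<union> S'). proj x (v + w) = 0" using S(3) S'(3) by (simp add: lin_add[OF lin_proj[OF Tc]])
    ultimately show "?good (v + w)" using S(1,2) S'(1,2) by (intro exI[of _ "S \<union> S'"] conjI) auto
  next
    fix c v assume "?good v"
    then obtain S where S: "finite S" "S \<subseteq> T" "\<forall>x\<in>T - S. proj x v = 0" "v - (\<Sum>x\<in>S. proj x v) \<in> GR q" by metis
    have "(\<Sum>x\<in>S. proj x (ps c v)) = ps c (\<Sum>x\<in>S. proj x v)"
      unfolding P.scale_sum_right using S(2) by (intro sum.cong refl lin_scale[OF lin_proj] Tc) auto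
    then have e: "ps c v - (\<Sum>x\<in>S. proj x (ps c v)) = ps c (v - (\<Sum>x\<in>S. proj x v))" by (simp add: P.scale_right_diff_distrib)
    have "ps c v - (\<Sum>x\<in>S. proj x (ps c v)) \<in> GR q" unfolding e by (rule P.subspace_scale[OF sub_GR S(4)])
    moreover have "\<forall>x\<in>T - S. proj x (ps c v) = 0" using S(3) by (simp add: lin_scale[OF lin_proj[OF Tc]])
    ultimately show "?good (ps c v)" using S(1,2) by (intro exI[of _ S] conjI)
  qed
  have "v \<in> {v. ?good v}"
  proof (rule hom_in[OF lin_id[OF vs_ps] sub v[unfolded GV_def]], unfold mem_Collect_eq)
    fix ys y m assume ys: "ys \<in> tuples (carrier G) (Suc q)" and y: "y \<in> carrier G" and m: "m \<in> W y"
    let ?v = "Poly_Mapping.single ys m"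
    obtain x where x: "x \<in> T" "cls x y" "\<And>x'. x' \<in> T \<Longrightarrow> cls x' y \<Longrightarrow> x' = x"
      using T y unfolding conjugacy_reps_def cls_def by metis
    note k = cnj[OF Tc[OF x(1)] x(2)]
    have "proj x' ?v = 0" if "x' \<in> T" "x' \<noteq> x" for x'
      using x(3) that by (auto simp: proj_single[OF Tc m])
    moreover have "?v - proj x ?v \<in> GR q"
    proof -
      have "Poly_Mapping.single (map (\<lambda>z. z \<otimes> cnj x y) ys) (a (inv (cnj x y)) m) -
          Poly_Mapping.single ys (a (cnj x y) (a (inv (cnj x y)) m)) \<in> GR q" by (rule GR_gen[OF ys k(1)])
      from P.subspace_neg[OF sub_GR this] show ?thesis
        using x(2) k(1) by (simp add: proj_single[OF Tc[OF x(1)] m] a_inv)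
    qed
    ultimately show "?good ?v" using x(1) by (intro exI[of _ "{x}"]) auto
  qed
  then show ?thesis by simp
qed

section \<open>The Tsygan complex of the crossed module\<close>

definition FS :: "'k \<Rightarrow> (nat \<Rightarrow> 'g list \<Rightarrow>\<^sub>0 'm) \<Rightarrow> nat \<Rightarrow> 'g list \<Rightarrow>\<^sub>0 'm" where "FS c f = (\<lambda>q. ps c (f q))"

lemma vs_FS: "vector_space FS"
  by unfold_locales (auto simp: FS_def P.scale_right_distrib P.scale_left_distrib)

sublocale FS: vector_space FS by (rule vs_FS)

text \<open>
  The total differential on representatives, indexed as in \<open>tsygan_diff\<close>; only the values at \<open>q < n\<close> are
  meaningful.
\<close>

definition GD :: "nat \<Rightarrow> (nat \<Rightarrow> 'g list \<Rightarrow>\<^sub>0 'm) \<Rightarrow> nat \<Rightarrow> 'g list \<Rightarrow>\<^sub>0 'm" where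
  "GD n f = (\<lambda>q. (if even (n - 1 - q) then bd (f (Suc q)) else - bd' (f (Suc q))) +
                 (if even (n - 1 - q) then f q - gt q (f q) else gn q (f q)))"

definition tot :: "(nat \<Rightarrow> ('g list \<Rightarrow>\<^sub>0 'm) set) \<Rightarrow> nat \<Rightarrow> (nat \<Rightarrow> 'g list \<Rightarrow>\<^sub>0 'm) set" where
  "tot V n = {f. \<forall>q\<le>n. f q \<in> V q}"

text \<open>
  The locale for \<open>x\<close> defines its cyclic operator with \<open>x\<close> built in, while \<open>gt\<close> reads the degree off the
  coefficient. They agree on coefficients of degree \<open>x\<close> and in the degrees \<open>q \<le> n\<close>, so the cycles and
  boundaries are the same.
\<close>

lemma presents_component:
  fixes n :: nat
  assumes x: "x \<in> carrier G"
  shows "ord x > 0 \<Longrightarrow> presents FS (cycles (tot (Lx x)) (tot (Rx x)) GD n) (boundaries (tot (Lx x)) (tot (Rx x)) GD n)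
      (vs_dsum (UNIV :: nat set) (\<lambda>i. group_homology (centralizer_quot G x) scale (coset_act act) (W x) (int n - 2 * int i)))"
    and "ord x = 0 \<Longrightarrow> presents FS (cycles (tot (Lx x)) (tot (Rx x)) GD n) (boundaries (tot (Lx x)) (tot (Rx x)) GD n)
      (group_homology (centralizer_quot G x) scale (coset_act act) (W x) (int n))"
    and "presented_complex FS (tot (Lx x)) (tot (Rx x)) GD"
proof -
  interpret X: twisted_coeff scale G a "W x" x by (rule twisted[OF x])
  have L: "X.C.L (Suc q) = Lx x q" for q by (simp add: X.C.L_def Lx_def)
  have R: "X.C.Rel (Suc q) = Rx x q" for q unfolding X.C.Rel_def Rx_def by simp
  have tV: "X.T.tot_V = tot (Lx x)" by (rule ext, subst X.T.tot_V_def, simp only: tot_def L)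
  have tR: "X.T.tot_R = tot (Rx x)" by (rule ext, subst X.T.tot_R_def, simp only: tot_def R)
  have ts: "X.T.tot_scale = FS" by (simp add: fun_eq_iff X.T.tot_scale_def FS_def)
  have t: "X.t v = gt q v" if v: "v \<in> Lx x q" for v q
  proof (rule X.C.lin_eq_L[OF X.lin_t lin_gt v[folded L]])
    fix ys m assume "ys \<in> tuples (carrier G) (Suc q)" "m \<in> W x"
    then show "X.t (Poly_Mapping.single ys m) = gt q (Poly_Mapping.single ys m)"
      by (auto simp: X.t_single X.rot_def gt_single tuples_def)
  qed
  have tp: "(X.t ^^ i) v = (gt q ^^ i) v" if v: "v \<in> Lx x q" for v q i
  proof (induction i)
    case (Suc i)
    have "(X.t ^^ i) v \<in> Lx x q" using X.tpow_L[OF v[folded L]] by (simp add: L)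
    then show ?case using t Suc by simp
  qed simp
  have N: "X.T.N q v = gn q v" if v: "v \<in> Lx x q" for v q
    unfolding X.T.N_def gn_def by (simp only: tp[OF v])
  have d: "X.T.tot_d (Suc n) f q = GD (Suc n) f q" if "f \<in> tot (Lx x) (Suc n)" "q \<le> n" for f q n
    using that t N by (simp add: X.T.tot_d_def GD_def tot_def)
  have cyc: "X.T.tot_cycles n = cycles (tot (Lx x)) (tot (Rx x)) GD n" for n
    unfolding cycles_def tV tR by (cases n) (auto simp: tot_def[of "Rx x"] d)
  interpret XC: presented_complex FS "tot (Lx x)" "tot (Rx x)" X.T.tot_d
    using X.T.tot_complex unfolding tV tR ts .
  have sub_tR: "FS.subspace (tot (Rx x) n)" for n by (rule XC.sub_R)
  have bnd: "X.T.tot_boundaries n = boundaries (tot (Lx x)) (tot (Rx x)) GD n" for n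
  proof -
    have close: "X.T.tot_d (Suc n) f - GD (Suc n) f \<in> tot (Rx x) n" if "f \<in> tot (Lx x) (Suc n)" for f
      using d[OF that] P.subspace_0[OF sub_Rx] by (simp add: tot_def)
    show ?thesis
      unfolding boundaries_def tV tR
    proof (intro equalityI subsetI)
      fix z assume "z \<in> ssum (X.T.tot_d (Suc n) ` tot (Lx x) (Suc n)) (tot (Rx x) n)"
      then obtain f r where z: "z = X.T.tot_d (Suc n) f + r" "f \<in> tot (Lx x) (Suc n)" "r \<in> tot (Rx x) n" by blast
      have "z = GD (Suc n) f + ((X.T.tot_d (Suc n) f - GD (Suc n) f) + r)" using z(1) by simp
      then show "z \<in> ssum (GD (Suc n) ` tot (Lx x) (Suc n)) (tot (Rx x) n)"
        using FS.subspace_add[OF sub_tR close[OF z(2)] z(3)] z(2) by blast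
    next
      fix z assume "z \<in> ssum (GD (Suc n) ` tot (Lx x) (Suc n)) (tot (Rx x) n)"
      then obtain f r where z: "z = GD (Suc n) f + r" "f \<in> tot (Lx x) (Suc n)" "r \<in> tot (Rx x) n" by blast
      have "z = X.T.tot_d (Suc n) f + (r - (X.T.tot_d (Suc n) f - GD (Suc n) f))" using z(1) by simp
      then show "z \<in> ssum (X.T.tot_d (Suc n) ` tot (Lx x) (Suc n)) (tot (Rx x) n)"
        using FS.subspace_diff[OF sub_tR z(3) close[OF z(2)]] z(2) by blast
    qed
  qed
  have ca: "X.ca = coset_act act" by (simp add: fun_eq_iff X.ca_def coset_act_def a_def)
  show "presents FS (cycles (tot (Lx x)) (tot (Rx x)) GD n) (boundaries (tot (Lx x)) (tot (Rx x)) GD n)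
      (vs_dsum (UNIV :: nat set) (\<lambda>i. group_homology (centralizer_quot G x) scale (coset_act act) (W x) (int n - 2 * int i)))"
    if "ord x > 0"
    using X.presents_tot_finite[OF that pow_ord_eq_1[OF x], of n] by (simp only: cyc bnd ts ca)
  show "presents FS (cycles (tot (Lx x)) (tot (Rx x)) GD n) (boundaries (tot (Lx x)) (tot (Rx x)) GD n)
      (group_homology (centralizer_quot G x) scale (coset_act act) (W x) (int n))"
    if "ord x = 0"
    using X.presents_tot_infinite[OF that, of n] by (simp only: cyc bnd ts ca)
  show "presented_complex FS (tot (Lx x)) (tot (Rx x)) GD"
  proof (intro presented_complex.intro presented_complex_axioms.intro)
    show "Vector_Spaces.linear FS FS (GD n)" for n
      by (rule linI[OF vs_FS vs_FS])
        (auto simp: FS_def GD_def fun_eq_iff lin_add[OF lin_bd] lin_add[OF lin_bd'] lin_add[OF lin_gt] lin_add[OF lin_gn]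
          lin_scale[OF lin_bd] lin_scale[OF lin_bd'] lin_scale[OF lin_gt] lin_scale[OF lin_gn]
          P.scale_right_distrib P.scale_right_diff_distrib algebra_simps)
    show V: "GD (Suc n) z \<in> tot (Lx x) n" if "z \<in> tot (Lx x) (Suc n)" for z n
      using XC.d_V[OF that] d[OF that] by (simp add: tot_def)
    show "GD (Suc n) z \<in> tot (Rx x) n" if "z \<in> tot (Rx x) (Suc n)" for z n
      using XC.d_R[OF that] d[of z n] subsetD[OF XC.R_le that] by (simp add: tot_def)
    show "GD (Suc n) (GD (Suc (Suc n)) z) \<in> tot (Rx x) n" if z: "z \<in> tot (Lx x) (Suc (Suc n))" for z n
    proof -
      have "GD (Suc (Suc n)) z p = X.T.tot_d (Suc (Suc n)) z p" if "p \<le> Suc n" for p using d[OF z that] by simp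
      then have "GD (Suc n) (GD (Suc (Suc n)) z) q = GD (Suc n) (X.T.tot_d (Suc (Suc n)) z) q" if "q \<le> n" for q
        using that by (simp add: GD_def[of "Suc n"])
      then show ?thesis using XC.dd[OF z] d[OF XC.d_V[OF z]] by (simp add: tot_def)
    qed
  qed (rule vs_FS XC.sub_V XC.sub_R XC.R_le)+
qed

end

lemma pres_map_pointwise:
  fixes s :: "'k::field \<Rightarrow> 'a::ab_group_add \<Rightarrow> 'a" and I :: "'i set"
  assumes I: "finite I" and vs: "vector_space s" and vs': "vector_space (\<lambda>c (f :: 'i \<Rightarrow> 'a) q. s c (f q))"
    and p: "\<And>q. q \<in> I \<Longrightarrow> pres_map s (V q) (R q) (A q) (\<phi> q)"
  shows "pres_map (\<lambda>c f q. s c (f q)) {f. \<forall>q\<in>I. f q \<in> V q} {f. \<forall>q\<in>I. f q \<in> R q} (vs_dsum I A) (\<lambda>f. \<lambda>q\<in>I. \<phi> q (f q))"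
proof -
  interpret V: vector_space s by fact
  interpret F: vector_space "\<lambda>c (f :: 'i \<Rightarrow> 'a) q. s c (f q)" by fact
  note pD = pres_mapD[OF p]
  show ?thesis
    unfolding pres_map_def
  proof (intro conjI ballI allI)
    show "F.subspace {f. \<forall>q\<in>I. f q \<in> V q}"
      by (rule F.subspaceI) (auto simp: V.subspace_0[OF pD(2)] V.subspace_add[OF pD(2)] V.subspace_scale[OF pD(2)])
    show "F.subspace {f. \<forall>q\<in>I. f q \<in> R q}"
      by (rule F.subspaceI) (auto simp: V.subspace_0[OF pD(3)] V.subspace_add[OF pD(3)] V.subspace_scale[OF pD(3)])
    show "{f. \<forall>q\<in>I. f q \<in> R q} \<subseteq> {f. \<forall>q\<in>I. f q \<in> V q}" using pD(4) by blast
    show "(\<lambda>f. \<lambda>q\<in>I. \<phi> q (f q)) ` {f. \<forall>q\<in>I. f q \<in> V q} = carrier (vs_dsum I A)"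
    proof
      show "(\<lambda>f. \<lambda>q\<in>I. \<phi> q (f q)) ` {f. \<forall>q\<in>I. f q \<in> V q} \<subseteq> carrier (vs_dsum I A)"
        using I pD(7) by (auto simp: vs_dsum_def)
      show "carrier (vs_dsum I A) \<subseteq> (\<lambda>f. \<lambda>q\<in>I. \<phi> q (f q)) ` {f. \<forall>q\<in>I. f q \<in> V q}"
      proof
        fix g assume "g \<in> carrier (vs_dsum I A)"
        then have g: "g \<in> (\<Pi>\<^sub>E q\<in>I. carrier (A q))" by (simp add: vs_dsum_def)
        have "\<forall>q\<in>I. \<exists>z. z \<in> V q \<and> \<phi> q z = g q"
        proof
          fix q assume q: "q \<in> I"
          show "\<exists>z. z \<in> V q \<and> \<phi> q z = g q" by (rule pres_map_ex[OF p[OF q]]) (use g q in auto)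
        qed
        then obtain f where f: "\<And>q. q \<in> I \<Longrightarrow> f q \<in> V q \<and> \<phi> q (f q) = g q" by metis
        have "g = (\<lambda>q\<in>I. \<phi> q (f q))" using f g by (auto simp: fun_eq_iff PiE_def extensional_def)
        then show "g \<in> (\<lambda>f. \<lambda>q\<in>I. \<phi> q (f q)) ` {f. \<forall>q\<in>I. f q \<in> V q}" using f by blast
      qed
    qed
    show "(\<lambda>q\<in>I. \<phi> q ((0 :: _ \<Rightarrow> 'a) q)) = \<zero>\<^bsub>vs_dsum I A\<^esub>" using pD(6) by (auto simp: vs_dsum_def)
  next
    fix x y assume "x \<in> {f. \<forall>q\<in>I. f q \<in> V q}" "y \<in> {f. \<forall>q\<in>I. f q \<in> V q}"
    then show "(\<lambda>q\<in>I. \<phi> q ((x + y) q)) = (\<lambda>q\<in>I. \<phi> q (x q)) \<oplus>\<^bsub>vs_dsum I A\<^esub> (\<lambda>q\<in>I. \<phi> q (y q))"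
      using pD(8) by (auto simp: vs_dsum_def)
  next
    fix c x assume "x \<in> {f. \<forall>q\<in>I. f q \<in> V q}"
    then show "(\<lambda>q\<in>I. \<phi> q (s c (x q))) = c \<odot>\<^bsub>vs_dsum I A\<^esub> (\<lambda>q\<in>I. \<phi> q (x q))"
      using pD(9) by (auto simp: vs_dsum_def)
  next
    fix x assume x: "x \<in> {f. \<forall>q\<in>I. f q \<in> V q}"
    have "(\<lambda>q\<in>I. \<phi> q (x q)) = \<zero>\<^bsub>vs_dsum I A\<^esub> \<longleftrightarrow> (\<forall>q\<in>I. \<phi> q (x q) = \<zero>\<^bsub>A q\<^esub>)"
      by (auto simp: vs_dsum_def fun_eq_iff)
    then show "((\<lambda>q\<in>I. \<phi> q (x q)) = \<zero>\<^bsub>vs_dsum I A\<^esub>) = (x \<in> {f. \<forall>q\<in>I. f q \<in> R q})"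
      using x pD(10) by auto
  qed (fact vs')
qed

context modular_coeff
begin

text \<open>
  The identities modulo \<open>GR\<close> are inherited from the summands: by \<open>decompose\<close> a chain lies in \<open>GR\<close> as
  soon as all its projections are relations.
\<close>

lemma presented_complex_global:
  assumes T: "conjugacy_reps G T"
  shows "presented_complex FS (tot GV) (tot GR) GD"
proof (intro presented_complex.intro presented_complex_axioms.intro)
  have Tc: "x \<in> carrier G" if "x \<in> T" for x using T that by (auto simp: conjugacy_reps_def)
  show "vector_space FS" by (rule vs_FS)
  show "FS.subspace (tot GV n)" for n
    by (rule FS.subspaceI) (auto simp: tot_def FS_def P.subspace_0[OF sub_GV] P.subspace_add[OF sub_GV] P.subspace_scale[OF sub_GV])
  show "FS.subspace (tot GR n)" for n
    by (rule FS.subspaceI) (auto simp: tot_def FS_def P.subspace_0[OF sub_GR] P.subspace_add[OF sub_GR] P.subspace_scale[OF sub_GR])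
  show "tot GR n \<subseteq> tot GV n" for n using GR_le by (auto simp: tot_def)
  show "Vector_Spaces.linear FS FS (GD n)" for n
    by (rule linI[OF vs_FS vs_FS])
      (auto simp: FS_def GD_def fun_eq_iff lin_add[OF lin_bd] lin_add[OF lin_bd'] lin_add[OF lin_gt] lin_add[OF lin_gn]
        lin_scale[OF lin_bd] lin_scale[OF lin_bd'] lin_scale[OF lin_gt] lin_scale[OF lin_gn]
        P.scale_right_distrib P.scale_right_diff_distrib algebra_simps)
  have bV: "bd v \<in> GV q" "bd' v \<in> GV q" if "v \<in> GV (Suc q)" for v q
    using that unfolding GV_def by (auto intro: bd_L[OF subspace_UNIV] bd'_L[OF subspace_UNIV])
  have nV: "gn q v \<in> GV q" if "v \<in> GV q" for v q unfolding gn_def by (intro P.subspace_sum[OF sub_GV] gtpow_GV that)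
  have dV: "GD (Suc n) f q \<in> GV q" if "f \<in> tot GV (Suc n)" "q \<le> n" for f q n
    using that unfolding GD_def
    by (auto simp: tot_def intro!: P.subspace_add[OF sub_GV] P.subspace_diff[OF sub_GV] P.subspace_neg[OF sub_GV] bV gt_GV nV)
  then show "GD (Suc n) f \<in> tot GV n" if "f \<in> tot GV (Suc n)" for f n using that by (simp add: tot_def)
  have proj_d: "proj x (GD (Suc n) f q) = GD (Suc n) (\<lambda>q. proj x (f q)) q"
    if x: "x \<in> carrier G" and f: "f \<in> tot GV (Suc n)" and q: "q \<le> n" for x f q n
  proof -
    note l = lin_add[OF lin_proj[OF x]] lin_diff[OF lin_proj[OF x]] lin_neg[OF lin_proj[OF x]]
    have fq: "f q \<in> GV q" using f q by (simp add: tot_def)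
    show ?thesis by (simp add: GD_def l bd_proj[OF x] bd'_proj[OF x] gt_proj[OF x fq] gn_proj[OF x fq])
  qed
  have in_GR: "v \<in> GR q" if v: "v \<in> GV q" and px: "\<And>x. x \<in> T \<Longrightarrow> proj x v \<in> Rx x q" for v q
  proof -
    obtain S where S: "finite S" "S \<subseteq> T" "v - (\<Sum>x\<in>S. proj x v) \<in> GR q" using decompose[OF T v] by blast
    have "(\<Sum>x\<in>S. proj x v) \<in> GR q" using S(2) px Rx_GR by (intro P.subspace_sum[OF sub_GR]) blast
    from P.subspace_add[OF sub_GR S(3) this] show ?thesis by simp
  qed
  show "GD (Suc n) f \<in> tot GR n" if f: "f \<in> tot GR (Suc n)" for f n
  proof -
    have fV: "f \<in> tot GV (Suc n)" using f GR_le by (auto simp: tot_def)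
    have "GD (Suc n) f q \<in> GR q" if q: "q \<le> n" for q
    proof (rule in_GR[OF dV[OF fV q]])
      fix x assume x: "x \<in> T"
      interpret XC: presented_complex FS "tot (Lx x)" "tot (Rx x)" GD by (rule presents_component(3)[OF Tc[OF x]])
      have "(\<lambda>q. proj x (f q)) \<in> tot (Rx x) (Suc n)" using f proj_GR[OF Tc[OF x]] by (simp add: tot_def)
      from XC.d_R[OF this] show "proj x (GD (Suc n) f q) \<in> Rx x q"
        using proj_d[OF Tc[OF x] fV q] q by (simp add: tot_def)
    qed
    then show ?thesis by (simp add: tot_def)
  qed
  show "GD (Suc n) (GD (Suc (Suc n)) f) \<in> tot GR n" if f: "f \<in> tot GV (Suc (Suc n))" for f n
  proof -
    have f1: "GD (Suc (Suc n)) f \<in> tot GV (Suc n)" using dV[OF f] by (simp add: tot_def)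
    have "GD (Suc n) (GD (Suc (Suc n)) f) q \<in> GR q" if q: "q \<le> n" for q
    proof (rule in_GR[OF dV[OF f1 q]])
      fix x assume x: "x \<in> T"
      interpret XC: presented_complex FS "tot (Lx x)" "tot (Rx x)" GD by (rule presents_component(3)[OF Tc[OF x]])
      have "(\<lambda>q. proj x (f q)) \<in> tot (Lx x) (Suc (Suc n))" using f proj_Lx[OF Tc[OF x]] by (simp add: tot_def)
      note XC.dd[OF this]
      moreover have "GD (Suc n) (\<lambda>q. proj x (GD (Suc (Suc n)) f q)) q = GD (Suc n) (GD (Suc (Suc n)) (\<lambda>q. proj x (f q))) q"
        using proj_d[OF Tc[OF x] f, of q] proj_d[OF Tc[OF x] f, of "Suc q"] q by (simp add: GD_def[of "Suc n"])
      ultimately show "proj x (GD (Suc n) (GD (Suc (Suc n)) f) q) \<in> Rx x q"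
        using proj_d[OF Tc[OF x] f1 q] q by (simp add: tot_def)
    qed
    then show ?thesis by (simp add: tot_def)
  qed
qed

text \<open>
  The projections are chain maps that split the complex into the summands for \<open>x \<in> T\<close>. The index set is divided
  into two parts, which are separated by \<open>presents_dsum2\<close> before \<open>presents_dsum\<close> is applied to each of them.
\<close>

lemma presents_sum:
  assumes T: "conjugacy_reps G T" and T': "T1 \<union> T2 = T" "T1 \<inter> T2 = {}"
    and A1: "\<And>x. x \<in> T1 \<Longrightarrow> presents FS (cycles (tot (Lx x)) (tot (Rx x)) GD n) (boundaries (tot (Lx x)) (tot (Rx x)) GD n) (A1 x)"
    and A2: "\<And>x. x \<in> T2 \<Longrightarrow> presents FS (cycles (tot (Lx x)) (tot (Rx x)) GD n) (boundaries (tot (Lx x)) (tot (Rx x)) GD n) (A2 x)"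
  shows "presents FS (cycles (tot GV) (tot GR) GD n) (boundaries (tot GV) (tot GR) GD n)
    (vs_dsum2 (vs_dsum T1 A1) (vs_dsum T2 A2))"
proof -
  have Tc: "x \<in> carrier G" if "x \<in> T" for x using T that by (auto simp: conjugacy_reps_def)
  have disj: "\<not> cls x x'" if "x \<in> T" "x' \<in> T" "x \<noteq> x'" for x x'
  proof
    assume "cls x x'"
    then have "x' \<in> carrier G" "\<exists>g\<in>carrier G. x' = g \<otimes> x \<otimes> inv g" using Tc[OF that(2)] by (auto simp: cls_def)
    moreover have "\<exists>g\<in>carrier G. x' = g \<otimes> x' \<otimes> inv g" using cls_refl[OF Tc[OF that(2)]] by (simp add: cls_def)
    ultimately show False using T that unfolding conjugacy_reps_def by blast
  qed
  interpret GC: presented_complex FS "tot GV" "tot GR" GD by (rule presented_complex_global[OF T])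
  define pr where "pr x f = (\<lambda>q. proj x (f q))" for x and f :: "nat \<Rightarrow> 'g list \<Rightarrow>\<^sub>0 'm"
  let ?Z = "cycles (tot GV) (tot GR) GD n" and ?B = "boundaries (tot GV) (tot GR) GD n"
  define Zx where "Zx x = cycles (tot (Lx x)) (tot (Rx x)) GD n" for x
  define Bx where "Bx x = boundaries (tot (Lx x)) (tot (Rx x)) GD n" for x
  have cx: "presented_complex FS (tot (Lx x)) (tot (Rx x)) GD" if "x \<in> T" for x
    by (rule presents_component(3)[OF Tc[OF that]])
  note sub_Zx = presented_complex.sub_cycles[OF cx, of _ n, folded Zx_def]
    and sub_Bx = presented_complex.sub_boundaries[OF cx, of _ n, folded Bx_def]
    and R_Bx = presented_complex.R_le_boundaries[OF cx, of _ n, folded Bx_def]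
  have ZV: "f q \<in> GV q" if "f \<in> ?Z" "q \<le> n" for f q using that by (auto simp: cycles_def tot_def)
  have lin_pr: "Vector_Spaces.linear FS FS (pr x)" if "x \<in> T" for x
    using lin_add[OF lin_proj[OF Tc[OF that]]] lin_scale[OF lin_proj[OF Tc[OF that]]]
    by (intro linI[OF vs_FS vs_FS]) (simp_all add: pr_def FS_def fun_eq_iff)
  have pr_tot: "pr x f \<in> tot (Lx x) k" if "x \<in> T" "f \<in> tot GV k" for x f k
    using that proj_Lx[OF Tc] by (simp add: tot_def pr_def)
  have pr_totR: "pr x f \<in> tot (Rx x) k" if "x \<in> T" "f \<in> tot GR k" for x f k
    using that proj_GR[OF Tc] by (simp add: tot_def pr_def)
  have pr_d: "pr x (GD (Suc k) f) q = GD (Suc k) (pr x f) q" if x: "x \<in> T" and f: "f \<in> tot GV (Suc k)" and q: "q \<le> k" for x f k q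
  proof -
    note l = lin_add[OF lin_proj[OF Tc[OF x]]] lin_diff[OF lin_proj[OF Tc[OF x]]] lin_neg[OF lin_proj[OF Tc[OF x]]]
    have fq: "f q \<in> GV q" using f q by (simp add: tot_def)
    show ?thesis
      by (simp add: pr_def GD_def l bd_proj[OF Tc[OF x]] bd'_proj[OF Tc[OF x]] gt_proj[OF Tc[OF x] fq] gn_proj[OF Tc[OF x] fq])
  qed
  have pr_Z: "pr x f \<in> Zx x" if x: "x \<in> T" and f: "f \<in> ?Z" for x f
  proof (cases n)
    case 0
    then show ?thesis using f pr_tot[OF x, of f 0] by (simp add: Zx_def cycles_def)
  next
    case (Suc k)
    then have fV: "f \<in> tot GV (Suc k)" and fR: "GD (Suc k) f \<in> tot GR k" using f by (auto simp: cycles_def)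
    have "GD (Suc k) (pr x f) \<in> tot (Rx x) k"
      using pr_totR[OF x fR] pr_d[OF x fV] by (simp add: tot_def)
    then show ?thesis using pr_tot[OF x fV] Suc by (simp add: Zx_def cycles_def)
  qed
  have Zx_Z: "Zx x \<subseteq> ?Z" if "x \<in> T" for x
    by (auto simp: Zx_def cycles_def tot_def intro: subsetD[OF Lx_GV] subsetD[OF Rx_GR])
  have Bx_B: "Bx x \<subseteq> ?B" for x
  proof -
    have "tot (Lx x) (Suc n) \<subseteq> tot GV (Suc n)" "tot (Rx x) n \<subseteq> tot GR n"
      by (auto simp: tot_def intro: subsetD[OF Lx_GV] subsetD[OF Rx_GR])
    then show ?thesis unfolding Bx_def boundaries_def by blast
  qed
  have zero_Bx: "f \<in> Bx x" if "x \<in> T" "\<And>q. q \<le> n \<Longrightarrow> f q = 0" for f x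
    using R_Bx[OF that(1)] that(2) by (auto simp: tot_def P.subspace_0[OF sub_Rx])
  have pr_B: "pr x f \<in> Bx x" if x: "x \<in> T" and f: "f \<in> ?B" for x f
  proof -
    obtain g r where g: "f = GD (Suc n) g + r" "g \<in> tot GV (Suc n)" "r \<in> tot GR n"
      using f unfolding boundaries_def by blast
    let ?r = "pr x f - GD (Suc n) (pr x g)"
    have "?r q = pr x r q" if "q \<le> n" for q
      using pr_d[OF x g(2) that] g(1) by (simp add: lin_add[OF lin_pr[OF x]])
    then have "?r \<in> tot (Rx x) n" using pr_totR[OF x g(3)] by (simp add: tot_def)
    moreover have "pr x f = GD (Suc n) (pr x g) + ?r" by simp
    ultimately show ?thesis unfolding Bx_def boundaries_def using pr_tot[OF x g(2)] by blast
  qed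
  have Zx_L: "f q \<in> Lx x q" if "f \<in> Zx x" "q \<le> n" for x f q using that by (simp add: Zx_def cycles_def tot_def)
  have pr_same: "pr x f q = f q" if "x \<in> T" "f \<in> Zx x" "q \<le> n" for x f q
    unfolding pr_def by (rule proj_id[OF Tc[OF that(1)] Zx_L[OF that(2,3)]])
  have pr_other: "pr x f q = 0" if "x \<in> T" "x' \<in> T" "x \<noteq> x'" "f \<in> Zx x'" "q \<le> n" for x x' f q
    unfolding pr_def by (rule proj_other[OF Tc[OF that(1)] Zx_L[OF that(4,5)] disj[OF that(1-3)]])
  have pr_sum: "pr x (\<Sum>x'\<in>S. h x') q = (if x \<in> S then h x q else 0)"
    if x: "x \<in> T" and S: "finite S" "S \<subseteq> T" and h: "\<And>x'. x' \<in> S \<Longrightarrow> h x' \<in> Zx x'" and q: "q \<le> n" for x S h q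
  proof -
    have sum_app: "(\<Sum>x'\<in>S. h' x') q = (\<Sum>x'\<in>S. h' x' q)" for h' :: "'g \<Rightarrow> nat \<Rightarrow> 'g list \<Rightarrow>\<^sub>0 'm"
      using S(1) by (induction S) auto
    have "pr x (\<Sum>x'\<in>S. h x') q = (\<Sum>x'\<in>S. pr x (h x') q)" by (simp add: lin_sum[OF lin_pr[OF x]] sum_app)
    also have "\<dots> = (\<Sum>x'\<in>S. if x' = x then h x q else 0)"
      using S h x q pr_same[OF x _ q] pr_other[OF x _ _ _ q] by (intro sum.cong) auto
    finally show ?thesis using S(1) by simp
  qed
  have dec: "\<exists>S. finite S \<and> S \<subseteq> T \<and> (\<forall>x\<in>T - S. \<forall>q\<le>n. pr x f q = 0) \<and> (\<forall>q\<le>n. f q - (\<Sum>x\<in>S. pr x f q) \<in> GR q)"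
    if f: "f \<in> ?Z" for f
  proof -
    have "\<forall>q\<in>{..n}. \<exists>S. finite S \<and> S \<subseteq> T \<and> (\<forall>x\<in>T - S. proj x (f q) = 0) \<and> f q - (\<Sum>x\<in>S. proj x (f q)) \<in> GR q"
      using decompose[OF T ZV[OF f]] by blast
    then obtain S where S: "\<And>q. q \<le> n \<Longrightarrow> finite (S q) \<and> S q \<subseteq> T \<and> (\<forall>x\<in>T - S q. proj x (f q) = 0) \<and>
        f q - (\<Sum>x\<in>S q. proj x (f q)) \<in> GR q" by (metis atMost_iff)
    let ?S = "\<Union>q\<le>n. S q"
    have "(\<Sum>x\<in>?S. proj x (f q)) = (\<Sum>x\<in>S q. proj x (f q))" if q: "q \<le> n" for q
    proof (rule sum.mono_neutral_right)
      show "finite ?S" using S by simp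
      show "S q \<subseteq> ?S" using q by blast
      show "\<forall>x\<in>?S - S q. proj x (f q) = 0" using S S[OF q] by blast
    qed
    then show ?thesis using S by (intro exI[of _ ?S]) (auto simp: pr_def)
  qed
  define BB where "BB I = {f \<in> ?Z. \<forall>x\<in>I. pr x f \<in> Bx x}" for I
  have sub_BB: "FS.subspace (BB I)" if "I \<subseteq> T" for I
    unfolding BB_def using that GC.sub_cycles
    by (intro FS.subspaceI)
      (auto simp: FS.subspace_0 FS.subspace_add FS.subspace_scale lin_0[OF lin_pr] lin_add[OF lin_pr] lin_scale[OF lin_pr]
        subset_iff sub_Bx)
  have part: "presents FS ?Z (BB I) (vs_dsum I A)"
    if I: "I \<subseteq> T" and A: "\<And>x. x \<in> I \<Longrightarrow> presents FS (Zx x) (Bx x) (A x)" for I and A :: "'g \<Rightarrow> ('k, 'c) module"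
  proof (rule presents_dsum[OF vs_FS GC.sub_cycles sub_BB[OF I] _ A])
    show "BB I \<subseteq> ?Z" by (auto simp: BB_def)
    show "Vector_Spaces.linear FS FS (pr x)" if "x \<in> I" for x using lin_pr I that by blast
    show "pr x z \<in> Zx x" if "x \<in> I" "z \<in> ?Z" for x z using pr_Z I that by blast
    show "finite {x \<in> I. pr x z \<notin> Bx x}" if z: "z \<in> ?Z" for z
    proof -
      obtain S where S: "finite S" "\<forall>x\<in>T - S. \<forall>q\<le>n. pr x z q = 0" using dec[OF z] by blast
      have "{x \<in> I. pr x z \<notin> Bx x} \<subseteq> S" using S(2) zero_Bx I by blast
      then show ?thesis using S(1) finite_subset by blast
    qed
    show "(z \<in> BB I) = (\<forall>x\<in>I. pr x z \<in> Bx x)" if "z \<in> ?Z" for z using that by (simp add: BB_def)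
    show "\<exists>z\<in>?Z. \<forall>x\<in>I. w x - pr x z \<in> Bx x"
      if w: "\<forall>x\<in>I. w x \<in> Zx x" and fin: "finite {x \<in> I. w x \<noteq> 0}" for w
    proof -
      let ?S = "{x \<in> I. w x \<noteq> 0}"
      let ?z = "\<Sum>x\<in>?S. w x"
      have "?z \<in> ?Z" using w Zx_Z I by (intro FS.subspace_sum[OF GC.sub_cycles]) blast
      moreover have "w x - pr x ?z \<in> Bx x" if x: "x \<in> I" for x
      proof (rule zero_Bx)
        show "(w x - pr x ?z) q = 0" if q: "q \<le> n" for q
        proof -
          have "pr x ?z q = (if x \<in> ?S then w x q else 0)"
          proof (rule pr_sum)
            show "x \<in> T" "?S \<subseteq> T" using I x by auto
            show "finite ?S" by (rule fin)
            show "w x' \<in> Zx x'" if "x' \<in> ?S" for x' using w that by blast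
          qed (rule q)
          then show ?thesis using x by (cases "w x = 0") auto
        qed
      qed (use I x in blast)
      ultimately show ?thesis by blast
    qed
  qed
  have "BB T1 \<inter> BB T2 = ?B"
  proof (intro equalityI subsetI)
    fix f assume "f \<in> ?B"
    then show "f \<in> BB T1 \<inter> BB T2" using GC.boundaries_le pr_B T' by (auto simp: BB_def)
  next
    fix f assume "f \<in> BB T1 \<inter> BB T2"
    then have f: "f \<in> ?Z" and fB: "\<And>x. x \<in> T \<Longrightarrow> pr x f \<in> Bx x" using T' by (auto simp: BB_def)
    obtain S where S: "finite S" "S \<subseteq> T" "\<forall>q\<le>n. f q - (\<Sum>x\<in>S. pr x f q) \<in> GR q" using dec[OF f] by blast
    have sum_app: "(\<Sum>x\<in>S. h x) q = (\<Sum>x\<in>S. h x q)" for h :: "'g \<Rightarrow> nat \<Rightarrow> 'g list \<Rightarrow>\<^sub>0 'm" and q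
      using S(1) by (induction S) auto
    have "f - (\<Sum>x\<in>S. pr x f) \<in> tot GR n" using S(3) by (simp add: tot_def sum_app)
    then have 1: "f - (\<Sum>x\<in>S. pr x f) \<in> ?B" using GC.R_le_boundaries by blast
    have 2: "(\<Sum>x\<in>S. pr x f) \<in> ?B" using S(2) fB Bx_B by (intro FS.subspace_sum[OF GC.sub_boundaries]) blast
    show "f \<in> ?B" using FS.subspace_add[OF GC.sub_boundaries 1 2] by simp
  qed
  moreover have "presents FS ?Z (BB T1 \<inter> BB T2) (vs_dsum2 (vs_dsum T1 A1) (vs_dsum T2 A2))"
  proof (rule presents_dsum2)
    show "presents FS ?Z (BB T1) (vs_dsum T1 A1)" using T' A1 by (intro part) (auto simp: Zx_def Bx_def)
    show "presents FS ?Z (BB T2) (vs_dsum T2 A2)" using T' A2 by (intro part) (auto simp: Zx_def Bx_def)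
    show "\<exists>z2\<in>BB T2. z - z2 \<in> BB T1" if z: "z \<in> ?Z" for z
    proof -
      obtain S where S: "finite S" "S \<subseteq> T" "\<forall>x\<in>T - S. \<forall>q\<le>n. pr x z q = 0" using dec[OF z] by blast
      let ?S = "S \<inter> T1"
      let ?z = "\<Sum>x\<in>?S. pr x z"
      have zZ: "?z \<in> ?Z" using S pr_Z[OF _ z] Zx_Z by (intro FS.subspace_sum[OF GC.sub_cycles]) blast
      have p: "pr x ?z q = (if x \<in> ?S then pr x z q else 0)" if "x \<in> T" "q \<le> n" for x q
        using S pr_Z[OF _ z] that by (intro pr_sum) auto
      have "?z \<in> BB T2"
        unfolding BB_def using zZ
      proof (intro CollectI conjI ballI)
        fix x assume x: "x \<in> T2"
        show "pr x ?z \<in> Bx x" by (rule zero_Bx) (use x T' p in auto)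
      qed
      moreover have "z - ?z \<in> BB T1"
        unfolding BB_def using FS.subspace_diff[OF GC.sub_cycles z zZ]
      proof (intro CollectI conjI ballI)
        fix x assume x: "x \<in> T1"
        then have xT: "x \<in> T" using T' by blast
        show "pr x (z - ?z) \<in> Bx x"
        proof (rule zero_Bx[OF xT])
          show "pr x (z - ?z) q = 0" if "q \<le> n" for q
            using p[OF xT that] S(3) xT x that by (auto simp: lin_diff[OF lin_pr[OF xT]])
        qed
      qed
      ultimately show ?thesis by blast
    qed
  qed
  ultimately show ?thesis by simp
qed

section \<open>Cyclic homology of the crossed module\<close>

lemma pre_face_eq: "pre_face scale i = push (delete_nth i)"
  by (simp add: pre_face_def push_def ga_counit_basis)

lemma pcyc_GV: assumes v: "v \<in> GV q" shows "pcyc v \<in> GV q"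
proof -
  have "(-1 :: 'k) ^ q * (-1) ^ q = 1" by (simp flip: power_mult_distrib)
  then have "pcyc v = ps ((-1) ^ q) (gt q v)" by (simp add: gt_def)
  then show ?thesis using P.subspace_scale[OF sub_GV gt_GV[OF v]] by simp
qed

lemma pcyc_GR: assumes r: "r \<in> GR q" shows "pcyc r \<in> GR q"
proof (rule GR_in[OF lin_pcyc sub_GR r])
  fix ys g y m
  assume ys: "ys \<in> tuples (carrier G) (Suc q)" and g: "g \<in> carrier G" and y: "y \<in> carrier G" and m: "m \<in> W y"
  obtain zs z where z: "ys = zs @ [z]" "z \<in> carrier G" "zs \<in> tuples (carrier G) q" using ys by (auto elim: tuples_snocE)
  let ?ys = "(z \<otimes> (g \<otimes> y \<otimes> inv g)) # zs"
  have "?ys \<in> tuples (carrier G) (Suc q)" using z g y by simp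
  moreover have "z \<otimes> (g \<otimes> y \<otimes> inv g) \<otimes> g = z \<otimes> g \<otimes> y" using z g y by (simp add: m_assoc)
  ultimately have "Poly_Mapping.single ((z \<otimes> g \<otimes> y) # map (\<lambda>z. z \<otimes> g) zs) m - Poly_Mapping.single ?ys (a g m) \<in> GR q"
    using GR_gen[of ?ys q g m] g by simp
  then show "pcyc (Poly_Mapping.single (map (\<lambda>z. z \<otimes> g) ys) m) - pcyc (Poly_Mapping.single ys (a g m)) \<in> GR q"
    unfolding pcyc_single[OF m] pcyc_single[OF W_a[OF g m]] by (simp add: z(1))
qed

lemma delete_GR: assumes r: "r \<in> GR (Suc q)" and i: "i \<le> Suc q" shows "push (delete_nth i) r \<in> GR q"
  by (rule GR_in[OF lin_push sub_GR r]) (simp add: delete_nth_map GR_gen delete_nth_tuples i)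

lemma delete_GV: assumes v: "v \<in> GV (Suc q)" and i: "i \<le> Suc q" shows "push (delete_nth i) v \<in> GV q"
  using v i unfolding GV_def by (intro push_L[OF subspace_UNIV]) (auto intro: delete_nth_tuples)

abbreviation Z where "Z \<equiv> Z_cyclic G scale act \<rho>"

definition coset :: "nat \<Rightarrow> ('g list \<Rightarrow>\<^sub>0 'm) \<Rightarrow> ('g list \<Rightarrow>\<^sub>0 'm) set" where
  "coset q v = GR q +>\<^bsub>Z_pre G scale q\<^esub> v"

lemma pres_space: "pres_map ps (GV q) (GR q) (space Z q) (coset q)"
  using pres_quot_fs[OF subspace_UNIV sub_GR GR_le[unfolded GV_def], of q]
  by (simp add: Z_cyclic_def Let_def Z_pre_def Z_rel_eq GV_def coset_def[abs_def])

lemma induced_coset: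
  assumes "Vector_Spaces.linear ps ps F" "\<And>r. r \<in> GR q \<Longrightarrow> F r \<in> GR q'"
  shows "induced_map (Z_pre G scale q') (Z_rel G scale act q') F (coset q v) = coset q' (F v)"
  unfolding coset_def Z_pre_def Z_rel_eq by (rule induced_fs[OF assms(1) sub_GR sub_GR assms(2)])

lemma face_coset: assumes "i \<le> Suc q" shows "cyclic_object.face Z (Suc q) i (coset (Suc q) v) = coset q (push (delete_nth i) v)"
  using induced_coset[OF lin_push delete_GR[OF _ assms]] by (simp add: Z_cyclic_def Let_def pre_face_eq)

lemma cyc_coset: "cyc Z q (coset q v) = coset q (pcyc v)"
  using induced_coset[OF lin_pcyc pcyc_GR] by (simp add: Z_cyclic_def Let_def pcyc_def)

lemma b_coset: assumes v: "v \<in> GV (Suc q)" shows "tsygan_b Z (Suc q) (coset (Suc q) v) = coset q (bd v)"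
proof -
  have "tsygan_b Z (Suc q) (coset (Suc q) v) = coset q (\<Sum>i<Suc (Suc q). ps ((-1) ^ i) (push (delete_nth i) v))"
    unfolding tsygan_b_def diff_Suc_1
    by (rule alt_sum_pres[OF pres_space]) (simp_all add: face_coset delete_GV[OF v])
  then show ?thesis using bd_face[OF v[unfolded GV_def]] by (simp only: face_def)
qed

lemma b'_coset: assumes v: "v \<in> GV (Suc q)" shows "tsygan_b' Z (Suc q) (coset (Suc q) v) = coset q (bd' v)"
proof -
  have "tsygan_b' Z (Suc q) (coset (Suc q) v) = coset q (\<Sum>i<Suc q. ps ((-1) ^ i) (push (delete_nth i) v))"
    unfolding tsygan_b'_def diff_Suc_1
    by (rule alt_sum_pres[OF pres_space]) (simp_all add: face_coset delete_GV[OF v])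
  then show ?thesis using bd'_face[OF v[unfolded GV_def]] by (simp only: face_def diff_Suc_1)
qed

lemma signed_cyc_coset: assumes v: "v \<in> GV q" shows "signed_cyc Z q (coset q v) = coset q (gt q v)"
  unfolding signed_cyc_def cyc_coset gt_def by (rule pres_mapD(9)[OF pres_space pcyc_GV[OF v], symmetric])

lemma norm_coset: assumes v: "v \<in> GV q" shows "tsygan_norm Z q (coset q v) = coset q (gn q v)"
proof -
  have "(signed_cyc Z q ^^ i) (coset q v) = coset q ((gt q ^^ i) v)" for i
    by (induction i) (simp_all add: signed_cyc_coset gtpow_GV[OF v])
  then show ?thesis
    unfolding tsygan_norm_def gn_def
    using pres_map_sum[OF pres_space, of "{..q}" "\<lambda>i. (gt q ^^ i) v" q] by (simp add: gtpow_GV[OF v])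
qed

theorem presents_HC:
  assumes T: "conjugacy_reps G T"
  shows "presents FS (cycles (tot GV) (tot GR) GD n) (boundaries (tot GV) (tot GR) GD n) (HC G scale act \<rho> n)"
  unfolding HC_def cyclic_homology_def
proof (rule presented_complex.presents_homology[OF presented_complex_global[OF T]])
  let ?\<phi> = "\<lambda>n f. \<lambda>q\<in>{..n}. coset q (f q)"
  have FS': "FS = (\<lambda>c f q. ps c (f q))" by (simp add: fun_eq_iff FS_def)
  show "pres_map FS (tot GV n) (tot GR n) (tsygan_tot Z n) (?\<phi> n)" for n
    using pres_map_pointwise[of "{..n}" ps GV GR "space Z" coset] vs_FS pres_space
    by (simp add: FS' vs_ps tsygan_tot_def tot_def Ball_def)
  show "tsygan_diff Z (Suc n) (?\<phi> (Suc n) f) = ?\<phi> n (GD (Suc n) f)" if f: "f \<in> tot GV (Suc n)" for n f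
  proof
    fix q
    show "tsygan_diff Z (Suc n) (?\<phi> (Suc n) f) q = ?\<phi> n (GD (Suc n) f) q"
    proof (cases "q \<le> n")
      case True
      then have fq: "f q \<in> GV q" "f (Suc q) \<in> GV (Suc q)" using f by (auto simp: tot_def)
      have V: "bd (f (Suc q)) \<in> GV q" "bd' (f (Suc q)) \<in> GV q" "gt q (f q) \<in> GV q" "gn q (f q) \<in> GV q"
        using fq gt_GV gtpow_GV unfolding gn_def
        by (auto simp: GV_def intro!: bd_L[OF subspace_UNIV] bd'_L[OF subspace_UNIV] P.subspace_sum[OF sub_GV[unfolded GV_def]])
      have V2: "- bd' (f (Suc q)) \<in> GV q" "f q - gt q (f q) \<in> GV q"
        using V fq by (auto intro: P.subspace_neg[OF sub_GV] P.subspace_diff[OF sub_GV])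
      note r = b_coset[OF fq(2)] b'_coset[OF fq(2)] signed_cyc_coset[OF fq(1)] norm_coset[OF fq(1)]
        pres_map_minus[OF pres_space V(2), symmetric] pres_map_diff[OF pres_space fq(1) V(3), symmetric]
      show ?thesis
        using True pres_mapD(8)[OF pres_space V(1) V2(2), symmetric] pres_mapD(8)[OF pres_space V2(1) V(4), symmetric]
        by (simp add: tsygan_diff_def Let_def GD_def r)
    next
      case False
      then show ?thesis by (simp add: tsygan_diff_def)
    qed
  qed
qed

end

theorem corollary5p13:
  fixes G :: "('g, 'z) monoid_scheme"
    and scale :: "'k::field_char_0 \<Rightarrow> 'm::ab_group_add \<Rightarrow> 'm"
    and act :: "('g \<Rightarrow>\<^sub>0 'k) \<Rightarrow> 'm \<Rightarrow> 'm"
    and \<rho> :: "'m \<Rightarrow> ('g \<Rightarrow>\<^sub>0 'm)"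
    and T :: "'g set"
    and n :: nat
  assumes "modular_crossed_module G scale act \<rho>"
    and "conjugacy_reps G T"
  shows "vs_isomorphic
    (HC G scale act \<rho> n)
    (vs_dsum2
      (vs_dsum (finite_order_reps G T) (\<lambda>x. vs_dsum (UNIV :: nat set) (\<lambda>i.
        group_homology (centralizer_quot G x) scale (coset_act act) (homogeneous_part scale \<rho> x)
          (int n - 2 * int i))))
      (vs_dsum (T - finite_order_reps G T) (\<lambda>x.
        group_homology (centralizer_quot G x) scale (coset_act act) (homogeneous_part scale \<rho> x)
          (int n))))"
proof -
  interpret modular_crossed_module G scale act \<rho> by (rule assms(1))
  interpret modular_coeff G scale act \<rho> by unfold_locales
  have Tc: "x \<in> carrier G" if "x \<in> T" for x using assms(2) that by (auto simp: conjugacy_reps_def)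
  show ?thesis
    by (rule presents_isomorphic[OF presents_HC[OF assms(2)] presents_sum[OF assms(2)]])
      (auto simp: finite_order_reps_def Tc intro!: presents_component(1,2))
qed

end
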